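(* Let $(R,\mathfrak m,k)$ be a reduced excellent Noetherian local ring of prime characteristic $p>0$ and dimension $d$ that is quasi-unmixed in the sense that its $\mathfrak m$-adic completion is reduced and equidimensional. Let $I,J$ be $\mathfrak m$-primary ideals of $R$ such that $J$ has the same tight closure as an ideal generated by a system of parameters of $R$. Let $q_0$ be a power of $p$ such that $J^{[q_0]}\subseteq I$. Then for all powers $q$ of $p$ with $q\ge q_0$, \[ e_{\rm HK}(IJ^{[q]})=d\cdot e_{\rm HK}(I)+e_{\rm HK}(J^{[q]}). \]
   Context: For an ideal $\mathfrak a$ and a power $q=p^e$ of $p$, the bracket power $\mathfrak a^{[q]}$ is the ideal generated by the $q$th powers of all elements of $\mathfrak a$. With $\lambda_R$ denoting length, the Hilbert-Kunz multiplicity of an $\mathfrak m$-primary ideal $\mathfrak a$ is $e_{\rm HK}(\mathfrak a)=\lim_{q\to\infty}\lambda_R(R/\mathfrak a^{[q]})/q^d$, where $q$ runs over powers of $p$ (this limit exists). The tight closure $\mathfrak a^*$ is the ideal of all $x\in R$ for which there is $c\in R$, not in any minimal prime of $R$, with $cx^q\in\mathfrak a^{[q]}$ for all sufficiently large $q=p^e$. The hypothesis on $J$ means that there is a system of parameters $a_1,\dots,a_d$ of $R$ with $(a_1,\dots,a_d)^*=J^*$. *)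

theory Defs
  imports Complex_Main "HOL-Library.Extended_Nat" "HOL-Algebra.Algebra"
begin

section \<open>Chains, dimension and length\<close>

definition chain_sup :: "('a set \<Rightarrow> bool) \<Rightarrow> enat" where
  "chain_sup \<P> = (SUP n \<in> {n. \<exists>C :: nat \<Rightarrow> 'a set.
     (\<forall>i\<le>n. \<P> (C i)) \<and> (\<forall>i<n. C i \<subset> C (Suc i))}. enat n)"

text \<open>The zero ring gets dimension 0 here; the dimension is only used for nonzero rings below.\<close>

definition krull_dim :: "('a, 'b) ring_scheme \<Rightarrow> enat" where
  "krull_dim R = chain_sup (\<lambda>P. primeideal P R)"

definition module_length :: "('a, 'b) ring_scheme \<Rightarrow> ('a, 'c, 'd) module_scheme \<Rightarrow> enat" where
  "module_length R M = chain_sup (\<lambda>N. submodule N R M)"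

text \<open>The cyclic module \<open>R/I\<close>: the additive group of \<open>R Quot I\<close> with the action of \<open>R\<close> through
  the projection.\<close>

definition quot_module :: "('a, 'b) ring_scheme \<Rightarrow> 'a set \<Rightarrow> ('a, 'a set) module" where
  "quot_module R I =
     \<lparr> carrier = carrier (R Quot I), monoid.mult = (\<otimes>\<^bsub>R Quot I\<^esub>), one = \<one>\<^bsub>R Quot I\<^esub>,
       ring.zero = \<zero>\<^bsub>R Quot I\<^esub>, ring.add = (\<oplus>\<^bsub>R Quot I\<^esub>),
       smult = (\<lambda>r U. (I +>\<^bsub>R\<^esub> r) \<otimes>\<^bsub>R Quot I\<^esub> U) \<rparr>"


section \<open>Basic notions for commutative rings\<close>

text \<open>For a prime number \<open>p\<close> this says that \<open>p\<close> is the least positive integer with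
  \<open>p \<cdot> 1 = 0\<close>; for \<open>p = 0\<close> it says that no positive integer has this property.\<close>

definition has_characteristic :: "('a, 'b) ring_scheme \<Rightarrow> nat \<Rightarrow> bool" where
  "has_characteristic R p \<longleftrightarrow> (\<forall>n::nat. [n] \<cdot>\<^bsub>R\<^esub> \<one>\<^bsub>R\<^esub> = \<zero>\<^bsub>R\<^esub> \<longleftrightarrow> p dvd n)"

definition reduced_ring :: "('a, 'b) ring_scheme \<Rightarrow> bool" where
  "reduced_ring R \<longleftrightarrow>
     cring R \<and> (\<forall>x \<in> carrier R. \<forall>n::nat. x [^]\<^bsub>R\<^esub> n = \<zero>\<^bsub>R\<^esub> \<longrightarrow> x = \<zero>\<^bsub>R\<^esub>)"

definition local_ring :: "('a, 'b) ring_scheme \<Rightarrow> bool" where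
  "local_ring R \<longleftrightarrow> cring R \<and> (\<exists>!M. maximalideal M R)"

definition max_ideal :: "('a, 'b) ring_scheme \<Rightarrow> 'a set" where
  "max_ideal R = (THE M. maximalideal M R)"

definition minimal_prime :: "('a, 'b) ring_scheme \<Rightarrow> 'a set \<Rightarrow> bool" where
  "minimal_prime R P \<longleftrightarrow> primeideal P R \<and> (\<forall>Q. primeideal Q R \<and> Q \<subseteq> P \<longrightarrow> Q = P)"

definition radical :: "('a, 'b) ring_scheme \<Rightarrow> 'a set \<Rightarrow> 'a set" where
  "radical R I = {x \<in> carrier R. \<exists>n::nat. x [^]\<^bsub>R\<^esub> n \<in> I}"

definition primary_ideal :: "('a, 'b) ring_scheme \<Rightarrow> 'a set \<Rightarrow> bool" where
  "primary_ideal R Q \<longleftrightarrow> ideal Q R \<and> Q \<noteq> carrier R \<and>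
     (\<forall>x \<in> carrier R. \<forall>y \<in> carrier R. x \<otimes>\<^bsub>R\<^esub> y \<in> Q \<longrightarrow> x \<in> Q \<or> y \<in> radical R Q)"

text \<open>\<open>I\<close> is \<open>P\<close>-primary.\<close>

definition primary_to :: "('a, 'b) ring_scheme \<Rightarrow> 'a set \<Rightarrow> 'a set \<Rightarrow> bool" where
  "primary_to R P I \<longleftrightarrow> primary_ideal R I \<and> radical R I = P"

definition equidimensional :: "('a, 'b) ring_scheme \<Rightarrow> bool" where
  "equidimensional R \<longleftrightarrow> (\<forall>P. minimal_prime R P \<longrightarrow> krull_dim (R Quot P) = krull_dim R)"

definition system_of_parameters :: "('a, 'b) ring_scheme \<Rightarrow> 'a list \<Rightarrow> bool" where
  "system_of_parameters R xs \<longleftrightarrow> set xs \<subseteq> max_ideal R \<and> enat (length xs) = krull_dim R \<and>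
     primary_to R (max_ideal R) (Idl\<^bsub>R\<^esub> (set xs))"


section \<open>Completion and localization\<close>

primrec ideal_power :: "('a, 'b) ring_scheme \<Rightarrow> 'a set \<Rightarrow> nat \<Rightarrow> 'a set" where
  "ideal_power R I 0 = carrier R"
| "ideal_power R I (Suc n) = ideal_prod R (ideal_power R I n) I"

text \<open>The inverse limit of the rings \<open>R/I^n\<close>. Elements of \<open>R/I^n\<close> are cosets, and the coset
  \<open>f n\<close> is the image of the coset \<open>f (Suc n)\<close> iff it contains it.\<close>

definition adic_completion :: "('a, 'b) ring_scheme \<Rightarrow> 'a set \<Rightarrow> (nat \<Rightarrow> 'a set) ring" where
  "adic_completion R I =
     \<lparr> carrier = {f. (\<forall>n. f n \<in> carrier (R Quot ideal_power R I n)) \<and> (\<forall>n. f (Suc n) \<subseteq> f n)},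
       monoid.mult = (\<lambda>f g n. f n \<otimes>\<^bsub>R Quot ideal_power R I n\<^esub> g n),
       one = (\<lambda>n. \<one>\<^bsub>R Quot ideal_power R I n\<^esub>),
       ring.zero = (\<lambda>n. \<zero>\<^bsub>R Quot ideal_power R I n\<^esub>),
       ring.add = (\<lambda>f g n. f n \<oplus>\<^bsub>R Quot ideal_power R I n\<^esub> g n) \<rparr>"

definition completion_map :: "('a, 'b) ring_scheme \<Rightarrow> 'a set \<Rightarrow> 'a \<Rightarrow> nat \<Rightarrow> 'a set" where
  "completion_map R I a = (\<lambda>n. ideal_power R I n +>\<^bsub>R\<^esub> a)"

text \<open>The fraction \<open>r/s\<close> is the equivalence class of \<open>(r, s)\<close>. The unions in the ring operations
  range over all representatives, which all give the same class.\<close>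

definition fraction :: "('a, 'b) ring_scheme \<Rightarrow> 'a set \<Rightarrow> 'a \<Rightarrow> 'a \<Rightarrow> ('a \<times> 'a) set" where
  "fraction R S r s = {(r', s'). r' \<in> carrier R \<and> s' \<in> S \<and>
     (\<exists>u \<in> S. u \<otimes>\<^bsub>R\<^esub> (r \<otimes>\<^bsub>R\<^esub> s') = u \<otimes>\<^bsub>R\<^esub> (r' \<otimes>\<^bsub>R\<^esub> s))}"

definition localization :: "('a, 'b) ring_scheme \<Rightarrow> 'a set \<Rightarrow> ('a \<times> 'a) set ring" where
  "localization R S =
     \<lparr> carrier = {fraction R S r s | r s. r \<in> carrier R \<and> s \<in> S},
       monoid.mult = (\<lambda>U V. \<Union>(r, s) \<in> U. \<Union>(r', s') \<in> V. fraction R S (r \<otimes>\<^bsub>R\<^esub> r') (s \<otimes>\<^bsub>R\<^esub> s')),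
       one = fraction R S \<one>\<^bsub>R\<^esub> \<one>\<^bsub>R\<^esub>,
       ring.zero = fraction R S \<zero>\<^bsub>R\<^esub> \<one>\<^bsub>R\<^esub>,
       ring.add = (\<lambda>U V. \<Union>(r, s) \<in> U. \<Union>(r', s') \<in> V.
                fraction R S (r \<otimes>\<^bsub>R\<^esub> s' \<oplus>\<^bsub>R\<^esub> r' \<otimes>\<^bsub>R\<^esub> s) (s \<otimes>\<^bsub>R\<^esub> s')) \<rparr>"

definition localization_at :: "('a, 'b) ring_scheme \<Rightarrow> 'a set \<Rightarrow> ('a \<times> 'a) set ring" where
  "localization_at R P = localization R (carrier R - P)"

definition residue_field :: "('a, 'b) ring_scheme \<Rightarrow> 'a set \<Rightarrow> ('a \<times> 'a) set set ring" where
  "residue_field R P = localization_at R P Quot max_ideal (localization_at R P)"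

definition residue_map :: "('a, 'b) ring_scheme \<Rightarrow> 'a set \<Rightarrow> 'a \<Rightarrow> ('a \<times> 'a) set set" where
  "residue_map R P a =
     max_ideal (localization_at R P) +>\<^bsub>localization_at R P\<^esub> fraction R (carrier R - P) a \<one>\<^bsub>R\<^esub>"


section \<open>Monoid rings, polynomial rings and tensor products\<close>

text \<open>The monoid ring \<open>R[G]\<close>: finitely supported functions with convolution as product.\<close>

definition monoid_ring ::
    "('a, 'b) ring_scheme \<Rightarrow> ('m, 'c) monoid_scheme \<Rightarrow> ('m \<Rightarrow> 'a) ring" where
  "monoid_ring R G =
     \<lparr> carrier = {f. (\<forall>x. f x \<in> carrier R) \<and> finite {x. f x \<noteq> \<zero>\<^bsub>R\<^esub>} \<and>
                    {x. f x \<noteq> \<zero>\<^bsub>R\<^esub>} \<subseteq> carrier G},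
       monoid.mult = (\<lambda>f g z. finsum R (\<lambda>(x, y). f x \<otimes>\<^bsub>R\<^esub> g y)
                 {(x, y). f x \<noteq> \<zero>\<^bsub>R\<^esub> \<and> g y \<noteq> \<zero>\<^bsub>R\<^esub> \<and> x \<otimes>\<^bsub>G\<^esub> y = z}),
       one = (\<lambda>x. if x = \<one>\<^bsub>G\<^esub> then \<one>\<^bsub>R\<^esub> else \<zero>\<^bsub>R\<^esub>),
       ring.zero = (\<lambda>x. \<zero>\<^bsub>R\<^esub>),
       ring.add = (\<lambda>f g x. f x \<oplus>\<^bsub>R\<^esub> g x) \<rparr>"

text \<open>Monomials in the variables \<open>x\<^sub>0, \<dots>, x\<^sub>n\<^sub>-\<^sub>1\<close> are multisets over \<open>{..<n}\<close>.\<close>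

definition monomials :: "nat \<Rightarrow> nat multiset monoid" where
  "monomials n = \<lparr> carrier = {A. set_mset A \<subseteq> {..<n}}, monoid.mult = (+), one = {#} \<rparr>"

definition polynomial_ring :: "('a, 'b) ring_scheme \<Rightarrow> nat \<Rightarrow> (nat multiset \<Rightarrow> 'a) ring" where
  "polynomial_ring R n = monoid_ring R (monomials n)"

text \<open>The tensor product of \<open>A\<close>-algebras \<open>\<phi> : A \<rightarrow> B\<close> and \<open>\<psi> : A \<rightarrow> C\<close>. The additive group of the
  monoid ring over \<open>\<int>\<close> of the multiplicative monoid of \<open>B \<times> C\<close> is the free abelian group on the
  symbols \<open>b \<otimes> c\<close>, with \<open>(b \<otimes> c)(b' \<otimes> c') = bb' \<otimes> cc'\<close>. The set of defining relations of
  \<open>B \<otimes>\<^sub>A C\<close> is stable under multiplication by symbols, so the ideal it generates is the subgroup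
  it generates.\<close>

definition pure_tensor :: "'b \<Rightarrow> 'c \<Rightarrow> 'b \<times> 'c \<Rightarrow> int" where
  "pure_tensor b c = (\<lambda>x. if x = (b, c) then 1 else 0)"

definition tensor_relations ::
    "('a, 'x) ring_scheme \<Rightarrow> ('a \<Rightarrow> 'b) \<Rightarrow> ('b, 'y) ring_scheme \<Rightarrow> ('a \<Rightarrow> 'c) \<Rightarrow>
     ('c, 'z) ring_scheme \<Rightarrow> ('b \<times> 'c \<Rightarrow> int) set" where
  "tensor_relations A \<phi> B \<psi> C =
     {(\<lambda>x. pure_tensor (b \<oplus>\<^bsub>B\<^esub> b') c x - pure_tensor b c x - pure_tensor b' c x) | b b' c.
        b \<in> carrier B \<and> b' \<in> carrier B \<and> c \<in> carrier C} \<union>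
     {(\<lambda>x. pure_tensor b (c \<oplus>\<^bsub>C\<^esub> c') x - pure_tensor b c x - pure_tensor b c' x) | b c c'.
        b \<in> carrier B \<and> c \<in> carrier C \<and> c' \<in> carrier C} \<union>
     {(\<lambda>x. pure_tensor (\<phi> a \<otimes>\<^bsub>B\<^esub> b) c x - pure_tensor b (\<psi> a \<otimes>\<^bsub>C\<^esub> c) x) | a b c.
        a \<in> carrier A \<and> b \<in> carrier B \<and> c \<in> carrier C}"

definition tensor_ideal ::
    "('a, 'x) ring_scheme \<Rightarrow> ('a \<Rightarrow> 'b) \<Rightarrow> ('b, 'y) ring_scheme \<Rightarrow> ('a \<Rightarrow> 'c) \<Rightarrow>
     ('c, 'z) ring_scheme \<Rightarrow> ('b \<times> 'c \<Rightarrow> int) set" where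
  "tensor_ideal A \<phi> B \<psi> C = Idl\<^bsub>monoid_ring \<Z> (B \<times>\<times> C)\<^esub> (tensor_relations A \<phi> B \<psi> C)"

definition algebra_tensor ::
    "('a, 'x) ring_scheme \<Rightarrow> ('a \<Rightarrow> 'b) \<Rightarrow> ('b, 'y) ring_scheme \<Rightarrow> ('a \<Rightarrow> 'c) \<Rightarrow>
     ('c, 'z) ring_scheme \<Rightarrow> ('b \<times> 'c \<Rightarrow> int) set ring" where
  "algebra_tensor A \<phi> B \<psi> C = monoid_ring \<Z> (B \<times>\<times> C) Quot tensor_ideal A \<phi> B \<psi> C"

text \<open>The canonical map \<open>c \<mapsto> 1 \<otimes> c\<close> from \<open>C\<close> to \<open>B \<otimes>\<^sub>A C\<close>.\<close>

definition tensor_right_map ::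
    "('a, 'x) ring_scheme \<Rightarrow> ('a \<Rightarrow> 'b) \<Rightarrow> ('b, 'y) ring_scheme \<Rightarrow> ('a \<Rightarrow> 'c) \<Rightarrow>
     ('c, 'z) ring_scheme \<Rightarrow> 'c \<Rightarrow> ('b \<times> 'c \<Rightarrow> int) set" where
  "tensor_right_map A \<phi> B \<psi> C c =
     tensor_ideal A \<phi> B \<psi> C +>\<^bsub>monoid_ring \<Z> (B \<times>\<times> C)\<^esub> pure_tensor \<one>\<^bsub>B\<^esub> c"


section \<open>Excellent rings\<close>

definition regular_local_ring :: "('a, 'b) ring_scheme \<Rightarrow> bool" where
  "regular_local_ring R \<longleftrightarrow> local_ring R \<and> noetherian_ring R \<and>
     (\<exists>U \<subseteq> carrier R. finite U \<and> enat (card U) = krull_dim R \<and> max_ideal R = Idl\<^bsub>R\<^esub> U)"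

definition regular_ring :: "('a, 'b) ring_scheme \<Rightarrow> bool" where
  "regular_ring R \<longleftrightarrow> cring R \<and> noetherian_ring R \<and>
     (\<forall>P. primeideal P R \<longrightarrow> regular_local_ring (localization_at R P))"

text \<open>For a field \<open>K\<close> and a \<open>K\<close>-algebra \<open>\<phi> : K \<rightarrow> F\<close>. Fixing the element type of \<open>L\<close> is no
  restriction: via a basis, a finite extension of degree \<open>n\<close> is in bijection with \<open>K^n\<close>, which
  embeds into \<open>nat \<Rightarrow> 'k\<close>.\<close>

definition geometrically_regular ::
    "('k, 'x) ring_scheme \<Rightarrow> ('k \<Rightarrow> 'f) \<Rightarrow> ('f, 'y) ring_scheme \<Rightarrow> bool" where
  "geometrically_regular K \<phi> F \<longleftrightarrow>
     (\<forall>(L :: (nat \<Rightarrow> 'k) ring) h. field L \<and> h \<in> ring_hom K L \<and>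
        ring.finite_dimension L (h ` carrier K) (carrier L) \<longrightarrow>
        regular_ring (algebra_tensor K \<phi> F h L))"

text \<open>For a local ring \<open>A\<close> with completion \<open>A'\<close>: the fibres \<open>A' \<otimes>\<^sub>A \<kappa>(Q)\<close> are geometrically regular
  over \<open>\<kappa>(Q)\<close>.\<close>

definition geom_regular_formal_fibres :: "('a, 'b) ring_scheme \<Rightarrow> bool" where
  "geom_regular_formal_fibres A \<longleftrightarrow>
     (\<forall>Q. primeideal Q A \<longrightarrow>
        (let A' = adic_completion A (max_ideal A); \<phi> = completion_map A (max_ideal A);
             \<kappa> = residue_field A Q; \<psi> = residue_map A Q
         in geometrically_regular \<kappa> (tensor_right_map A \<phi> A' \<psi> \<kappa>) (algebra_tensor A \<phi> A' \<psi> \<kappa>)))"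

definition G_ring :: "('a, 'b) ring_scheme \<Rightarrow> bool" where
  "G_ring R \<longleftrightarrow> cring R \<and> noetherian_ring R \<and>
     (\<forall>P. primeideal P R \<longrightarrow> geom_regular_formal_fibres (localization_at R P))"

definition zariski_open :: "('a, 'b) ring_scheme \<Rightarrow> 'a set set \<Rightarrow> bool" where
  "zariski_open R U \<longleftrightarrow> (\<exists>E \<subseteq> carrier R. U = {P. primeideal P R \<and> \<not> E \<subseteq> P})"

definition regular_locus :: "('a, 'b) ring_scheme \<Rightarrow> 'a set set" where
  "regular_locus R = {P. primeideal P R \<and> regular_local_ring (localization_at R P)}"

text \<open>Up to isomorphism, the finitely generated \<open>R\<close>-algebras are the quotients of the polynomial
  rings over \<open>R\<close> in finitely many variables.\<close>

definition J2_ring :: "('a, 'b) ring_scheme \<Rightarrow> bool" where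
  "J2_ring R \<longleftrightarrow> cring R \<and> noetherian_ring R \<and>
     (\<forall>n I. ideal I (polynomial_ring R n) \<longrightarrow>
        (let B = polynomial_ring R n Quot I in zariski_open B (regular_locus B)))"

definition saturated_prime_chain ::
    "('a, 'b) ring_scheme \<Rightarrow> 'a set \<Rightarrow> 'a set \<Rightarrow> nat \<Rightarrow> (nat \<Rightarrow> 'a set) \<Rightarrow> bool" where
  "saturated_prime_chain R P Q n C \<longleftrightarrow> C 0 = P \<and> C n = Q \<and> (\<forall>i\<le>n. primeideal (C i) R) \<and>
     (\<forall>i<n. C i \<subset> C (Suc i) \<and> \<not> (\<exists>P'. primeideal P' R \<and> C i \<subset> P' \<and> P' \<subset> C (Suc i)))"

definition catenary :: "('a, 'b) ring_scheme \<Rightarrow> bool" where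
  "catenary R \<longleftrightarrow> (\<forall>P Q. primeideal P R \<and> primeideal Q R \<and> P \<subseteq> Q \<longrightarrow>
     (\<exists>!n. \<exists>C. saturated_prime_chain R P Q n C))"

definition universally_catenary :: "('a, 'b) ring_scheme \<Rightarrow> bool" where
  "universally_catenary R \<longleftrightarrow> cring R \<and> noetherian_ring R \<and>
     (\<forall>n I. ideal I (polynomial_ring R n) \<longrightarrow> catenary (polynomial_ring R n Quot I))"

definition excellent :: "('a, 'b) ring_scheme \<Rightarrow> bool" where
  "excellent R \<longleftrightarrow> noetherian_ring R \<and> universally_catenary R \<and> G_ring R \<and> J2_ring R"


section \<open>Tight closure and Hilbert--Kunz multiplicity\<close>

definition bracket_power :: "('a, 'b) ring_scheme \<Rightarrow> 'a set \<Rightarrow> nat \<Rightarrow> 'a set" where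
  "bracket_power R I q = Idl\<^bsub>R\<^esub> ((\<lambda>x. x [^]\<^bsub>R\<^esub> q) ` I)"

definition tight_closure :: "('a, 'b) ring_scheme \<Rightarrow> nat \<Rightarrow> 'a set \<Rightarrow> 'a set" where
  "tight_closure R p I = {x \<in> carrier R. \<exists>c \<in> carrier R. (\<forall>P. minimal_prime R P \<longrightarrow> c \<notin> P) \<and>
     (\<exists>e0. \<forall>e\<ge>e0. c \<otimes>\<^bsub>R\<^esub> (x [^]\<^bsub>R\<^esub> (p ^ e)) \<in> bracket_power R I (p ^ e))}"

text \<open>For local rings of finite dimension and ideals primary to the maximal ideal, where dimension
  and lengths are finite.\<close>

definition hilbert_kunz :: "('a, 'b) ring_scheme \<Rightarrow> nat \<Rightarrow> 'a set \<Rightarrow> real" where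
  "hilbert_kunz R p I =
     lim (\<lambda>e. real (the_enat (module_length R (quot_module R (bracket_power R I (p ^ e)))))
              / real (p ^ e) ^ the_enat (krull_dim R))"

end

theory Submission
  imports Defs "HOL-Library.Set_Algebras" "HOL-Computational_Algebra.Polynomial"
begin

text \<open>Fix parameters \<open>a\<^sub>1, \<dots>, a\<^sub>d\<close> whose ideal \<open>a\<close> has the tight closure of \<open>J\<close>, let \<open>b = a\<^bsup>[qQ]\<^esup>\<close> with
  generators \<open>b\<^sub>i\<close>, and count lengths up to \<open>o(Q\<^sup>d)\<close>. An element \<open>c\<close> outside all minimal primes cuts the
  dimension, so \<open>R/(c, I\<^bsup>[Q]\<^esup>)\<close> is negligible, and \<open>J\<^bsup>[qQ]\<^esup>\<close> may be replaced by \<open>b\<close>; moreover \<open>b + I\<^bsup>[Q]\<^esup>\<close> is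
  negligible modulo \<open>I\<^bsup>[Q]\<^esup>\<close>. Filtering by the \<open>b\<^sub>i\<close>, the length of \<open>b/I\<^bsup>[Q]\<^esup>b\<close> is at most
  \<open>d \<cdot> \<lambda>(R/I\<^bsup>[Q]\<^esup>)\<close>, and the defect is bounded by the lengths of \<open>(b + U\<^sub>i)/b\<close>, where \<open>U\<^sub>i\<close> is the colon ideal
  of the other generators by \<open>b\<^sub>i\<close>. These lengths are in turn bounded by \<open>p\<^sup>d \<lambda>(R/b) - \<lambda>(R/b\<^bsup>[p]\<^esup>)\<close>,
  which is negligible because \<open>\<lambda>(R/a\<^bsup>[Q]\<^esup>)/Q\<^sup>d\<close> converges.

  The limits exist because the reduced completion is a finite algebra over a ring of power series in the
  parameters with coefficients in a coefficient field; modulo the primes of this algebra a Frobenius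
  semilinear map shows that the normalized lengths are almost decreasing.

  A ring given by a carrier is replaced by the free commutative ring on its elements, so that ideals become
  ideals of a type of class \<open>comm_ring_1\<close> containing a fixed base ideal, written \<open>Z\<close> or \<open>K\<close>.\<close>

section \<open>The free commutative ring\<close>

text \<open>The residue field may have infinite degree over its \<open>p\<close>-th powers, so the
  Frobenius need not be finite, and convergence cannot come from viewing the algebra as a module
  over its own \<open>p\<close>-th powers. The semilinear map is therefore not the Frobenius. Modulo
  a prime, let \<open>C\<close> be the subring generated over the power series ring \<open>A\<close>
  by the \<open>p^e\<close>-th powers. Its rank over \<open>A\<close> decreases with
  \<open>e\<close>; where it stalls, \<open>C\<close> and the subring generated over
  \<open>A\<close> by its \<open>p\<close>-th powers have the same fraction field. The map raises
  coefficients with respect to a generic basis over \<open>C\<close> to the power \<open>p\<close>.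
  It carries bracket powers to the next ones as the Frobenius would, its image fills the algebra up
  to torsion, and the \<open>d\<close> parameters alone account for the growth of length by
  \<open>p^d\<close>. The colon bound comes from filtering the quotient by \<open>b^[p]\<close>
  along powers of one generator: one of the factors is killed by \<open>U_i\<close> too, and there
  the length of \<open>(b + U_i)/b\<close> is lost.\<close>

datatype 'a rterm = RVar 'a | RZero | ROne | RNeg "'a rterm"
  | RAdd "'a rterm" "'a rterm" | RMul "'a rterm" "'a rterm"

inductive req :: "'a rterm \<Rightarrow> 'a rterm \<Rightarrow> bool" where
  refl: "req x x"
| sym: "req x y \<Longrightarrow> req y x"
| trans: "req x y \<Longrightarrow> req y z \<Longrightarrow> req x z"
| neg: "req x y \<Longrightarrow> req (RNeg x) (RNeg y)"
| add: "req x y \<Longrightarrow> req x' y' \<Longrightarrow> req (RAdd x x') (RAdd y y')"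
| mul: "req x y \<Longrightarrow> req x' y' \<Longrightarrow> req (RMul x x') (RMul y y')"
| add_assoc: "req (RAdd (RAdd x y) z) (RAdd x (RAdd y z))"
| add_comm: "req (RAdd x y) (RAdd y x)"
| add_zero: "req (RAdd RZero x) x"
| add_neg: "req (RAdd (RNeg x) x) RZero"
| mul_assoc: "req (RMul (RMul x y) z) (RMul x (RMul y z))"
| mul_comm: "req (RMul x y) (RMul y x)"
| mul_one: "req (RMul ROne x) x"
| distrib: "req (RMul (RAdd x y) z) (RAdd (RMul x z) (RMul y z))"

quotient_type 'a frng = "'a rterm" / req
  by (intro equivpI reflpI sympI transpI) (auto intro: req.refl req.sym req.trans)

text \<open>The value at all variables zero. It separates the terms for 0 and 1, as the class
  \<open>comm_ring_1\<close> demands.\<close>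

primrec int_eval :: "'a rterm \<Rightarrow> int" where
  "int_eval (RVar a) = 0"
| "int_eval RZero = 0"
| "int_eval ROne = 1"
| "int_eval (RNeg x) = - int_eval x"
| "int_eval (RAdd x y) = int_eval x + int_eval y"
| "int_eval (RMul x y) = int_eval x * int_eval y"

lemma req_int_eval: "req x y \<Longrightarrow> int_eval x = int_eval y"
  by (induction rule: req.induct) (auto simp: algebra_simps)

instantiation frng :: (type) comm_ring_1
begin

lift_definition zero_frng :: "'a frng" is RZero .
lift_definition one_frng :: "'a frng" is ROne .
lift_definition uminus_frng :: "'a frng \<Rightarrow> 'a frng" is RNeg by (rule req.neg)
lift_definition plus_frng :: "'a frng \<Rightarrow> 'a frng \<Rightarrow> 'a frng" is RAdd by (rule req.add)
lift_definition times_frng :: "'a frng \<Rightarrow> 'a frng \<Rightarrow> 'a frng" is RMul by (rule req.mul)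
definition minus_frng :: "'a frng \<Rightarrow> 'a frng \<Rightarrow> 'a frng" where "minus_frng x y = x + - y"

instance
proof
  fix a b c :: "'a frng"
  show "a * b * c = a * (b * c)" by transfer (rule req.mul_assoc)
  show "a * b = b * a" by transfer (rule req.mul_comm)
  show "1 * a = a" by transfer (rule req.mul_one)
  show "a + b + c = a + (b + c)" by transfer (rule req.add_assoc)
  show "a + b = b + a" by transfer (rule req.add_comm)
  show "0 + a = a" by transfer (rule req.add_zero)
  show "- a + a = 0" by transfer (rule req.add_neg)
  show "a - b = a + - b" by (rule minus_frng_def)
  show "(a + b) * c = a * c + b * c" by transfer (rule req.distrib)
  show "(0 :: 'a frng) \<noteq> 1" by transfer (auto dest: req_int_eval)
qed

end

lift_definition fvar :: "'a \<Rightarrow> 'a frng" is RVar .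

text \<open>A variable outside the carrier is sent to zero, so that every term has its value in the
  carrier.\<close>

primrec term_eval :: "('a, 'b) ring_scheme \<Rightarrow> 'a rterm \<Rightarrow> 'a" where
  "term_eval R (RVar a) = (if a \<in> carrier R then a else \<zero>\<^bsub>R\<^esub>)"
| "term_eval R RZero = \<zero>\<^bsub>R\<^esub>"
| "term_eval R ROne = \<one>\<^bsub>R\<^esub>"
| "term_eval R (RNeg x) = \<ominus>\<^bsub>R\<^esub> term_eval R x"
| "term_eval R (RAdd x y) = term_eval R x \<oplus>\<^bsub>R\<^esub> term_eval R y"
| "term_eval R (RMul x y) = term_eval R x \<otimes>\<^bsub>R\<^esub> term_eval R y"

definition feval :: "('a, 'b) ring_scheme \<Rightarrow> 'a frng \<Rightarrow> 'a" where
  "feval R x = term_eval R (rep_frng x)"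

context cring
begin

lemma term_eval_closed: "term_eval R x \<in> carrier R"
  by (induction x) auto

lemma req_term_eval: "req x y \<Longrightarrow> term_eval R x = term_eval R y"
proof (induction rule: req.induct)
  case (add_assoc x y z) then show ?case by (simp add: term_eval_closed a_assoc)
next
  case (add_comm x y) then show ?case by (simp add: term_eval_closed a_comm)
next
  case (add_neg x) then show ?case by (simp add: term_eval_closed l_neg)
next
  case (mul_assoc x y z) then show ?case by (simp add: term_eval_closed m_assoc)
next
  case (mul_comm x y) then show ?case by (simp add: term_eval_closed m_comm)
next
  case (distrib x y z) then show ?case by (simp add: term_eval_closed l_distr)
qed (auto simp: term_eval_closed)

lemma feval_abs: "feval R (abs_frng t) = term_eval R t"
  unfolding feval_def
  by (rule req_term_eval, rule Quotient3_rep_abs[OF Quotient3_frng], rule req.refl)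

lemma feval_closed [simp]: "feval R x \<in> carrier R"
  by (simp add: feval_def term_eval_closed)

lemma feval_fvar: "a \<in> carrier R \<Longrightarrow> feval R (fvar a) = a"
  by (simp add: fvar_def feval_abs)

lemma feval_zero [simp]: "feval R 0 = \<zero>" and feval_one [simp]: "feval R 1 = \<one>"
  by (simp_all add: zero_frng_def one_frng_def feval_abs)

lemma feval_add [simp]: "feval R (x + y) = feval R x \<oplus> feval R y"
  by (induction x, induction y) (simp add: plus_frng.abs_eq feval_abs)

lemma feval_mult [simp]: "feval R (x * y) = feval R x \<otimes> feval R y"
  by (induction x, induction y) (simp add: times_frng.abs_eq feval_abs)

lemma feval_uminus [simp]: "feval R (- x) = \<ominus> feval R x"
  by (induction x) (simp add: uminus_frng.abs_eq feval_abs)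

lemma feval_diff [simp]: "feval R (x - y) = feval R x \<ominus> feval R y"
  by (simp add: diff_conv_add_uminus a_minus_def del: add_uminus_conv_diff)

lemma feval_power [simp]: "feval R (x ^ n) = feval R x [^] n"
  by (induction n) (simp_all add: m_comm)

end

section \<open>Submodules and their lengths\<close>

definition srng :: "'t::comm_ring_1 set \<Rightarrow> bool" where
  "srng S \<longleftrightarrow> 1 \<in> S \<and> -1 \<in> S \<and> (\<forall>x\<in>S. \<forall>y\<in>S. x + y \<in> S \<and> x * y \<in> S)"

text \<open>Lengths are taken over a coefficient subring as well as over the whole ring; ideals are
  the case \<open>S = UNIV\<close>.\<close>

definition sub :: "'t::comm_ring_1 set \<Rightarrow> 't set \<Rightarrow> bool" where
  "sub S U \<longleftrightarrow> 0 \<in> U \<and> (\<forall>x\<in>U. \<forall>y\<in>U. x + y \<in> U) \<and> (\<forall>s\<in>S. \<forall>x\<in>U. s * x \<in> U)"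

abbreviation idl :: "'t::comm_ring_1 set \<Rightarrow> bool" where "idl \<equiv> sub UNIV"

lemma srng_UNIV [simp]: "srng UNIV" by (simp add: srng_def)

lemma srngD: assumes "srng S" shows "1 \<in> S" "-1 \<in> S" "0 \<in> S"
    "x \<in> S \<Longrightarrow> y \<in> S \<Longrightarrow> x + y \<in> S" "x \<in> S \<Longrightarrow> y \<in> S \<Longrightarrow> x * y \<in> S"
    "x \<in> S \<Longrightarrow> - x \<in> S" "x \<in> S \<Longrightarrow> y \<in> S \<Longrightarrow> x - y \<in> S"
proof -
  show 1: "1 \<in> S" "-1 \<in> S" "x \<in> S \<Longrightarrow> y \<in> S \<Longrightarrow> x + y \<in> S" "x \<in> S \<Longrightarrow> y \<in> S \<Longrightarrow> x * y \<in> S" for x y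
    using assms by (auto simp: srng_def)
  show "0 \<in> S" using 1(3)[OF 1(1,2)] by simp
  show 2: "- x \<in> S" if "x \<in> S" for x using 1(4)[OF 1(2) that] by simp
  show "x \<in> S \<Longrightarrow> y \<in> S \<Longrightarrow> x - y \<in> S" using 1(3)[OF _ 2] by simp
qed

lemma srng_power: "srng S \<Longrightarrow> x \<in> S \<Longrightarrow> x ^ n \<in> S"
  by (induction n) (auto intro: srngD)

lemma subI:
  assumes "0 \<in> U" "\<And>x y. x \<in> U \<Longrightarrow> y \<in> U \<Longrightarrow> x + y \<in> U" "\<And>s x. s \<in> S \<Longrightarrow> x \<in> U \<Longrightarrow> s * x \<in> U"
  shows "sub S U"
  using assms by (auto simp: sub_def)

lemma sub_zero: "sub S U \<Longrightarrow> 0 \<in> U" by (simp add: sub_def)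
lemma sub_add: "sub S U \<Longrightarrow> x \<in> U \<Longrightarrow> y \<in> U \<Longrightarrow> x + y \<in> U" by (simp add: sub_def)
lemma sub_smult: "sub S U \<Longrightarrow> s \<in> S \<Longrightarrow> x \<in> U \<Longrightarrow> s * x \<in> U" by (simp add: sub_def)

lemma sub_uminus: "sub S U \<Longrightarrow> srng S \<Longrightarrow> x \<in> U \<Longrightarrow> - x \<in> U"
  using sub_smult[of S U "-1" x] by (simp add: srng_def)

lemma sub_diff: "sub S U \<Longrightarrow> srng S \<Longrightarrow> x \<in> U \<Longrightarrow> y \<in> U \<Longrightarrow> x - y \<in> U"
  using sub_add[of S U x "- y"] sub_uminus[of S U y] by simp

lemma idl_uminus: "idl U \<Longrightarrow> x \<in> U \<Longrightarrow> - x \<in> U" by (rule sub_uminus) auto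
lemma idl_diff: "idl U \<Longrightarrow> x \<in> U \<Longrightarrow> y \<in> U \<Longrightarrow> x - y \<in> U" by (rule sub_diff) auto
lemma idl_mult: "idl U \<Longrightarrow> x \<in> U \<Longrightarrow> s * x \<in> U" by (rule sub_smult) auto
lemma idl_mult': "idl U \<Longrightarrow> x \<in> U \<Longrightarrow> x * s \<in> U" using idl_mult[of U x s] by (simp add: mult.commute)

lemma idl_trans: "idl U \<Longrightarrow> x - y \<in> U \<Longrightarrow> y - z \<in> U \<Longrightarrow> x - z \<in> U"
  using sub_add[of UNIV U "x - y" "y - z"] by simp

lemma idl_cong: "idl U \<Longrightarrow> x - y \<in> U \<Longrightarrow> x \<in> U \<longleftrightarrow> y \<in> U"
  using sub_add[of UNIV U "x - y" y] idl_diff[of U x "x - y"] by auto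

lemma sub_UNIV: "sub S UNIV" by (simp add: sub_def)

lemma sub_mono: "sub S U \<Longrightarrow> S' \<subseteq> S \<Longrightarrow> sub S' U" by (auto simp: sub_def)

lemma idl_sub: "idl U \<Longrightarrow> sub S U" by (erule sub_mono) auto

lemma sub_Int: "sub S U \<Longrightarrow> sub S V \<Longrightarrow> sub S (U \<inter> V)" by (auto simp: sub_def)

lemma sub_Inter: "(\<And>U. U \<in> F \<Longrightarrow> sub S U) \<Longrightarrow> sub S (\<Inter>F)" by (auto simp: sub_def)

definition gen :: "'t::comm_ring_1 set \<Rightarrow> 't set \<Rightarrow> 't set" where
  "gen S G = \<Inter>{U. sub S U \<and> G \<subseteq> U}"

lemma sub_gen: "sub S (gen S G)" unfolding gen_def by (rule sub_Inter) auto

lemma gen_superset: "G \<subseteq> gen S G" unfolding gen_def by auto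

lemma gen_inc: "x \<in> G \<Longrightarrow> x \<in> gen S G" using gen_superset by auto

lemma gen_minimal: "G \<subseteq> U \<Longrightarrow> sub S U \<Longrightarrow> gen S G \<subseteq> U" unfolding gen_def by auto

lemma gen_mono: "G \<subseteq> Y \<Longrightarrow> gen S G \<subseteq> gen S Y" unfolding gen_def by auto

lemma sub_plus: assumes "sub S U" "sub S V" shows "sub S (U + V)"
proof (rule subI)
  show "0 \<in> U + V" using set_plus_intro[of 0 U 0 V] assms by (simp add: sub_zero)
next
  fix x y assume "x \<in> U + V" "y \<in> U + V"
  then obtain a b c d where *: "x = a + b" "y = c + d" "a \<in> U" "b \<in> V" "c \<in> U" "d \<in> V"
    by (auto elim!: set_plus_elim)
  have "x + y = (a + c) + (b + d)" using * by simp
  then show "x + y \<in> U + V" using * assms by (metis set_plus_intro sub_add)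
next
  fix s x assume "s \<in> S" "x \<in> U + V"
  then obtain a b where *: "x = a + b" "a \<in> U" "b \<in> V" by (auto elim!: set_plus_elim)
  then show "s * x \<in> U + V" using \<open>s \<in> S\<close> assms
    by (simp add: distrib_left set_plus_intro sub_smult)
qed

lemma plus_left_subset: "sub S V \<Longrightarrow> U \<subseteq> U + V"
  using set_plus_intro[of _ U 0 V] by (auto simp: sub_zero)

lemma plus_right_subset: "sub S U \<Longrightarrow> V \<subseteq> U + V"
  using set_plus_intro[of 0 U _ V] by (auto simp: sub_zero)

lemma plus_least: "sub S W \<Longrightarrow> U \<subseteq> W \<Longrightarrow> V \<subseteq> W \<Longrightarrow> U + V \<subseteq> W"
  by (auto elim!: set_plus_elim intro: sub_add)

lemma plus_mono: "U \<subseteq> U' \<Longrightarrow> V \<subseteq> V' \<Longrightarrow> U + V \<subseteq> U' + (V'::'t::comm_ring_1 set)"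
  by (rule set_plus_mono2)

lemma sub_image: assumes "sub S V" shows "sub S ((*) x ` V)"
proof (rule subI)
  show "0 \<in> (*) x ` V" using sub_zero[OF assms] by force
next
  fix a b assume "a \<in> (*) x ` V" "b \<in> (*) x ` V"
  then show "a + b \<in> (*) x ` V" using sub_add[OF assms] by (auto simp flip: distrib_left)
next
  fix s a assume "s \<in> S" "a \<in> (*) x ` V"
  then show "s * a \<in> (*) x ` V"
    using sub_smult[OF assms] by (auto simp: mult.left_commute[of s x])
qed

text \<open>The length of the \<open>S\<close>-module \<open>V/U\<close>, read off from the
  submodules between \<open>U\<close> and \<open>V\<close>, so that no quotient has to be
  formed.\<close>

definition slen :: "'t::comm_ring_1 set \<Rightarrow> 't set \<Rightarrow> 't set \<Rightarrow> enat" where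
  "slen S U V = chain_sup (\<lambda>W. sub S W \<and> U \<subseteq> W \<and> W \<subseteq> V)"

lemma chain_sup_upper:
  assumes "\<forall>i\<le>n. P (C i)" "\<forall>i<n. C i \<subset> C (Suc i)"
  shows "enat n \<le> chain_sup P"
  unfolding chain_sup_def
proof (rule SUP_upper, rule CollectI)
  show "\<exists>C. (\<forall>i\<le>n. P (C i)) \<and> (\<forall>i<n. C i \<subset> C (Suc i))"
    by (rule exI[of _ C]) (use assms in simp)
qed

lemma chain_sup_least:
  assumes "\<And>n C. \<forall>i\<le>n. P (C i) \<Longrightarrow> \<forall>i<n. C i \<subset> C (Suc i) \<Longrightarrow> enat n \<le> b"
  shows "chain_sup P \<le> b"
  unfolding chain_sup_def
proof (rule SUP_least, drule CollectD, elim exE conjE)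
  fix n C assume "\<forall>i\<le>n. P (C i)" "\<forall>i<n. C i \<subset> C (Suc i)"
  then show "enat n \<le> b" by (rule assms)
qed

text \<open>Drop the repetitions from a weakly increasing chain. Such chains arise when a chain is
  intersected with a fixed submodule, or when that submodule is added to it.\<close>

lemma chain_sup_mono_steps:
  assumes "\<forall>i\<le>n. P (D i)" "\<forall>i<n. D i \<subseteq> D (Suc i)"
  shows "enat (card {i. i < n \<and> D i \<noteq> D (Suc i)}) \<le> chain_sup P"
proof -
  have "\<exists>C. (\<forall>i\<le>card {i. i < n \<and> D i \<noteq> D (Suc i)}. P (C i)) \<and>
      (\<forall>i<card {i. i < n \<and> D i \<noteq> D (Suc i)}. C i \<subset> C (Suc i)) \<and>
      C (card {i. i < n \<and> D i \<noteq> D (Suc i)}) = D n"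
    using assms
  proof (induction n)
    case 0
    then show ?case by (intro exI[of _ D]) auto
  next
    case (Suc n)
    let ?A = "\<lambda>n. {i. i < n \<and> D i \<noteq> D (Suc i)}"
    have "\<forall>i\<le>n. P (D i)" "\<forall>i<n. D i \<subseteq> D (Suc i)" using Suc.prems by auto
    from Suc.IH[OF this]
    obtain C where C: "\<forall>i\<le>card (?A n). P (C i)" "\<forall>i<card (?A n). C i \<subset> C (Suc i)" "C (card (?A n)) = D n"
      by (elim exE conjE)
    show ?case
    proof (cases "D n = D (Suc n)")
      case True
      then have "?A (Suc n) = ?A n" by (auto simp: less_Suc_eq)
      then show ?thesis using C True by auto
    next
      case False
      then have "?A (Suc n) = insert n (?A n)" by (auto simp: less_Suc_eq)
      then have c: "card (?A (Suc n)) = Suc (card (?A n))" by simp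
      have "D n \<subset> D (Suc n)" using False Suc.prems(2) by blast
      then show ?thesis unfolding c using C Suc.prems(1)
        by (intro exI[of _ "C(Suc (card (?A n)) := D (Suc n))"]) (auto simp: le_Suc_eq less_Suc_eq)
    qed
  qed
  then show ?thesis
  proof (elim exE conjE)
    fix C assume "\<forall>i\<le>card {i. i < n \<and> D i \<noteq> D (Suc i)}. P (C i)"
      "\<forall>i<card {i. i < n \<and> D i \<noteq> D (Suc i)}. C i \<subset> C (Suc i)"
    then show ?thesis by (rule chain_sup_upper)
  qed
qed

text \<open>A supremum over no chains is 0 as well, so \<open>n = 0\<close> relies on the member
  \<open>G\<close>; longer chains are truncated.\<close>

lemma chain_sup_attained:
  assumes "enat n \<le> chain_sup P" "P G"
  obtains C where "\<forall>i\<le>n. P (C i)" "\<forall>i<n. C i \<subset> C (Suc i)"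
proof (cases n)
  case 0
  then show thesis using that[of "\<lambda>_. G"] assms by auto
next
  case (Suc m)
  have "\<exists>k C. k \<ge> n \<and> (\<forall>i\<le>k. P (C i)) \<and> (\<forall>i<k. C i \<subset> C (Suc i))"
  proof (rule ccontr)
    assume no: "\<not> ?thesis"
    have "chain_sup P \<le> enat m"
    proof (rule chain_sup_least)
      fix k C assume "\<forall>i\<le>k. P (C i)" "\<forall>i<k. C i \<subset> C (Suc i)"
      then have "\<not> n \<le> k" using no by blast
      then show "enat k \<le> enat m" using Suc by simp
    qed
    then have "enat n \<le> enat m" using assms(1) by (rule order.trans[rotated])
    then show False using Suc by simp
  qed
  then obtain k C where k: "k \<ge> n" "\<forall>i\<le>k. P (C i)" "\<forall>i<k. C i \<subset> C (Suc i)" by blast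
  show thesis by (rule that[of C]) (use k in simp_all)
qed

lemma slen_attained:
  assumes "enat n \<le> slen S U V" "sub S U" "U \<subseteq> V"
  obtains C where "\<forall>i\<le>n. sub S (C i)" "\<forall>i\<le>n. U \<subseteq> C i" "\<forall>i\<le>n. C i \<subseteq> V" "\<forall>i<n. C i \<subset> C (Suc i)"
proof (rule chain_sup_attained[of n "\<lambda>W. sub S W \<and> U \<subseteq> W \<and> W \<subseteq> V" U])
  show "enat n \<le> chain_sup (\<lambda>W. sub S W \<and> U \<subseteq> W \<and> W \<subseteq> V)" using assms(1) by (simp add: slen_def)
  show "sub S U \<and> U \<subseteq> U \<and> U \<subseteq> V" using assms by simp
  fix C assume "\<forall>i\<le>n. sub S (C i) \<and> U \<subseteq> C i \<and> C i \<subseteq> V" "\<forall>i<n. C i \<subset> C (Suc i)"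
  then show thesis by (intro that[of C]) simp_all
qed

lemma slen_mono:
  assumes "U \<subseteq> U'" "V' \<subseteq> V" "S \<subseteq> S'"
  shows "slen S' U' V' \<le> slen S U V"
  unfolding slen_def
proof (rule chain_sup_least)
  fix n C assume *: "\<forall>i\<le>n. sub S' (C i) \<and> U' \<subseteq> C i \<and> C i \<subseteq> V'" "\<forall>i<n. C i \<subset> C (Suc i)"
  show "enat n \<le> chain_sup (\<lambda>W. sub S W \<and> U \<subseteq> W \<and> W \<subseteq> V)"
  proof (rule chain_sup_upper[of _ _ C])
    show "\<forall>i\<le>n. sub S (C i) \<and> U \<subseteq> C i \<and> C i \<subseteq> V"
    proof (intro allI impI)
      fix i assume "i \<le> n"
      then have i: "sub S' (C i)" "U' \<subseteq> C i" "C i \<subseteq> V'" using * by auto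
      show "sub S (C i) \<and> U \<subseteq> C i \<and> C i \<subseteq> V" using sub_mono[OF i(1) assms(3)] i(2,3) assms by auto
    qed
  qed (use * in blast)
qed

lemma slen_self: "slen S U U = 0"
proof -
  have "slen S U U \<le> 0"
    unfolding slen_def
  proof (rule chain_sup_least)
    fix n C assume *: "\<forall>i\<le>n. sub S (C i) \<and> U \<subseteq> C i \<and> C i \<subseteq> U" "\<forall>i<n. C i \<subset> C (Suc i)"
    have "n = 0"
    proof (rule ccontr)
      assume "n \<noteq> 0"
      then have "0 < n" "0 \<le> n" "Suc 0 \<le> n" by auto
      then have "C 0 \<subset> C (Suc 0)" "U \<subseteq> C 0" "C (Suc 0) \<subseteq> U" using * by blast+
      then show False by blast
    qed
    then show "enat n \<le> 0" by (simp add: zero_enat_def)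
  qed
  then show ?thesis by simp
qed

lemma enat_eq_infinityI: assumes "\<And>n. enat n \<le> c" shows "c = \<infinity>"
  using assms[of "Suc (the_enat c)"] by (cases c) auto

lemma enat_add_leI:
  assumes "\<And>n m. enat n \<le> a \<Longrightarrow> enat m \<le> b \<Longrightarrow> enat (n + m) \<le> c"
  shows "a + b \<le> c"
proof (cases a)
  case (enat n)
  show ?thesis
  proof (cases b)
    case (enat m)
    then show ?thesis using assms[of n m] \<open>a = enat n\<close> by simp
  next
    case infinity
    have "enat m \<le> c" for m using assms[of 0 m] infinity by (simp flip: zero_enat_def)
    then have "c = \<infinity>" by (rule enat_eq_infinityI)
    then show ?thesis by simp
  qed
next
  case infinity
  have "enat n \<le> c" for n using assms[of n 0] infinity by (simp flip: zero_enat_def)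
  then have "c = \<infinity>" by (rule enat_eq_infinityI)
  then show ?thesis by simp
qed

text \<open>Concatenation of chains gives one inequality. For the other, a strict step of a chain
  from \<open>U\<close> to \<open>W\<close> stays strict after intersecting with \<open>V\<close> or
  after adding \<open>V\<close>, by the modular law.\<close>

lemma slen_add:
  assumes S: "srng S" "sub S U" "sub S V" "sub S W" and UV: "U \<subseteq> V" and VW: "V \<subseteq> W"
  shows "slen S U W = slen S U V + slen S V W"
proof (rule antisym)
  show "slen S U V + slen S V W \<le> slen S U W"
  proof (rule enat_add_leI)
    fix n m assume n: "enat n \<le> slen S U V" and m: "enat m \<le> slen S V W"
    obtain C where C: "\<forall>i\<le>n. sub S (C i)" "\<forall>i\<le>n. U \<subseteq> C i" "\<forall>i\<le>n. C i \<subseteq> V" "\<forall>i<n. C i \<subset> C (Suc i)"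
      by (rule slen_attained[OF n S(2) UV])
    obtain D where D: "\<forall>i\<le>m. sub S (D i)" "\<forall>i\<le>m. V \<subseteq> D i" "\<forall>i\<le>m. D i \<subseteq> W" "\<forall>i<m. D i \<subset> D (Suc i)"
      by (rule slen_attained[OF m S(3) VW])
    let ?E = "\<lambda>i. if i < n then C i else D (i - n)"
    show "enat (n + m) \<le> slen S U W"
      unfolding slen_def
    proof (rule chain_sup_upper[of _ _ ?E]; safe)
      fix i assume "i \<le> n + m"
      then have k: "\<not> i < n \<Longrightarrow> i - n \<le> m" by simp
      show "sub S (?E i)" using C D k by simp
      show "x \<in> ?E i" if "x \<in> U" for x
      proof (cases "i < n")
        case True then show ?thesis using C(2) that by (simp add: subset_iff)
      next
        case False then show ?thesis using D(2) k UV that by (simp add: subset_iff)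
      qed
      show "x \<in> W" if "x \<in> ?E i" for x
      proof (cases "i < n")
        case True
        then have "C i \<subseteq> V" using C(3) by simp
        then show ?thesis using True VW that by auto
      next
        case False then show ?thesis using D(3) k that by (simp add: subset_iff)
      qed
    next
      fix i assume i: "i < n + m"
      have *: "?E i \<subset> ?E (Suc i)"
      proof (cases "Suc i < n")
        case True then show ?thesis using C(4) by simp
      next
        case False
        show ?thesis
        proof (cases "i < n")
          case True
          then have "n = Suc i" using False by simp
          then have "?E i = C i" "?E (Suc i) = D 0" "C i \<subset> C n" "C n \<subseteq> V" "V \<subseteq> D 0"
            using C D by auto
          then show ?thesis by blast
        next
          case False
          then show ?thesis using D(4) i by (simp add: Suc_diff_le)
        qed
      qed
      then show "\<And>x. x \<in> ?E i \<Longrightarrow> x \<in> ?E (Suc i)" by blast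
      show "?E i = ?E (Suc i) \<Longrightarrow> False" using * by blast
    qed
  qed
next
  show "slen S U W \<le> slen S U V + slen S V W"
    unfolding slen_def[of S U W]
  proof (rule chain_sup_least)
    fix n C assume C: "\<forall>i\<le>n. sub S (C i) \<and> U \<subseteq> C i \<and> C i \<subseteq> W" "\<forall>i<n. C i \<subset> C (Suc i)"
    let ?A = "{i. i < n \<and> C i \<inter> V \<noteq> C (Suc i) \<inter> V}"
    let ?B = "{i. i < n \<and> C i + V \<noteq> C (Suc i) + V}"
    have "enat (card ?A) \<le> slen S U V"
      unfolding slen_def by (rule chain_sup_mono_steps) (use C S UV in \<open>auto intro: sub_Int\<close>)
    moreover have "enat (card ?B) \<le> slen S V W"
      unfolding slen_def
    proof (rule chain_sup_mono_steps)
      show "\<forall>i\<le>n. sub S (C i + V) \<and> V \<subseteq> C i + V \<and> C i + V \<subseteq> W"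
      proof (intro allI impI)
        fix i assume "i \<le> n"
        then have i: "sub S (C i)" "C i \<subseteq> W" using C by auto
        then show "sub S (C i + V) \<and> V \<subseteq> C i + V \<and> C i + V \<subseteq> W"
          using sub_plus[OF i(1) S(3)] plus_right_subset[OF i(1), of V] plus_least[OF S(4) i(2) VW] by simp
      qed
      show "\<forall>i<n. C i + V \<subseteq> C (Suc i) + V" using C(2) plus_mono[OF _ order.refl] by (meson psubset_imp_subset)
    qed
    moreover have "{..<n} \<subseteq> ?A \<union> ?B"
    proof (rule subsetI, rule ccontr)
      fix i assume "i \<in> {..<n}" and "i \<notin> ?A \<union> ?B"
      then have i: "i < n" "C i \<inter> V = C (Suc i) \<inter> V" "C i + V = C (Suc i) + V" by auto
      have s: "sub S (C i)" "sub S (C (Suc i))" "C i \<subset> C (Suc i)" using C i by auto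
      have "C (Suc i) \<subseteq> C i"
      proof
        fix x assume x: "x \<in> C (Suc i)"
        then have "x \<in> C i + V" unfolding i(3) using plus_left_subset[OF S(3)] by blast
        then obtain a b where ab: "x = a + b" "a \<in> C i" "b \<in> V" by (auto elim: set_plus_elim)
        then have "b \<in> C (Suc i)" using sub_diff[OF s(2) S(1) x, of a] s(3) by auto
        then have "b \<in> C i" using i(2) ab by blast
        then show "x \<in> C i" using ab sub_add[OF s(1)] by blast
      qed
      then show False using s(3) by blast
    qed
    then have "n \<le> card ?A + card ?B"
      using card_mono[of "?A \<union> ?B" "{..<n}"] card_Un_le[of ?A ?B] by simp
    then have "enat n \<le> enat (card ?A) + enat (card ?B)" by simp
    ultimately show "enat n \<le> slen S U V + slen S V W"
      by (meson add_mono order_trans)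
  qed
qed

text \<open>Multiplication by \<open>x\<close> maps \<open>V/U\<close> onto the quotient on the
  left, so chains there have strictly increasing preimages in \<open>V\<close>.\<close>

lemma slen_image:
  assumes S: "srng S" "sub S U" "sub S V" "sub S U'" and UV: "U \<subseteq> V" and x: "(*) x ` U \<subseteq> U'"
  shows "slen S U' (U' + (*) x ` V) \<le> slen S U V"
  unfolding slen_def[of S U']
proof (rule chain_sup_least)
  fix n C assume C: "\<forall>i\<le>n. sub S (C i) \<and> U' \<subseteq> C i \<and> C i \<subseteq> U' + (*) x ` V" "\<forall>i<n. C i \<subset> C (Suc i)"
  let ?D = "\<lambda>i. {v \<in> V. x * v \<in> C i}"
  have sC: "i \<le> n \<Longrightarrow> sub S (C i)" for i using C by blast
  show "enat n \<le> slen S U V"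
    unfolding slen_def
  proof (rule chain_sup_upper[of _ _ ?D]; intro allI impI)
    fix i assume i: "i \<le> n"
    have "sub S (?D i)"
      by (rule subI) (use S sC[OF i] in \<open>auto simp: sub_zero sub_add sub_smult distrib_left mult.left_commute[of x]\<close>)
    moreover have "U \<subseteq> ?D i" using UV x C i by blast
    ultimately show "sub S (?D i) \<and> U \<subseteq> ?D i \<and> ?D i \<subseteq> V" by blast
  next
    fix i assume i: "i < n"
    then obtain w where w: "w \<in> C (Suc i)" "w \<notin> C i" using C by blast
    then have "w \<in> U' + (*) x ` V" using C i Suc_leI by blast
    then obtain u v where uv: "w = u + x * v" "u \<in> U'" "v \<in> V" by (auto elim!: set_plus_elim)
    have "U' \<subseteq> C (Suc i)" "U' \<subseteq> C i" using C(1) i by auto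
    then have "u \<in> C (Suc i)" "u \<in> C i" using uv by auto
    then have "x * v \<in> C (Suc i)" "x * v \<notin> C i"
      using uv w sub_diff[OF sC[of "Suc i"] S(1) w(1), of u] sub_add[OF sC[of i], of u "x * v"] i by auto
    then show "?D i \<subset> ?D (Suc i)" using uv C(2) i by blast
  qed
qed

lemma slen_plus:
  assumes S: "srng S" "sub S U" "sub S V" "sub S U'" and UV: "U \<subseteq> V" "U \<subseteq> U'"
  shows "slen S U' (U' + V) \<le> slen S U V"
  using slen_image[OF S UV(1), of 1] UV(2) by simp

lemma slen_simple:
  assumes S: "srng S" "sub S U" "sub S V"
    and *: "\<And>y. y \<in> V \<Longrightarrow> y \<notin> U \<Longrightarrow> V \<subseteq> gen S (insert y U)"
  shows "slen S U V \<le> 1"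
  unfolding slen_def
proof (rule chain_sup_least, rule ccontr)
  fix n C assume C: "\<forall>i\<le>n. sub S (C i) \<and> U \<subseteq> C i \<and> C i \<subseteq> V" "\<forall>i<n. C i \<subset> C (Suc i)"
    and "\<not> enat n \<le> 1"
  then have n: "2 \<le> n" by (simp add: one_enat_def)
  then have 1: "C 0 \<subset> C 1" "C 1 \<subset> C (Suc 1)" using C(2) by auto
  have 2: "sub S (C 1)" "U \<subseteq> C 0" "U \<subseteq> C 1" "C 1 \<subseteq> V" "C (Suc 1) \<subseteq> V" using C(1) n by auto
  obtain y where y: "y \<in> C 1" "y \<notin> C 0" using 1 by blast
  have "gen S (insert y U) \<subseteq> C 1" by (rule gen_minimal) (use 2 y in auto)
  then have "V \<subseteq> C 1" using *[of y] y 2 by blast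
  then show False using 1 2 by blast
qed

lemma slen_pos: assumes "sub S U" "sub S V" "U \<subset> V" shows "1 \<le> slen S U V"
  unfolding slen_def one_enat_def
  by (rule chain_sup_upper[of _ _ "\<lambda>i. if i = 0 then U else V"]) (use assms in auto)

lemma slen_eq_0D: "slen S U V = 0 \<Longrightarrow> sub S U \<Longrightarrow> sub S V \<Longrightarrow> U \<subseteq> V \<Longrightarrow> U = V"
  using slen_pos[of S U V] by (cases "U = V") auto

text \<open>The step for inductions on length: among the submodules strictly above \<open>U\<close>,
  one of least length over \<open>U\<close> is simple over \<open>U\<close>.\<close>

lemma slen_atom:
  assumes S: "srng S" "sub S U" "sub S V" and UV: "U \<subset> V" and n: "slen S U V = enat n"
  obtains W where "sub S W" "U \<subset> W" "W \<subseteq> V" "slen S U W = 1" "slen S U V = 1 + slen S W V"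
proof -
  obtain W where W: "sub S W" "U \<subset> W" "W \<subseteq> V"
    and min: "\<And>W'. sub S W' \<and> U \<subset> W' \<and> W' \<subseteq> V \<Longrightarrow> slen S U W \<le> slen S U W'"
  proof -
    have fin: "slen S U W = enat (the_enat (slen S U W))" if "W \<subseteq> V" for W
      using slen_mono[of U U W V S S] that n by (cases "slen S U W") auto
    obtain W where W: "sub S W \<and> U \<subset> W \<and> W \<subseteq> V"
       "\<forall>W'. sub S W' \<and> U \<subset> W' \<and> W' \<subseteq> V \<longrightarrow> the_enat (slen S U W) \<le> the_enat (slen S U W')"
      using ex_has_least_nat[of "\<lambda>W. sub S W \<and> U \<subset> W \<and> W \<subseteq> V" V "\<lambda>W. the_enat (slen S U W)"] assms by blast
    show thesis
    proof (rule that[of W])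
      fix W' assume W': "sub S W' \<and> U \<subset> W' \<and> W' \<subseteq> V"
      then have "the_enat (slen S U W) \<le> the_enat (slen S U W')" using W by blast
      then have "enat (the_enat (slen S U W)) \<le> enat (the_enat (slen S U W'))" by simp
      then show "slen S U W \<le> slen S U W'" using fin[of W] fin[of W'] W W' by simp
    qed (use W in auto)
  qed
  have fin: "slen S U W \<noteq> \<infinity>"
    using slen_mono[of U U W V S S] W n by auto
  have "slen S U W \<le> 1"
  proof (rule slen_simple[OF S(1,2) W(1)])
    fix y assume y: "y \<in> W" "y \<notin> U"
    let ?Y = "gen S (insert y U)"
    have Y: "sub S ?Y" "U \<subset> ?Y" "?Y \<subseteq> W"
      using y W gen_superset[of "insert y U" S] gen_minimal[of "insert y U" W S] by (auto simp: sub_gen)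
    then have "slen S U W \<le> slen S U ?Y" using min W by blast
    moreover have "slen S U W = slen S U ?Y + slen S ?Y W"
      using slen_add[OF S(1,2) Y(1) W(1)] Y by blast
    ultimately have "slen S ?Y W = 0" using fin
      by (cases "slen S U ?Y"; cases "slen S ?Y W") (auto simp: zero_enat_def)
    then show "W \<subseteq> ?Y" using slen_eq_0D[of S ?Y W] Y W by blast
  qed
  then have "slen S U W = 1" using slen_pos[OF S(2) W(1,2)] by simp
  moreover have "slen S U V = 1 + slen S W V"
    using slen_add[OF S(1,2) W(1) S(3)] W calculation by auto
  ultimately show thesis using that W by blast
qed

text \<open>Modulo its kernel multiplication by \<open>x\<close> is injective, so chains remain
  strict when pushed forward.\<close>

lemma slen_preimage:
  assumes S: "srng S" "sub S F" "sub S V"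
  shows "slen S {v \<in> V. x * v \<in> F} V \<le> slen S F (F + (*) x ` V)"
  unfolding slen_def[of S "{v \<in> V. x * v \<in> F}"]
proof (rule chain_sup_least)
  fix n C assume C: "\<forall>i\<le>n. sub S (C i) \<and> {v \<in> V. x * v \<in> F} \<subseteq> C i \<and> C i \<subseteq> V" "\<forall>i<n. C i \<subset> C (Suc i)"
  show "enat n \<le> slen S F (F + (*) x ` V)"
    unfolding slen_def
  proof (rule chain_sup_upper[of _ _ "\<lambda>i. F + (*) x ` C i"]; intro allI impI)
    fix i assume i: "i \<le> n"
    then have "sub S (C i)" "C i \<subseteq> V" using C by auto
    then show "sub S (F + (*) x ` C i) \<and> F \<subseteq> F + (*) x ` C i \<and> F + (*) x ` C i \<subseteq> F + (*) x ` V"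
      by (intro conjI sub_plus S sub_image plus_left_subset[of S] plus_mono image_mono order.refl)
  next
    fix i assume i: "i < n"
    then obtain w where w: "w \<in> C (Suc i)" "w \<notin> C i" using C(2) by blast
    have s: "sub S (C i)" "sub S (C (Suc i))" "{v \<in> V. x * v \<in> F} \<subseteq> C i" "C (Suc i) \<subseteq> V" "C i \<subseteq> C (Suc i)"
      using C i by auto
    have "x * w \<notin> F + (*) x ` C i"
    proof
      assume "x * w \<in> F + (*) x ` C i"
      then obtain f c where f: "x * w = f + x * c" "f \<in> F" "c \<in> C i" by (auto elim!: set_plus_elim)
      then have "x * (w - c) \<in> F" by (simp add: algebra_simps)
      moreover have "w - c \<in> V" using sub_diff[OF S(3,1)] w f s by blast
      ultimately have "w - c \<in> C i" using s(3) by blast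
      then show False using sub_add[OF s(1), of "w - c" c] f w by simp
    qed
    moreover have "x * w \<in> F + (*) x ` C (Suc i)"
      using w set_plus_intro[of 0 F "x * w"] sub_zero[OF S(2)] by auto
    moreover have "F + (*) x ` C i \<subseteq> F + (*) x ` C (Suc i)" using s by (intro plus_mono image_mono order.refl)
    ultimately show "F + (*) x ` C i \<subset> F + (*) x ` C (Suc i)" by blast
  qed
qed

text \<open>Multiplication by \<open>c\<close> on \<open>B/U\<close> has kernel and cokernel of
  equal length, as \<open>B/U\<close> has finite length. The kernel contains \<open>V/U\<close>, and
  the right-hand side is the length of the cokernel.\<close>

lemma slen_torsion:
  assumes S: "srng S" "sub S U" "sub S V" "sub S B"
    and sb: "U \<subseteq> V" "V \<subseteq> B" "(*) c ` V \<subseteq> U" "(*) c ` B \<subseteq> B"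
    and fin: "slen S U B \<noteq> \<infinity>"
  shows "slen S U V \<le> slen S (U + (*) c ` B) B"
proof -
  let ?K = "{v \<in> B. c * v \<in> U}"
  let ?I = "U + (*) c ` B"
  have K: "sub S ?K"
    by (rule subI) (use S in \<open>auto simp: sub_zero sub_add sub_smult distrib_left mult.left_commute[of c]\<close>)
  have UK: "U \<subseteq> ?K" "?K \<subseteq> B" "V \<subseteq> ?K" using sb by auto
  have "U \<subseteq> B" using sb by auto
  then have I: "sub S ?I" "U \<subseteq> ?I" "?I \<subseteq> B"
    using sub_plus[OF S(2) sub_image[OF S(4)]] plus_left_subset[OF sub_image[OF S(4)]] plus_least[OF S(4) _ sb(4)]
    by auto
  have "slen S U ?I \<le> slen S ?K B"
    by (rule slen_image) (use S K UK in auto)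
  moreover have "slen S U B = slen S U ?K + slen S ?K B" "slen S U B = slen S U ?I + slen S ?I B"
    by (rule slen_add; use S K UK I in auto)+
  ultimately have "slen S U ?K \<le> slen S ?I B" using fin
    by (cases "slen S U ?I"; cases "slen S ?K B"; cases "slen S U ?K"; cases "slen S ?I B") auto
  moreover have "slen S U V \<le> slen S U ?K" using UK by (intro slen_mono) auto
  ultimately show ?thesis by (rule order.trans[rotated])
qed

text \<open>The powers of \<open>x\<close> filter the quotient into \<open>t\<close> pieces, each an
  image of the quotient by \<open>C + x B\<close>.\<close>

lemma slen_power:
  assumes S: "srng S" "srng B" "S \<subseteq> B" "sub B C" "C \<subseteq> B" "x \<in> B"
  shows "slen S (C + (*) (x ^ t) ` B) B \<le> of_nat t * slen S (C + (*) x ` B) B"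
proof (induction t)
  case 0
  have "B \<subseteq> C + B" using S(4) by (rule plus_right_subset)
  moreover have "slen S (C + B) B \<le> slen S B B" by (rule slen_mono) (use calculation in auto)
  ultimately show ?case by (simp add: slen_self)
next
  case (Suc t)
  have B: "sub B B" using S(2) by (auto intro!: subI dest: srngD)
  have xB: "(*) (x ^ k) ` B \<subseteq> B" for k using srngD(5)[OF S(2) srng_power[OF S(2,6)]] by auto
  let ?D = "\<lambda>k. C + (*) (x ^ k) ` B"
  have D: "sub S (?D k)" "sub B (?D k)" "?D k \<subseteq> B" for k
    using sub_plus[OF S(4) sub_image[OF B]] sub_mono[OF _ S(3)] plus_least[OF B S(5) xB] by blast+
  have le: "?D (Suc t) \<subseteq> ?D t"
  proof (rule plus_mono, rule order.refl)
    show "(*) (x ^ Suc t) ` B \<subseteq> (*) (x ^ t) ` B"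
    proof
      fix y assume "y \<in> (*) (x ^ Suc t) ` B"
      then obtain b where "b \<in> B" "y = x ^ t * (x * b)" by (auto simp: mult.assoc mult.left_commute)
      then show "y \<in> (*) (x ^ t) ` B" using srngD(5)[OF S(2,6)] by blast
    qed
  qed
  have "slen S (?D (Suc t)) B = slen S (?D (Suc t)) (?D t) + slen S (?D t) B"
    using slen_add[OF S(1) D(1) D(1) _ le D(3)] sub_mono[OF B S(3)] by blast
  also have "slen S (?D (Suc t)) (?D t) \<le> slen S (?D 1) B"
  proof -
    have "slen S (?D (Suc t)) (?D (Suc t) + (*) (x ^ t) ` B) \<le> slen S (?D 1) B"
    proof (rule slen_image[OF S(1) D(1) _ D(1) D(3)])
      show "sub S B" using sub_mono[OF B S(3)] .
      show "(*) (x ^ t) ` ?D 1 \<subseteq> ?D (Suc t)"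
      proof
        fix y assume "y \<in> (*) (x ^ t) ` ?D 1"
        then obtain c b where "y = x ^ t * (c + x * b)" "c \<in> C" "b \<in> B" by (auto elim!: set_plus_elim)
        then have "y = x ^ t * c + x ^ Suc t * b" "x ^ t * c \<in> C" "x ^ Suc t * b \<in> (*) (x ^ Suc t) ` B"
          using sub_smult[OF S(4) srng_power[OF S(2,6)]] by (auto simp: algebra_simps)
        then show "y \<in> ?D (Suc t)" using set_plus_intro by blast
      qed
    qed
    moreover have "?D t \<subseteq> ?D (Suc t) + (*) (x ^ t) ` B"
      using B S by (intro plus_mono plus_left_subset[of B] sub_image) auto
    ultimately show ?thesis
      using slen_mono[of "?D (Suc t)" "?D (Suc t)" "?D t" "?D (Suc t) + (*) (x ^ t) ` B" S S] by (auto intro: order.trans)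
  qed
  also have "slen S (?D t) B \<le> of_nat t * slen S (C + (*) x ` B) B" by (rule Suc)
  finally show ?case by (simp add: distrib_right add_mono)
qed

text \<open>\<open>pw B t [x\<^sub>1, \<dots>, x\<^sub>n] C\<close> is \<open>C + x\<^sub>1\<^sup>t B + \<dots> + x\<^sub>n\<^sup>t B\<close>.\<close>

primrec pw :: "'t::comm_ring_1 set \<Rightarrow> nat \<Rightarrow> 't list \<Rightarrow> 't set \<Rightarrow> 't set" where
  "pw B t [] C = C"
| "pw B t (x # xs) C = pw B t xs (C + (*) (x ^ t) ` B)"

lemma pw_plus: "pw B t xs (C + D) = pw B t xs C + D"
proof (induction xs arbitrary: C)
  case (Cons x xs)
  have "C + D + (*) (x ^ t) ` B = (C + (*) (x ^ t) ` B) + D" by (simp add: add.assoc add.commute[of D])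
  then show ?case using Cons[of "C + (*) (x ^ t) ` B"] by simp
qed simp

lemma pw_append: "pw B t (xs @ ys) C = pw B t ys (pw B t xs C)"
  by (induction xs arbitrary: C) auto

lemma pw_map_power: "pw B t (map (\<lambda>x. x ^ q) xs) C = pw B (q * t) xs C"
  by (induction xs arbitrary: C) (auto simp: power_mult)

lemma pw_sub: "sub S B \<Longrightarrow> sub S C \<Longrightarrow> sub S (pw B t xs C)"
  by (induction xs arbitrary: C) (auto intro: sub_plus sub_image)

lemma pw_mono: "B \<subseteq> B' \<Longrightarrow> C \<subseteq> C' \<Longrightarrow> pw B t xs C \<subseteq> pw B' t xs C'"
proof (induction xs arbitrary: C C')
  case (Cons x xs)
  show ?case by (simp, rule Cons.IH[OF Cons.prems(1)], intro plus_mono image_mono Cons.prems)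
qed simp

lemma pw_superset: "sub S B \<Longrightarrow> C \<subseteq> pw B t xs C"
proof (induction xs arbitrary: C)
  case (Cons x xs)
  have "C \<subseteq> C + (*) (x ^ t) ` B" using Cons.prems by (intro plus_left_subset[of S] sub_image)
  also have "\<dots> \<subseteq> pw B t (x # xs) C" using Cons by simp
  finally show ?case .
qed auto

lemma pw_least:
  "sub S W \<Longrightarrow> C \<subseteq> W \<Longrightarrow> (\<And>x b. x \<in> set xs \<Longrightarrow> b \<in> B \<Longrightarrow> x ^ t * b \<in> W) \<Longrightarrow> pw B t xs C \<subseteq> W"
proof (induction xs arbitrary: C)
  case (Cons x xs)
  have "C + (*) (x ^ t) ` B \<subseteq> W" by (rule plus_least[OF Cons.prems(1,2)]) (use Cons.prems in auto)
  then show ?case using Cons by simp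
qed auto

lemma pw_mem:
  assumes "sub S B" "sub S C" "x \<in> set xs" "b \<in> B" shows "x ^ t * b \<in> pw B t xs C"
  using assms(2,3)
proof (induction xs arbitrary: C)
  case (Cons y xs)
  show ?case
  proof (cases "x = y")
    case True
    have "x ^ t * b \<in> C + (*) (y ^ t) ` B"
      using plus_right_subset[OF Cons.prems(1), of "(*) (y ^ t) ` B"] True assms(4) by auto
    then show ?thesis using pw_superset[OF assms(1)] by auto
  next
    case False
    then show ?thesis using Cons assms(1) by (auto intro!: Cons.IH sub_plus sub_image)
  qed
qed auto

lemma slen_pw:
  assumes "srng S" "srng B" "S \<subseteq> B" "sub B C" "C \<subseteq> B" "set xs \<subseteq> B"
  shows "slen S (pw B t xs C) B \<le> of_nat (t ^ length xs) * slen S (pw B 1 xs C) B"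
  using assms(4-6)
proof (induction xs arbitrary: C)
  case Nil
  then show ?case by simp
next
  case (Cons x xs)
  have B: "sub B B" using assms(2) by (auto intro!: subI dest: srngD)
  have xB: "(*) (x ^ k) ` B \<subseteq> B" for k
    using srngD(5)[OF assms(2) srng_power[OF assms(2)]] Cons.prems by auto
  have D: "sub B (C + (*) (x ^ k) ` B)" "C + (*) (x ^ k) ` B \<subseteq> B" for k
    using sub_plus[OF Cons.prems(1) sub_image[OF B]] plus_least[OF B Cons.prems(2) xB] by auto
  have P: "sub B (pw B 1 xs C)" "pw B 1 xs C \<subseteq> B"
  proof -
    show "sub B (pw B 1 xs C)" by (rule pw_sub[OF B Cons.prems(1)])
    show "pw B 1 xs C \<subseteq> B"
      by (rule pw_least[OF B Cons.prems(2)]) (use Cons.prems srngD(5)[OF assms(2)] in auto)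
  qed
  have "slen S (pw B t (x # xs) C) B \<le> of_nat (t ^ length xs) * slen S (pw B 1 xs (C + (*) (x ^ t) ` B)) B"
    using Cons.IH[OF D] Cons.prems by simp
  also have "\<dots> = of_nat (t ^ length xs) * slen S (pw B 1 xs C + (*) (x ^ t) ` B) B" by (simp add: pw_plus)
  also have "\<dots> \<le> of_nat (t ^ length xs) * (of_nat t * slen S (pw B 1 xs C + (*) x ` B) B)"
    using Cons.prems by (intro mult_left_mono slen_power assms P) auto
  also have "\<dots> = of_nat (t ^ length (x # xs)) * slen S (pw B 1 (x # xs) C) B"
    by (simp add: pw_plus mult.assoc mult.left_commute)
  finally show ?case .
qed

section \<open>Parameter ideals\<close>

abbreviation len :: "'t::comm_ring_1 set \<Rightarrow> 't set \<Rightarrow> enat" where "len \<equiv> slen UNIV"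
abbreviation pid :: "nat \<Rightarrow> 't::comm_ring_1 list \<Rightarrow> 't set \<Rightarrow> 't set" where "pid \<equiv> pw UNIV"

lemmas len_add = slen_add[OF srng_UNIV]
lemmas len_image = slen_image[OF srng_UNIV]
lemmas len_plus = slen_plus[OF srng_UNIV]
lemmas len_power = slen_power[OF srng_UNIV srng_UNIV subset_UNIV _ subset_UNIV UNIV_I]
lemmas len_pid = slen_pw[OF srng_UNIV srng_UNIV subset_UNIV _ subset_UNIV subset_UNIV]
lemmas idl_plus = sub_plus[where S = UNIV]
lemmas idl_image = sub_image[where S = UNIV]
lemmas idl_pid = pw_sub[where S = UNIV, OF sub_UNIV]

definition colon :: "'t::comm_ring_1 set \<Rightarrow> 't \<Rightarrow> 't set" where
  "colon D x = {r. x * r \<in> D}"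

lemma idl_colon: "idl D \<Longrightarrow> idl (colon D x)"
  by (rule subI) (auto simp: colon_def sub_zero sub_add idl_mult distrib_left mult.left_commute[of x])

text \<open>Filter by the powers of \<open>x\<close>. Each of the \<open>t\<close> factors is an
  image of the quotient by \<open>D + (x)\<close>, but the factor between \<open>(x)\<close> and
  \<open>(x^2)\<close> is also killed by \<open>colon D x\<close>, hence shorter by the second term
  on the left. The hypothesis \<open>t \<ge> 2\<close> ensures that this factor occurs.\<close>

lemma len_power_defect:
  assumes D: "idl D" and t: "t \<ge> 2"
  shows "len (D + (*) (x ^ t) ` UNIV) UNIV + len (D + (*) x ` UNIV) (D + (*) x ` UNIV + colon D x)
     \<le> of_nat t * len (D + (*) x ` UNIV) UNIV"
proof -
  let ?D = "\<lambda>k. D + (*) (x ^ k) ` (UNIV :: 'a set)"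
  let ?E = "?D 1 + colon D x"
  have s: "idl (?D k)" for k using D by (intro idl_plus idl_image sub_UNIV)
  have E: "idl ?E" by (rule idl_plus[OF s idl_colon[OF D]])
  have le: "?D k \<subseteq> ?D j" if "j \<le> k" for j k
  proof (rule plus_mono[OF order.refl])
    obtain i where "k = j + i" using \<open>j \<le> k\<close> le_Suc_ex by blast
    then show "(*) (x ^ k) ` UNIV \<subseteq> (*) (x ^ j) ` UNIV" by (auto simp: power_add mult.assoc)
  qed
  have step: "len (?D (k + j)) (?D k) \<le> len (?D j) UNIV" for k j
  proof -
    have "len (?D (k + j)) (?D (k + j) + (*) (x ^ k) ` UNIV) \<le> len (?D j) UNIV"
      by (rule len_image[OF s sub_UNIV s subset_UNIV])
        (auto elim!: set_plus_elim simp: distrib_left power_add mult.assoc intro!: set_plus_intro idl_mult[OF D])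
    moreover have "?D k \<subseteq> ?D (k + j) + (*) (x ^ k) ` UNIV"
      by (rule plus_mono[OF plus_left_subset[OF idl_image[OF sub_UNIV]] order.refl])
    ultimately show ?thesis
      using slen_mono[of "?D (k+j)" "?D (k+j)" "?D k" "?D (k+j) + (*) (x ^ k) ` UNIV" UNIV UNIV]
      by (auto intro: order.trans)
  qed
  obtain j where j: "t = 2 + j" using t le_Suc_ex by blast
  have "len (?D t) UNIV = len (?D t) (?D 2) + len (?D 2) UNIV"
    by (rule len_add[OF s s sub_UNIV le subset_UNIV]) (use t in simp)
  also have "len (?D 2) UNIV = len (?D 2) (?D 1) + len (?D 1) UNIV"
    by (rule len_add[OF s s sub_UNIV le subset_UNIV]) simp
  also have "len (?D t) (?D 2) \<le> of_nat j * len (?D 1) UNIV"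
  proof -
    have "len (?D t) (?D 2) \<le> len (?D j) UNIV" unfolding j by (rule step)
    also have "\<dots> \<le> of_nat j * len (?D 1) UNIV" using len_power[OF D, of x j] by simp
    finally show ?thesis .
  qed
  also have "len (?D 2) (?D 1) \<le> len ?E UNIV"
  proof -
    have "len (?D 2) (?D 2 + (*) x ` UNIV) \<le> len ?E UNIV"
    proof (rule len_image[OF E sub_UNIV s subset_UNIV])
      show "(*) x ` ?E \<subseteq> ?D 2"
      proof
        fix y assume "y \<in> (*) x ` ?E"
        then obtain a b c where y: "y = x * ((a + x * b) + c)" "a \<in> D" "x * c \<in> D"
          by (auto elim!: set_plus_elim simp: colon_def)
        have "y = (x * a + x * c) + x ^ 2 * b" using y(1) by (simp add: algebra_simps power2_eq_square)
        moreover have "x * a + x * c \<in> D" by (rule sub_add[OF D idl_mult[OF D y(2)] y(3)])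
        ultimately show "y \<in> ?D 2" by (metis rangeI set_plus_intro)
      qed
    qed
    moreover have "?D 1 \<subseteq> ?D 2 + (*) x ` UNIV"
      by (rule plus_mono[OF plus_left_subset[OF idl_image[OF sub_UNIV]]]) simp
    ultimately show ?thesis
      using slen_mono[of "?D 2" "?D 2" "?D 1" "?D 2 + (*) x ` UNIV" UNIV UNIV]
      by (auto intro: order.trans)
  qed
  also have "len (?D 1) UNIV = len (?D 1) ?E + len ?E UNIV"
    by (rule len_add[OF s E sub_UNIV _ subset_UNIV]) (use D in \<open>intro plus_left_subset[of UNIV] idl_colon\<close>)
  finally have 1: "len (?D t) UNIV \<le> of_nat j * len (?D 1) UNIV + (len ?E UNIV + len (?D 1) UNIV)"
    using \<open>len (?D 1) UNIV = len (?D 1) ?E + len ?E UNIV\<close> by (simp add: add_mono)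
  have "len (?D t) UNIV + len (?D 1) ?E
      \<le> of_nat j * len (?D 1) UNIV + (len ?E UNIV + len (?D 1) UNIV) + len (?D 1) ?E"
    by (rule add_right_mono[OF 1])
  also have "\<dots> = of_nat j * len (?D 1) UNIV + (len (?D 1) UNIV + (len (?D 1) ?E + len ?E UNIV))"
    by (simp add: ac_simps)
  also have "len (?D 1) ?E + len ?E UNIV = len (?D 1) UNIV"
    using \<open>len (?D 1) UNIV = len (?D 1) ?E + len ?E UNIV\<close> by simp
  also have "of_nat j * len (?D 1) UNIV + (len (?D 1) UNIV + len (?D 1) UNIV) = of_nat t * len (?D 1) UNIV"
    unfolding j by (simp add: distrib_right ac_simps mult_2 flip: one_add_one)
  finally show ?thesis by simp
qed

text \<open>The parameters other than \<open>x\<close> contribute the factor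
  \<open>t ^ length (pre @ post)\<close> by filtration; the estimate for the single parameter
  \<open>x\<close> is then applied modulo their first powers.\<close>

lemma pid_defect:
  assumes "idl Z" "t \<ge> 2"
  shows "len (pid t (pre @ x # post) Z) UNIV
      + of_nat (t ^ length (pre @ post)) *
        len (pid 1 (pre @ x # post) Z) (pid 1 (pre @ x # post) Z + colon (pid 1 (pre @ post) Z) x)
     \<le> of_nat (t ^ length (pre @ x # post)) * len (pid 1 (pre @ x # post) Z) UNIV"
proof -
  let ?D = "pid 1 (pre @ post) Z"
  have D: "idl ?D" using assms(1) by (rule idl_pid)
  have eq: "pid k (pre @ x # post) Z = pid k (pre @ post) (Z + (*) (x ^ k) ` UNIV)" for k
    by (simp add: pw_append pw_plus)
  have *: "pid 1 (pre @ x # post) Z = ?D + (*) x ` UNIV" by (simp add: eq pw_plus)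
  have "len (pid t (pre @ x # post) Z) UNIV
     \<le> of_nat (t ^ length (pre @ post)) * len (pid 1 (pre @ post) (Z + (*) (x ^ t) ` UNIV)) UNIV"
    unfolding eq by (rule len_pid) (use assms in \<open>intro idl_plus idl_image sub_UNIV\<close>)
  then have "len (pid t (pre @ x # post) Z) UNIV
      + of_nat (t ^ length (pre @ post)) * len (?D + (*) x ` UNIV) (?D + (*) x ` UNIV + colon ?D x)
    \<le> of_nat (t ^ length (pre @ post)) * (len (?D + (*) (x ^ t) ` UNIV) UNIV +
        len (?D + (*) x ` UNIV) (?D + (*) x ` UNIV + colon ?D x))"
    by (simp add: pw_plus distrib_left)
  also have "\<dots> \<le> of_nat (t ^ length (pre @ post)) * (of_nat t * len (?D + (*) x ` UNIV) UNIV)"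
    by (intro mult_left_mono len_power_defect D assms) simp
  finally show ?thesis unfolding * by (simp add: mult.assoc mult.left_commute)
qed

text \<open>Replace \<open>x I\<close> by the ideal of \<open>x\<close>, one generator at a time;
  every replacement adds an image of the quotient by \<open>I\<close>.\<close>

lemma len_ideal_multiple_upper:
  assumes Z: "idl Z" and I: "idl I"
  shows "len (pw I 1 bs Z) (pid 1 bs Z) \<le> of_nat (length bs) * len I UNIV"
  using Z
proof (induction bs arbitrary: Z)
  case (Cons x bs)
  let ?A = "pw I 1 bs (Z + (*) x ` I)" and ?B = "pw I 1 bs (Z + (*) x ` UNIV)"
  have s: "idl (Z + (*) x ` I)" "idl (Z + (*) x ` UNIV)" using Cons.prems I by (auto intro!: idl_plus idl_image sub_UNIV)
  then have AB: "idl ?A" "idl ?B" using I by (auto intro!: pw_sub)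
  have "Z + (*) x ` I \<subseteq> Z + (*) x ` UNIV" by (intro plus_mono image_mono) auto
  then have le: "?A \<subseteq> ?B" by (intro pw_mono order.refl)
  have C: "idl (pid 1 bs (Z + (*) x ` UNIV))" "?B \<subseteq> pid 1 bs (Z + (*) x ` UNIV)"
    by (rule idl_pid[OF s(2)], rule pw_mono) auto
  have "len ?A (pid 1 bs (Z + (*) x ` UNIV)) = len ?A ?B + len ?B (pid 1 bs (Z + (*) x ` UNIV))"
    by (rule len_add[OF AB C(1) le C(2)])
  also have "len ?B (pid 1 bs (Z + (*) x ` UNIV)) \<le> of_nat (length bs) * len I UNIV" by (rule Cons.IH[OF s(2)])
  also have "len ?A ?B \<le> len I UNIV"
  proof -
    have "len ?A (?A + (*) x ` UNIV) \<le> len I UNIV"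
    proof (rule len_image[OF I sub_UNIV AB(1) subset_UNIV])
      have "(*) x ` I \<subseteq> Z + (*) x ` I" using Cons.prems by (rule plus_right_subset)
      also have "\<dots> \<subseteq> ?A" using I by (rule pw_superset)
      finally show "(*) x ` I \<subseteq> ?A" .
    qed
    moreover have "?B \<subseteq> ?A + (*) x ` UNIV"
      unfolding pw_plus by (rule plus_mono[OF plus_left_subset[OF idl_image[OF I]] order.refl])
    ultimately show ?thesis
      using slen_mono[of ?A ?A ?B "?A + (*) x ` UNIV" UNIV UNIV] by (auto intro: order.trans)
  qed
  finally show ?case by (simp add: distrib_right add_mono)
qed (simp add: slen_self)

text \<open>Adjoin the generators to \<open>pw I 1 bs Z\<close> one at a time. When \<open>x\<close>
  is adjoined to \<open>F\<close>, the gain is the length of the quotient by \<open>F : x\<close>.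
  Since \<open>F\<close> lies in \<open>D + x I\<close>, where \<open>D\<close> belongs to the other
  generators, this colon ideal lies in \<open>I + colon D x\<close>, so at most
  \<open>\<delta>\<close> is lost against the quotient by \<open>I\<close>.\<close>

lemma len_ideal_multiple_lower:
  assumes Z: "idl Z" and I: "idl I" "Z \<subseteq> I"
    and \<delta>: "\<And>pre x post. bs = pre @ x # post \<Longrightarrow> len I (I + colon (pid 1 (pre @ post) Z) x) \<le> \<delta>"
  shows "of_nat (length bs) * len I UNIV \<le> len (pw I 1 bs Z) (pid 1 bs Z) + of_nat (length bs) * \<delta>"
proof -
  have "of_nat (length pre) * len I UNIV \<le> len (pw I 1 bs Z) (pw I 1 bs Z + pid 1 pre Z) + of_nat (length pre) * \<delta>"
    if "bs = pre @ post" for pre post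
    using that
  proof (induction pre arbitrary: post rule: rev_induct)
    case Nil
    show ?case by simp
  next
    case (snoc x pre)
    let ?D = "pid 1 (pre @ post) Z" and ?I = "pw I 1 bs Z"
    let ?F = "?I + pid 1 pre Z"
    have D: "idl ?D" "idl ?I" "idl (pid 1 pre Z)" "idl (pid 1 (pre @ [x]) Z)" using Z I
      by (auto intro!: idl_pid pw_sub)
    have eqF: "?I + pid 1 (pre @ [x]) Z = ?F + (*) x ` UNIV" by (simp add: pw_append add.assoc)
    have F: "idl ?F" "idl (?I + pid 1 (pre @ [x]) Z)" using D by (auto intro!: idl_plus)
    have F': "?F \<subseteq> ?I + pid 1 (pre @ [x]) Z"
      unfolding eqF by (rule plus_left_subset[OF idl_image[OF sub_UNIV]])
    have "?F \<subseteq> ?D + (*) x ` I"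
    proof (rule plus_least)
      show "idl (?D + (*) x ` I)" using D I by (intro idl_plus idl_image)
      have "?I = pw I 1 (pre @ post) Z + (*) x ` I" using snoc.prems by (simp add: pw_append pw_plus)
      also have "\<dots> \<subseteq> ?D + (*) x ` I" by (intro plus_mono pw_mono) auto
      finally show "?I \<subseteq> ?D + (*) x ` I" .
      have "pid 1 pre Z \<subseteq> ?D" unfolding pw_append by (rule pw_superset[OF sub_UNIV])
      also have "\<dots> \<subseteq> ?D + (*) x ` I" by (rule plus_left_subset[OF idl_image[OF I(1)]])
      finally show "pid 1 pre Z \<subseteq> ?D + (*) x ` I" .
    qed
    then have col: "{v \<in> UNIV. x * v \<in> ?F} \<subseteq> I + colon ?D x"
    proof (intro subsetI)
      fix v assume *: "?F \<subseteq> ?D + (*) x ` I" and "v \<in> {v \<in> UNIV. x * v \<in> ?F}"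
      then obtain d i where d: "x * v = d + x * i" "d \<in> ?D" "i \<in> I" by (auto elim!: set_plus_elim)
      then have "v - i \<in> colon ?D x" by (simp add: colon_def algebra_simps)
      then have "i + (v - i) \<in> I + colon ?D x" using d by (intro set_plus_intro)
      then show "v \<in> I + colon ?D x" by simp
    qed
    have cD: "idl (colon ?D x)" "idl (I + colon ?D x)" using D I by (auto intro!: idl_plus idl_colon)
    have "len I UNIV = len I (I + colon ?D x) + len (I + colon ?D x) UNIV"
      by (rule len_add[OF I(1) cD(2) sub_UNIV plus_left_subset[OF cD(1)] subset_UNIV])
    also have "len I (I + colon ?D x) \<le> \<delta>" using \<delta>[of pre x post] snoc.prems by simp
    also have "len (I + colon ?D x) UNIV \<le> len {v \<in> UNIV. x * v \<in> ?F} UNIV" by (rule slen_mono) (use col in auto)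
    also have "\<dots> \<le> len ?F (?F + (*) x ` UNIV)" by (rule slen_preimage[OF srng_UNIV F(1) sub_UNIV])
    finally have 1: "len I UNIV \<le> \<delta> + len ?F (?I + pid 1 (pre @ [x]) Z)" unfolding eqF by (simp add: add_mono)
    have "len ?I (?I + pid 1 (pre @ [x]) Z) = len ?I ?F + len ?F (?I + pid 1 (pre @ [x]) Z)"
      by (rule len_add[OF D(2) F(1,2) plus_left_subset[OF D(3)] F'])
    moreover have 2: "of_nat (length pre) * len I UNIV \<le> len ?I ?F + of_nat (length pre) * \<delta>"
      using snoc by simp
    ultimately show ?case using add_mono[OF 2 1]
      by (simp add: distrib_right distrib_left ac_simps)
  qed
  from this[of bs "[]"] have "of_nat (length bs) * len I UNIV \<le> len (pw I 1 bs Z) (pw I 1 bs Z + pid 1 bs Z) + of_nat (length bs) * \<delta>"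
    by simp
  also have "len (pw I 1 bs Z) (pw I 1 bs Z + pid 1 bs Z) \<le> len (pw I 1 bs Z) (pid 1 bs Z)"
    by (rule slen_mono[OF order.refl plus_least[OF idl_pid[OF Z] pw_mono]]) auto
  finally show ?thesis by (simp add: add_mono)
qed

text \<open>Used with \<open>I\<close> a bracket power and \<open>B\<close> generated by powers of
  parameters: \<open>B\<close> is almost contained in \<open>I\<close>, while the colon ideal
  \<open>U\<close> is controlled modulo \<open>B\<close>.\<close>

lemma len_colon_compare:
  assumes "idl Z" "idl I" "idl B" "idl U"
  shows "len I (I + U) \<le> len I (I + B) + len B (B + U)"
proof -
  have s: "idl (I + B)" "idl (I + B + U)" "idl (B + U)" using assms by (auto intro!: idl_plus)
  have "len I (I + U) \<le> len I (I + B + U)"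
    by (rule slen_mono[OF order.refl plus_mono[OF plus_left_subset[OF assms(3)] order.refl] order.refl])
  also have "\<dots> = len I (I + B) + len (I + B) (I + B + U)"
    by (rule len_add[OF assms(2) s(1,2) plus_left_subset[OF assms(3)] plus_left_subset[OF assms(4)]])
  also have "len (I + B) (I + B + U) \<le> len B (B + U)"
  proof -
    have "len (I + B) (I + B + (B + U)) \<le> len B (B + U)"
      by (rule len_plus[OF assms(3) s(3,1) plus_left_subset[OF assms(4)] plus_right_subset[OF assms(2)]])
    moreover have "I + B + U \<subseteq> I + B + (B + U)"
      by (rule plus_mono[OF order.refl plus_right_subset[OF assms(3)]])
    ultimately show ?thesis
      using slen_mono[of "I + B" "I + B" "I + B + U" "I + B + (B + U)" UNIV UNIV] by (auto intro: order.trans)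
  qed
  finally show ?thesis by (simp add: add_mono)
qed

section \<open>Frobenius powers\<close>

lemma idl_sum: "idl U \<Longrightarrow> (\<And>i. i \<in> I \<Longrightarrow> f i \<in> U) \<Longrightarrow> sum f I \<in> U"
  by (induction I rule: infinite_finite_induct) (auto simp: sub_zero sub_add)

text \<open>The prime \<open>p\<close> vanishes only modulo \<open>Z\<close>, not in the ambient
  ring, so the Frobenius is additive only modulo \<open>Z\<close>.\<close>

lemma frobenius_add:
  assumes Z: "idl Z" and p: "Factorial_Ring.prime p" "of_nat p \<in> Z"
  shows "(x + y) ^ (p ^ e) - (x ^ (p ^ e) + y ^ (p ^ e)) \<in> Z"
proof (induction e)
  case 0
  then show ?case using Z by (simp add: sub_zero)
next
  case (Suc e)
  have step: "(u + v) ^ p - (u ^ p + v ^ p) \<in> Z" for u v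
  proof -
    have p1: "p > 1" using p prime_gt_1_nat by blast
    let ?f = "\<lambda>k. of_nat (p choose k) * u ^ k * v ^ (p - k)"
    have "(u + v) ^ p = sum ?f {..p}" by (rule binomial_ring)
    also have "{..p} = insert 0 (insert p {0<..<p})" using p1 by auto
    also have "sum ?f \<dots> = v ^ p + (u ^ p + sum ?f {0<..<p})" using p1 by simp
    finally have "(u + v) ^ p - (u ^ p + v ^ p) = sum ?f {0<..<p}" by simp
    moreover have "sum ?f {0<..<p} \<in> Z"
    proof (rule idl_sum[OF Z])
      fix k assume "k \<in> {0<..<p}"
      then have "p dvd (p choose k)" using p by (intro dvd_choose_prime) auto
      then obtain j where "p choose k = p * j" by auto
      then have "?f k = of_nat p * (of_nat j * u ^ k * v ^ (p - k))" by (simp add: mult.assoc)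
      then show "?f k \<in> Z" using idl_mult'[OF Z p(2)] by (metis (no_types))
    qed
    ultimately show ?thesis by simp
  qed
  let ?q = "p ^ e"
  define z where "z = (x + y) ^ ?q - (x ^ ?q + y ^ ?q)"
  have "z \<in> Z" using Suc by (simp add: z_def)
  have eq: "(x + y) ^ ?q = (x ^ ?q + y ^ ?q) + z" by (simp add: z_def)
  have "(x + y) ^ (p ^ Suc e) = ((x ^ ?q + y ^ ?q) + z) ^ p"
    by (simp add: eq[symmetric] power_mult[symmetric] mult.commute)
  moreover have "((x ^ ?q + y ^ ?q) + z) ^ p - ((x ^ ?q + y ^ ?q) ^ p + z ^ p) \<in> Z" by (rule step)
  moreover have "(x ^ ?q + y ^ ?q) ^ p + z ^ p - (x ^ ?q + y ^ ?q) ^ p \<in> Z"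
  proof -
    have "p > 0" using p prime_gt_0_nat by blast
    then show ?thesis using \<open>z \<in> Z\<close> Z by (cases p) (auto intro: idl_mult')
  qed
  moreover have "(x ^ ?q + y ^ ?q) ^ p - ((x ^ ?q) ^ p + (y ^ ?q) ^ p) \<in> Z" by (rule step)
  ultimately have "(x + y) ^ (p ^ Suc e) - ((x ^ ?q) ^ p + (y ^ ?q) ^ p) \<in> Z"
    by (metis idl_trans[OF Z])
  then show ?case by (simp add: power_mult[symmetric] mult.commute)
qed

lemma idl_power: "idl U \<Longrightarrow> x \<in> U \<Longrightarrow> n > 0 \<Longrightarrow> x ^ n \<in> U"
  by (cases n) (auto intro: idl_mult')

lemma idl_power_cong: "idl U \<Longrightarrow> x - y \<in> U \<Longrightarrow> x ^ n - y ^ n \<in> U"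
proof (induction n)
  case (Suc n)
  have "x ^ Suc n - y ^ Suc n = x * (x ^ n - y ^ n) + (x - y) * y ^ n" by (simp add: algebra_simps)
  then show ?case using Suc by (simp add: sub_add idl_mult idl_mult')
qed (simp add: sub_zero)

lemma idl_mult_cong: "idl U \<Longrightarrow> x - y \<in> U \<Longrightarrow> x' - y' \<in> U \<Longrightarrow> x * x' - y * y' \<in> U"
proof -
  assume *: "idl U" "x - y \<in> U" "x' - y' \<in> U"
  have "x * x' - y * y' = (x - y) * x' + y * (x' - y')" by (simp add: algebra_simps)
  then show ?thesis using * by (simp add: sub_add idl_mult idl_mult')
qed

lemma idl_add_cong: "idl U \<Longrightarrow> x - y \<in> U \<Longrightarrow> x' - y' \<in> U \<Longrightarrow> (x + x') - (y + y') \<in> U"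
  using sub_add[of UNIV U "x - y" "x' - y'"] by (simp add: algebra_simps)

lemma frobenius_minus_one:
  assumes Z: "idl Z" and p: "Factorial_Ring.prime p" "of_nat p \<in> Z"
  shows "(- 1) ^ p + 1 \<in> Z"
  using frobenius_add[OF assms, of "-1" 1 1] idl_uminus[OF Z] p
  by (simp add: zero_power prime_gt_0_nat) (metis add.commute add_uminus_conv_diff minus_diff_eq minus_minus)

text \<open>The preimage of the bracket power of the image of \<open>I\<close> modulo
  \<open>Z\<close>.\<close>

definition br :: "'t::comm_ring_1 set \<Rightarrow> 't set \<Rightarrow> nat \<Rightarrow> 't set" where
  "br Z I q = gen UNIV ((\<lambda>x. x ^ q) ` I \<union> Z)"

lemma idl_br: "idl (br Z I q)" by (simp add: br_def sub_gen)

lemma br_superset: "Z \<subseteq> br Z I q" "x \<in> I \<Longrightarrow> x ^ q \<in> br Z I q"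
  by (auto simp: br_def intro: gen_inc)

lemma br_least: "idl W \<Longrightarrow> Z \<subseteq> W \<Longrightarrow> (\<And>x. x \<in> I \<Longrightarrow> x ^ q \<in> W) \<Longrightarrow> br Z I q \<subseteq> W"
  unfolding br_def by (intro gen_minimal) auto

text \<open>Meant for sets \<open>W\<close> that are closed under addition without being ideals,
  such as the preimage of an ideal under a Frobenius-semilinear map.\<close>

lemma gen_UNIV_least:
  assumes "0 \<in> W" "\<And>x y. x \<in> W \<Longrightarrow> y \<in> W \<Longrightarrow> x + y \<in> W" "\<And>r y. y \<in> Y \<Longrightarrow> r * y \<in> W"
  shows "gen UNIV Y \<subseteq> W"
proof -
  have "gen UNIV Y \<subseteq> {x. \<forall>r. r * x \<in> W}"
    by (rule gen_minimal) (use assms in \<open>auto intro!: subI simp: distrib_left mult.assoc[symmetric]\<close>)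
  then show ?thesis by (metis (no_types, lifting) mem_Collect_eq mult_1 subsetD subsetI)
qed

section \<open>Spans of finite lists\<close>

primrec Span :: "'t::comm_ring_1 set \<Rightarrow> 't list \<Rightarrow> 't set" where
  "Span S [] = {0}"
| "Span S (g # gs) = {s * g + v | s v. s \<in> S \<and> v \<in> Span S gs}"

lemma sub_Span: "srng S \<Longrightarrow> sub S (Span S gs)"
proof (induction gs)
  case (Cons g gs)
  have *: "sub S (Span S gs)" using Cons by simp
  show ?case
  proof (rule subI)
    show "0 \<in> Span S (g # gs)" using sub_zero[OF *] srngD(3)[OF Cons.prems] by force
  next
    fix x y assume "x \<in> Span S (g # gs)" "y \<in> Span S (g # gs)"
    then obtain s v t w where "x = s * g + v" "y = t * g + w" "s \<in> S" "t \<in> S" "v \<in> Span S gs" "w \<in> Span S gs"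
      by auto
    then have "x + y = (s + t) * g + (v + w)" "s + t \<in> S" "v + w \<in> Span S gs"
      using sub_add[OF *] srngD(4)[OF Cons.prems] by (auto simp: algebra_simps)
    then show "x + y \<in> Span S (g # gs)" by auto
  next
    fix s x assume "s \<in> S" "x \<in> Span S (g # gs)"
    then obtain t w where "x = t * g + w" "t \<in> S" "w \<in> Span S gs" by auto
    then have "s * x = (s * t) * g + s * w" "s * t \<in> S" "s * w \<in> Span S gs"
      using \<open>s \<in> S\<close> sub_smult[OF *] srngD(5)[OF Cons.prems] by (auto simp: algebra_simps)
    then show "s * x \<in> Span S (g # gs)" by auto
  qed
qed (auto intro: subI)

lemma Span_mem: "srng S \<Longrightarrow> s \<in> S \<Longrightarrow> g \<in> set gs \<Longrightarrow> s * g \<in> Span S gs"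
proof (induction gs)
  case (Cons h gs)
  show ?case
  proof (cases "g = h")
    case True
    then show ?thesis using Cons.prems sub_zero[OF sub_Span[OF Cons.prems(1)], of gs] by force
  next
    case False
    then have "s * g \<in> Span S gs" using Cons by auto
    then show ?thesis using srngD(3)[OF Cons.prems(1)] by force
  qed
qed auto

lemma Span_least: "sub S W \<Longrightarrow> (\<And>g s. g \<in> set gs \<Longrightarrow> s \<in> S \<Longrightarrow> s * g \<in> W) \<Longrightarrow> Span S gs \<subseteq> W"
proof (induction gs)
  case (Cons g gs)
  then have "Span S gs \<subseteq> W" by auto
  then show ?case using Cons.prems by (auto intro!: sub_add[OF Cons.prems(1)])
qed (auto simp: sub_zero)

text \<open>Linear independence modulo \<open>P\<close> over the image of \<open>C\<close>, in
  triangular form: each entry is independent of the later ones.\<close>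

primrec indep :: "'t::comm_ring_1 set \<Rightarrow> 't set \<Rightarrow> 't list \<Rightarrow> bool" where
  "indep C P [] \<longleftrightarrow> True"
| "indep C P (w # ws) \<longleftrightarrow> (\<forall>c\<in>C. \<forall>v\<in>Span C ws. c * w + v \<in> P \<longrightarrow> c \<in> P) \<and> indep C P ws"

lemma common_multiple:
  assumes C: "srng C" "sub C W" and mult: "\<And>c c'. c \<in> C \<Longrightarrow> c' \<in> C \<Longrightarrow> c * c' \<in> P \<Longrightarrow> c \<in> P \<or> c' \<in> P"
    and one: "1 \<notin> P" and ex: "\<And>g. g \<in> set gs \<Longrightarrow> \<exists>c\<in>C. c \<notin> P \<and> c * g \<in> W"
  shows "\<exists>c\<in>C. c \<notin> P \<and> (\<forall>g\<in>set gs. c * g \<in> W)"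
  using ex
proof (induction gs)
  case Nil
  show ?case using srngD(1)[OF C(1)] one by auto
next
  case (Cons h gs)
  then obtain c where c: "c \<in> C" "c \<notin> P" "\<forall>g\<in>set gs. c * g \<in> W" by auto
  obtain d where d: "d \<in> C" "d \<notin> P" "d * h \<in> W" using Cons.prems by auto
  have "c * d \<in> C" "c * d \<notin> P" using c d mult srngD(5)[OF C(1)] by blast+
  moreover have "c * d * h \<in> W" using sub_smult[OF C(2) c(1) d(3)] by (simp add: mult.assoc)
  moreover have "c * d * g \<in> W" if "g \<in> set gs" for g
    using sub_smult[OF C(2) d(1)] c(3) that by (metis mult.assoc mult.commute)
  ultimately show ?case by auto
qed

text \<open>Go through \<open>gs\<close> and adjoin a generator exactly when no multiple of it by an
  element of \<open>C\<close> outside \<open>P\<close> lies in the span of the earlier choices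
  modulo \<open>P\<close>. The denominators of the finitely many generators are then multiplied
  together.\<close>

lemma max_indep:
  assumes C: "srng C" and P: "idl P"
    and mult: "\<And>c c'. c \<in> C \<Longrightarrow> c' \<in> C \<Longrightarrow> c * c' \<in> P \<Longrightarrow> c \<in> P \<or> c' \<in> P" and one: "1 \<notin> P"
  obtains ws c where "indep C P ws" "c \<in> C" "c \<notin> P" "\<And>x. x \<in> Span C gs \<Longrightarrow> c * x \<in> Span C ws + P"
proof -
  have "\<exists>ws. indep C P ws \<and> (\<forall>g\<in>set gs. \<exists>c\<in>C. c \<notin> P \<and> c * g \<in> Span C ws + P)"
  proof (induction gs)
    case Nil
    show ?case by (rule exI[of _ "[]"]) simp
  next
    case (Cons h gs)
    then obtain ws where ws: "indep C P ws" "\<forall>g\<in>set gs. \<exists>c\<in>C. c \<notin> P \<and> c * g \<in> Span C ws + P" by blast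
    show ?case
    proof (cases "\<exists>c\<in>C. c \<notin> P \<and> c * h \<in> Span C ws + P")
      case True
      then show ?thesis using ws by (intro exI[of _ ws]) auto
    next
      case False
      have sP: "sub C P" using idl_sub[OF P] .
      have le: "Span C ws + P \<subseteq> Span C (h # ws) + P"
      proof (rule plus_mono[OF _ order.refl], rule subsetI)
        fix v assume "v \<in> Span C ws"
        then have "0 * h + v \<in> Span C (h # ws)" using srngD(3)[OF C] by (simp del: mult_zero_left) blast
        then show "v \<in> Span C (h # ws)" by simp
      qed
      have "indep C P (h # ws)"
      proof (unfold indep.simps, intro conjI ballI impI ws(1), rule ccontr)
        fix c v assume c: "c \<in> C" "v \<in> Span C ws" "c * h + v \<in> P" "c \<notin> P"
        have "- v \<in> Span C ws" using sub_uminus[OF sub_Span[OF C] C c(2)] .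
        then have "- v + (c * h + v) \<in> Span C ws + P" using c(3) by (intro set_plus_intro)
        then have "c * h \<in> Span C ws + P" by simp
        then show False using False c(1,4) by blast
      qed
      moreover have "1 * h \<in> Span C (h # ws) + P"
        using plus_left_subset[OF sP, of "Span C (h # ws)"] Span_mem[OF C srngD(1)[OF C], of h "h # ws"] by auto
      moreover have "\<exists>c\<in>C. c \<notin> P \<and> c * g \<in> Span C (h # ws) + P" if "g \<in> set gs" for g
        using ws(2) that le by blast
      ultimately show ?thesis using one srngD(1)[OF C] by (intro exI[of _ "h # ws"]) (auto simp del: Span.simps)
    qed
  qed
  then obtain ws where ws: "indep C P ws" "\<forall>g\<in>set gs. \<exists>c\<in>C. c \<notin> P \<and> c * g \<in> Span C ws + P" by blast
  have sW: "sub C (Span C ws + P)" using sub_plus[OF sub_Span[OF C] idl_sub[OF P]] .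
  obtain c where c: "c \<in> C" "c \<notin> P" "\<forall>g\<in>set gs. c * g \<in> Span C ws + P"
    using common_multiple[OF C sW mult one, of gs] ws(2) by blast
  have "Span C gs \<subseteq> {x. c * x \<in> Span C ws + P}"
  proof (rule Span_least)
    show "sub C {x. c * x \<in> Span C ws + P}"
      by (rule subI) (use sW in \<open>auto simp: sub_zero sub_add distrib_left sub_smult mult.left_commute[of c]\<close>)
    show "s * g \<in> {x. c * x \<in> Span C ws + P}" if "g \<in> set gs" "s \<in> C" for g s
      using c(3) that sub_smult[OF sW that(2)] by (simp add: mult.left_commute[of c])
  qed
  then show thesis using that ws(1) c by blast
qed

text \<open>A free module over a domain has no torsion: the terms of the combination are cancelled
  one by one, beginning with the first entry of the list.\<close>

lemma indep_torsion:
  assumes C: "srng C" and P: "idl P" and c': "c' \<in> C" "c' \<notin> P"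
    and mult: "\<And>c c'. c \<in> C \<Longrightarrow> c' \<in> C \<Longrightarrow> c * c' \<in> P \<Longrightarrow> c \<in> P \<or> c' \<in> P"
    and v: "indep C P ws" "v \<in> Span C ws" "c' * v \<in> P"
  shows "v \<in> P"
  using v
proof (induction ws arbitrary: v)
  case Nil
  then show ?case using sub_zero[OF P] by simp
next
  case (Cons w ws)
  obtain s u where v: "v = s * w + u" "s \<in> C" "u \<in> Span C ws" using Cons.prems by auto
  have cu: "c' * u \<in> Span C ws" using sub_smult[OF sub_Span[OF C] c'(1) v(3)] .
  have "(c' * s) * w + c' * u \<in> P" using Cons.prems(3) v(1) by (simp add: algebra_simps)
  then have "c' * s \<in> P" using Cons.prems(1) cu srngD(5)[OF C c'(1) v(2)] by auto
  then have s: "s * w \<in> P" using mult[OF c'(1) v(2)] c' idl_mult'[OF P] by blast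
  then have "c' * v - c' * (s * w) \<in> P" using idl_diff[OF P Cons.prems(3)] idl_mult[OF P] by blast
  then have "c' * u \<in> P" using v(1) by (simp add: algebra_simps)
  then have "u \<in> P" using Cons v by simp
  then show ?case using v(1) sub_add[OF P s] by simp
qed

section \<open>Sequences\<close>

lemma decreasing_nat_stalls: fixes f :: "nat \<Rightarrow> nat" shows "\<exists>i. f i \<le> f (Suc i)"
proof (rule ccontr)
  assume "\<not> ?thesis"
  then have *: "f (Suc i) < f i" for i by (simp add: not_le)
  have "f i + i \<le> f 0" for i
  proof (induction i)
    case (Suc i) then show ?case using *[of i] by simp
  qed simp
  from this[of "Suc (f 0)"] show False by simp
qed

lemma convergent_if_almost_decreasing:
  fixes u :: "nat \<Rightarrow> real"
  assumes u: "\<And>e. u e \<ge> 0" and p: "(p::nat) \<ge> 2"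
    and step: "\<And>e. e \<ge> e0 \<Longrightarrow> u (Suc e) \<le> u e + K / real p ^ e"
  shows "convergent u"
proof -
  \<comment> \<open>This constant gives \<open>K + L / p \<le> L\<close> for
    \<open>p \<ge> 2\<close>, so adding the geometric tail \<open>L / p ^ e\<close> turns
    \<open>u\<close> into a decreasing sequence.\<close>
  define L where "L = max K 0 * 2"
  define v where "v e = u (e + e0) + L / real p ^ (e + e0)" for e
  have dec: "v (Suc e) \<le> v e" for e
  proof -
    let ?P = "real p ^ (e + e0)"
    have P: "?P > 0" using p by simp
    have "L / real p \<le> L / 2" using p by (intro divide_left_mono) (auto simp: L_def)
    then have "K + L / real p \<le> L" by (auto simp: L_def)
    then have "(K + L / real p) / ?P \<le> L / ?P" using P by (intro divide_right_mono) auto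
    moreover have "(K + L / real p) / ?P = K / ?P + L / (real p * ?P)" by (simp add: add_divide_distrib mult.commute)
    ultimately show ?thesis using step[of "e + e0"] by (simp add: v_def)
  qed
  have "v e \<ge> 0" for e using u by (simp add: v_def L_def)
  then have "convergent v"
    using decseq_convergent[of v 0] dec by (metis convergentI decseq_SucI)
  then obtain l where l: "v \<longlonglongrightarrow> l" by (auto simp: convergent_def)
  have "(\<lambda>e. L * (1 / real p) ^ (e + e0)) \<longlonglongrightarrow> L * 0"
    using LIMSEQ_ignore_initial_segment[OF LIMSEQ_power_zero[of "1 / real p"], of e0] p
    by (intro tendsto_mult tendsto_const) auto
  then have "(\<lambda>e. L / real p ^ (e + e0)) \<longlonglongrightarrow> 0" by (simp add: power_divide)
  from tendsto_diff[OF l this] have "(\<lambda>e. u (e + e0)) \<longlonglongrightarrow> l" by (simp add: v_def)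
  then show ?thesis by (metis LIMSEQ_offset convergentI)
qed

lemma convergent_squeeze:
  fixes u v w :: "nat \<Rightarrow> real"
  assumes "convergent v" "w \<longlonglongrightarrow> 0" "\<And>e. \<bar>u e - v e\<bar> \<le> w e"
  shows "convergent u"
proof -
  obtain l where l: "v \<longlonglongrightarrow> l" using assms(1) by (auto simp: convergent_def)
  have "(\<lambda>e. u e - v e) \<longlonglongrightarrow> 0"
    by (rule tendsto_rabs_zero_cancel, rule tendsto_sandwich[OF _ _ tendsto_const assms(2)])
       (use assms(3) in auto)
  from tendsto_add[OF this l] show ?thesis by (auto simp: convergent_def)
qed

section \<open>Finite algebras over a power series ring\<close>

text \<open>The local ring is the whole type modulo \<open>Z\<close>, with maximal ideal
  \<open>m\<close>, and \<open>A\<close> is a subring. The last assumption says that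
  \<open>A\<close> maps onto the residue field, which makes lengths over \<open>A\<close> comparable
  with lengths over the ring.\<close>

locale local_pair =
  fixes Z A m :: "'v::comm_ring_1 set"
  assumes Z: "idl Z" and A: "srng A" and ZA: "Z \<subseteq> A"
    and m: "idl m" "Z \<subseteq> m" "1 \<notin> m"
    and unit: "x \<notin> m \<Longrightarrow> \<exists>y. x * y - 1 \<in> Z"
    and Am: "\<exists>a\<in>A. x - a \<in> m"
begin

lemma Z0: "0 \<in> Z" using sub_zero[OF Z] .
lemma one_notin_Z: "1 \<notin> Z" using m by auto

lemma sub_A: "sub A A" using A by (intro subI) (auto dest: srngD)

text \<open>The quotient \<open>W/U\<close> is simple, hence generated by any \<open>x\<close> in
  \<open>W\<close> outside \<open>U\<close>. If \<open>y x\<close> were outside \<open>U\<close> for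
  some \<open>y\<close> in \<open>m\<close>, then \<open>x\<close> would be a multiple of
  \<open>y x\<close> modulo \<open>U\<close>, and a unit \<open>1 - y t\<close> would put
  \<open>x\<close> into \<open>U\<close>. So \<open>W/U\<close> is a line over the residue field,
  onto which \<open>A\<close> maps.\<close>

lemma len_atom_structure:
  assumes UW: "idl U" "idl W" "U \<subset> W" "len U W = 1" "Z \<subseteq> U"
  obtains x where "x \<in> W" "x \<notin> U" "\<And>y. y \<in> m \<Longrightarrow> y * x \<in> U" "\<And>w. w \<in> W \<Longrightarrow> \<exists>a\<in>A. w - a * x \<in> U"
proof -
  obtain x where x: "x \<in> W" "x \<notin> U" using UW by blast
  have gen: "W \<subseteq> U + (*) v ` UNIV" if v: "v \<in> W" "v \<notin> U" for v
  proof (rule ccontr)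
    let ?G = "U + (*) v ` UNIV"
    assume ns: "\<not> W \<subseteq> ?G"
    have "U \<subseteq> ?G" by (rule plus_left_subset[OF idl_image[OF sub_UNIV]])
    moreover have "v \<in> ?G" using set_plus_intro[OF sub_zero[OF UW(1)] rangeI[of "(*) v" 1]] by simp
    moreover have "?G \<subseteq> W" using UW v by (intro plus_least) (auto intro: idl_mult')
    ultimately have G: "U \<subset> ?G" "?G \<subset> W" "idl ?G" using v ns UW by (auto intro!: idl_plus idl_image sub_UNIV)
    have "len U W = len U ?G + len ?G W" by (rule len_add) (use G UW in auto)
    moreover have "1 \<le> len U ?G" "1 \<le> len ?G W" using G UW by (auto intro!: slen_pos)
    ultimately have "1 + 1 \<le> (1::enat)" using UW(4) by (metis add_mono)
    then show False by (simp add: one_enat_def)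
  qed
  have mx: "y * x \<in> U" if y: "y \<in> m" for y
  proof (rule ccontr)
    assume n: "y * x \<notin> U"
    have "y * x \<in> W" using x idl_mult[OF UW(2)] by blast
    from gen[OF this n] x have "x \<in> U + (*) (y * x) ` UNIV" by blast
    then obtain u b where "x = u + b" "u \<in> U" "b \<in> (*) (y * x) ` UNIV" by (rule set_plus_elim)
    then obtain t where t: "x = u + y * x * t" "u \<in> U" by (elim imageE) metis
    have "1 - y * t \<notin> m"
      using sub_add[OF m(1), of "1 - y * t" "y * t"] idl_mult'[OF m(1) y] m(3) by auto
    then obtain b where "(1 - y * t) * b - 1 \<in> Z" using unit by blast
    then have "((1 - y * t) * b - 1) * x \<in> U" using UW idl_mult'[OF UW(1)] by blast
    moreover have "((1 - y * t) * x) * b \<in> U"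
    proof -
      have "(1 - y * t) * x = x - y * x * t" by (simp add: algebra_simps)
      also have "\<dots> = u" using t(1) by (metis add_diff_cancel_right')
      finally show ?thesis using t idl_mult'[OF UW(1)] by simp
    qed
    ultimately have "((1 - y * t) * x) * b - ((1 - y * t) * b - 1) * x \<in> U" by (rule idl_diff[OF UW(1), rotated])
    then show False using x by (simp add: algebra_simps)
  qed
  have "\<exists>a\<in>A. w - a * x \<in> U" if w: "w \<in> W" for w
  proof -
    obtain u t where t: "w = u + x * t" "u \<in> U" using gen[OF x] w by (auto elim!: set_plus_elim)
    obtain a where a: "a \<in> A" "t - a \<in> m" using Am by blast
    have "u + (t - a) * x \<in> U" using mx[OF a(2)] sub_add[OF UW(1) t(2)] by blast
    then show ?thesis using a t by (auto simp: algebra_simps)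
  qed
  then show thesis using that x mx by blast
qed

text \<open>As \<open>A\<close> maps onto the residue field, every simple quotient remains simple
  over \<open>A\<close>.\<close>

lemma slen_A_le:
  assumes "idl U" "Z \<subseteq> U" shows "slen A U UNIV \<le> len U UNIV"
proof (cases "len U UNIV")
  case (enat n)
  then show ?thesis using assms
  proof (induction n arbitrary: U rule: less_induct)
    case (less n)
    show ?case
    proof (cases "U = UNIV")
      case True
      then show ?thesis by (simp add: slen_self)
    next
      case False
      then obtain W where W: "idl W" "U \<subset> W" "len U W = 1" "len U UNIV = 1 + len W UNIV"
        using slen_atom[OF srng_UNIV less.prems(2) sub_UNIV _ less.prems(1)] by auto
      obtain x where x: "x \<in> W" "x \<notin> U" "\<And>y. y \<in> m \<Longrightarrow> y * x \<in> U" "\<And>w. w \<in> W \<Longrightarrow> \<exists>a\<in>A. w - a * x \<in> U"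
        using len_atom_structure[OF less.prems(2) W(1,2,3) less.prems(3)] by blast
      obtain k where k: "len W UNIV = enat k" "n = Suc k"
        using W(4) less.prems(1) by (cases "len W UNIV") (auto simp: one_enat_def)
      have IH: "slen A W UNIV \<le> len W UNIV" using less.IH[of k W] k W less.prems by auto
      have "slen A U W \<le> 1"
      proof (rule slen_simple[OF A idl_sub[OF less.prems(2)] idl_sub[OF W(1)]])
        fix y assume y: "y \<in> W" "y \<notin> U"
        let ?G = "gen A (insert y U)"
        have G: "sub A ?G" "U \<subseteq> ?G" "y \<in> ?G" by (auto simp: sub_gen intro: gen_inc)
        obtain a where a: "a \<in> A" "y - a * x \<in> U" using x(4)[OF y(1)] by blast
        have "a \<notin> m" using x(3)[of a] sub_add[OF less.prems(2) a(2), of "a * x"] y by auto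
        then obtain b where b: "a * b - 1 \<in> Z" using unit by blast
        obtain t where t: "t \<in> A" "b - t \<in> m" using Am by blast
        have "a * b - 1 - a * (b - t) \<in> m" using idl_diff[OF m(1) _ idl_mult[OF m(1) t(2)]] b m(2) by blast
        then have "a * t - 1 \<in> m" by (simp add: algebra_simps)
        then have 1: "(a * t - 1) * x \<in> U" by (rule x(3))
        have 2: "t * (y - a * x) \<in> U" using a idl_mult[OF less.prems(2)] by blast
        have "t * y \<in> ?G" using sub_smult[OF G(1) t(1) G(3)] .
        then have "t * y - (t * (y - a * x) + (a * t - 1) * x) \<in> ?G"
          using 1 2 G(2) by (intro sub_diff[OF G(1) A] sub_add[OF G(1)]) auto
        then have xG: "x \<in> ?G" by (simp add: algebra_simps)
        show "W \<subseteq> ?G"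
        proof
          fix w assume "w \<in> W"
          then obtain a where "a \<in> A" "w - a * x \<in> U" using x(4) by blast
          then show "w \<in> ?G" using sub_add[OF G(1), of "w - a * x" "a * x"] sub_smult[OF G(1) _ xG] G(2) by auto
        qed
      qed
      moreover have "slen A U UNIV = slen A U W + slen A W UNIV"
        by (rule slen_add[OF A]) (use W less.prems idl_sub sub_UNIV in auto)
      ultimately show ?thesis using IH W(4) by (simp add: add_mono)
    qed
  qed
qed simp

end

text \<open>\<open>Q/Z\<close> is a finite algebra over \<open>A/Z\<close>, where \<open>Q\<close> is the whole type. Quotients of \<open>Q/Z\<close> by
  prime ideals \<open>P \<supseteq> Z\<close> are not formed: one works modulo \<open>P\<close>.\<close>

locale fin_alg = local_pair Z A m
  for Z A m :: "'v::comm_ring_1 set" +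
  fixes gs as :: "'v list" and p :: nat
  assumes p: "Factorial_Ring.prime p" and pZ: "of_nat p \<in> Z"
    and red: "x * x \<in> Z \<Longrightarrow> x \<in> Z"
    and span: "x \<in> Span A gs + Z"
    and asA: "set as \<subseteq> A" "set as \<subseteq> m"
    and mA: "x \<in> A \<Longrightarrow> x \<in> m \<Longrightarrow> x \<in> pw A 1 as Z"
    \<comment> \<open>Elements of \<open>A\<close> outside \<open>Z\<close> cut the dimension: the
      length is \<open>O(q^(d-1))\<close>. The factor \<open>q\<close> on the left avoids the
      exponent \<open>d - 1\<close>, whose truncation at \<open>d = 0\<close> would be
      wrong.\<close>
    and good: "c \<in> A \<Longrightarrow> c \<notin> Z \<Longrightarrow>
      \<exists>K. \<forall>q\<ge>1. of_nat q * len (pid q as (Z + (*) c ` UNIV)) UNIV \<le> of_nat (K * q ^ length as)"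
    and fin: "len (pid 1 as Z) UNIV \<noteq> \<infinity>"
begin

abbreviation "d \<equiv> length as"

lemma p_pos: "p > 0" using p prime_gt_0_nat by blast

lemma slen_A_maximal: "slen A (pw A 1 as Z) A \<le> 1"
proof (rule slen_simple[OF A pw_sub[OF sub_A idl_sub[OF Z]] sub_A])
  fix y assume y: "y \<in> A" "y \<notin> pw A 1 as Z"
  let ?U = "pw A 1 as Z"
  let ?G = "gen A (insert y ?U)"
  have G: "sub A ?G" "?U \<subseteq> ?G" "y \<in> ?G" by (auto simp: sub_gen intro: gen_inc)
  have "y \<notin> m" using y mA by blast
  then obtain b where b: "y * b - 1 \<in> Z" using unit by blast
  obtain t where t: "t \<in> A" "b - t \<in> m" using Am by blast
  have "y * b - 1 - y * (b - t) \<in> m" using idl_diff[OF m(1) _ idl_mult[OF m(1) t(2)]] b m(2) by blast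
  then have "y * t - 1 \<in> m" by (simp add: algebra_simps)
  moreover have "y * t - 1 \<in> A" using srngD(5)[OF A y(1) t(1)] srngD(1,7)[OF A] by blast
  ultimately have "y * t - 1 \<in> ?U" by (intro mA)
  then have "y * t - 1 \<in> ?G" using G(2) by blast
  then have "t * y - (y * t - 1) \<in> ?G" using sub_diff[OF G(1) A] sub_smult[OF G(1) t(1) G(3)] by blast
  moreover have "t * y - (y * t - 1) = 1" by (simp add: mult.commute)
  ultimately have one: "1 \<in> ?G" by simp
  show "A \<subseteq> ?G"
  proof
    fix a assume "a \<in> A"
    then show "a \<in> ?G" using sub_smult[OF G(1) _ one, of a] by simp
  qed
qed

text \<open>Saturation means that the quotient by \<open>W\<close> is torsion-free over
  \<open>A\<close>. In particular a saturated proper ideal meets \<open>A\<close> only in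
  \<open>Z\<close>.\<close>

definition "sat W \<longleftrightarrow> sub A W \<and> Z \<subseteq> W \<and> (\<forall>c\<in>A. \<forall>x. c \<notin> Z \<longrightarrow> c * x \<in> W \<longrightarrow> x \<in> W)"

definition "cl V = {x. \<exists>c\<in>A. c \<notin> Z \<and> c * x \<in> V}"

primrec rk :: "'v list \<Rightarrow> 'v set \<Rightarrow> nat" where
  "rk [] W = 0"
| "rk (g # hs) W = rk hs W + (if \<exists>w\<in>W. w \<in> cl (Span A (g # hs) + Z) \<and> w \<notin> cl (Span A hs + Z) then 1 else 0)"

lemma rk_le: "rk hs W \<le> length hs" by (induction hs) auto

lemma rk_mono: "W \<subseteq> W' \<Longrightarrow> rk hs W \<le> rk hs W'" by (induction hs) (auto intro: add_mono)

lemma satD: "sat W \<Longrightarrow> c \<in> A \<Longrightarrow> c \<notin> Z \<Longrightarrow> c * x \<in> W \<Longrightarrow> x \<in> W"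
  by (auto simp: sat_def)

end

section \<open>Saturated submodules and rank over a domain\<close>

locale fin_dom = fin_alg +
  assumes dom: "c \<in> A \<Longrightarrow> c' \<in> A \<Longrightarrow> c * c' \<in> Z \<Longrightarrow> c \<in> Z \<or> c' \<in> Z"
begin

lemma sub_cl: assumes "sub A V" shows "sub A (cl V)" "V \<subseteq> cl V"
proof -
  show "V \<subseteq> cl V" using one_notin_Z srngD(1)[OF A] by (force simp: cl_def)
  show "sub A (cl V)"
  proof (rule subI)
    show "0 \<in> cl V" using sub_zero[OF assms] \<open>V \<subseteq> cl V\<close> by auto
  next
    fix x y assume "x \<in> cl V" "y \<in> cl V"
    then obtain c d where c: "c \<in> A" "c \<notin> Z" "c * x \<in> V" and d: "d \<in> A" "d \<notin> Z" "d * y \<in> V" by (auto simp: cl_def)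
    have "c * d * (x + y) = d * (c * x) + c * (d * y)" by (simp add: algebra_simps)
    then have "c * d * (x + y) \<in> V" using c d by (auto intro!: sub_add[OF assms] sub_smult[OF assms])
    moreover have "c * d \<in> A" "c * d \<notin> Z" using c d dom srngD(5)[OF A] by blast+
    ultimately show "x + y \<in> cl V" by (auto simp: cl_def)
  next
    fix s x assume s: "s \<in> A" "x \<in> cl V"
    then obtain c where c: "c \<in> A" "c \<notin> Z" "c * x \<in> V" by (auto simp: cl_def)
    then have "c * (s * x) \<in> V" using sub_smult[OF assms s(1) c(3)] by (simp add: mult.left_commute)
    then show "s * x \<in> cl V" using c by (auto simp: cl_def)
  qed
qed

lemma sat_cl: assumes "sub A V" "Z \<subseteq> V" shows "sat (cl V)"
proof -
  have "x \<in> cl V" if c: "c \<in> A" "c \<notin> Z" "c * x \<in> cl V" for c x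
  proof -
    obtain d where d: "d \<in> A" "d \<notin> Z" "d * (c * x) \<in> V" using c by (auto simp: cl_def)
    then have "d * c \<in> A" "d * c \<notin> Z" "d * c * x \<in> V" using c d dom srngD(5)[OF A] by (auto simp: mult.assoc)
    then show ?thesis by (auto simp: cl_def)
  qed
  then show ?thesis using sub_cl[OF assms(1)] assms(2) by (auto simp: sat_def)
qed

text \<open>The rank counts the steps of the flag given by the generators in which a submodule grows;
  so it is strictly monotone on saturated submodules.\<close>

lemma rk_eq_imp_subset:
  assumes W: "sat W" "sat W'" "W \<subseteq> W'"
  shows "rk hs W = rk hs W' \<Longrightarrow> W' \<inter> cl (Span A hs + Z) \<subseteq> W"
proof (induction hs)
  case Nil
  show ?case
  proof
    fix x assume "x \<in> W' \<inter> cl (Span A [] + Z)"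
    then obtain c where "c \<in> A" "c \<notin> Z" "c * x \<in> Z" by (auto simp: cl_def elim: set_plus_elim)
    then show "x \<in> W" using W(1) by (auto simp: sat_def)
  qed
next
  case (Cons g hs)
  let ?M = "cl (Span A hs + Z)" and ?N = "cl (Span A (g # hs) + Z)"
  have sS: "sub A (Span A hs + Z)" using sub_plus[OF sub_Span[OF A] idl_sub[OF Z]] .
  have sW: "sub A W" "sub A W'" using W by (auto simp: sat_def)
  have "rk hs W \<le> rk hs W'" using W(3) by (rule rk_mono)
  then have eq: "rk hs W = rk hs W'" "(\<exists>w\<in>W'. w \<in> ?N \<and> w \<notin> ?M) \<longrightarrow> (\<exists>w\<in>W. w \<in> ?N \<and> w \<notin> ?M)"
    using Cons.prems W(3) by (auto simp del: Span.simps split: if_splits)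
  have IH: "W' \<inter> ?M \<subseteq> W" using Cons.IH eq(1) by blast
  show ?case
  proof
    fix w' assume w': "w' \<in> W' \<inter> ?N"
    show "w' \<in> W"
    proof (cases "w' \<in> ?M")
      case True then show ?thesis using IH w' by blast
    next
      case False
      then obtain w where w: "w \<in> W" "w \<in> ?N" "w \<notin> ?M" using eq(2) w' by blast
      have ex: "\<exists>c a u. c \<in> A \<and> c \<notin> Z \<and> a \<in> A \<and> u \<in> Span A hs + Z \<and> c * x = a * g + u" if x: "x \<in> ?N" for x
      proof -
        obtain c where "c \<in> A" "c \<notin> Z" "c * x \<in> Span A (g # hs) + Z" using x by (auto simp: cl_def)
        then obtain a v z where "c \<in> A" "c \<notin> Z" "a \<in> A" "v \<in> Span A hs" "z \<in> Z" "c * x = (a * g + v) + z"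
          by (auto elim!: set_plus_elim)
        then show ?thesis using set_plus_intro[of v "Span A hs" z Z] by (metis add.assoc)
      qed
      obtain c a u where c: "c \<in> A" "c \<notin> Z" "a \<in> A" "u \<in> Span A hs + Z" "c * w = a * g + u" using ex w by blast
      obtain c' a' u' where c': "c' \<in> A" "c' \<notin> Z" "a' \<in> A" "u' \<in> Span A hs + Z" "c' * w' = a' * g + u'"
        using ex w' by blast
      have aZ: "a \<notin> Z"
      proof
        assume "a \<in> Z"
        then have "a * g \<in> Span A hs + Z"
          using plus_right_subset[OF sub_Span[OF A, of hs], of Z] idl_mult'[OF Z] by blast
        then have "c * w \<in> Span A hs + Z" using c sub_add[OF sS] by simp
        then show False using w c by (auto simp: cl_def)
      qed
      \<comment> \<open>This combination eliminates \<open>g\<close> from the two relations, so it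
        drops to the previous step of the flag.\<close>
      let ?y = "a * (c' * w') - a' * (c * w)"
      have aw: "a' * (c * w) \<in> W" using w c c' by (intro sub_smult[OF sW(1)])
      have "?y = a * u' - a' * u" using c c' by (simp add: algebra_simps)
      then have "?y \<in> ?M" using sub_diff[OF sS A] sub_smult[OF sS] c c' sub_cl(2)[OF sS] by auto
      moreover have "?y \<in> W'"
      proof (rule sub_diff[OF sW(2) A])
        show "a * (c' * w') \<in> W'" using w' c c' by (intro sub_smult[OF sW(2)]) auto
        show "a' * (c * w) \<in> W'" using aw W(3) by blast
      qed
      ultimately have "?y \<in> W" using IH by blast
      then have "a * (c' * w') \<in> W" using sub_add[OF sW(1) _ aw] by fastforce
      then show ?thesis using satD[OF W(1)] c(3) aZ c'(1,2) by blast
    qed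
  qed
qed

lemma cl_span: "cl (Span A gs + Z) = UNIV"
  using sub_cl(2)[OF sub_plus[OF sub_Span[OF A] idl_sub[OF Z]]] span by blast

lemma rk_eq_imp_eq: "sat W \<Longrightarrow> sat W' \<Longrightarrow> W \<subseteq> W' \<Longrightarrow> rk gs W' \<le> rk gs W \<Longrightarrow> W = W'"
  using rk_eq_imp_subset[of W W' gs] rk_mono[of W W' gs] cl_span by auto

text \<open>An injective endomorphism of a torsion-free module of finite rank has torsion cokernel.
  The ranks of the ideals \<open>P + (x^i)\<close> cannot decrease forever; where they stall, some
  \<open>c x^i\<close> lies in \<open>P + (x^(i+1))\<close>, and \<open>x^i\<close> cancels modulo
  \<open>P\<close>.\<close>

lemma torsion_cokernel:
  assumes P: "idl P" "sat P" and x: "\<And>y. x * y \<in> P \<Longrightarrow> y \<in> P"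
  obtains c where "c \<in> A" "c \<notin> Z" "c \<in> P + (*) x ` UNIV"
proof -
  let ?V = "\<lambda>i. P + (*) (x ^ i) ` UNIV"
  have ZP: "Z \<subseteq> P" using P by (auto simp: sat_def)
  have V: "idl (?V i)" "Z \<subseteq> ?V i" for i
    using idl_plus[OF P(1) idl_image[OF sub_UNIV]] plus_left_subset[OF idl_image[OF sub_UNIV], of P] ZP by blast+
  have clV: "sat (cl (?V i))" for i by (rule sat_cl[OF idl_sub[OF V(1)] V(2)])
  have le: "?V (Suc i) \<subseteq> ?V i" for i
    by (rule plus_mono) (auto simp: mult.assoc power_Suc2 simp del: power_Suc)
  obtain i where i: "rk gs (cl (?V i)) \<le> rk gs (cl (?V (Suc i)))"
    using decreasing_nat_stalls[of "\<lambda>i. rk gs (cl (?V i))"] by blast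
  have "cl (?V (Suc i)) \<subseteq> cl (?V i)" using le[of i] by (auto simp: cl_def)
  then have "cl (?V (Suc i)) = cl (?V i)" using rk_eq_imp_eq[OF clV clV _ i] by blast
  moreover have "x ^ i \<in> cl (?V i)"
  proof -
    have "x ^ i * 1 \<in> ?V i" using plus_right_subset[OF P(1), of "(*) (x ^ i) ` UNIV"] by blast
    then show ?thesis using sub_cl(2)[OF idl_sub[OF V(1)]] by auto
  qed
  ultimately obtain c where c: "c \<in> A" "c \<notin> Z" "c * x ^ i \<in> ?V (Suc i)" by (auto simp: cl_def)
  then obtain b t where b: "c * x ^ i = b + x ^ Suc i * t" "b \<in> P" by (auto elim!: set_plus_elim)
  then have "x ^ i * (c - x * t) \<in> P" by (simp add: algebra_simps)
  then have "c - x * t \<in> P" by (induction i) (auto simp: mult.assoc dest: x)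
  then have "(c - x * t) + x * t \<in> P + (*) x ` UNIV" by (intro set_plus_intro) auto
  then show thesis using that c by simp
qed

end

section \<open>Semilinear maps and subrings generated by p-power elements\<close>

context fin_alg
begin

text \<open>Climb from \<open>U\<close> along simple quotients \<open>W/U\<close>, each spanned by
  one \<open>x\<close> that the parameters multiply into \<open>U\<close>. Modulo the span of the
  image of \<open>U\<close>, the image of \<open>W\<close> is spanned over \<open>A\<close> by
  \<open>\<theta> x\<close>, which is killed by the \<open>p\<close>-th powers of the parameters. So
  each step adds at most \<open>p ^ d\<close> to the length over \<open>A\<close>.\<close>

lemma semilinear_slen:
  assumes P: "idl P" "Z \<subseteq> P"
    and add: "\<And>u v. \<theta> (u + v) - (\<theta> u + \<theta> v) \<in> P"
    and smult: "\<And>a u. a \<in> A \<Longrightarrow> \<theta> (a * u) - a ^ p * \<theta> u \<in> P"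
    and U: "idl U" "P \<subseteq> U" "len U UNIV \<noteq> \<infinity>"
  shows "slen A (gen A (\<theta> ` U \<union> P)) (gen A (\<theta> ` UNIV \<union> P)) \<le> of_nat (p ^ d) * len U UNIV"
proof -
  obtain n where "len U UNIV = enat n" using U by auto
  then show ?thesis using U(1,2)
  proof (induction n arbitrary: U rule: less_induct)
    case (less n)
    let ?T = "\<lambda>U. gen A (\<theta> ` U \<union> P)"
    have T: "sub A (?T U)" "P \<subseteq> ?T U" "u \<in> U \<Longrightarrow> \<theta> u \<in> ?T U" for U u
      by (auto simp: sub_gen intro: gen_inc)
    show ?case
    proof (cases "U = UNIV")
      case True
      then show ?thesis by (simp add: slen_self)
    next
      case False
      have ZU: "Z \<subseteq> U" using P less.prems by blast
      obtain W where W: "idl W" "U \<subset> W" "len U W = 1" "len U UNIV = 1 + len W UNIV"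
        by (rule slen_atom[OF srng_UNIV less.prems(2) sub_UNIV _ less.prems(1)]) (use False in auto)
      obtain x where x: "x \<in> W" "\<And>y. y \<in> m \<Longrightarrow> y * x \<in> U" "\<And>w. w \<in> W \<Longrightarrow> \<exists>a\<in>A. w - a * x \<in> U"
        by (rule len_atom_structure[OF less.prems(2) W(1,2,3) ZU]) (rule that; blast)
      obtain k where k: "len W UNIV = enat k" "n = Suc k"
        using W(4) less.prems(1) by (cases "len W UNIV") (auto simp: one_enat_def)
      have PW: "P \<subseteq> W" using W(2) less.prems by blast
      have IH: "slen A (?T W) (?T UNIV) \<le> of_nat (p ^ d) * len W UNIV"
        by (rule less.IH[of k W]) (use k W PW in simp_all)
      have TUW: "?T U \<subseteq> ?T W" "?T W \<subseteq> ?T UNIV" using W(2) by (intro gen_mono Un_mono image_mono; simp)+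
      let ?R = "?T U + (*) (\<theta> x) ` A"
      have sR: "sub A ?R" by (rule sub_plus[OF T(1) sub_image[OF sub_A]])
      have UR: "?T U \<subseteq> ?R" by (rule plus_left_subset[OF sub_image[OF sub_A]])
      have "?T W \<subseteq> ?R"
      proof (rule gen_minimal[OF _ sR], rule Un_least)
        show "P \<subseteq> ?R" by (rule order.trans[OF T(2) UR])
        show "\<theta> ` W \<subseteq> ?R"
        proof
          fix y assume "y \<in> \<theta> ` W"
          then obtain w where w: "w \<in> W" "y = \<theta> w" by blast
          obtain a where a: "a \<in> A" "w - a * x \<in> U" using x(3)[OF w(1)] by blast
          let ?u = "w - a * x"
          have 1: "\<theta> (?u + a * x) - (\<theta> ?u + \<theta> (a * x)) \<in> P" by (rule add)
          have 2: "\<theta> (a * x) - a ^ p * \<theta> x \<in> P" by (rule smult[OF a(1)])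
          have "\<theta> (?u + a * x) - (\<theta> ?u + \<theta> (a * x)) + (\<theta> (a * x) - a ^ p * \<theta> x) \<in> P"
            using 1 2 by (rule sub_add[OF P(1)])
          then have "\<theta> w - \<theta> ?u - a ^ p * \<theta> x \<in> P" by (simp add: algebra_simps)
          then have "\<theta> ?u + (\<theta> w - \<theta> ?u - a ^ p * \<theta> x) \<in> ?T U"
            by (rule sub_add[OF T(1) T(3)[OF a(2)] subsetD[OF T(2)]])
          moreover have "\<theta> x * a ^ p \<in> (*) (\<theta> x) ` A" using srng_power[OF A a(1)] by blast
          ultimately have "\<theta> ?u + (\<theta> w - \<theta> ?u - a ^ p * \<theta> x) + \<theta> x * a ^ p \<in> ?R" by (rule set_plus_intro)
          then show "y \<in> ?R" using w(2) by (simp add: algebra_simps)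
        qed
      qed
      then have "slen A (?T U) (?T W) \<le> slen A (?T U) ?R" by (intro slen_mono) auto
      also have "\<dots> \<le> slen A (pw A p as Z) A"
      proof (rule slen_image[OF A pw_sub[OF sub_A idl_sub[OF Z]] sub_A T(1)])
        show "pw A p as Z \<subseteq> A"
        proof (rule pw_least[OF sub_A ZA])
          fix y b assume "y \<in> set as" "b \<in> A"
          then show "y ^ p * b \<in> A" using srngD(5)[OF A srng_power[OF A]] asA(1) by blast
        qed
        have s: "sub A {v. \<theta> x * v \<in> ?T U}"
          by (rule subI) (use T(1)[of U] in \<open>auto simp: sub_zero sub_add distrib_left sub_smult mult.left_commute[of "\<theta> x"]\<close>)
        have "pw A p as Z \<subseteq> {v. \<theta> x * v \<in> ?T U}"
        proof (rule pw_least[OF s])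
          show "Z \<subseteq> {v. \<theta> x * v \<in> ?T U}"
          proof
            fix z assume "z \<in> Z"
            then have "\<theta> x * z \<in> P" using idl_mult[OF Z] P(2) by blast
            then show "z \<in> {v. \<theta> x * v \<in> ?T U}" using subsetD[OF T(2)] by simp
          qed
          fix y b assume y: "y \<in> set as" "b \<in> A"
          then have "y * x \<in> U" "y \<in> A" using x(2) asA by auto
          then have "\<theta> (y * x) - (\<theta> (y * x) - y ^ p * \<theta> x) \<in> ?T U"
            by (intro sub_diff[OF T(1) A T(3)] subsetD[OF T(2)] smult)
          then have "\<theta> x * y ^ p \<in> ?T U" by (simp add: mult.commute)
          then have "b * (\<theta> x * y ^ p) \<in> ?T U" by (rule sub_smult[OF T(1) y(2)])
          then show "y ^ p * b \<in> {v. \<theta> x * v \<in> ?T U}" by (simp add: ac_simps)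
        qed
        then show "(*) (\<theta> x) ` pw A p as Z \<subseteq> ?T U" by blast
      qed
      also have "\<dots> \<le> of_nat (p ^ d) * slen A (pw A 1 as Z) A"
        by (rule slen_pw[OF A A order.refl idl_sub[OF Z] ZA asA(1)])
      also have "\<dots> \<le> of_nat (p ^ d) * 1" using slen_A_maximal by (rule mult_left_mono) simp
      finally have 3: "slen A (?T U) (?T W) \<le> of_nat (p ^ d)" by simp
      have "slen A (?T U) (?T UNIV) = slen A (?T U) (?T W) + slen A (?T W) (?T UNIV)"
        by (rule slen_add[OF A T(1) T(1) T(1) TUW])
      also have "\<dots> \<le> of_nat (p ^ d) + of_nat (p ^ d) * len W UNIV" using 3 IH by (rule add_mono)
      also have "\<dots> = of_nat (p ^ d) * len U UNIV" by (simp add: W(4) distrib_left)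
      finally show ?thesis .
    qed
  qed
qed

text \<open>The subring generated over \<open>A\<close> by all \<open>p^e\<close>-th powers.
  Additivity of the Frobenius modulo \<open>Z\<close> is the reason why the powers of the module
  generators already span it over \<open>A\<close>, up to \<open>Z\<close>.\<close>

definition Fr :: "nat \<Rightarrow> 'v set" where
  "Fr e = Span A (map (\<lambda>g. g ^ (p ^ e)) gs) + Z"

lemma sub_Fr: "sub A (Fr e)" "Z \<subseteq> Fr e"
  unfolding Fr_def using sub_plus[OF sub_Span[OF A] idl_sub[OF Z]] plus_right_subset[OF sub_Span[OF A]] by auto

lemma Fr_gen: "a \<in> A \<Longrightarrow> g \<in> set gs \<Longrightarrow> a * g ^ (p ^ e) \<in> Fr e"
  unfolding Fr_def
  using Span_mem[OF A, of a "g ^ (p ^ e)" "map (\<lambda>g. g ^ (p ^ e)) gs"] plus_left_subset[OF idl_sub[OF Z, of A]] by auto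

lemma Fr_least:
  assumes "sub A W" "Z \<subseteq> W" "\<And>g. g \<in> set gs \<Longrightarrow> g ^ (p ^ e) \<in> W"
  shows "Fr e \<subseteq> W"
  unfolding Fr_def
  by (rule plus_least[OF assms(1) Span_least[OF assms(1)] assms(2)]) (use assms sub_smult[OF assms(1)] in auto)

lemma Fr_power: "x ^ (p ^ e) \<in> Fr e"
proof -
  have add: "(u + v) ^ (p ^ e) \<in> Fr e" if "u ^ (p ^ e) \<in> Fr e" "v ^ (p ^ e) \<in> Fr e" for u v
  proof -
    have "(u + v) ^ (p ^ e) - (u ^ (p ^ e) + v ^ (p ^ e)) \<in> Fr e" using frobenius_add[OF Z p pZ] sub_Fr by blast
    then show ?thesis using sub_add[OF sub_Fr(1) _ sub_add[OF sub_Fr(1) that]] by fastforce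
  qed
  have zero: "0 ^ (p ^ e) \<in> Fr e" using sub_zero[OF sub_Fr(1)] p_pos by (simp add: zero_power)
  have "Span A hs \<subseteq> {u. u ^ (p ^ e) \<in> Fr e}" if "set hs \<subseteq> set gs" for hs
    using that
  proof (induction hs)
    case (Cons h hs)
    have "(s * h) ^ (p ^ e) \<in> Fr e" if "s \<in> A" for s
      using Fr_gen[OF srng_power[OF A that], of h] Cons.prems by (simp add: power_mult_distrib)
    then show ?case using Cons by (auto intro!: add)
  qed (use zero in simp)
  then have 1: "u ^ (p ^ e) \<in> Fr e" if "u \<in> Span A gs" for u using that by blast
  have 2: "z ^ (p ^ e) \<in> Fr e" if "z \<in> Z" for z
    using idl_power[OF Z that, of "p ^ e"] sub_Fr p_pos by auto
  obtain u z where "x = u + z" "u \<in> Span A gs" "z \<in> Z" using span[of x] by (auto elim: set_plus_elim)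
  then show ?thesis using add 1 2 by blast
qed

lemma srng_Fr: "srng (Fr e)"
proof -
  have one: "1 \<in> Fr e" using Fr_power[of 1 e] by simp
  have "x * y \<in> Fr e" if x: "x \<in> Fr e" and y: "y \<in> Fr e" for x y
  proof -
    have 1: "g ^ (p ^ e) * y \<in> Fr e" for g
    proof -
      have s: "sub A {y. g ^ (p ^ e) * y \<in> Fr e}"
        by (rule subI) (use sub_Fr(1)[of e] in \<open>auto simp: sub_zero sub_add distrib_left sub_smult mult.left_commute[of "g ^ _"]\<close>)
      have "Fr e \<subseteq> {y. g ^ (p ^ e) * y \<in> Fr e}"
        by (rule Fr_least[OF s]) (use sub_Fr(2) idl_mult[OF Z] Fr_power in \<open>auto simp flip: power_mult_distrib\<close>)
      then show ?thesis using y by blast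
    qed
    have s: "sub A {x. x * y \<in> Fr e}"
      by (rule subI) (use sub_Fr(1)[of e] in \<open>auto simp: sub_zero sub_add distrib_right sub_smult mult.assoc\<close>)
    have "Fr e \<subseteq> {x. x * y \<in> Fr e}"
      by (rule Fr_least[OF s]) (use sub_Fr(2) idl_mult'[OF Z] 1 in auto)
    then show ?thesis using x by blast
  qed
  then show ?thesis
    using one sub_add[OF sub_Fr(1)] sub_uminus[OF sub_Fr(1) A one] by (auto simp: srng_def)
qed

lemma A_Fr: "A \<subseteq> Fr e"
  using sub_smult[OF sub_Fr(1) _ srngD(1)[OF srng_Fr]] by (metis mult.right_neutral subsetI)

lemma Fr_decreasing: "Fr (Suc e) \<subseteq> Fr e"
proof (rule Fr_least[OF sub_Fr])
  fix g show "g ^ (p ^ Suc e) \<in> Fr e" using Fr_power[of "g ^ p" e] by (simp add: power_mult)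
qed

lemma Fr_antimono: "e \<le> e' \<Longrightarrow> Fr e' \<subseteq> Fr e"
  by (rule lift_Suc_antimono_le) (use Fr_decreasing in auto)

end

text \<open>The graph of the map \<open>\<Sum> e\<^sub>i w\<^sub>i \<mapsto> \<Sum> e\<^sub>i\<^sup>n w\<^sub>i\<close>.\<close>

primrec power_graph :: "'t::comm_ring_1 set \<Rightarrow> nat \<Rightarrow> 't list \<Rightarrow> ('t \<times> 't) set" where
  "power_graph C n [] = {(0, 0)}"
| "power_graph C n (w # ws) = {(e * w + x, e ^ n * w + y) | e x y. e \<in> C \<and> (x, y) \<in> power_graph C n ws}"

lemma power_graph_ConsI:
  "e \<in> C \<Longrightarrow> (x, y) \<in> power_graph C n ws \<Longrightarrow> (e * w + x, e ^ n * w + y) \<in> power_graph C n (w # ws)"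
  by auto

lemma power_graph_total: "x \<in> Span C ws \<Longrightarrow> \<exists>y. (x, y) \<in> power_graph C n ws"
proof (induction ws arbitrary: x)
  case (Cons w ws)
  then obtain e u where 1: "x = e * w + u" "e \<in> C" "u \<in> Span C ws" by auto
  then obtain y where "(u, y) \<in> power_graph C n ws" using Cons.IH by blast
  then show ?case using power_graph_ConsI[OF 1(2)] 1(1) by blast
qed auto

lemma power_graph_Span: "(x, y) \<in> power_graph C n ws \<Longrightarrow> x \<in> Span C ws"
  by (induction ws arbitrary: x y) auto

lemma power_graph_smult:
  assumes "srng C" "c \<in> C"
  shows "(x, y) \<in> power_graph C n ws \<Longrightarrow> (c * x, c ^ n * y) \<in> power_graph C n ws"
proof (induction ws arbitrary: x y)
  case (Cons w ws)
  then obtain e u v where *: "x = e * w + u" "y = e ^ n * w + v" "e \<in> C" "(u, v) \<in> power_graph C n ws" by auto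
  then have "c * x = (c * e) * w + c * u" "c ^ n * y = (c * e) ^ n * w + c ^ n * v"
    by (simp_all add: algebra_simps power_mult_distrib)
  moreover have "c * e \<in> C" "(c * u, c ^ n * v) \<in> power_graph C n ws"
    using Cons.IH[OF *(4)] srngD(5)[OF assms *(3)] by simp_all
  ultimately show ?case using power_graph_ConsI[of "c * e" C "c * u"] by simp
qed auto

lemma power_graph_add:
  assumes C: "srng C" and Z: "idl Z" and p: "Factorial_Ring.prime p" "of_nat p \<in> Z"
  shows "(x, y) \<in> power_graph C p ws \<Longrightarrow> (x', y') \<in> power_graph C p ws \<Longrightarrow>
    \<exists>y''. (x + x', y'') \<in> power_graph C p ws \<and> y'' - (y + y') \<in> Z"
proof (induction ws arbitrary: x y x' y')
  case Nil
  then show ?case using sub_zero[OF Z] by auto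
next
  case (Cons w ws)
  obtain e u v where 1: "x = e * w + u" "y = e ^ p * w + v" "e \<in> C" "(u, v) \<in> power_graph C p ws"
    using Cons.prems by auto
  obtain e' u' v' where 2: "x' = e' * w + u'" "y' = e' ^ p * w + v'" "e' \<in> C" "(u', v') \<in> power_graph C p ws"
    using Cons.prems by auto
  obtain v'' where v: "(u + u', v'') \<in> power_graph C p ws" "v'' - (v + v') \<in> Z" using Cons.IH[OF 1(4) 2(4)] by blast
  have "x + x' = (e + e') * w + (u + u')" using 1 2 by (simp add: algebra_simps)
  then have "(x + x', (e + e') ^ p * w + v'') \<in> power_graph C p (w # ws)"
    using power_graph_ConsI[OF srngD(4)[OF C 1(3) 2(3)] v(1)] by simp
  moreover have "((e + e') ^ p - (e ^ p + e' ^ p)) * w + (v'' - (v + v')) \<in> Z"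
    using frobenius_add[OF Z p, of e e' 1] by (intro sub_add[OF Z] idl_mult'[OF Z] v) simp
  then have "(e + e') ^ p * w + v'' - (y + y') \<in> Z" using 1 2 by (simp add: algebra_simps)
  ultimately show ?case by blast
qed

lemma power_graph_ideal:
  assumes P: "idl P" and n: "n > 0"
  shows "indep C P ws \<Longrightarrow> (x, y) \<in> power_graph C n ws \<Longrightarrow> x \<in> P \<Longrightarrow> y \<in> P"
proof (induction ws arbitrary: x y)
  case (Cons w ws)
  then obtain e u v where 1: "x = e * w + u" "y = e ^ n * w + v" "e \<in> C" "(u, v) \<in> power_graph C n ws" by auto
  then have e: "e \<in> P" using Cons.prems power_graph_Span[OF 1(4)] by auto
  then have "x - e * w \<in> P" using Cons.prems idl_diff[OF P] idl_mult'[OF P] by blast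
  then have "v \<in> P" using Cons 1 by auto
  then show ?case using 1(2) e idl_power[OF P e n] by (auto intro!: sub_add[OF P] idl_mult'[OF P])
qed auto

lemma power_graph_mem:
  assumes C: "srng C" shows "e \<in> C \<Longrightarrow> w \<in> set ws \<Longrightarrow> n > 0 \<Longrightarrow> (e * w, e ^ n * w) \<in> power_graph C n ws"
proof (induction ws)
  case (Cons v ws)
  have z: "(0, 0) \<in> power_graph C n us" for us
  proof (induction us)
    case (Cons u us)
    have "(0 * u + 0, 0 ^ n * u + 0) \<in> power_graph C n (u # us)"
      by (rule power_graph_ConsI[OF srngD(3)[OF C] Cons.IH])
    then show ?case using \<open>n > 0\<close> by (simp add: zero_power)
  qed simp
  show ?case
  proof (cases "w = v")
    case True
    have "(e * w + 0, e ^ n * w + 0) \<in> power_graph C n (w # ws)"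
      by (rule power_graph_ConsI[OF Cons.prems(1) z])
    then show ?thesis using True by simp
  next
    case False
    then have "(e * w, e ^ n * w) \<in> power_graph C n ws" using Cons by auto
    then have "(0 * v + e * w, 0 ^ n * v + e ^ n * w) \<in> power_graph C n (v # ws)"
      by (rule power_graph_ConsI[OF srngD(3)[OF C]])
    then show ?thesis using \<open>n > 0\<close> by (simp add: zero_power)
  qed
qed auto

text \<open>Subtract the pairs by adding \<open>-1\<close> times the second one, whose value picks
  up \<open>(-1)^p\<close>. Independence forces the value at an element of \<open>P\<close> into
  \<open>P\<close>. Thus the graph is that of a map modulo \<open>P\<close>.\<close>

lemma power_graph_unique:
  assumes C: "srng C" and Z: "idl Z" and p: "Factorial_Ring.prime p" "of_nat p \<in> Z"
    and P: "idl P" "Z \<subseteq> P" "indep C P ws"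
    and xy: "(x, y) \<in> power_graph C p ws" "(x', y') \<in> power_graph C p ws" "x - x' \<in> P"
  shows "y - y' \<in> P"
proof -
  have p0: "p > 0" using p prime_gt_0_nat by blast
  have "(- 1 * x', (- 1) ^ p * y') \<in> power_graph C p ws" by (rule power_graph_smult[OF C srngD(2)[OF C] xy(2)])
  then obtain y'' where y: "(x + (- 1 * x'), y'') \<in> power_graph C p ws" "y'' - (y + (- 1) ^ p * y') \<in> Z"
    using power_graph_add[OF C Z p xy(1)] by blast
  have "y'' \<in> P" by (rule power_graph_ideal[OF P(1) p0 P(3) y(1)]) (use xy in simp)
  moreover have "((- 1) ^ p + 1) * y' \<in> P" using frobenius_minus_one[OF Z p] P idl_mult' by blast
  moreover have "y'' - (y + (- 1) ^ p * y') \<in> P" using y(2) P(2) by blast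
  ultimately have "(y'' - (y'' - (y + (- 1) ^ p * y'))) - ((- 1) ^ p + 1) * y' \<in> P"
    using idl_diff[OF P(1)] by (metis (no_types))
  moreover have "(y'' - (y'' - (y + (- 1) ^ p * y'))) - ((- 1) ^ p + 1) * y' = y - y'"
    by (simp add: algebra_simps)
  ultimately show ?thesis by (simp only:)
qed

text \<open>Meaningful for finite lengths only: the value at infinity is unspecified, whence the
  finiteness conditions in the rules below.\<close>

definition rlen :: "enat \<Rightarrow> real" where "rlen x = real (the_enat x)"

lemma rlen_add: "x \<noteq> \<infinity> \<Longrightarrow> y \<noteq> \<infinity> \<Longrightarrow> rlen (x + y) = rlen x + rlen y"
  by (cases x; cases y) (auto simp: rlen_def)

lemma rlen_mult: "x \<noteq> \<infinity> \<Longrightarrow> rlen (of_nat n * x) = real n * rlen x"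
  by (cases x) (auto simp: rlen_def of_nat_eq_enat)

lemma rlen_mono: "x \<le> y \<Longrightarrow> y \<noteq> \<infinity> \<Longrightarrow> rlen x \<le> rlen y"
  by (cases x; cases y) (auto simp: rlen_def)

lemma rlen_nonneg: "rlen x \<ge> 0" by (simp add: rlen_def)

lemma rlen_of_nat: "rlen (of_nat n) = real n" by (simp add: rlen_def of_nat_eq_enat)

lemma of_nat_mult_finite: "x \<noteq> \<infinity> \<Longrightarrow> of_nat n * x \<noteq> (\<infinity>::enat)"
  by (cases x) (auto simp: of_nat_eq_enat)

lemma enat_finite_mono: "x \<le> y \<Longrightarrow> y \<noteq> \<infinity> \<Longrightarrow> x \<noteq> (\<infinity>::enat)"
  by (cases x; cases y) auto

lemma enat_add_finiteD: "x + y \<noteq> \<infinity> \<Longrightarrow> x \<noteq> \<infinity> \<and> y \<noteq> (\<infinity>::enat)"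
  by (cases x; cases y) auto

section \<open>Normalized lengths of bracket powers and their error terms\<close>

locale hk_alg = fin_alg Z A m gs as p
  for Z A m :: "'v::comm_ring_1 set" and gs as p +
  fixes I :: "'v set" and s :: nat
  assumes I: "idl I" "Z \<subseteq> I" and s: "s \<ge> 1" and asI: "\<And>a. a \<in> set as \<Longrightarrow> a ^ s \<in> I"
begin

abbreviation "B e \<equiv> br Z I (p ^ e)"
definition "F b e = len (B e + b) UNIV"
text \<open>The powers of the parameters with exponent \<open>s * p ^ e\<close> lie in
  \<open>B e\<close>. So this length bounds \<open>F b e\<close> whenever \<open>c\<close> lies in
  \<open>b\<close>, and by \<open>slen_torsion\<close> also every quotient of finite-colength ideals
  above \<open>B e\<close> that is killed by \<open>c\<close>.\<close>

definition "err c e = len (pid (s * p ^ e) as (Z + (*) c ` UNIV)) UNIV"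
definition "fr b e = rlen (F b e) / real (p ^ e) ^ d"
definition "rerr c e = rlen (err c e) / real (p ^ e) ^ d"

lemma N_pos: "real (p ^ e) ^ d > 0" using p_pos by simp

lemma pid_le_B: "pid (s * p ^ e) as Z \<subseteq> B e"
proof (rule pw_least[OF idl_br br_superset(1)])
  fix a b assume "a \<in> set as"
  then have "(a ^ s) ^ (p ^ e) \<in> B e" using asI br_superset(2) by blast
  then show "a ^ (s * p ^ e) * b \<in> B e" using idl_mult'[OF idl_br] by (simp add: power_mult)
qed

lemma F_finite: "idl b \<Longrightarrow> F b e \<noteq> \<infinity>"
proof -
  assume b: "idl b"
  have "F b e \<le> len (pid (s * p ^ e) as Z) UNIV"
    unfolding F_def using pid_le_B plus_left_subset[OF b] by (intro slen_mono) blast+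
  also have "\<dots> \<le> of_nat ((s * p ^ e) ^ d) * len (pid 1 as Z) UNIV" by (rule len_pid[OF Z])
  finally show ?thesis using of_nat_mult_finite[OF fin] enat_finite_mono by blast
qed

lemma idl_principal: "idl (Z + (*) c ` UNIV)" by (rule idl_plus[OF Z idl_image[OF sub_UNIV]])

lemma err_bound:
  assumes "c \<in> A" "c \<notin> Z"
  obtains K where "K \<ge> 0" "\<And>e. err c e \<noteq> \<infinity>" "\<And>e. rerr c e \<le> K / real p ^ e"
proof -
  obtain K where K: "\<forall>q\<ge>1. of_nat q * len (pid q as (Z + (*) c ` UNIV)) UNIV \<le> of_nat (K * q ^ d)"
    using good[OF assms] by blast
  have sq: "s * p ^ e \<ge> 1" for e using s p_pos by (simp add: Suc_leI)
  have 1: "of_nat (s * p ^ e) * err c e \<le> of_nat (K * (s * p ^ e) ^ d)" for e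
    using K sq unfolding err_def by blast
  have fin: "err c e \<noteq> \<infinity>" for e
  proof
    assume "err c e = \<infinity>"
    moreover obtain k where "s * p ^ e = Suc k" using sq[of e] by (cases "s * p ^ e") auto
    ultimately show False using 1[of e] by (simp add: distrib_right of_nat_eq_enat)
  qed
  have "rerr c e \<le> (real K * real s ^ d) / real p ^ e" for e
  proof -
    have *: "rlen (of_nat (s * p ^ e) * err c e) \<le> rlen (of_nat (K * (s * p ^ e) ^ d))"
      by (rule rlen_mono[OF 1]) (simp add: of_nat_eq_enat)
    from *[unfolded rlen_mult[OF fin] rlen_of_nat]
    have "real (s * p ^ e) * rlen (err c e) \<le> real K * real (s * p ^ e) ^ d" by simp
    then have "real (p ^ e) * rlen (err c e) * 1 \<le> real K * real (s * p ^ e) ^ d"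
    proof (rule order.trans[rotated])
      have "1 * (real (p ^ e) * rlen (err c e)) \<le> real s * (real (p ^ e) * rlen (err c e))"
        using s rlen_nonneg by (intro mult_right_mono) auto
      then show "real (p ^ e) * rlen (err c e) * 1 \<le> real (s * p ^ e) * rlen (err c e)" by (simp add: mult.assoc)
    qed
    then have "rlen (err c e) \<le> real K * real s ^ d * real (p ^ e) ^ d / real (p ^ e)"
      using p_pos by (simp add: field_simps power_mult_distrib)
    then have "rerr c e \<le> (real K * real s ^ d * real (p ^ e) ^ d / real (p ^ e)) / real (p ^ e) ^ d"
      unfolding rerr_def using N_pos by (intro divide_right_mono) auto
    also have "\<dots> = real K * real s ^ d / real p ^ e" using p_pos by (simp add: field_simps)
    finally show ?thesis .
  qed
  with fin show thesis by (intro that[of "real K * real s ^ d"]) simp_all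
qed

lemma err_finite: "c \<in> A \<Longrightarrow> c \<notin> Z \<Longrightarrow> err c e \<noteq> \<infinity>"
  by (rule err_bound)

lemma rerr_tendsto:
  assumes "c \<in> A" "c \<notin> Z" shows "rerr c \<longlonglongrightarrow> 0"
proof -
  obtain K where K: "K \<ge> 0" "\<And>e. err c e \<noteq> \<infinity>" "\<And>e. rerr c e \<le> K / real p ^ e"
    by (rule err_bound[OF assms]) (rule that; blast)
  have p1: "real p > 1" using p prime_gt_1_nat by simp
  have "(\<lambda>e. K * (1 / real p) ^ e) \<longlonglongrightarrow> K * 0" using p1 by (intro tendsto_mult tendsto_const LIMSEQ_power_zero) auto
  then have "(\<lambda>e. K / real p ^ e) \<longlonglongrightarrow> 0" by (simp add: power_divide)
  moreover have "\<forall>\<^sub>F e in sequentially. 0 \<le> rerr c e" by (simp add: rerr_def rlen_nonneg)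
  moreover have "\<forall>\<^sub>F e in sequentially. rerr c e \<le> K / real p ^ e" using K(3) by simp
  ultimately show ?thesis by (intro tendsto_sandwich[of "\<lambda>_. 0" "rerr c" sequentially "\<lambda>e. K / real p ^ e" 0]) simp_all
qed

lemma F_le_err: "c \<in> b \<Longrightarrow> idl b \<Longrightarrow> F b e \<le> err c e"
  unfolding F_def err_def
proof (rule slen_mono)
  assume b: "c \<in> b" "idl b"
  show "pid (s * p ^ e) as (Z + (*) c ` UNIV) \<subseteq> B e + b"
  proof (rule pw_least[of UNIV])
    show i: "idl (B e + b)" by (rule idl_plus[OF idl_br b(2)])
    have "(*) c ` UNIV \<subseteq> b" using idl_mult'[OF b(2,1)] by auto
    then show "Z + (*) c ` UNIV \<subseteq> B e + b" by (intro plus_mono br_superset)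
    fix a r assume "a \<in> set as"
    then have "a ^ (s * p ^ e) * r \<in> pid (s * p ^ e) as Z" by (rule pw_mem[OF sub_UNIV Z _ UNIV_I])
    then show "a ^ (s * p ^ e) * r \<in> B e + b" using pid_le_B plus_left_subset[OF b(2)] by blast
  qed
qed auto

lemma torsion_le_err:
  assumes "idl U" "idl V" "U \<subseteq> V" "B e \<subseteq> U" "(*) c ` V \<subseteq> U" "len U UNIV \<noteq> \<infinity>"
  shows "len U V \<le> err c e"
proof -
  have "len U V \<le> len (U + (*) c ` UNIV) UNIV"
    by (rule slen_torsion[OF srng_UNIV assms(1,2) sub_UNIV assms(3) subset_UNIV assms(5) subset_UNIV assms(6)])
  also have "\<dots> \<le> err c e"
    unfolding err_def
  proof (rule slen_mono)
    show "pid (s * p ^ e) as (Z + (*) c ` UNIV) \<subseteq> U + (*) c ` UNIV"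
      unfolding pw_plus using pid_le_B[of e] assms(4) by (intro plus_mono) auto
  qed auto
  finally show ?thesis .
qed

lemma fr_small:
  assumes "c \<in> A" "c \<notin> Z" "c \<in> b" "idl b" shows "fr b \<longlonglongrightarrow> 0"
proof (rule tendsto_sandwich[OF _ _ tendsto_const rerr_tendsto[OF assms(1,2)]])
  note fin = err_finite[OF assms(1,2)]
  have "fr b e \<le> rerr c e" for e
    unfolding fr_def rerr_def using rlen_mono[OF F_le_err[OF assms(3,4)] fin] N_pos
    by (intro divide_right_mono) auto
  then show "\<forall>\<^sub>F e in sequentially. fr b e \<le> rerr c e" by simp
  show "\<forall>\<^sub>F e in sequentially. 0 \<le> fr b e" by (simp add: fr_def rlen_nonneg)
qed

lemma fr_torsion:
  assumes "c \<in> A" "c \<notin> Z" and b: "idl b" "idl b0" "b \<subseteq> b0" "(*) c ` b0 \<subseteq> b"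
  shows "\<bar>fr b e - fr b0 e\<bar> \<le> rerr c e"
proof -
  note fin = err_finite[OF assms(1,2)]
  have s: "idl (B e + b)" "idl (B e + b0)" using b by (auto intro: idl_plus idl_br)
  have le: "B e + b \<subseteq> B e + b0" by (intro plus_mono b order.refl)
  have 1: "F b e = len (B e + b) (B e + b0) + F b0 e"
    unfolding F_def by (rule len_add[OF s sub_UNIV le subset_UNIV])
  have 2: "len (B e + b) (B e + b0) \<le> err c e"
  proof (rule torsion_le_err[OF s le plus_left_subset[OF b(1)]])
    show "(*) c ` (B e + b0) \<subseteq> B e + b"
    proof
      fix y assume "y \<in> (*) c ` (B e + b0)"
      then obtain u v where "y = c * (u + v)" "u \<in> B e" "v \<in> b0" by (auto elim!: set_plus_elim)
      then have "y = c * u + c * v" "c * u \<in> B e" "c * v \<in> b" using idl_mult[OF idl_br] b(4) by (auto simp: distrib_left)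
      then show "y \<in> B e + b" using set_plus_intro by blast
    qed
    show "len (B e + b) UNIV \<noteq> \<infinity>" using F_finite[OF b(1)] by (simp add: F_def)
  qed
  have "rlen (F b e) = rlen (len (B e + b) (B e + b0)) + rlen (F b0 e)"
    unfolding 1 by (rule rlen_add[OF enat_finite_mono[OF 2 fin] F_finite[OF b(2)]])
  moreover have "rlen (len (B e + b) (B e + b0)) \<le> rlen (err c e)" by (rule rlen_mono[OF 2 fin])
  ultimately have "\<bar>rlen (F b e) - rlen (F b0 e)\<bar> \<le> rlen (err c e)" using rlen_nonneg by simp
  then show ?thesis
    unfolding fr_def rerr_def using N_pos[of e] by (simp add: divide_right_mono flip: diff_divide_distrib)
qed

text \<open>Let \<open>U\<close>, \<open>V\<close>, \<open>W\<close> be \<open>b\<close>,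
  \<open>b1\<close>, \<open>b2\<close> enlarged by \<open>B e\<close>. The quotients by
  \<open>V\<close> and \<open>W\<close> together have the length of the quotient by their
  intersection plus that of the quotient by \<open>V + W\<close>. Since \<open>c\<close> kills
  \<open>V \<inter> W\<close> modulo \<open>U\<close> and lies in \<open>V + W\<close>, both
  deviations are bounded by the error of \<open>c\<close>.\<close>

lemma fr_split:
  assumes c: "c \<in> A" "c \<notin> Z" "c \<in> b1 + b2"
    and b: "idl b" "idl b1" "idl b2" "b \<subseteq> b1" "b \<subseteq> b2" "\<And>x y. x \<in> b1 \<Longrightarrow> y \<in> b2 \<Longrightarrow> x * y \<in> b"
  shows "\<bar>fr b e - (fr b1 e + fr b2 e)\<bar> \<le> rerr c e"
proof -
  note fin = err_finite[OF c(1,2)]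
  let ?U = "B e + b" and ?V = "B e + b1" and ?W = "B e + b2"
  let ?N = "?V \<inter> ?W"
  have i: "idl ?U" "idl ?V" "idl ?W" using b(1-3) by (auto intro: idl_plus idl_br)
  have UN: "?U \<subseteq> ?V" "?U \<subseteq> ?W" by (rule plus_mono[OF order.refl b(4)], rule plus_mono[OF order.refl b(5)])
  have VN: "{v \<in> ?V. 1 * v \<in> ?W} = ?N" by auto
  have N: "idl ?N" using i by (intro sub_Int)
  have WV: "idl (?W + ?V)" "?W \<subseteq> ?W + ?V" by (rule idl_plus[OF i(3,2)], rule plus_left_subset[OF i(2)])
  have f: "len ?U UNIV \<noteq> \<infinity>" "len ?V UNIV \<noteq> \<infinity>" "len ?W UNIV \<noteq> \<infinity>"
    using F_finite[OF b(1)] F_finite[OF b(2)] F_finite[OF b(3)] by (auto simp: F_def)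
  have 1: "len ?U UNIV = len ?U ?N + len ?N UNIV"
    by (rule len_add[OF i(1) N sub_UNIV]) (use UN in auto)
  have 2: "len ?N UNIV = len ?N ?V + len ?V UNIV"
    by (rule len_add[OF N i(2) sub_UNIV]) auto
  have 3: "len ?W UNIV = len ?W (?W + ?V) + len (?W + ?V) UNIV"
    by (rule len_add[OF i(3) WV(1) sub_UNIV WV(2) subset_UNIV])
  have "len {v \<in> ?V. 1 * v \<in> ?W} ?V \<le> len ?W (?W + (*) 1 ` ?V)"
    by (rule slen_preimage[OF srng_UNIV i(3,2)])
  then have "len ?N ?V \<le> len ?W (?W + ?V)" unfolding VN by simp
  moreover have "len ?W (?W + ?V) \<le> len ?N ?V"
    by (rule len_plus[OF N i(2,3)]) simp_all
  ultimately have 4: "len ?W (?W + ?V) = len ?N ?V" by (rule order.antisym[rotated])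
  have 5: "len ?U ?N \<le> err c e"
  proof (rule torsion_le_err[OF i(1) N _ plus_left_subset[OF b(1)] _ f(1)])
    show "?U \<subseteq> ?N" using UN by blast
    obtain c1 c2 where cc: "c = c1 + c2" "c1 \<in> b1" "c2 \<in> b2" using c(3) by (auto elim: set_plus_elim)
    show "(*) c ` ?N \<subseteq> ?U"
    proof
      fix y assume "y \<in> (*) c ` ?N"
      then obtain n where n: "y = c * n" "n \<in> ?V" "n \<in> ?W" by blast
      obtain u v where uv: "n = u + v" "u \<in> B e" "v \<in> b1" using n(2) by (auto elim: set_plus_elim)
      obtain u' v' where uv': "n = u' + v'" "u' \<in> B e" "v' \<in> b2" using n(3) by (auto elim: set_plus_elim)
      \<comment> \<open>The part of \<open>c\<close> in \<open>b1\<close> multiplies the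
        decomposition of \<open>n\<close> that involves \<open>b2\<close>, and vice versa, so that
        the cross terms lie in \<open>b\<close>.\<close>
      have "y = c1 * (u' + v') + c2 * (u + v)" using n cc uv uv' by (simp add: distrib_right)
      then have "y = (c1 * u' + c2 * u) + (c1 * v' + v * c2)" by (simp add: algebra_simps)
      moreover have "c1 * u' + c2 * u \<in> B e" using uv uv' by (intro sub_add[OF idl_br] idl_mult[OF idl_br])
      moreover have "c1 * v' + v * c2 \<in> b" using uv uv' cc by (intro sub_add[OF b(1)] b(6))
      ultimately show "y \<in> ?U" using set_plus_intro[of "c1 * u' + c2 * u" "B e" "c1 * v' + v * c2" b] by simp
    qed
  qed
  have 6: "len (?W + ?V) UNIV \<le> err c e"
  proof -
    have "len (?W + ?V) UNIV \<le> F (b1 + b2) e"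
      unfolding F_def
    proof (rule slen_mono)
      have "b1 \<subseteq> ?W + ?V" using plus_right_subset[OF idl_br] plus_right_subset[OF i(3)] by blast
      moreover have "b2 \<subseteq> ?W + ?V" "B e \<subseteq> ?W + ?V"
        using plus_right_subset[OF idl_br, of b2] plus_left_subset[OF b(3), of "B e"] WV(2) by blast+
      ultimately show "B e + (b1 + b2) \<subseteq> ?W + ?V" by (intro plus_least[OF WV(1)])
    qed auto
    also have "\<dots> \<le> err c e" by (rule F_le_err[OF c(3) idl_plus[OF b(2,3)]])
    finally show ?thesis .
  qed
  have g: "len ?N ?V \<noteq> \<infinity>" "len ?N UNIV \<noteq> \<infinity>" "len ?U ?N \<noteq> \<infinity>" "len (?W + ?V) UNIV \<noteq> \<infinity>"
    using enat_add_finiteD[of "len ?U ?N"] enat_add_finiteD[of "len ?N ?V"] 1 2 f(1) enat_finite_mono[OF 6 fin]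
    by metis+
  have "rlen (len ?U UNIV) = rlen (len ?U ?N) + (rlen (len ?N ?V) + rlen (len ?V UNIV))"
    using 1 2 g f by (simp add: rlen_add)
  moreover have "rlen (len ?W UNIV) = rlen (len ?N ?V) + rlen (len (?W + ?V) UNIV)"
    using 3 4 g by (simp add: rlen_add)
  moreover have "rlen (len ?U ?N) \<le> rlen (err c e)" "rlen (len (?W + ?V) UNIV) \<le> rlen (err c e)"
    by (rule rlen_mono[OF 5 fin], rule rlen_mono[OF 6 fin])
  ultimately have "\<bar>rlen (F b e) - (rlen (F b1 e) + rlen (F b2 e))\<bar> \<le> rlen (err c e)"
    unfolding F_def using rlen_nonneg[of "len ?U ?N"] rlen_nonneg[of "len (?W + ?V) UNIV"] by simp
  then have "\<bar>(rlen (F b e) - (rlen (F b1 e) + rlen (F b2 e))) / real (p ^ e) ^ d\<bar> \<le> rlen (err c e) / real (p ^ e) ^ d"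
    using N_pos[of e] by (simp add: divide_right_mono)
  then show ?thesis unfolding fr_def rerr_def by (simp add: add_divide_distrib diff_divide_distrib)
qed

end

lemma Span_mono: "S \<subseteq> S' \<Longrightarrow> Span S gs \<subseteq> Span S' gs"
proof (induction gs)
  case (Cons g gs)
  then have "Span S gs \<subseteq> Span S' gs" by blast
  then show ?case using Cons.prems by fastforce
qed simp

section \<open>Convergence over a domain: from prime to radical ideals\<close>

locale hk_dom = hk_alg Z A m gs as p I s + fin_dom Z A m gs as p
  for Z A m :: "'v::comm_ring_1 set" and gs as p I s
begin

context
  fixes P
  assumes P: "idl P" "sat P" and prime: "\<And>x y. x * y \<in> P \<Longrightarrow> x \<in> P \<or> y \<in> P" and one: "1 \<notin> P"
begin

lemma ZP: "Z \<subseteq> P" using P(2) by (simp add: sat_def)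

text \<open>The ranks over \<open>A\<close> of the decreasing subrings modulo \<open>P\<close> stall
  at some \<open>e0\<close>. Then \<open>Fr e0\<close> and \<open>Fr (Suc e0)\<close> have the same
  fraction field modulo \<open>P\<close>, and one denominator \<open>c\<close> serves the finitely
  many generators.\<close>

lemma Frobenius_stable:
  "\<exists>e0 c. c \<in> A \<and> c \<notin> Z \<and> (\<forall>x\<in>Fr e0. c * x \<in> Fr (Suc e0) + P)"
proof -
  let ?W = "\<lambda>e. cl (Fr e + P)"
  have V: "sub A (Fr e + P)" "Z \<subseteq> Fr e + P" for e
    using sub_plus[OF sub_Fr(1) idl_sub[OF P(1)]] sub_Fr(2) plus_left_subset[OF P(1)] by blast+
  have W: "sat (?W e)" for e by (rule sat_cl[OF V])
  obtain e0 where e0: "rk gs (?W e0) \<le> rk gs (?W (Suc e0))"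
    using decreasing_nat_stalls[of "\<lambda>e. rk gs (?W e)"] by blast
  have "Fr (Suc e0) + P \<subseteq> Fr e0 + P" by (rule plus_mono[OF Fr_decreasing order.refl])
  then have "?W (Suc e0) \<subseteq> ?W e0" by (auto simp: cl_def)
  then have eq: "?W (Suc e0) = ?W e0" using rk_eq_imp_eq[OF W W _ e0] by blast
  have "\<exists>c\<in>A. c \<notin> Z \<and> c * g \<in> Fr (Suc e0) + P" if "g \<in> set (map (\<lambda>g. g ^ (p ^ e0)) gs)" for g
  proof -
    have "g \<in> Fr e0 + P" using that Fr_power plus_left_subset[OF P(1)] by auto
    then have "g \<in> ?W (Suc e0)" unfolding eq using sub_cl(2)[OF V(1)] by blast
    then show ?thesis by (simp add: cl_def)
  qed
  then have "\<exists>c\<in>A. c \<notin> Z \<and> (\<forall>g\<in>set (map (\<lambda>g. g ^ (p ^ e0)) gs). c * g \<in> Fr (Suc e0) + P)"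
    by (intro common_multiple[OF A V(1) dom one_notin_Z])
  then obtain c where c: "c \<in> A" "c \<notin> Z" "\<forall>g\<in>set (map (\<lambda>g. g ^ (p ^ e0)) gs). c * g \<in> Fr (Suc e0) + P"
    by blast
  have "Fr e0 \<subseteq> {x. c * x \<in> Fr (Suc e0) + P}"
  proof (rule Fr_least)
    show "sub A {x. c * x \<in> Fr (Suc e0) + P}"
      by (rule subI) (use V(1)[of "Suc e0"] in \<open>auto simp: sub_zero sub_add distrib_left sub_smult mult.left_commute[of c]\<close>)
    show "Z \<subseteq> {x. c * x \<in> Fr (Suc e0) + P}" using V(2) idl_mult[OF Z] by blast
  qed (use c in auto)
  then have "\<forall>x\<in>Fr e0. c * x \<in> Fr (Suc e0) + P" by blast
  then show ?thesis using c(1,2) by (intro exI[of _ e0] exI[of _ c] conjI)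
qed

lemma generic_basis:
  assumes "srng C" "A \<subseteq> C"
  shows "\<exists>ws c. indep C P ws \<and> c \<in> A \<and> c \<notin> Z \<and> (\<forall>x. c * x \<in> Span C ws + P)"
proof -
  obtain ws c where ws: "indep C P ws" "c \<in> C" "c \<notin> P" "\<And>x. x \<in> Span C gs \<Longrightarrow> c * x \<in> Span C ws + P"
    by (rule max_indep[OF assms(1) P(1), of gs]) (use prime one in auto)
  have sW: "sub C (Span C ws + P)" by (rule sub_plus[OF sub_Span[OF assms(1)] idl_sub[OF P(1)]])
  have PW: "P \<subseteq> Span C ws + P" by (rule plus_right_subset[OF sub_Span[OF assms(1)]])
  have all: "c * x \<in> Span C ws + P" for x
  proof -
    obtain u z where x: "x = u + z" "u \<in> Span A gs" "z \<in> Z" using span[of x] by (auto elim: set_plus_elim)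
    then have "c * u \<in> Span C ws + P" using ws(4) Span_mono[OF assms(2)] by blast
    moreover have "c * z \<in> Span C ws + P" using x idl_mult[OF Z] ZP PW by blast
    ultimately show ?thesis using sub_add[OF sW] x by (simp add: distrib_left)
  qed
  have inj: "\<And>y. c * y \<in> P \<Longrightarrow> y \<in> P" using prime ws(3) by blast
  \<comment> \<open>So far the denominator \<open>c\<close> lies only in \<open>C\<close>.
    Multiplication by it is injective modulo \<open>P\<close>, so its torsion cokernel supplies a
    denominator in \<open>A\<close>.\<close>
  obtain c2 where c2: "c2 \<in> A" "c2 \<notin> Z" "c2 \<in> P + (*) c ` UNIV"
    by (rule torsion_cokernel[OF P inj]) 
  then obtain \<pi> t where t: "c2 = \<pi> + c * t" "\<pi> \<in> P" by (auto elim!: set_plus_elim)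
  have "c2 * x \<in> Span C ws + P" for x
  proof -
    have "\<pi> * x \<in> Span C ws + P" using idl_mult'[OF P(1) t(2)] PW by blast
    then show ?thesis using sub_add[OF sW _ all[of "t * x"]] t by (simp add: distrib_right mult.assoc)
  qed
  then show ?thesis using ws(1) c2(1,2) by (intro exI[of _ ws] exI[of _ c2] conjI allI)
qed

text \<open>For \<open>e \<ge> e0\<close> the power \<open>x^(p^e)\<close> is a scalar in
  \<open>Fr e0\<close>, so the semilinear map sends \<open>x^(p^e) r\<close> to
  \<open>x^(p^(e+1))\<close> times the image of \<open>r\<close>, modulo \<open>P\<close>. Hence it
  carries \<open>B e\<close> into \<open>B (Suc e) + P\<close>; the part of the ring that its image
  misses is absorbed by the error term.\<close>

lemma recurrence:
  "\<exists>e0 c. c \<in> A \<and> c \<notin> Z \<and> (\<forall>e\<ge>e0. F P (Suc e) \<le> of_nat (p ^ d) * F P e + err c (Suc e))"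
proof -
  obtain e0 c1 where c1: "c1 \<in> A" "c1 \<notin> Z" "\<forall>x\<in>Fr e0. c1 * x \<in> Fr (Suc e0) + P"
    using Frobenius_stable by blast
  let ?C = "Fr e0"
  note C = srng_Fr[of e0]
  obtain ws c2 where ws: "indep ?C P ws" "c2 \<in> A" "c2 \<notin> Z" "\<forall>x. c2 * x \<in> Span ?C ws + P"
    using generic_basis[OF C A_Fr] by blast
  \<comment> \<open>Only \<open>c2 u\<close> is known to lie in the span of the basis modulo
    \<open>P\<close>, so the value at \<open>u\<close> is read from the graph at
    \<open>c2 u\<close>. It is determined modulo \<open>P\<close>.\<close>
  define T where "T u y \<longleftrightarrow> (\<exists>w. (w, y) \<in> power_graph ?C p ws \<and> w - c2 * u \<in> P)" for u y
  define \<theta> where "\<theta> u = (SOME y. T u y)" for u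
  have "\<exists>y. T u y" for u
  proof -
    obtain w \<pi> where w: "c2 * u = w + \<pi>" "w \<in> Span ?C ws" "\<pi> \<in> P" using spec[OF ws(4), of u] by (auto elim: set_plus_elim)
    then have "w - c2 * u \<in> P" using idl_uminus[OF P(1)] by simp
    then show ?thesis unfolding T_def using power_graph_total[OF w(2)] by blast
  qed
  then have T: "T u (\<theta> u)" for u unfolding \<theta>_def by (rule someI_ex)
  have uniq: "y - y' \<in> P" if Tu: "T u y" "T u y'" for u y y'
  proof -
    obtain w w' where w: "(w, y) \<in> power_graph ?C p ws" "w - c2 * u \<in> P" "(w', y') \<in> power_graph ?C p ws" "w' - c2 * u \<in> P"
      using Tu by (auto simp: T_def)
    have "w - w' \<in> P" using idl_diff[OF P(1) w(2,4)] by simp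
    then show ?thesis using power_graph_unique[OF C Z p pZ P(1) ZP ws(1) w(1,3)] by blast
  qed
  have add: "\<theta> (u + v) - (\<theta> u + \<theta> v) \<in> P" for u v
  proof -
    obtain w w' where w: "(w, \<theta> u) \<in> power_graph ?C p ws" "w - c2 * u \<in> P" "(w', \<theta> v) \<in> power_graph ?C p ws" "w' - c2 * v \<in> P"
      using T[of u] T[of v] by (auto simp: T_def)
    obtain y where y: "(w + w', y) \<in> power_graph ?C p ws" "y - (\<theta> u + \<theta> v) \<in> Z"
      using power_graph_add[OF C Z p pZ w(1,3)] by blast
    have "w + w' - c2 * (u + v) \<in> P" using sub_add[OF P(1) w(2,4)] by (simp add: algebra_simps)
    then have "T (u + v) y" using y by (auto simp: T_def)
    then have "\<theta> (u + v) - y \<in> P" using uniq T by blast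
    then show ?thesis by (rule idl_trans[OF P(1)]) (use y ZP in blast)
  qed
  have smult: "\<theta> (a * u) - a ^ p * \<theta> u \<in> P" if "a \<in> ?C" for a u
  proof -
    obtain w where w: "(w, \<theta> u) \<in> power_graph ?C p ws" "w - c2 * u \<in> P" using T[of u] by (auto simp: T_def)
    have "(a * w, a ^ p * \<theta> u) \<in> power_graph ?C p ws" by (rule power_graph_smult[OF C that w(1)])
    moreover have "a * w - c2 * (a * u) \<in> P" using idl_mult[OF P(1) w(2), of a] by (simp add: algebra_simps)
    ultimately have "T (a * u) (a ^ p * \<theta> u)" by (auto simp: T_def)
    then show ?thesis using uniq T by blast
  qed
  have \<theta>P: "\<theta> u \<in> P" if "u \<in> P" for u
  proof -
    have 0: "(0, 0) \<in> power_graph ?C p us" for us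
    proof (induction us)
      case (Cons v us)
      show ?case using power_graph_ConsI[OF srngD(3)[OF C] Cons.IH, of v] p_pos by (simp add: zero_power)
    qed simp
    have "0 - c2 * u \<in> P" using that by (intro idl_diff[OF P(1)] idl_mult[OF P(1)] sub_zero[OF P(1)])
    then have "T u 0" unfolding T_def using 0[of ws] by blast
    then show ?thesis using uniq[OF T] by fastforce
  qed
  let ?\<Theta> = "\<lambda>U. gen A (\<theta> ` U \<union> P)"
  have \<Theta>: "sub A (?\<Theta> U)" "P \<subseteq> ?\<Theta> U" for U by (auto simp: sub_gen intro: gen_inc)
  \<comment> \<open>The factor \<open>c2\<close> brings an element into the span of the basis,
    \<open>c1\<close> brings its coefficients from \<open>Fr e0\<close> into
    \<open>Fr (Suc e0)\<close>, and \<open>c2 ^ p\<close> is what the map makes of the factor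
    \<open>c2\<close> built into it.\<close>
  define c3 where "c3 = c2 ^ p * c1 * c2"
  have c3: "c3 \<in> A" "c3 \<notin> Z"
  proof -
    have pw: "c2 ^ n \<in> A \<and> c2 ^ n \<notin> Z" for n
    proof (induction n)
      case (Suc n)
      then show ?case using dom[of c2 "c2 ^ n"] ws srngD(5)[OF A] by auto
    qed (use one_notin_Z srngD(1)[OF A] in auto)
    have "c2 ^ p * c1 \<in> A" "c2 ^ p * c1 \<notin> Z" using pw[of p] c1 dom srngD(5)[OF A] by blast+
    then show "c3 \<in> A" "c3 \<notin> Z" unfolding c3_def using ws dom srngD(5)[OF A] by blast+
  qed
  have c3U: "c3 * u \<in> ?\<Theta> UNIV" for u
  proof -
    have 1: "c2 ^ p * f * w \<in> ?\<Theta> UNIV" if w: "w \<in> set ws" and f: "f \<in> Fr (Suc e0)" for w f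
    proof -
      have "Fr (Suc e0) \<subseteq> {f. c2 ^ p * f * w \<in> ?\<Theta> UNIV}"
      proof (rule Fr_least)
        show "sub A {f. c2 ^ p * f * w \<in> ?\<Theta> UNIV}"
          by (rule subI) (use \<Theta>(1)[of UNIV] in
            \<open>auto simp: sub_zero sub_add distrib_left distrib_right sub_smult mult.left_commute[of "c2 ^ p"] mult.assoc\<close>)
        show "Z \<subseteq> {f. c2 ^ p * f * w \<in> ?\<Theta> UNIV}"
        proof
          fix z assume "z \<in> Z"
          then have "c2 ^ p * z * w \<in> P" using ZP by (intro idl_mult'[OF P(1)] idl_mult[OF P(1)]) auto
          then show "z \<in> {f. c2 ^ p * f * w \<in> ?\<Theta> UNIV}" using subsetD[OF \<Theta>(2)] by simp
        qed
        fix g assume "g \<in> set gs"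
        let ?e = "c2 * g ^ (p ^ e0)"
        have "?e \<in> ?C" using srngD(5)[OF C _ Fr_power] ws(2) A_Fr by blast
        then have "(?e * w, ?e ^ p * w) \<in> power_graph ?C p ws" using power_graph_mem[OF C _ w p_pos] by blast
        moreover have "?e * w - c2 * (g ^ (p ^ e0) * w) \<in> P" using sub_zero[OF P(1)] by (simp add: mult.assoc)
        ultimately have "T (g ^ (p ^ e0) * w) (?e ^ p * w)" by (auto simp: T_def)
        then have "?e ^ p * w - \<theta> (g ^ (p ^ e0) * w) \<in> ?\<Theta> UNIV" by (intro subsetD[OF \<Theta>(2)] uniq[OF _ T])
        then have "(?e ^ p * w - \<theta> (g ^ (p ^ e0) * w)) + \<theta> (g ^ (p ^ e0) * w) \<in> ?\<Theta> UNIV"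
          by (rule sub_add[OF \<Theta>(1)]) (auto intro: gen_inc)
        then have "?e ^ p * w \<in> ?\<Theta> UNIV" by simp
        moreover have "?e ^ p = c2 ^ p * g ^ (p ^ Suc e0)"
          by (simp add: power_mult_distrib power_mult[symmetric] mult.commute)
        ultimately show "g ^ (p ^ Suc e0) \<in> {f. c2 ^ p * f * w \<in> ?\<Theta> UNIV}" by simp
      qed
      then show ?thesis using f by blast
    qed
    have 2: "c2 ^ p * c1 * v \<in> ?\<Theta> UNIV" if "v \<in> Span ?C vs" "set vs \<subseteq> set ws" for v vs
      using that
    proof (induction vs arbitrary: v)
      case (Cons w vs)
      then obtain e v' where v: "v = e * w + v'" "e \<in> ?C" "v' \<in> Span ?C vs" by auto
      obtain f \<pi> where f: "c1 * e = f + \<pi>" "f \<in> Fr (Suc e0)" "\<pi> \<in> P" using bspec[OF c1(3) v(2)] by (auto elim: set_plus_elim)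
      have "c2 ^ p * f * w \<in> ?\<Theta> UNIV" using 1[OF _ f(2)] Cons.prems by auto
      moreover have "c2 ^ p * \<pi> * w \<in> ?\<Theta> UNIV"
        by (intro subsetD[OF \<Theta>(2)] idl_mult'[OF P(1)] idl_mult[OF P(1)] f(3))
      moreover have "c2 ^ p * c1 * v' \<in> ?\<Theta> UNIV" using Cons v by auto
      ultimately have "c2 ^ p * f * w + c2 ^ p * \<pi> * w + c2 ^ p * c1 * v' \<in> ?\<Theta> UNIV" by (intro sub_add[OF \<Theta>(1)])
      moreover have "c2 ^ p * f * w + c2 ^ p * \<pi> * w + c2 ^ p * c1 * v' = c2 ^ p * (f + \<pi>) * w + c2 ^ p * c1 * v'"
        by (simp add: algebra_simps)
      moreover have "\<dots> = c2 ^ p * c1 * v" unfolding f(1)[symmetric] v(1) by (simp add: algebra_simps)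
      ultimately show ?case by simp
    qed (use sub_zero[OF \<Theta>(1)] in simp)
    obtain v \<pi> where v: "c2 * u = v + \<pi>" "v \<in> Span ?C ws" "\<pi> \<in> P" using spec[OF ws(4), of u] by (auto elim: set_plus_elim)
    have "c2 ^ p * c1 * \<pi> \<in> ?\<Theta> UNIV" by (intro subsetD[OF \<Theta>(2)] idl_mult[OF P(1)] v(3))
    with 2[OF v(2)] have "c2 ^ p * c1 * v + c2 ^ p * c1 * \<pi> \<in> ?\<Theta> UNIV" by (intro sub_add[OF \<Theta>(1)]) auto
    then show ?thesis unfolding c3_def using v(1) by (simp add: distrib_left[symmetric] mult.assoc)
  qed
  have "F P (Suc e) \<le> of_nat (p ^ d) * F P e + err c3 (Suc e)" if e: "e \<ge> e0" for e
  proof -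
    let ?Ve = "B e + P" and ?V = "B (Suc e) + P"
    have V: "idl ?Ve" "idl ?V" by (intro idl_plus idl_br P)+
    have PV: "P \<subseteq> ?Ve" "P \<subseteq> ?V" by (rule plus_right_subset[OF idl_br])+
    have closed: "\<theta> (x + y) \<in> ?V" if "\<theta> x \<in> ?V" "\<theta> y \<in> ?V" for x y
    proof -
      have "(\<theta> (x + y) - (\<theta> x + \<theta> y)) + (\<theta> x + \<theta> y) \<in> ?V"
        by (intro sub_add[OF V(2)] subsetD[OF PV(2) add] that)
      then show ?thesis by simp
    qed
    have "B e \<subseteq> {u. \<theta> u \<in> ?V}"
      unfolding br_def[of Z I "p ^ e"]
    proof (rule gen_UNIV_least)
      show "0 \<in> {u. \<theta> u \<in> ?V}" using \<theta>P[OF sub_zero[OF P(1)]] PV by blast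
      fix r y assume "y \<in> (\<lambda>x. x ^ p ^ e) ` I \<union> Z"
      then consider x where "x \<in> I" "y = x ^ (p ^ e)" | "y \<in> Z" by blast
      then have "\<theta> (r * y) \<in> ?V"
      proof cases
        case 1
        have "y \<in> ?C" using Fr_power[of x e] Fr_antimono[OF e] 1 by blast
        then have "\<theta> (y * r) - y ^ p * \<theta> r \<in> ?V" using smult PV by blast
        moreover have "y ^ p \<in> B (Suc e)"
          using br_superset(2)[OF 1(1), of "p ^ Suc e" Z] 1(2) by (simp add: power_mult[symmetric] mult.commute)
        then have "y ^ p * \<theta> r \<in> ?V" using idl_mult'[OF idl_br] plus_left_subset[OF P(1)] by blast
        ultimately have "(\<theta> (y * r) - y ^ p * \<theta> r) + y ^ p * \<theta> r \<in> ?V" by (rule sub_add[OF V(2)])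
        then show ?thesis by (simp add: mult.commute)
      next
        case 2
        then have "r * y \<in> P" using idl_mult[OF P(1)] ZP by blast
        then show ?thesis using \<theta>P PV by blast
      qed
      then show "r * y \<in> {u. \<theta> u \<in> ?V}" by simp
    qed (use closed in auto)
    then have BV: "\<theta> u \<in> ?V" if "u \<in> B e" for u using that by blast
    have "\<theta> u \<in> ?V" if u: "u \<in> ?Ve" for u
    proof -
      obtain x y where xy: "u = x + y" "x \<in> B e" "y \<in> P" using u by (rule set_plus_elim)
      show ?thesis unfolding xy(1) by (rule closed[OF BV[OF xy(2)] subsetD[OF PV(2) \<theta>P[OF xy(3)]]])
    qed
    then have \<Theta>V: "?\<Theta> ?Ve \<subseteq> ?V" using PV(2) by (intro gen_minimal[OF _ idl_sub[OF V(2)]]) auto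
    have fin0: "len ?Ve UNIV \<noteq> \<infinity>" using F_finite[OF P(1)] by (simp add: F_def)
    have sA: "sub A (?V + ?\<Theta> UNIV)" "?V \<subseteq> ?V + ?\<Theta> UNIV"
      using sub_plus[OF idl_sub[OF V(2)] \<Theta>(1)] plus_left_subset[OF \<Theta>(1)] by blast+
    \<comment> \<open>The image of the semilinear map spans only an \<open>A\<close>-submodule, so
      the count passes to lengths over \<open>A\<close>; for the cokernel it returns to the ring by
      \<open>slen_A_le\<close>.\<close>
    have "F P (Suc e) \<le> slen A ?V UNIV" unfolding F_def by (rule slen_mono) auto
    also have "\<dots> = slen A ?V (?V + ?\<Theta> UNIV) + slen A (?V + ?\<Theta> UNIV) UNIV"
      by (rule slen_add[OF A idl_sub[OF V(2)] sA(1) sub_UNIV sA(2) subset_UNIV])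
    also have "slen A ?V (?V + ?\<Theta> UNIV) \<le> slen A (?\<Theta> ?Ve) (?\<Theta> UNIV)"
      by (rule slen_plus[OF A \<Theta>(1) \<Theta>(1) idl_sub[OF V(2)] _ \<Theta>V]) (intro gen_mono Un_mono image_mono; simp)
    also have "\<dots> \<le> of_nat (p ^ d) * len ?Ve UNIV"
      by (rule semilinear_slen[OF P(1) ZP add smult V(1) PV(1) fin0]) (use A_Fr in blast)
    also have "slen A (?V + ?\<Theta> UNIV) UNIV \<le> slen A (B (Suc e) + (Z + (*) c3 ` UNIV)) UNIV"
    proof (rule slen_mono)
      have "Z + (*) c3 ` UNIV \<subseteq> ?\<Theta> UNIV"
        by (rule plus_least[OF \<Theta>(1)]) (use \<Theta>(2) ZP c3U in blast)+
      then show "B (Suc e) + (Z + (*) c3 ` UNIV) \<subseteq> ?V + ?\<Theta> UNIV"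
        by (intro plus_mono plus_left_subset[OF P(1)])
    qed auto
    also have "\<dots> \<le> len (B (Suc e) + (Z + (*) c3 ` UNIV)) UNIV"
      by (rule slen_A_le) (use idl_plus[OF idl_br idl_principal] br_superset(1) plus_left_subset[OF idl_principal] in blast)+
    also have "\<dots> = F (Z + (*) c3 ` UNIV) (Suc e)" by (simp add: F_def)
    also have "\<dots> \<le> err c3 (Suc e)"
    proof (rule F_le_err[OF _ idl_principal])
      show "c3 \<in> Z + (*) c3 ` UNIV" using set_plus_intro[OF Z0 rangeI[of "(*) c3" 1]] by simp
    qed
    finally show ?thesis by (simp add: F_def add_mono)
  qed
  then show ?thesis using c3 by (intro exI[of _ e0] exI[of _ c3] conjI allI impI)
qed

lemma convergent_prime: "convergent (fr P)"
proof -
  obtain e0 c where c: "c \<in> A" "c \<notin> Z" and rec: "\<forall>e\<ge>e0. F P (Suc e) \<le> of_nat (p ^ d) * F P e + err c (Suc e)"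
    using recurrence by blast
  obtain K where K: "K \<ge> 0" "\<And>e. err c e \<noteq> \<infinity>" "\<And>e. rerr c e \<le> K / real p ^ e"
    by (rule err_bound[OF c]) (rule that; blast)
  show ?thesis
  proof (rule convergent_if_almost_decreasing[of _ p e0 K])
    show "fr P e \<ge> 0" for e by (simp add: fr_def rlen_nonneg)
    show p2: "p \<ge> 2" using p prime_ge_2_nat by blast
    fix e assume e: "e0 \<le> e"
    have fin: "F P e \<noteq> \<infinity>" "of_nat (p ^ d) * F P e \<noteq> \<infinity>"
      using F_finite[OF P(1)] of_nat_mult_finite by blast+
    have "rlen (F P (Suc e)) \<le> rlen (of_nat (p ^ d) * F P e + err c (Suc e))"
      using rec e fin(2) K(2)[of "Suc e"] by (intro rlen_mono) (simp_all only: plus_eq_infty_iff_enat, simp_all)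
    also have "\<dots> = real (p ^ d) * rlen (F P e) + rlen (err c (Suc e))"
      by (simp only: rlen_add[OF fin(2) K(2)] rlen_mult[OF fin(1)])
    finally have "fr P (Suc e) \<le> (real (p ^ d) * rlen (F P e) + rlen (err c (Suc e))) / real (p ^ Suc e) ^ d"
      unfolding fr_def using N_pos[of "Suc e"] by (intro divide_right_mono) auto
    also have "\<dots> = fr P e + rerr c (Suc e)"
      unfolding fr_def rerr_def using p_pos by (simp add: add_divide_distrib power_mult_distrib)
    also have "rerr c (Suc e) \<le> K / real p ^ Suc e" by (rule K(3))
    also have "K / real p ^ Suc e \<le> K / real p ^ e"
      using K(1) p2 by (intro divide_left_mono) (auto intro!: mult_pos_pos)
    finally show "fr P (Suc e) \<le> fr P e + K / real p ^ e" by simp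
  qed
qed

end

text \<open>Induction on the corank takes the place of a decomposition into primes. If
  \<open>x y\<close> shows that \<open>b\<close> is not prime, then \<open>b1 = b : x\<close> and
  \<open>b2 = b : b1\<close> are strictly larger, radical and saturated, with
  \<open>b1 b2 \<subseteq> b\<close>. As \<open>x\<close> is a nonzerodivisor modulo
  \<open>b1\<close> and lies in \<open>b2\<close>, some element of \<open>A\<close> outside
  \<open>Z\<close> lies in \<open>b1 + b2\<close>, and the normalized lengths add up by
  \<open>fr_split\<close>.\<close>

lemma convergent_radical:
  assumes "idl b" "sat b" "\<And>x. x * x \<in> b \<Longrightarrow> x \<in> b"
  shows "convergent (fr b)"
  using assms
proof (induction "length gs - rk gs b" arbitrary: b rule: less_induct)
  case less
  have Zb: "Z \<subseteq> b" using less.prems(2) by (simp add: sat_def)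
  show ?case
  proof (cases "1 \<in> b")
    case True
    then show ?thesis
      using fr_small[OF srngD(1)[OF A] one_notin_Z True less.prems(1)] convergentI by blast
  next
    case one: False
    show ?thesis
    proof (cases "\<forall>x y. x * y \<in> b \<longrightarrow> x \<in> b \<or> y \<in> b")
      case True
      then show ?thesis using convergent_prime[OF less.prems(1,2) _ one] by blast
    next
      case False
      then obtain x y where xy: "x * y \<in> b" "x \<notin> b" "y \<notin> b" by blast
      define b1 where "b1 = colon b x"
      define b2 where "b2 = {z. \<forall>w\<in>b1. z * w \<in> b}"
      have i1: "idl b1" unfolding b1_def by (rule idl_colon[OF less.prems(1)])
      have i2: "idl b2" unfolding b2_def
        by (rule subI) (use less.prems(1) in \<open>auto simp: sub_zero sub_add idl_mult distrib_right mult.assoc\<close>)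
      have le: "b \<subseteq> b1" "b \<subseteq> b2" using less.prems(1) by (auto simp: b1_def b2_def colon_def idl_mult idl_mult')
      have s1: "sat b1" unfolding sat_def
      proof (intro conjI ballI allI impI)
        fix c u assume c: "c \<in> A" "c \<notin> Z" "c * u \<in> b1"
        then have "c * (x * u) \<in> b" by (simp add: b1_def colon_def mult.left_commute)
        then show "u \<in> b1" using satD[OF less.prems(2) c(1,2)] by (simp add: b1_def colon_def)
      qed (use i1 le Zb idl_sub in auto)
      have s2: "sat b2" unfolding sat_def
      proof (intro conjI ballI allI impI)
        fix c u assume c: "c \<in> A" "c \<notin> Z" "c * u \<in> b2"
        then have "c * (u * w) \<in> b" if "w \<in> b1" for w using that by (simp add: b2_def mult.assoc)
        then show "u \<in> b2" using satD[OF less.prems(2) c(1,2)] by (simp add: b2_def)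
      qed (use i2 le Zb idl_sub in auto)
      have r1: "u \<in> b1" if "u * u \<in> b1" for u
      proof -
        have "(x * u) * (x * u) = x * (x * (u * u))" by (simp add: ac_simps)
        moreover have "x * (x * (u * u)) \<in> b" using that idl_mult[OF less.prems(1)] by (simp add: b1_def colon_def)
        ultimately have "(x * u) * (x * u) \<in> b" by (simp only:)
        then have "x * u \<in> b" by (rule less.prems(3))
        then show ?thesis by (simp add: b1_def colon_def)
      qed
      have r2: "u \<in> b2" if "u * u \<in> b2" for u
      proof -
        have sq: "(u * w) * (u * w) \<in> b" if w: "w \<in> b1" for w
        proof -
          have "(u * w) * (u * w) = (u * u * w) * w" by (simp add: ac_simps)
          moreover have "(u * u * w) * w \<in> b"
            using \<open>u * u \<in> b2\<close> w idl_mult'[OF less.prems(1)] by (simp add: b2_def)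
          ultimately show ?thesis by (simp only:)
        qed
        have "u * w \<in> b" if "w \<in> b1" for w by (rule less.prems(3)[OF sq[OF that]])
        then show ?thesis by (simp add: b2_def)
      qed
      have ne: "b1 \<noteq> b" "b2 \<noteq> b"
      proof -
        have "y \<in> b1" using xy(1) by (simp add: b1_def colon_def)
        then show "b1 \<noteq> b" using xy(3) by blast
        have "x \<in> b2" by (simp add: b2_def b1_def colon_def)
        then show "b2 \<noteq> b" using xy(2) by blast
      qed
      have dec: "length gs - rk gs b' < length gs - rk gs b" if "sat b'" "b \<subseteq> b'" "b' \<noteq> b" for b'
      proof -
        have "\<not> rk gs b' \<le> rk gs b" using rk_eq_imp_eq[OF less.prems(2) that(1,2)] that(3) by blast
        then show ?thesis using rk_le[of gs b'] by simp
      qed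
      have C: "convergent (fr b1)" "convergent (fr b2)"
        by (rule less.hyps[OF dec[OF s1 le(1) ne(1)] i1 s1 r1], assumption)
          (rule less.hyps[OF dec[OF s2 le(2) ne(2)] i2 s2 r2], assumption)
      have inj: "u \<in> b1" if "x * u \<in> b1" for u
      proof -
        have "(x * u) * (x * u) = u * (x * (x * u))" by (simp add: ac_simps)
        moreover have "u * (x * (x * u)) \<in> b" using that idl_mult[OF less.prems(1)] by (simp add: b1_def colon_def)
        ultimately have "(x * u) * (x * u) \<in> b" by (simp only:)
        then have "x * u \<in> b" by (rule less.prems(3))
        then show ?thesis by (simp add: b1_def colon_def)
      qed
      obtain c where c: "c \<in> A" "c \<notin> Z" "c \<in> b1 + (*) x ` UNIV" by (rule torsion_cokernel[OF i1 s1 inj])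
      have "x \<in> b2" by (simp add: b2_def b1_def colon_def)
      then have "(*) x ` UNIV \<subseteq> b2" using idl_mult'[OF i2] by auto
      then have "b1 + (*) x ` UNIV \<subseteq> b1 + b2" by (rule plus_mono[OF order.refl])
      then have c': "c \<in> b1 + b2" using c by blast
      have "u * v \<in> b" if "u \<in> b1" "v \<in> b2" for u v using that by (simp add: b2_def mult.commute)
      then have "\<bar>fr b e - (fr b1 e + fr b2 e)\<bar> \<le> rerr c e" for e
        by (rule fr_split[OF c(1,2) c' less.prems(1) i1 i2 le])
      then show ?thesis
        using convergent_squeeze[OF convergent_add[OF C] rerr_tendsto[OF c(1,2)], of "fr b"] by blast
    qed
  qed
qed

text \<open>The closure of \<open>Z\<close> is saturated and radical, so its lengths converge. It
  differs from \<open>Z\<close> by the \<open>A\<close>-torsion, which a single \<open>c\<close>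
  kills: \<open>c\<close> maps the ring into a free module modulo \<open>Z\<close>, and that is
  torsion-free.\<close>

lemma convergent_dom: "convergent (fr Z)"
proof -
  let ?b = "cl Z"
  have sZ: "sub A Z" using idl_sub[OF Z] .
  have Zb: "Z \<subseteq> ?b" by (rule sub_cl(2)[OF sZ])
  have b: "idl ?b"
  proof (rule subI)
    show "0 \<in> ?b" using Zb Z0 by blast
    show "\<And>x y. x \<in> ?b \<Longrightarrow> y \<in> ?b \<Longrightarrow> x + y \<in> ?b" by (rule sub_add[OF sub_cl(1)[OF sZ]])
    show "\<And>r x. x \<in> ?b \<Longrightarrow> r * x \<in> ?b"
      using idl_mult[OF Z] by (fastforce simp: cl_def mult.left_commute)
  qed
  have sb: "sat ?b" by (rule sat_cl[OF sZ order.refl])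
  have rb: "x \<in> ?b" if xx: "x * x \<in> ?b" for x
  proof -
    obtain c where c: "c \<in> A" "c \<notin> Z" "c * (x * x) \<in> Z" using xx by (auto simp: cl_def)
    then have "c * (c * (x * x)) \<in> Z" using idl_mult[OF Z] by blast
    then have "(c * x) * (c * x) \<in> Z" by (simp add: ac_simps)
    then have "c * x \<in> Z" by (rule red)
    then show ?thesis unfolding cl_def using c(1,2) by blast
  qed
  have conv: "convergent (fr ?b)" by (rule convergent_radical[OF b sb rb])
  obtain ws c where ws: "indep A Z ws" "c \<in> A" "c \<notin> Z" "\<And>x. x \<in> Span A gs \<Longrightarrow> c * x \<in> Span A ws + Z"
    by (rule max_indep[OF A Z, of gs]) (use dom one_notin_Z in auto)
  have "c * x \<in> Z" if x: "x \<in> ?b" for x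
  proof -
    obtain c' where c': "c' \<in> A" "c' \<notin> Z" "c' * x \<in> Z" using x by (auto simp: cl_def)
    obtain u z where u: "x = u + z" "u \<in> Span A gs" "z \<in> Z" using span[of x] by (auto elim: set_plus_elim)
    obtain v z' where v: "c * u = v + z'" "v \<in> Span A ws" "z' \<in> Z" using ws(4)[OF u(2)] by (auto elim: set_plus_elim)
    have eq: "c * x = v + (z' + c * z)" using u v by (simp add: algebra_simps)
    have z: "z' + c * z \<in> Z" using u v by (intro sub_add[OF Z] idl_mult[OF Z])
    have "c' * (c * x) \<in> Z" using idl_mult[OF Z c'(3), of c] by (simp add: mult.left_commute)
    then have "c' * (c * x) - c' * (z' + c * z) \<in> Z" by (rule idl_diff[OF Z _ idl_mult[OF Z z]])
    then have "c' * v \<in> Z" unfolding eq by (simp add: algebra_simps)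
    with indep_torsion[OF A Z c'(1,2) dom ws(1) v(2)] have "v \<in> Z" by blast
    then show ?thesis unfolding eq using z by (rule sub_add[OF Z])
  qed
  then have "(*) c ` ?b \<subseteq> Z" by blast
  from fr_torsion[OF ws(2,3) Z b Zb this] have "\<bar>fr Z e - fr ?b e\<bar> \<le> rerr c e" for e .
  then show ?thesis by (rule convergent_squeeze[OF conv rerr_tendsto[OF ws(2,3)]])
qed

end

context hk_alg
begin

text \<open>If \<open>A\<close> has zero divisors \<open>c\<close>, \<open>c'\<close> modulo
  \<open>Z\<close>, the limit is 0: modulo \<open>c\<close> the lengths are negligible, and the
  ideal of \<open>c\<close> is killed by \<open>c'\<close>.\<close>

theorem convergent_hk: "convergent (fr Z)"
proof (cases "\<forall>c\<in>A. \<forall>c'\<in>A. c * c' \<in> Z \<longrightarrow> c \<in> Z \<or> c' \<in> Z")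
  case True
  interpret hk_dom Z A m gs as p I s
    by unfold_locales (use True in blast)
  show ?thesis by (rule convergent_dom)
next
  case False
  then obtain c c' where c: "c \<in> A" "c \<notin> Z" and c': "c' \<in> A" "c' \<notin> Z" and cc: "c * c' \<in> Z" by blast
  have "\<bar>fr Z e - (fr (Z + (*) c ` UNIV) e)\<bar> \<le> rerr c' e" for e
  proof (rule fr_torsion[OF c' Z idl_principal plus_left_subset[OF idl_image[OF sub_UNIV]]])
    show "(*) c' ` (Z + (*) c ` UNIV) \<subseteq> Z"
    proof
      fix y assume "y \<in> (*) c' ` (Z + (*) c ` UNIV)"
      then obtain z t where y: "y = c' * (z + c * t)" "z \<in> Z" by (auto elim!: set_plus_elim)
      have "c' * z + (c * c') * t \<in> Z" by (rule sub_add[OF Z idl_mult[OF Z y(2)] idl_mult'[OF Z cc]])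
      then show "y \<in> Z" using y(1) by (simp add: algebra_simps)
    qed
  qed
  moreover have "c \<in> Z + (*) c ` UNIV" using set_plus_intro[OF Z0 rangeI[of "(*) c" 1]] by simp
  then have "convergent (fr (Z + (*) c ` UNIV))"
    using fr_small[OF c _ idl_principal] convergentI by blast
  ultimately show ?thesis using convergent_squeeze[OF _ rerr_tendsto[OF c']] by blast
qed

end

section \<open>Purely inseparable extensions of degree p\<close>

definition polyset :: "'t::comm_ring_1 set \<Rightarrow> 't poly set" where
  "polyset S = {f. \<forall>i. coeff f i \<in> S}"

lemma srng_sum: "srng S \<Longrightarrow> (\<And>i. i \<in> I \<Longrightarrow> f i \<in> S) \<Longrightarrow> sum f I \<in> S"
  by (induction I rule: infinite_finite_induct) (auto dest: srngD)

lemma idl_polyset: "idl U \<Longrightarrow> idl (polyset U)"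
  by (rule subI) (auto simp: polyset_def sub_zero sub_add coeff_mult intro!: idl_sum idl_mult)

lemma srng_polyset: "srng S \<Longrightarrow> srng (polyset S)"
  unfolding srng_def[of "polyset S"]
  by (auto simp: polyset_def coeff_mult coeff_1 intro!: srng_sum srngD(4-6) dest: srngD split: if_splits)

lemma poly_mem_idl: "idl U \<Longrightarrow> f \<in> polyset U \<Longrightarrow> poly f x \<in> U"
  by (auto simp: polyset_def poly_altdef intro!: idl_sum idl_mult')

lemma poly_mem_srng: "srng S \<Longrightarrow> f \<in> polyset S \<Longrightarrow> x \<in> S \<Longrightarrow> poly f x \<in> S"
  by (auto simp: polyset_def poly_altdef intro!: srng_sum srngD(5) srng_power)

lemma monic_coeff:
  fixes f h :: "'t::comm_ring_1 poly"
  assumes U: "idl U" and f: "lead_coeff f = 1" and h: "\<And>i. i > k \<Longrightarrow> coeff h i \<in> U"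
  shows "coeff (f * h) (degree f + k) - coeff h k \<in> U"
proof -
  let ?t = "\<lambda>i. coeff f i * coeff h (degree f + k - i)"
  have "coeff (f * h) (degree f + k) = sum ?t {..degree f + k}" by (rule coeff_mult)
  also have "\<dots> = ?t (degree f) + sum ?t ({..degree f + k} - {degree f})" by (rule sum.remove) auto
  finally have "coeff (f * h) (degree f + k) - coeff h k = sum ?t ({..degree f + k} - {degree f})"
    using f by simp
  also have "\<dots> \<in> U"
  proof (rule idl_sum[OF U])
    fix i assume i: "i \<in> {..degree f + k} - {degree f}"
    show "?t i \<in> U"
    proof (cases "i < degree f")
      case True
      then show ?thesis using h[of "degree f + k - i"] by (intro idl_mult[OF U]) auto
    next
      case False
      then have "coeff f i = 0" using i by (intro coeff_eq_0) auto
      then show ?thesis using sub_zero[OF U] by simp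
    qed
  qed
  finally show ?thesis .
qed

lemma top_coeff:
  assumes U: "idl U" and h: "h \<notin> polyset U"
  shows "\<exists>k. coeff h k \<notin> U \<and> (\<forall>i>k. coeff h i \<in> U)"
proof -
  let ?I = "{i. coeff h i \<notin> U}"
  have "?I \<subseteq> {..degree h}" using sub_zero[OF U] by (auto intro: le_degree)
  then have fin: "finite ?I" by (rule finite_subset) simp
  have "?I \<noteq> {}" using h by (auto simp: polyset_def)
  then have "Max ?I \<in> ?I" using fin by (rule Max_in[rotated])
  then have top: "coeff h (Max ?I) \<notin> U" by simp
  have above: "coeff h i \<in> U" if "i > Max ?I" for i
  proof (rule ccontr)
    assume "coeff h i \<notin> U"
    then have "i \<le> Max ?I" using Max_ge[OF fin, of i] by simp
    then show False using that by simp
  qed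
  show ?thesis using top above by blast
qed

lemma monic_cancel:
  assumes U: "idl U" and f: "lead_coeff f = 1" and fh: "f * h \<in> polyset U"
  shows "h \<in> polyset U"
proof (rule ccontr)
  assume "h \<notin> polyset U"
  then obtain k where k: "coeff h k \<notin> U" "\<forall>i>k. coeff h i \<in> U" using top_coeff[OF U] by blast
  have "coeff (f * h) (degree f + k) - coeff h k \<in> U" by (rule monic_coeff[OF U f k(2)[rule_format]])
  moreover have "coeff (f * h) (degree f + k) \<in> U" using fh by (simp add: polyset_def)
  ultimately show False using k(1) idl_cong[OF U] by blast
qed

lemma monic_not_unit:
  assumes U: "idl U" "1 \<notin> U" and f: "lead_coeff f = 1" "degree f > 0"
  shows "f * h - 1 \<notin> polyset U"
proof
  assume fh: "f * h - 1 \<in> polyset U"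
  note P = idl_polyset[OF U(1)]
  have "h \<notin> polyset U"
  proof
    assume "h \<in> polyset U"
    then have "f * h - (f * h - 1) \<in> polyset U" using idl_diff[OF P idl_mult[OF P] fh] by blast
    then have "1 \<in> polyset U" by simp
    then show False using U(2) by (auto simp: polyset_def dest: spec[of _ 0])
  qed
  then obtain k where k: "coeff h k \<notin> U" "\<forall>i>k. coeff h i \<in> U" using top_coeff[OF U(1)] by blast
  have "coeff (f * h - 1) (degree f + k) \<in> U" using fh unfolding polyset_def by blast
  then have "coeff (f * h) (degree f + k) \<in> U" using f(2) by simp
  then show False using monic_coeff[OF U(1) f(1) k(2)[rule_format]] k(1) idl_cong[OF U(1)] by blast
qed

lemma synthetic_monic:
  fixes f :: "'t::comm_ring_1 poly"
  assumes f: "lead_coeff f = 1" "degree f > 0"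
  shows "f = [:- x, 1:] * synthetic_div f x + [:poly f x:]" "lead_coeff (synthetic_div f x) = 1"
    "degree (synthetic_div f x) = degree f - 1"
proof -
  let ?g = "synthetic_div f x"
  show eq: "f = [:- x, 1:] * ?g + [:poly f x:]" by (rule synthetic_div_correct'[symmetric])
  show d: "degree ?g = degree f - 1" by (rule degree_synthetic_div)
  have "coeff f (degree f) = coeff ([:- x, 1:] * ?g + [:poly f x:]) (Suc (degree f - 1))"
    using f(2) eq by simp
  also have "\<dots> = coeff ?g (degree f - 1) - x * coeff ?g (degree f)"
    using f(2) by (simp add: coeff_pCons split: nat.splits)
  also have "coeff ?g (degree f) = 0" using d f(2) by (intro coeff_eq_0) simp
  finally show "lead_coeff ?g = 1" using f(1) d by simp
qed

text \<open>Evaluation at \<open>x\<close> shows that \<open>f\<close> or \<open>h\<close> vanishes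
  there modulo the prime \<open>U\<close>. Divide that factor by the linear polynomial and lower
  \<open>N\<close>; the degree of \<open>f\<close> drops only in the first case.\<close>

lemma monic_dvd_linear_power:
  assumes U: "idl U" "1 \<notin> U" and prime: "\<And>a b. a * b \<in> U \<Longrightarrow> a \<in> U \<or> b \<in> U"
  shows "lead_coeff f = 1 \<Longrightarrow> f * h - [:- x, 1:] ^ N \<in> polyset U \<Longrightarrow> f - [:- x, 1:] ^ degree f \<in> polyset U"
proof (induction N arbitrary: f h)
  case 0
  then have "degree f = 0" using monic_not_unit[OF U 0(1)] by auto
  then have "f = 1" using 0(1) by (metis degree_0_id one_pCons)
  then show ?case using sub_zero[OF idl_polyset[OF U(1)]] by simp
next
  case (Suc N)
  note P = idl_polyset[OF U(1)]
  define L where "L = [:- x, 1:]"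
  have L: "lead_coeff L = 1" by (simp add: L_def)
  have Lx: "poly (L ^ Suc N) x = 0" by (simp add: L_def)
  have fh: "f * h - L ^ Suc N \<in> polyset U" using Suc.prems(2) by (simp only: L_def)
  have const: "[:c:] \<in> polyset U" if "c \<in> U" for c
    using that sub_zero[OF U(1)] by (auto simp: polyset_def coeff_pCons split: nat.splits)
  show ?case
  proof (cases "degree f = 0")
    case True
    then have "f = 1" using Suc.prems(1) by (metis degree_0_id one_pCons)
    then show ?thesis using sub_zero[OF P] by simp
  next
    case False
    have "poly (f * h - L ^ Suc N) x \<in> U" by (rule poly_mem_idl[OF U(1) fh])
    then have "poly f x * poly h x \<in> U" using Lx by simp
    then consider "poly f x \<in> U" | "poly h x \<in> U" using prime by blast
    then show ?thesis
    proof cases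
      case 1
      let ?g = "synthetic_div f x"
      have g: "f = L * ?g + [:poly f x:]" "lead_coeff ?g = 1" "degree ?g = degree f - 1"
        unfolding L_def using synthetic_monic[of f x] Suc.prems(1) False by auto
      have "L * (?g * h - L ^ N) = (f * h - L ^ Suc N) - h * [:poly f x:]"
        by (subst (2) g(1)) (simp add: algebra_simps)
      also have "\<dots> \<in> polyset U" by (intro idl_diff[OF P fh] idl_mult[OF P] const 1)
      finally have "?g * h - L ^ N \<in> polyset U" by (rule monic_cancel[OF U(1) L])
      then have "?g - L ^ degree ?g \<in> polyset U" unfolding L_def by (rule Suc.IH[OF g(2)])
      then have "L * (?g - L ^ degree ?g) + [:poly f x:] \<in> polyset U"
        by (intro sub_add[OF P] idl_mult[OF P] const 1)
      moreover have "L * (?g - L ^ degree ?g) + [:poly f x:] = (L * ?g + [:poly f x:]) - L ^ Suc (degree ?g)"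
        by (simp add: algebra_simps)
      moreover have "Suc (degree ?g) = degree f" using g(3) False by simp
      ultimately have "f - L ^ degree f \<in> polyset U" by (simp only: g(1)[symmetric])
      then show ?thesis by (simp only: L_def)
    next
      case 2
      let ?g = "synthetic_div h x"
      have g: "h = L * ?g + [:poly h x:]" unfolding L_def by (rule synthetic_div_correct'[symmetric])
      have "L * (f * ?g - L ^ N) = (f * h - L ^ Suc N) - f * [:poly h x:]"
        by (subst (2) g) (simp add: algebra_simps)
      also have "\<dots> \<in> polyset U" by (intro idl_diff[OF P fh] idl_mult[OF P] const 2)
      finally have "f * ?g - L ^ N \<in> polyset U" by (rule monic_cancel[OF U(1) L])
      then show ?thesis unfolding L_def by (rule Suc.IH[OF Suc.prems(1)])
    qed
  qed
qed

lemma linear_power_subleading: "coeff ([:- x, 1:] ^ Suc n) n = - (of_nat (Suc n) * (x::'t::comm_ring_1))"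
proof (induction n)
  case (Suc n)
  define f where "f = [:- x, 1:] ^ Suc n"
  have 1: "coeff f (Suc n) = 1" unfolding f_def by (rule coeff_linear_power)
  have 2: "coeff f n = - (of_nat (Suc n) * x)" unfolding f_def by (rule Suc)
  have "[:- x, 1:] ^ Suc (Suc n) = [:- x, 1:] * f" by (simp only: f_def power_Suc)
  then have "coeff ([:- x, 1:] ^ Suc (Suc n)) (Suc n) = coeff f n - x * coeff f (Suc n)"
    by (simp add: coeff_pCons)
  then show ?case by (simp add: 1 2 algebra_simps)
qed simp

text \<open>\<open>T + U\<close> is a subring with \<open>T/(T \<inter> U)\<close> a field, \<open>x\<close> lies outside, and \<open>x\<^sup>p\<close> inside. The minimal
  polynomial of \<open>x\<close> over this field divides \<open>(X - x)\<^sup>p\<close>, hence is \<open>(X - x)\<^sup>n\<close>; if \<open>0 < n < p\<close> then its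
  second coefficient \<open>- n x\<close> would give \<open>x\<close>.\<close>

lemma inseparable_independence:
  fixes U T :: "'t::comm_ring_1 set"
  assumes U: "idl U" "1 \<notin> U" and prime: "\<And>a b. a * b \<in> U \<Longrightarrow> a \<in> U \<or> b \<in> U"
    and p: "Factorial_Ring.prime p" "of_nat p \<in> U"
    and T: "srng T" and inv: "\<And>t. t \<in> T \<Longrightarrow> t \<notin> U \<Longrightarrow> \<exists>u\<in>T. t * u - 1 \<in> U"
    and x: "x ^ p \<in> T" "\<And>t. t \<in> T \<Longrightarrow> x - t \<notin> U"
    and f0: "f0 \<in> polyset T" "poly f0 x \<in> U" "\<forall>i\<ge>p. coeff f0 i \<in> U"
  shows "f0 \<in> polyset U"
proof (rule ccontr)
  assume f0U: "f0 \<notin> polyset U"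
  note P = idl_polyset[OF U(1)] and PT = srng_polyset[OF T]
  \<comment> \<open>The possible degrees modulo \<open>U\<close> of polynomials over
    \<open>T\<close> that vanish at \<open>x\<close> modulo \<open>U\<close>. The least one is the
    degree of the minimal polynomial of \<open>x\<close> over the field
    \<open>T/(T \<inter> U)\<close>.\<close>
  define R where "R n \<longleftrightarrow> (\<exists>f\<in>polyset T. poly f x \<in> U \<and> coeff f n \<notin> U \<and> (\<forall>i>n. coeff f i \<in> U))" for n
  obtain k where k: "coeff f0 k \<notin> U" "\<forall>i>k. coeff f0 i \<in> U" using top_coeff[OF U(1) f0U] by blast
  then have Rk: "R k" unfolding R_def using f0 by blast
  have kp: "k < p" using k f0(3) by (meson not_le)
  define n where "n = (LEAST n. R n)"
  have Rn: "R n" unfolding n_def by (rule LeastI[of R, OF Rk])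
  have nk: "n \<le> k" unfolding n_def by (rule Least_le[of R, OF Rk])
  have min: "g \<in> polyset U" if g: "g \<in> polyset T" "poly g x \<in> U" "\<forall>i\<ge>n. coeff g i \<in> U" for g
  proof (rule ccontr)
    assume "g \<notin> polyset U"
    then obtain j where j: "coeff g j \<notin> U" "\<forall>i>j. coeff g i \<in> U" using top_coeff[OF U(1)] by blast
    then have "R j" unfolding R_def using g by blast
    then have "n \<le> j" unfolding n_def by (rule Least_le[of R])
    then show False using g(3) j(1) by blast
  qed
  obtain f1 where f1: "f1 \<in> polyset T" "poly f1 x \<in> U" "coeff f1 n \<notin> U" "\<forall>i>n. coeff f1 i \<in> U"
    using Rn unfolding R_def by blast
  have "coeff f1 n \<in> T" using f1(1) by (simp add: polyset_def)
  then obtain u where u: "u \<in> T" "coeff f1 n * u - 1 \<in> U" using inv f1(3) by blast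
  \<comment> \<open>Modulo \<open>U\<close> this is \<open>u f1\<close>, but its leading coefficient
    is exactly 1, as division with remainder requires.\<close>
  define f where "f = poly_cutoff n (smult u f1) + monom 1 n"
  have cf: "coeff f i = (if i < n then u * coeff f1 i else if i = n then 1 else 0)" for i
    by (simp add: f_def coeff_poly_cutoff)
  have df: "degree f = n"
  proof (rule antisym)
    show "degree f \<le> n" by (rule degree_le) (simp add: cf)
    show "n \<le> degree f" by (rule le_degree) (simp add: cf)
  qed
  have lf: "lead_coeff f = 1" by (simp add: df cf)
  have fT: "f \<in> polyset T"
    using f1(1) u(1) srngD(1,3)[OF T] srngD(5)[OF T u(1)] by (auto simp: polyset_def cf)
  have "f - smult u f1 \<in> polyset U"
    unfolding polyset_def
  proof (intro CollectI allI)
    fix i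
    consider "i < n" | "i = n" | "i > n" by linarith
    then show "coeff (f - smult u f1) i \<in> U"
    proof cases
      case 1
      then show ?thesis using sub_zero[OF U(1)] by (simp add: cf)
    next
      case 2
      then show ?thesis using idl_uminus[OF U(1) u(2)] by (simp add: cf mult.commute)
    next
      case 3
      then show ?thesis using f1(4) idl_uminus[OF U(1)] idl_mult[OF U(1)] by (simp add: cf)
    qed
  qed
  then have "poly (f - smult u f1) x \<in> U" by (rule poly_mem_idl[OF U(1)])
  then have "(poly f x - u * poly f1 x) + u * poly f1 x \<in> U"
    using idl_mult[OF U(1) f1(2)] by (intro sub_add[OF U(1)]) simp_all
  then have fx: "poly f x \<in> U" by simp
  have n0: "n \<noteq> 0"
  proof
    assume "n = 0"
    then have "f = 1" using df lf by (metis degree_0_id one_pCons)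
    then show False using fx U(2) by simp
  qed
  \<comment> \<open>Division by the monic \<open>f\<close>: the remainder vanishes at
    \<open>x\<close> and has degree below \<open>n\<close>, so it is zero modulo \<open>U\<close> by
    minimality. This will be applied to \<open>X^p - x^p\<close>, which is \<open>(X - x)^p\<close>
    modulo \<open>U\<close>.\<close>
  have div: "\<exists>h. g - f * h \<in> polyset U"
    if "g \<in> polyset T" "poly g x \<in> U" "\<forall>i\<ge>N. coeff g i \<in> U" for g N
    using that
  proof (induction N arbitrary: g)
    case 0
    then have "g \<in> polyset U" by (simp add: polyset_def)
    then show ?case by (intro exI[of _ 0]) simp
  next
    case (Suc N)
    show ?case
    proof (cases "Suc N \<le> n")
      case True
      then have "g \<in> polyset U" using Suc.prems by (intro min) auto
      then show ?thesis by (intro exI[of _ 0]) simp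
    next
      case False
      define m where "m = monom (coeff g N) (N - n)"
      have mT: "m \<in> polyset T" using Suc.prems(1) srngD(3)[OF T] by (auto simp: polyset_def m_def)
      let ?g = "g - m * f"
      have "?g \<in> polyset T" using srngD(7)[OF PT Suc.prems(1) srngD(5)[OF PT mT fT]] .
      moreover have "poly ?g x \<in> U"
        using idl_diff[OF U(1) Suc.prems(2) idl_mult[OF U(1) fx, of "poly m x"]] by simp
      moreover have "\<forall>i\<ge>N. coeff ?g i \<in> U"
      proof (intro allI impI)
        fix i assume i: "N \<le> i"
        show "coeff ?g i \<in> U"
        proof (cases "i = N")
          case True
          then have "coeff (m * f) i = coeff g N" using False by (auto simp: m_def coeff_monom_mult cf)
          then show ?thesis using True sub_zero[OF U(1)] by simp
        next
          case False
          then have "degree f < i - (N - n)" using i \<open>\<not> Suc N \<le> n\<close> df by linarith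
          then have c: "coeff f (i - (N - n)) = 0" by (rule coeff_eq_0)
          have "coeff (m * f) i = 0" unfolding m_def coeff_monom_mult c by simp
          then show ?thesis using Suc.prems(3) False i by simp
        qed
      qed
      ultimately obtain h where "?g - f * h \<in> polyset U" using Suc.IH by blast
      then have "g - f * (h + m) \<in> polyset U" by (simp add: algebra_simps)
      then show ?thesis by blast
    qed
  qed
  let ?L = "[:- x, 1:]"
  define g where "g = monom 1 p - [:x ^ p:]"
  have p0: "p > 0" using p(1) prime_gt_0_nat by blast
  have "\<exists>h. g - f * h \<in> polyset U"
  proof (rule div[of g "Suc p"])
    show "g \<in> polyset T"
      unfolding g_def using x(1) srngD(1,3)[OF T]
      by (intro srngD(7)[OF PT]) (auto simp: polyset_def coeff_pCons split: nat.splits)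
    show "poly g x \<in> U" using sub_zero[OF U(1)] by (simp add: g_def poly_monom)
    show "\<forall>i\<ge>Suc p. coeff g i \<in> U" using sub_zero[OF U(1)] by (auto simp: g_def coeff_pCons split: nat.splits)
  qed
  then obtain h where h: "g - f * h \<in> polyset U" by blast
  have "of_nat p \<in> polyset U"
    using p(2) sub_zero[OF U(1)] by (auto simp: polyset_def of_nat_poly coeff_pCons split: nat.splits)
  then have "(?L + [:x:]) ^ (p ^ 1) - (?L ^ (p ^ 1) + [:x:] ^ (p ^ 1)) \<in> polyset U"
    by (rule frobenius_add[OF P p(1)])
  moreover have "?L + [:x:] = monom 1 1" by (simp add: monom_altdef)
  ultimately have "monom 1 p - (?L ^ p + [:x ^ p:]) \<in> polyset U" by (simp add: monom_power poly_const_pow)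
  then have "(monom 1 p - (?L ^ p + [:x ^ p:])) - (g - f * h) \<in> polyset U" using h by (rule idl_diff[OF P])
  then have "f * h - ?L ^ p \<in> polyset U" by (simp add: g_def algebra_simps)
  then have "f - ?L ^ n \<in> polyset U"
    using monic_dvd_linear_power[OF U prime lf] df by blast
  then have "coeff (f - ?L ^ n) (n - 1) \<in> U" by (simp add: polyset_def)
  moreover have "coeff (?L ^ n) (n - 1) = - (of_nat n * x)"
    using linear_power_subleading[of x "n - 1"] n0 by simp
  ultimately have 1: "coeff f (n - 1) + of_nat n * x \<in> U" by simp
  have nU: "of_nat n \<notin> U"
  proof
    assume nU: "of_nat n \<in> U"
    have "\<not> p dvd n" using n0 nk kp by (auto dest: dvd_imp_le)
    then have "coprime p n" using p(1) prime_imp_coprime by blast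
    then obtain a b where ab: "a * int p + b * int n = 1"
      using bezout_int[of "int p" "int n"] by (auto simp: coprime_iff_gcd_eq_1)
    have "of_int a * of_nat p + of_int b * of_nat n \<in> U"
      using p(2) nU by (intro sub_add[OF U(1)] idl_mult[OF U(1)])
    moreover have "of_int a * of_nat p + of_int b * of_nat n = (of_int (a * int p + b * int n) :: 't)" by simp
    ultimately show False using ab U(2) by simp
  qed
  have nT: "of_nat n \<in> T" by (induction n) (auto intro: srngD[OF T])
  obtain v where v: "v \<in> T" "of_nat n * v - 1 \<in> U" using inv[OF nT nU] by blast
  have cT: "coeff f (n - 1) \<in> T" using fT by (simp add: polyset_def)
  have "v * (coeff f (n - 1) + of_nat n * x) - (of_nat n * v - 1) * x \<in> U"
    by (rule idl_diff[OF U(1) idl_mult[OF U(1) 1] idl_mult'[OF U(1) v(2)]])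
  then have "x - (- (v * coeff f (n - 1))) \<in> U" by (simp add: algebra_simps)
  moreover have "- (v * coeff f (n - 1)) \<in> T" using srngD(5,6)[OF T] v cT by blast
  ultimately show False using x(2) by blast
qed

text \<open>Trade the leading monomial \<open>X^(N+p)\<close> for \<open>x^p\<close> times
  \<open>X^N\<close>, which has the same value at \<open>x\<close>.\<close>

lemma reduce_degree:
  fixes T :: "'t::comm_ring_1 set"
  assumes T: "srng T" and x: "x ^ p \<in> T" "p > 0"
  shows "f \<in> polyset T \<Longrightarrow> \<forall>i\<ge>N + p. coeff f i = 0 \<Longrightarrow>
    \<exists>g\<in>polyset T. poly g x = poly f x \<and> (\<forall>i\<ge>p. coeff g i = 0)"
proof (induction N arbitrary: f)
  case (Suc N)
  note PT = srng_polyset[OF T]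
  let ?c = "coeff f (N + p)"
  define g where "g = f - monom ?c (N + p) + monom (?c * x ^ p) N"
  have "?c \<in> T" using Suc.prems by (simp add: polyset_def)
  then have "monom ?c (N + p) \<in> polyset T" "monom (?c * x ^ p) N \<in> polyset T"
    using x(1) srngD(3)[OF T] srngD(5)[OF T] by (auto simp: polyset_def)
  then have "g \<in> polyset T" unfolding g_def using srngD(4,7)[OF PT] Suc.prems(1) by blast
  moreover have "\<forall>i\<ge>N + p. coeff g i = 0"
  proof (intro allI impI)
    fix i assume "N + p \<le> i"
    then show "coeff g i = 0" using Suc.prems(2) x(2) by (cases "i = N + p") (auto simp: g_def)
  qed
  ultimately obtain h where "h \<in> polyset T" "poly h x = poly g x" "\<forall>i\<ge>p. coeff h i = 0" using Suc.IH by blast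
  moreover have "poly g x = poly f x" by (simp add: g_def poly_monom power_add mult.assoc mult.commute)
  ultimately show ?case by auto
qed auto

section \<open>Coefficient fields\<close>

text \<open>The ring modulo \<open>Z\<close> is complete and separated for the filtration
  \<open>M\<close>. For a completion, \<open>M n\<close> will consist of the elements that vanish
  modulo the \<open>n\<close>-th power of the maximal ideal.\<close>

locale complete_ring =
  fixes Z :: "'v::comm_ring_1 set" and M :: "nat \<Rightarrow> 'v set" and p :: nat
  assumes Z: "idl Z" and M: "idl (M n)" and M0: "M 0 = UNIV" and M_Suc: "M (Suc n) \<subseteq> M n" and ZM: "Z \<subseteq> M n"
    and sep: "\<forall>n. x \<in> M n \<Longrightarrow> x \<in> Z"
    and M_mult: "x \<in> M i \<Longrightarrow> y \<in> M j \<Longrightarrow> x * y \<in> M (i + j)"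
    and lim: "\<forall>n. f (Suc n) - f n \<in> M n \<Longrightarrow> \<exists>g. \<forall>n. g - f n \<in> M n"
    and unit: "x \<notin> M 1 \<Longrightarrow> \<exists>y. x * y - 1 \<in> Z" and one: "1 \<notin> M 1"
    and p: "Factorial_Ring.prime p" and pZ: "of_nat p \<in> Z"
begin

lemma M_antimono: "i \<le> j \<Longrightarrow> M j \<subseteq> M i"
  by (rule lift_Suc_antimono_le[of M]) (use M_Suc in auto)

lemma M_power: "x \<in> M i \<Longrightarrow> x ^ n \<in> M (i * n)"
proof (induction n)
  case (Suc n)
  then show ?case using M_mult[of x i "x ^ n" "i * n"] by simp
qed (use M0 in simp)

lemma prime_M1: "a * b \<in> M 1 \<Longrightarrow> a \<in> M 1 \<or> b \<in> M 1"
proof (rule ccontr)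
  assume ab: "a * b \<in> M 1" and "\<not> (a \<in> M 1 \<or> b \<in> M 1)"
  then obtain y where y: "a * y - 1 \<in> M 1" using unit ZM by blast
  have "(a * b) * y - (a * y - 1) * b \<in> M 1"
    by (rule idl_diff[OF M idl_mult'[OF M ab] idl_mult'[OF M y]])
  then have "b \<in> M 1" by (simp add: algebra_simps)
  then show False using \<open>\<not> (a \<in> M 1 \<or> b \<in> M 1)\<close> by blast
qed

lemma p_pos: "p > 0" using p prime_gt_0_nat by blast

text \<open>The \<open>p\<close>-th powers of \<open>S\<close> form, modulo \<open>Z\<close>, a
  subring meeting \<open>M 1\<close> only in \<open>M (k * p)\<close>, but it may miss part of the
  residue field. A maximal subring of \<open>S\<close> that contains these powers and still has this
  small intersection reaches everything: otherwise a missed \<open>x\<close>, whose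
  \<open>p\<close>-th power is already inside, could be adjoined.\<close>

lemma coefficient_step:
  assumes S: "srng S" "Z \<subseteq> S" "\<forall>x. \<exists>s\<in>S. x - s \<in> M 1" "S \<inter> M 1 \<subseteq> M k"
  shows "\<exists>T. srng T \<and> Z \<subseteq> T \<and> T \<subseteq> S \<and> (\<forall>x. \<exists>s\<in>T. x - s \<in> M 1) \<and> T \<inter> M 1 \<subseteq> M (k * p)"
proof -
  define \<F> where "\<F> = {T. srng T \<and> Z \<subseteq> T \<and> T \<subseteq> S \<and> (\<forall>x\<in>S. x ^ p \<in> T) \<and> T \<inter> M 1 \<subseteq> M (k * p)}"
  let ?T = "{y. \<exists>x\<in>S. y - x ^ p \<in> Z}"
  have fr: "(x + y) ^ p - (x ^ p + y ^ p) \<in> Z" for x y using frobenius_add[OF Z p pZ, of x y 1] by simp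
  have "?T \<in> \<F>"
    unfolding \<F>_def
  proof (intro CollectI conjI)
    show "srng ?T"
      unfolding srng_def
    proof (intro conjI ballI)
      show "1 \<in> ?T" using srngD(1)[OF S(1)] sub_zero[OF Z] by (intro CollectI bexI[of _ 1]) auto
      have "-1 - (- 1) ^ p \<in> Z" using idl_uminus[OF Z frobenius_minus_one[OF Z p pZ]] by (simp add: algebra_simps)
      then show "-1 \<in> ?T" using srngD(2)[OF S(1)] by (intro CollectI bexI[of _ "-1"])
      fix x y assume "x \<in> ?T" "y \<in> ?T"
      then obtain u v where uv: "u \<in> S" "v \<in> S" "x - u ^ p \<in> Z" "y - v ^ p \<in> Z" by blast
      have "(x + y) - (u ^ p + v ^ p) \<in> Z" using uv(3,4) by (rule idl_add_cong[OF Z])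
      then have "((x + y) - (u ^ p + v ^ p)) - ((u + v) ^ p - (u ^ p + v ^ p)) \<in> Z" using fr by (rule idl_diff[OF Z])
      moreover have "((x + y) - (u ^ p + v ^ p)) - ((u + v) ^ p - (u ^ p + v ^ p)) = x + y - (u + v) ^ p" by simp
      ultimately have "x + y - (u + v) ^ p \<in> Z" by (simp only:)
      then show "x + y \<in> ?T" using srngD(4)[OF S(1) uv(1,2)] by blast
      have "x * y - u ^ p * v ^ p \<in> Z" using uv(3,4) by (rule idl_mult_cong[OF Z])
      then have "x * y - (u * v) ^ p \<in> Z" by (simp add: power_mult_distrib)
      then show "x * y \<in> ?T" using srngD(5)[OF S(1) uv(1,2)] by blast
    qed
    show "Z \<subseteq> ?T"
    proof
      fix z assume "z \<in> Z"
      then have "z - 0 ^ p \<in> Z" using p_pos by (simp add: zero_power)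
      then show "z \<in> ?T" using srngD(3)[OF S(1)] by blast
    qed
    show "?T \<subseteq> S"
    proof
      fix y assume "y \<in> ?T"
      then obtain x where x: "x \<in> S" "y - x ^ p \<in> S" using S(2) by blast
      then have "(y - x ^ p) + x ^ p \<in> S" using srngD(4)[OF S(1)] srng_power[OF S(1)] by blast
      then show "y \<in> S" by simp
    qed
    show "\<forall>x\<in>S. x ^ p \<in> ?T"
    proof
      fix x assume "x \<in> S"
      moreover have "x ^ p - x ^ p \<in> Z" using sub_zero[OF Z] by simp
      ultimately show "x ^ p \<in> ?T" by blast
    qed
    show "?T \<inter> M 1 \<subseteq> M (k * p)"
    proof
      fix y assume y: "y \<in> ?T \<inter> M 1"
      then obtain x where x: "x \<in> S" "y - x ^ p \<in> Z" by blast
      then have "y - x ^ p \<in> M 1" "y - x ^ p \<in> M (k * p)" using ZM by blast+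
      then have "x ^ p \<in> M 1" using y idl_cong[OF M] by blast
      moreover have "x ^ n \<in> M 1 \<Longrightarrow> x \<in> M 1" for n
        by (induction n) (use one prime_M1 in auto)
      ultimately have "x \<in> M k" using x(1) S(4) by blast
      then have "x ^ p \<in> M (k * p)" by (rule M_power)
      then show "y \<in> M (k * p)" using \<open>y - x ^ p \<in> M (k * p)\<close> idl_cong[OF M] by blast
    qed
  qed
  then have ne: "\<F> \<noteq> {}" by blast
  have "\<exists>T\<in>\<F>. \<forall>T'\<in>\<F>. T \<subseteq> T' \<longrightarrow> T' = T"
  proof (rule subset_Zorn_nonempty[OF ne])
    fix C assume C: "C \<noteq> {}" "subset.chain \<F> C"
    then have CF: "C \<subseteq> \<F>" and tot: "\<And>a b. a \<in> C \<Longrightarrow> b \<in> C \<Longrightarrow> a \<subseteq> b \<or> b \<subseteq> a"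
      by (auto simp: subset.chain_def)
    obtain T0 where T0: "T0 \<in> C" using C(1) by blast
    have mem: "T \<in> C \<Longrightarrow> srng T \<and> Z \<subseteq> T \<and> T \<subseteq> S \<and> (\<forall>x\<in>S. x ^ p \<in> T) \<and> T \<inter> M 1 \<subseteq> M (k * p)" for T
      using CF by (auto simp: \<F>_def)
    show "\<Union>C \<in> \<F>"
      unfolding \<F>_def
    proof (intro CollectI conjI)
      show "srng (\<Union>C)"
        unfolding srng_def
      proof (intro conjI ballI)
        show "1 \<in> \<Union>C" "-1 \<in> \<Union>C" using T0 mem[OF T0] srngD(1,2) by blast+
        fix x y assume "x \<in> \<Union>C" "y \<in> \<Union>C"
        then obtain a b where ab: "a \<in> C" "b \<in> C" "x \<in> a" "y \<in> b" by blast
        obtain T where T: "T \<in> C" "x \<in> T" "y \<in> T" using tot[OF ab(1,2)] ab by blast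
        have "srng T" using mem[OF T(1)] by blast
        then show "x + y \<in> \<Union>C" "x * y \<in> \<Union>C" using T srngD(4,5) by blast+
      qed
      show "Z \<subseteq> \<Union>C" "\<forall>x\<in>S. x ^ p \<in> \<Union>C" using mem[OF T0] T0 by blast+
      show "\<Union>C \<subseteq> S" using mem by blast
      show "\<Union>C \<inter> M 1 \<subseteq> M (k * p)" using mem by blast
    qed
  qed
  then obtain T where TF: "T \<in> \<F>" and max: "\<And>T'. T' \<in> \<F> \<Longrightarrow> T \<subseteq> T' \<Longrightarrow> T' = T" by blast
  have T: "srng T" "Z \<subseteq> T" "T \<subseteq> S" "\<And>x. x \<in> S \<Longrightarrow> x ^ p \<in> T" "T \<inter> M 1 \<subseteq> M (k * p)"
    using TF by (auto simp: \<F>_def)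
  \<comment> \<open>\<open>T\<close> contains the \<open>p\<close>-th powers of \<open>S\<close>: if
    \<open>s\<close> in \<open>S\<close> inverts \<open>t\<close> modulo \<open>M 1\<close>, then so
    does \<open>t ^ (p - 1) * s ^ p\<close>, which lies in \<open>T\<close>.\<close>
  have inv: "\<exists>u\<in>T. t * u - 1 \<in> M 1" if t: "t \<in> T" "t \<notin> M 1" for t
  proof -
    obtain y where y: "t * y - 1 \<in> Z" using unit[OF t(2)] by blast
    obtain s where s: "s \<in> S" "y - s \<in> M 1" using S(3) by blast
    have "(t * y - 1) - t * (y - s) \<in> M 1" by (rule idl_diff[OF M subsetD[OF ZM y] idl_mult[OF M s(2)]])
    then have "t * s - 1 \<in> M 1" by (simp add: algebra_simps)
    then have "(t * s) ^ p - 1 ^ p \<in> M 1" by (rule idl_power_cong[OF M])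
    moreover have "(t * s) ^ p = t * (t ^ (p - 1) * s ^ p)"
      using p_pos by (cases p) (simp_all add: power_mult_distrib mult.assoc)
    moreover have "t ^ (p - 1) * s ^ p \<in> T" using srngD(5)[OF T(1) srng_power[OF T(1) t(1)] T(4)[OF s(1)]] .
    ultimately show ?thesis by auto
  qed
  have TS: "\<exists>t\<in>T. x - t \<in> M 1" if x: "x \<in> S" for x
  proof (rule ccontr)
    assume no: "\<not> ?thesis"
    let ?T = "(\<lambda>f. poly f x) ` polyset T"
    note PT = srng_polyset[OF T(1)]
    have const: "[:t:] \<in> polyset T" if "t \<in> T" for t
      using that srngD(3)[OF T(1)] by (auto simp: polyset_def coeff_pCons split: nat.splits)
    have TT: "T \<subseteq> ?T" using const by (force intro: image_eqI[of _ _ "[:t:]" for t])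
    have "?T \<in> \<F>"
      unfolding \<F>_def
    proof (intro CollectI conjI)
      show "srng ?T"
        unfolding srng_def
      proof (intro conjI ballI)
        show "1 \<in> ?T" "-1 \<in> ?T" using TT srngD(1,2)[OF T(1)] by blast+
        fix a b assume "a \<in> ?T" "b \<in> ?T"
        then obtain f g where fg: "f \<in> polyset T" "g \<in> polyset T" "a = poly f x" "b = poly g x" by blast
        then have "a + b = poly (f + g) x" "a * b = poly (f * g) x" by simp_all
        then show "a + b \<in> ?T" "a * b \<in> ?T" using srngD(4,5)[OF PT fg(1,2)] by blast+
      qed
      show "Z \<subseteq> ?T" "\<forall>x\<in>S. x ^ p \<in> ?T" using TT T by blast+
      have "polyset T \<subseteq> polyset S" using T(3) by (auto simp: polyset_def)
      then show "?T \<subseteq> S" using poly_mem_srng[OF S(1) _ x] by blast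
      show "?T \<inter> M 1 \<subseteq> M (k * p)"
      proof
        fix y assume "y \<in> ?T \<inter> M 1"
        then obtain f where f: "f \<in> polyset T" "y = poly f x" "poly f x \<in> M 1" by blast
        \<comment> \<open>Lower the degree below \<open>p\<close>. The first \<open>p\<close> powers
          of \<open>x\<close> are independent over the residue field of \<open>T\<close>, so the
          coefficients lie in \<open>T \<inter> M 1\<close> and hence in
          \<open>M (k * p)\<close>.\<close>
        have "\<forall>i\<ge>Suc (degree f) + p. coeff f i = 0" by (simp add: coeff_eq_0)
        from reduce_degree[OF T(1) T(4)[OF x] p_pos f(1) this]
        obtain g where g: "g \<in> polyset T" "poly g x = poly f x" "\<forall>i\<ge>p. coeff g i = 0" by blast
        have "g \<in> polyset (M 1)"
        proof (rule inseparable_independence[OF M one prime_M1 p _ T(1) inv T(4)[OF x]])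
          show "of_nat p \<in> M 1" using pZ ZM by blast
          show "\<And>t. t \<in> T \<Longrightarrow> x - t \<notin> M 1" using no by blast
          show "\<forall>i\<ge>p. coeff g i \<in> M 1" using g(3) sub_zero[OF M] by simp
        qed (use g f in auto)
        then have "g \<in> polyset (M (k * p))" using g(1) T(5) by (auto simp: polyset_def)
        then have "poly g x \<in> M (k * p)" by (rule poly_mem_idl[OF M])
        then show "y \<in> M (k * p)" using g(2) f(2) by simp
      qed
    qed
    then have eq: "?T = T" using max TT by blast
    have "[:0, 1:] \<in> polyset T" using srngD(1,3)[OF T(1)] by (auto simp: polyset_def coeff_pCons split: nat.splits)
    then have "poly [:0, 1:] x \<in> ?T" by blast
    then have "x \<in> T" unfolding eq by simp
    then show False using no sub_zero[OF M, of 1] by force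
  qed
  have "\<exists>t\<in>T. x - t \<in> M 1" for x
  proof -
    obtain s where s: "s \<in> S" "x - s \<in> M 1" using S(3) by blast
    obtain t where "t \<in> T" "s - t \<in> M 1" using TS[OF s(1)] by blast
    then show ?thesis using idl_trans[OF M s(2)] by blast
  qed
  then show ?thesis using T by blast
qed

text \<open>Iteration gives decreasing subrings \<open>S n\<close> that reach the whole residue
  field but meet \<open>M 1\<close> only in \<open>M (p ^ n)\<close>. Lifts of a residue class to
  the successive \<open>S n\<close> form a Cauchy sequence, and \<open>K\<close> collects the
  elements that can be approximated in this way.\<close>

lemma coefficient_field:
  "\<exists>K. srng K \<and> Z \<subseteq> K \<and> K \<inter> M 1 \<subseteq> Z \<and> (\<forall>x. \<exists>k\<in>K. x - k \<in> M 1)"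
proof -
  let ?P = "\<lambda>n S. srng S \<and> Z \<subseteq> S \<and> (\<forall>x. \<exists>s\<in>S. x - s \<in> M 1) \<and> S \<inter> M 1 \<subseteq> M (p ^ n)"
  have "\<exists>S. \<forall>n. ?P n (S n) \<and> S (Suc n) \<subseteq> S n"
  proof (rule dependent_nat_choice)
    have "\<exists>s. x - s \<in> M 1" for x using sub_zero[OF M] by (intro exI[of _ x]) simp
    then show "\<exists>S. ?P 0 S" by (intro exI[of _ UNIV]) simp
    fix S n assume "?P n S"
    then show "\<exists>T. ?P (Suc n) T \<and> T \<subseteq> S" using coefficient_step[of S "p ^ n"] by (simp add: mult.commute) blast
  qed
  then obtain S where S: "\<And>n. srng (S n)" "\<And>n. Z \<subseteq> S n" "\<And>n x. \<exists>s\<in>S n. x - s \<in> M 1"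
    "\<And>n. S n \<inter> M 1 \<subseteq> M (p ^ n)" "\<And>n. S (Suc n) \<subseteq> S n" by blast
  have np: "n \<le> p ^ n" for n
    using less_exp[of n] power_mono[OF prime_ge_2_nat[OF p], of n] by linarith
  have SM: "x \<in> M n" if "x \<in> S n" "x \<in> M 1" for x n
    by (rule subsetD[OF M_antimono[OF np] subsetD[OF S(4) IntI[OF that]]])
  define K where "K = {x. \<forall>n. \<exists>s\<in>S n. x - s \<in> M n}"
  have "srng K"
    unfolding srng_def
  proof (intro conjI ballI)
    show "1 \<in> K" "-1 \<in> K" unfolding K_def using srngD(1,2)[OF S(1)] sub_zero[OF M] by force+
    fix x y assume xy: "x \<in> K" "y \<in> K"
    show "x + y \<in> K" unfolding K_def
    proof (intro CollectI allI)
      fix n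
      obtain s t where "s \<in> S n" "t \<in> S n" "x - s \<in> M n" "y - t \<in> M n" using xy unfolding K_def by blast
      then show "\<exists>s\<in>S n. x + y - s \<in> M n" using idl_add_cong[OF M] srngD(4)[OF S(1)] by blast
    qed
    show "x * y \<in> K" unfolding K_def
    proof (intro CollectI allI)
      fix n
      obtain s t where "s \<in> S n" "t \<in> S n" "x - s \<in> M n" "y - t \<in> M n" using xy unfolding K_def by blast
      then show "\<exists>s\<in>S n. x * y - s \<in> M n" using idl_mult_cong[OF M] srngD(5)[OF S(1)] by blast
    qed
  qed
  moreover have "Z \<subseteq> K" unfolding K_def using S(2) sub_zero[OF M] by force
  moreover have "K \<inter> M 1 \<subseteq> Z"
  proof
    fix x assume x: "x \<in> K \<inter> M 1"
    have "x \<in> M (Suc n)" for n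
    proof -
      obtain s where s: "s \<in> S (Suc n)" "x - s \<in> M (Suc n)" using x unfolding K_def by blast
      then have "x - s \<in> M 1" using M_antimono[of 1 "Suc n"] by auto
      then have "s \<in> M 1" using x idl_cong[OF M] by blast
      then have "s \<in> M (Suc n)" using SM s(1) by blast
      then show ?thesis using s(2) idl_cong[OF M] by blast
    qed
    then have "\<forall>n. x \<in> M n" using M_Suc by blast
    then show "x \<in> Z" by (rule sep)
  qed
  moreover have "\<exists>k\<in>K. x - k \<in> M 1" for x
  proof -
    define t where "t n = (SOME s. s \<in> S n \<and> x - s \<in> M 1)" for n
    have "t n \<in> S n \<and> x - t n \<in> M 1" for n
      unfolding t_def by (rule someI_ex) (use S(3)[of n x] in blast)
    then have t: "t n \<in> S n" "x - t n \<in> M 1" for n by blast+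
    have "t (Suc n) - t n \<in> M n" for n
    proof (rule SM)
      show "t (Suc n) - t n \<in> S n" using srngD(7)[OF S(1)] t(1) S(5) by blast
      have "(x - t n) - (x - t (Suc n)) \<in> M 1" by (rule idl_diff[OF M t(2) t(2)])
      then show "t (Suc n) - t n \<in> M 1" by simp
    qed
    then obtain g where g: "\<forall>n. g - t n \<in> M n" using lim by blast
    have "g \<in> K" unfolding K_def using g t(1) by blast
    moreover have "(x - t 1) - (g - t 1) \<in> M 1" by (rule idl_diff[OF M t(2) spec[OF g]])
    then have "x - g \<in> M 1" by simp
    ultimately show ?thesis by blast
  qed
  ultimately show ?thesis by blast
qed

end

section \<open>Power series subrings\<close>

context complete_ring
begin

text \<open>\<open>ser S a\<close> is the set of the values of the power series in \<open>a\<close> with coefficients in \<open>S\<close>: the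
  \<open>y n\<close> are the tails of the series.\<close>

definition ser :: "'v set \<Rightarrow> 'v \<Rightarrow> 'v set" where
  "ser S a = {x. \<exists>c y. y 0 = x \<and> (\<forall>n::nat. c n \<in> S \<and> y n - (c n + a * y (Suc n)) \<in> Z)}"

primrec PS :: "'v set \<Rightarrow> 'v list \<Rightarrow> 'v set" where
  "PS K [] = K"
| "PS K (a # as) = ser (PS K as) a"

lemma Z0: "0 \<in> Z" using sub_zero[OF Z] .

lemma ser_tail:
  assumes "x \<in> ser S a"
  shows "\<exists>c\<in>S. \<exists>y\<in>ser S a. x - (c + a * y) \<in> Z"
proof -
  obtain c y where cy: "y 0 = x" "\<forall>n::nat. c n \<in> S \<and> y n - (c n + a * y (Suc n)) \<in> Z"
    using assms unfolding ser_def by blast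
  have "y (Suc 0) \<in> ser S a"
    unfolding ser_def by (intro CollectI exI[of _ "\<lambda>n. c (Suc n)"] exI[of _ "\<lambda>n. y (Suc n)"]) (use cy in simp)
  then show ?thesis using cy by blast
qed

lemma ser_base: assumes "0 \<in> S" "x \<in> S" shows "x \<in> ser S a"
  unfolding ser_def
  by (intro CollectI exI[of _ "\<lambda>n. if n = 0 then x else 0"]) (use assms Z0 in auto)

lemma ser_var: assumes "0 \<in> S" "1 \<in> S" shows "a \<in> ser S a"
  unfolding ser_def
  by (intro CollectI exI[of _ "\<lambda>n. if n = 1 then 1 else 0"] exI[of _ "\<lambda>n. if n = 0 then a else if n = 1 then 1 else 0"])
    (use assms Z0 in auto)

lemma srng_ser:
  assumes S: "srng S" shows "srng (ser S a)"
  unfolding srng_def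
proof (intro conjI ballI)
  show "1 \<in> ser S a" "-1 \<in> ser S a" using ser_base[OF srngD(3)[OF S]] srngD(1,2)[OF S] by blast+
  fix x x' assume "x \<in> ser S a" "x' \<in> ser S a"
  then obtain c y c' y' where 1: "y 0 = x" "\<And>n::nat. c n \<in> S" "\<And>n::nat. y n - (c n + a * y (Suc n)) \<in> Z"
    and 2: "y' 0 = x'" "\<And>n::nat. c' n \<in> S" "\<And>n::nat. y' n - (c' n + a * y' (Suc n)) \<in> Z"
    unfolding ser_def by blast
  show "x + x' \<in> ser S a"
    unfolding ser_def
  proof (rule CollectI, rule exI[of _ "\<lambda>n. c n + c' n"], rule exI[of _ "\<lambda>n. y n + y' n"], intro conjI allI)
    fix n show "c n + c' n \<in> S" using srngD(4)[OF S 1(2) 2(2)] .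
    have "(y n + y' n) - ((c n + a * y (Suc n)) + (c' n + a * y' (Suc n))) \<in> Z"
      by (rule idl_add_cong[OF Z 1(3) 2(3)])
    then show "y n + y' n - (c n + c' n + a * (y (Suc n) + y' (Suc n))) \<in> Z" by (simp add: algebra_simps)
  qed (use 1 2 in simp)
  \<comment> \<open>The Cauchy product: \<open>z n\<close> is the \<open>n\<close>-th tail of the
    product series, and \<open>e n\<close> below is its \<open>n\<close>-th coefficient.\<close>
  define z where "z n = (\<Sum>i<n. c i * y' (n - i)) + y n * y' 0" for n
  define e where "e n = (\<Sum>i<n. c i * c' (n - i)) + c n * c' 0" for n
  show "x * x' \<in> ser S a"
    unfolding ser_def
  proof (rule CollectI, rule exI[of _ e], rule exI[of _ z], intro conjI allI)
    show "z 0 = x * x'" using 1 2 by (simp add: z_def)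
    fix n
    show "e n \<in> S" unfolding e_def using 1(2) 2(2) by (intro srngD(4)[OF S] srng_sum[OF S] srngD(5)[OF S])
    have "z (Suc n) = (\<Sum>i<n. c i * y' (Suc (n - i))) + c n * y' 1 + y (Suc n) * y' 0"
      unfolding z_def by (simp add: Suc_diff_le)
    then have "z n - (e n + a * z (Suc n)) = (\<Sum>i<n. c i * (y' (n - i) - (c' (n - i) + a * y' (Suc (n - i)))))
        + ((y n - (c n + a * y (Suc n))) * y' 0 + c n * (y' 0 - (c' 0 + a * y' (Suc 0))))"
      unfolding z_def e_def by (simp add: algebra_simps sum_subtractf sum.distrib sum_distrib_left)
    also have "\<dots> \<in> Z"
      using 1(3) 2(3) by (intro sub_add[OF Z idl_sum[OF Z]] sub_add[OF Z idl_mult'[OF Z] idl_mult[OF Z]] idl_mult[OF Z]) auto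
    finally show "z n - (e n + a * z (Suc n)) \<in> Z" .
  qed
qed

lemma srng_PS: "srng K \<Longrightarrow> srng (PS K as)" by (induction as) (auto intro: srng_ser)

lemma PS_superset: "srng K \<Longrightarrow> K \<subseteq> PS K as"
proof (induction as)
  case (Cons a as)
  then show ?case using ser_base[OF srngD(3)[OF srng_PS[OF Cons.prems]]] by auto
qed simp

lemma PS_vars: "srng K \<Longrightarrow> set as \<subseteq> PS K as"
proof (induction as)
  case (Cons a as)
  note S = srng_PS[OF Cons.prems, of as]
  show ?case using Cons ser_base[OF srngD(3)[OF S]] ser_var[OF srngD(3,1)[OF S]] by auto
qed simp

lemma PS_constant_term:
  assumes K: "srng K" "Z \<subseteq> K"
  shows "x \<in> PS K as \<Longrightarrow> \<exists>k\<in>K. x - k \<in> pw (PS K as) 1 as Z"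
proof (induction as arbitrary: x)
  case Nil
  then show ?case using Z0 by (intro bexI[of _ x]) auto
next
  case (Cons a as)
  let ?A = "PS K (a # as)" and ?B = "PS K as"
  have sA: "sub ?A ?A" using srng_PS[OF K(1), of "a # as"] by (intro subI) (auto dest: srngD simp del: PS.simps)
  have BA: "?B \<subseteq> ?A" using ser_base[OF srngD(3)[OF srng_PS[OF K(1)]]] by auto
  obtain c y where c: "c \<in> ?B" "y \<in> ?A" "x - (c + a * y) \<in> Z" using ser_tail Cons.prems by (metis PS.simps(2))
  obtain k where k: "k \<in> K" "c - k \<in> pw ?B 1 as Z" using Cons.IH[OF c(1)] by blast
  let ?P = "pw ?A 1 (a # as) Z"
  have sP: "sub ?A ?P" by (rule pw_sub[OF sA idl_sub[OF Z]])
  have "pw ?B 1 as Z \<subseteq> pw ?A 1 as (Z + (*) (a ^ 1) ` ?A)"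
    by (rule pw_mono[OF BA plus_left_subset[OF sub_image[OF sA]]])
  then have "c - k \<in> ?P" using k(2) by auto
  moreover have "a ^ 1 * y \<in> ?P" by (rule pw_mem[OF sA idl_sub[OF Z] _ c(2)]) simp
  moreover have "x - (c + a * y) \<in> ?P" using c(3) pw_superset[OF sA, of Z 1 "a # as"] by blast
  ultimately have "(c - k) + a ^ 1 * y + (x - (c + a * y)) \<in> ?P" by (intro sub_add[OF sP])
  moreover have "(c - k) + a ^ 1 * y + (x - (c + a * y)) = x - k" by simp
  ultimately show ?case using k(1) by (metis (no_types))
qed

text \<open>Factor out \<open>a\<close> as long as the coefficients lie in \<open>Z\<close>. This
  must stop, since otherwise \<open>x\<close> would lie in every \<open>M n\<close> and hence in
  \<open>Z\<close>.\<close>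

lemma ser_leading_term:
  assumes a: "a \<in> M 1" and x: "x \<in> ser S a" "x \<notin> Z"
  shows "\<exists>s c y. c \<in> S \<and> c \<notin> Z \<and> x - a ^ s * (c + a * y) \<in> Z"
proof -
  obtain c y where cy: "y 0 = x" "\<forall>n::nat. c n \<in> S \<and> y n - (c n + a * y (Suc n)) \<in> Z"
    using x(1) unfolding ser_def by blast
  have step: "x - a ^ n * y n \<in> Z" if "\<forall>i<n. c i \<in> Z" for n
    using that
  proof (induction n)
    case 0
    then show ?case using cy(1) Z0 by simp
  next
    case (Suc n)
    have 1: "x - a ^ n * y n \<in> Z" using Suc by simp
    have "(y n - (c n + a * y (Suc n))) + c n \<in> Z" using cy(2) Suc.prems by (intro sub_add[OF Z]) auto
    then have "a ^ n * (y n - a * y (Suc n)) \<in> Z" by (intro idl_mult[OF Z]) simp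
    then have "(x - a ^ n * y n) + a ^ n * (y n - a * y (Suc n)) \<in> Z" by (rule sub_add[OF Z 1])
    then show ?case by (simp add: algebra_simps)
  qed
  have "\<exists>s. c s \<notin> Z"
  proof (rule ccontr)
    assume "\<not> ?thesis"
    then have "x - a ^ n * y n \<in> M n" for n using step ZM by blast
    moreover have "a ^ n * y n \<in> M n" for n using M_power[OF a, of n] idl_mult'[OF M] by simp
    ultimately have "\<forall>n. x \<in> M n" using idl_cong[OF M] by blast
    then show False using sep x(2) by blast
  qed
  then obtain s where s: "c s \<notin> Z" "\<forall>i<s. c i \<in> Z" using exists_least_iff[of "\<lambda>s. c s \<notin> Z"] by blast
  have "(x - a ^ s * y s) + a ^ s * (y s - (c s + a * y (Suc s))) \<in> Z"
    using step[OF s(2)] cy(2) by (intro sub_add[OF Z] idl_mult[OF Z]) auto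
  then have "x - a ^ s * (c s + a * y (Suc s)) \<in> Z" by (simp add: algebra_simps)
  then show ?thesis using s(1) cy(2) by blast
qed

text \<open>Write \<open>x\<close> as \<open>a^s (c + a y)\<close> with \<open>c\<close> outside
  \<open>Z\<close> and split the quotient along multiplication by \<open>a^s\<close>. The part
  modulo \<open>a^s\<close> has one growing parameter fewer. The other part is an image of the
  quotient by \<open>c + a y\<close>; filtering by powers of \<open>a\<close> leaves
  \<open>q\<close> pieces modulo \<open>a\<close>, where \<open>c + a y\<close> becomes
  \<open>c\<close> and the induction hypothesis applies. With no parameters left, \<open>x\<close>
  is a unit modulo \<open>Z\<close>.\<close>

lemma PS_good:
  assumes K: "srng K" "Z \<subseteq> K" "K \<inter> M 1 \<subseteq> Z"
  shows "set as \<subseteq> M 1 \<Longrightarrow> x \<in> PS K as \<Longrightarrow> x \<notin> Z \<Longrightarrow> idl C \<Longrightarrow> Z \<subseteq> C \<Longrightarrow> len (pid 1 as C) UNIV \<noteq> \<infinity> \<Longrightarrow>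
    \<exists>N. \<forall>q\<ge>1. of_nat q * len (pid q as (C + (*) x ` UNIV)) UNIV \<le> of_nat (N * q ^ length as)"
proof (induction as arbitrary: x C)
  case Nil
  then have "x \<notin> M 1" using K(3) by auto
  then obtain y where y: "x * y - 1 \<in> Z" using unit by blast
  have "C + (*) x ` UNIV = UNIV"
  proof -
    have "v \<in> C + (*) x ` UNIV" for v
    proof -
      have "- ((x * y - 1) * v) \<in> C"
        using y Nil.prems(5) idl_uminus[OF Nil.prems(4) idl_mult'[OF Nil.prems(4)]] by blast
      then have "- ((x * y - 1) * v) + x * (y * v) \<in> C + (*) x ` UNIV" by (rule set_plus_intro) simp
      then show ?thesis by (simp add: algebra_simps)
    qed
    then show ?thesis by blast
  qed
  then show ?case by (simp add: slen_self)
next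
  case (Cons a as)
  note C = Cons.prems(4,5)
  let ?a = "\<lambda>k. (*) (a ^ k) ` (UNIV :: 'v set)" and ?n = "length as"
  have a: "a \<in> M 1" using Cons.prems by simp
  obtain s c y where c: "c \<in> PS K as" "c \<notin> Z" "x - a ^ s * (c + a * y) \<in> Z"
    using ser_leading_term[OF a] Cons.prems by (metis PS.simps(2))
  let ?c = "c + a * y"
  have iC: "idl (C + (*) b ` UNIV)" "C \<subseteq> C + (*) b ` UNIV" for b
    using idl_plus[OF C(1) idl_image[OF sub_UNIV]] plus_left_subset[OF idl_image[OF sub_UNIV], of C] by blast+
  have fin: "len (pid 1 as (C + ?a 1)) UNIV \<noteq> \<infinity>" using Cons.prems(6) by simp
  have "Z \<subseteq> C + ?a 1" using C(2) iC(2) by blast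
  then obtain N2 where N2: "\<forall>q\<ge>1. of_nat q * len (pid q as (C + ?a 1 + (*) c ` UNIV)) UNIV \<le> of_nat (N2 * q ^ ?n)"
    using Cons.IH[OF _ c(1,2) iC(1)[of "a ^ 1"] _ fin] Cons.prems(1) by auto
  obtain N1 where N1: "len (pid 1 as (C + ?a 1)) UNIV = of_nat N1"
    using fin by (metis not_infinity_eq of_nat_eq_enat)
  have "of_nat q * len (pid q (a # as) (C + (*) x ` UNIV)) UNIV \<le> of_nat ((s * N1 + N2) * q ^ length (a # as))"
    if q: "q \<ge> 1" for q
  proof -
    let ?D = "pid q as (C + (*) x ` UNIV + ?a q)" and ?W = "pid q as (C + (*) ?c ` UNIV + ?a q)"
    have iD: "idl (C + (*) x ` UNIV + ?a q)" "idl (C + (*) ?c ` UNIV + ?a q)"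
      using idl_plus[OF iC(1) idl_image[OF sub_UNIV]] by blast+
    have D: "idl ?D" "idl ?W" by (rule idl_pid[OF iD(1)], rule idl_pid[OF iD(2)])
    have CD: "C \<subseteq> ?D" "?a q \<subseteq> ?D" "(*) x ` UNIV \<subseteq> ?D"
    proof -
      have sup: "C + (*) x ` UNIV + ?a q \<subseteq> ?D" by (rule pw_superset[OF sub_UNIV])
      have "C + (*) x ` UNIV \<subseteq> C + (*) x ` UNIV + ?a q" by (rule plus_left_subset[OF idl_image[OF sub_UNIV]])
      moreover have "(*) x ` UNIV \<subseteq> C + (*) x ` UNIV" by (rule plus_right_subset[OF C(1)])
      ultimately show "C \<subseteq> ?D" "(*) x ` UNIV \<subseteq> ?D" using sup iC(2)[of x] by blast+
      show "?a q \<subseteq> ?D" using plus_right_subset[OF iC(1)] sup by blast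
    qed
    have xa: "a ^ s * ?c \<in> ?D"
    proof -
      have "x * 1 \<in> ?D" using CD(3) by blast
      then have x: "x \<in> ?D" by simp
      have "x - a ^ s * ?c \<in> ?D" using c(3) C(2) CD(1) by blast
      then have "x - (x - a ^ s * ?c) \<in> ?D" by (rule idl_diff[OF D(1) x])
      then show ?thesis by simp
    qed
    have E: "idl (?D + ?a s)" "?D \<subseteq> ?D + ?a s"
      using idl_plus[OF D(1) idl_image[OF sub_UNIV]] plus_left_subset[OF idl_image[OF sub_UNIV], of ?D] by blast+
    have "len ?D UNIV = len ?D (?D + ?a s) + len (?D + ?a s) UNIV"
      by (rule len_add[OF D(1) E(1) sub_UNIV E(2) subset_UNIV])
    also have "len ?D (?D + ?a s) \<le> len ?W UNIV"
    proof (rule len_image[OF D(2) sub_UNIV D(1) subset_UNIV])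
      have iv: "idl {v. a ^ s * v \<in> ?D}" using idl_colon[OF D(1)] by (simp add: colon_def)
      have "C + (*) ?c ` UNIV + ?a q \<subseteq> {v. a ^ s * v \<in> ?D}"
      proof (intro plus_least[OF iv])
        show "C \<subseteq> {v. a ^ s * v \<in> ?D}" using CD(1) idl_mult[OF D(1)] by blast
        show "?a q \<subseteq> {v. a ^ s * v \<in> ?D}" using CD(2) idl_mult[OF D(1)] by blast
        show "(*) ?c ` UNIV \<subseteq> {v. a ^ s * v \<in> ?D}" using idl_mult'[OF D(1) xa] by (auto simp: mult.assoc)
      qed
      then have "?W \<subseteq> {v. a ^ s * v \<in> ?D}"
      proof (rule pw_least[OF iv])
        fix b r assume "b \<in> set as"
        then have "b ^ q * r \<in> ?D" by (rule pw_mem[OF sub_UNIV iD(1) _ UNIV_I])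
        then show "b ^ q * r \<in> {v. a ^ s * v \<in> ?D}" using idl_mult[OF D(1)] by blast
      qed
      then show "(*) (a ^ s) ` ?W \<subseteq> ?D" by blast
    qed
    also have "len ?W UNIV \<le> of_nat q * len (pid q as (C + ?a 1 + (*) c ` UNIV)) UNIV"
    proof -
      let ?V = "pid q as (C + (*) ?c ` UNIV)"
      have iV: "idl ?V" by (rule idl_pid[OF iC(1)])
      have "?W = ?V + ?a q" by (simp add: pw_plus)
      then have "len ?W UNIV \<le> of_nat q * len (?V + (*) a ` UNIV) UNIV" using len_power[OF iV, of a q] by simp
      also have "len (?V + (*) a ` UNIV) UNIV \<le> len (pid q as (C + ?a 1 + (*) c ` UNIV)) UNIV"
      proof (rule slen_mono)
        have i: "idl (C + (*) ?c ` UNIV + ?a 1)" using idl_plus[OF iC(1) idl_image[OF sub_UNIV]] by blast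
        have sup: "C \<subseteq> C + (*) ?c ` UNIV + ?a 1" "?a 1 \<subseteq> C + (*) ?c ` UNIV + ?a 1" "(*) ?c ` UNIV \<subseteq> C + (*) ?c ` UNIV + ?a 1"
          using plus_left_subset[OF idl_image[OF sub_UNIV], of "C + (*) ?c ` UNIV" "a ^ 1"] iC(2)[of ?c]
            plus_right_subset[OF iC(1), of "?a 1"] plus_right_subset[OF C(1), of "(*) ?c ` UNIV"] by blast+
        have "(*) c ` UNIV \<subseteq> C + (*) ?c ` UNIV + ?a 1"
        proof
          fix v assume "v \<in> (*) c ` UNIV"
          then obtain r where r: "v = c * r" by blast
          have "?c * r - a ^ 1 * (y * r) \<in> C + (*) ?c ` UNIV + ?a 1"
            by (rule idl_diff[OF i]) (use sup(2,3) in blast)+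
          then show "v \<in> C + (*) ?c ` UNIV + ?a 1" using r by (simp add: algebra_simps)
        qed
        then have "C + ?a 1 + (*) c ` UNIV \<subseteq> C + (*) ?c ` UNIV + ?a 1"
          using sup by (intro plus_least[OF i])
        then have "pid q as (C + ?a 1 + (*) c ` UNIV) \<subseteq> pid q as (C + (*) ?c ` UNIV + ?a 1)" by (rule pw_mono[OF order.refl])
        then show "pid q as (C + ?a 1 + (*) c ` UNIV) \<subseteq> ?V + (*) a ` UNIV" by (simp add: pw_plus)
      qed auto
      finally show ?thesis by (simp add: mult_left_mono)
    qed
    also have "len (?D + ?a s) UNIV \<le> of_nat (q ^ ?n) * (of_nat s * of_nat N1)"
    proof -
      have "len (?D + ?a s) UNIV \<le> len (pid q as (C + ?a s)) UNIV"
      proof (rule slen_mono)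
        have "C \<subseteq> C + (*) x ` UNIV + ?a q"
          using iC(2)[of x] plus_left_subset[OF idl_image[OF sub_UNIV], of "C + (*) x ` UNIV" "a ^ q"] by blast
        then show "pid q as (C + ?a s) \<subseteq> ?D + ?a s"
          unfolding pw_plus[of UNIV q as C] by (intro plus_mono pw_mono order.refl)
      qed auto
      also have "\<dots> \<le> of_nat (q ^ ?n) * len (pid 1 as (C + ?a s)) UNIV" by (rule len_pid[OF iC(1)])
      also have "len (pid 1 as (C + ?a s)) UNIV \<le> of_nat s * len (pid 1 as C + ?a 1) UNIV"
        using len_power[OF idl_pid[OF C(1), of 1 as], of a s] by (simp add: pw_plus)
      also have "len (pid 1 as C + ?a 1) UNIV = of_nat N1" using N1 by (simp add: pw_plus)
      finally show ?thesis by (simp add: mult_left_mono)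
    qed
    finally have "len ?D UNIV \<le> of_nat q * len (pid q as (C + ?a 1 + (*) c ` UNIV)) UNIV + of_nat (q ^ ?n) * (of_nat s * of_nat N1)"
      by (simp add: add_mono)
    also have "of_nat q * len (pid q as (C + ?a 1 + (*) c ` UNIV)) UNIV \<le> of_nat (N2 * q ^ ?n)" using N2 q by blast
    finally have "len ?D UNIV \<le> of_nat (N2 * q ^ ?n) + of_nat (q ^ ?n) * (of_nat s * of_nat N1)" by (simp add: add_right_mono)
    also have "\<dots> = of_nat ((s * N1 + N2) * q ^ ?n)" by (simp add: algebra_simps)
    finally have "of_nat q * len ?D UNIV \<le> of_nat q * of_nat ((s * N1 + N2) * q ^ ?n)" by (rule mult_left_mono) simp
    also have "\<dots> = of_nat ((s * N1 + N2) * q ^ length (a # as))" by (simp add: ac_simps)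
    finally show ?thesis by simp
  qed
  then show ?case by blast
qed

end

lemma pid_Span: "idl C \<Longrightarrow> pid 1 bs C = Span UNIV bs + C"
proof (induction bs)
  case (Cons b bs)
  have "pid 1 (b # bs) C = pid 1 bs C + (*) b ` UNIV" by (simp add: pw_plus)
  also have "\<dots> = Span UNIV bs + (*) b ` UNIV + C" using Cons by (simp add: ac_simps)
  also have "Span UNIV bs + (*) b ` UNIV = Span UNIV (b # bs)"
  proof (intro equalityI subsetI)
    fix x assume "x \<in> Span UNIV bs + (*) b ` UNIV"
    then obtain u v where u: "x = u + b * v" "u \<in> Span UNIV bs" by (auto elim!: set_plus_elim)
    then have "v * b + u \<in> Span UNIV (b # bs)" unfolding Span.simps by blast
    then show "x \<in> Span UNIV (b # bs)" using u(1) by (simp add: ac_simps del: Span.simps)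
  next
    fix x assume "x \<in> Span UNIV (b # bs)"
    then obtain s v where x: "x = v + b * s" "v \<in> Span UNIV bs" by (auto simp: ac_simps)
    then show "x \<in> Span UNIV bs + (*) b ` UNIV" by (auto intro: set_plus_intro)
  qed
  finally show ?case .
qed simp

context local_pair
begin

text \<open>Each simple quotient costs one generator, because \<open>A\<close> maps onto the residue
  field.\<close>

lemma finite_generation:
  assumes "idl U" "Z \<subseteq> U" "len U UNIV = enat n"
  shows "\<exists>gs. \<forall>x. x \<in> Span A gs + U"
  using assms
proof (induction n arbitrary: U rule: less_induct)
  case (less n)
  show ?case
  proof (cases "U = UNIV")
    case True
    then show ?thesis by (intro exI[of _ "[]"]) simp
  next
    case False
    then obtain W where W: "idl W" "U \<subset> W" "len U W = 1" "len U UNIV = 1 + len W UNIV"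
      using slen_atom[OF srng_UNIV less.prems(1) sub_UNIV _ less.prems(3)] by auto
    obtain x where x: "x \<in> W" "x \<notin> U" "\<And>y. y \<in> m \<Longrightarrow> y * x \<in> U" "\<And>w. w \<in> W \<Longrightarrow> \<exists>a\<in>A. w - a * x \<in> U"
      using len_atom_structure[OF less.prems(1) W(1,2,3) less.prems(2)] by blast
    obtain k where k: "len W UNIV = enat k" "n = Suc k"
      using W(4) less.prems(3) by (cases "len W UNIV") (auto simp: one_enat_def)
    obtain gs where gs: "\<forall>x. x \<in> Span A gs + W" using less.IH[of k W] k W less.prems by auto
    have "y \<in> Span A (x # gs) + U" for y
    proof -
      obtain v w where vw: "y = v + w" "v \<in> Span A gs" "w \<in> W" using spec[OF gs, of y] by (rule set_plus_elim)
      obtain a where a: "a \<in> A" "w - a * x \<in> U" using x(4)[OF vw(3)] by blast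
      have "a * x + v \<in> Span A (x # gs)" using a vw by auto
      then have "(a * x + v) + (w - a * x) \<in> Span A (x # gs) + U" using a(2) by (rule set_plus_intro)
      then show ?thesis using vw(1) by (simp add: ac_simps)
    qed
    then show ?thesis by blast
  qed
qed

end

section \<open>Finiteness over the power series subring\<close>

context complete_ring
begin

lemma series_limit:
  assumes a: "a \<in> M 1"
  shows "\<exists>Y. \<forall>m. Y m - (u m + a * Y (Suc m)) \<in> Z"
proof -
  define f where "f m N = (\<Sum>i<N. u (m + i) * a ^ i)" for m N :: nat
  have aM: "a ^ n \<in> M n" for n using M_power[OF a, of n] by simp
  have "\<exists>g. \<forall>N. g - f m N \<in> M N" for m
    by (rule lim) (use idl_mult[OF M aM] in \<open>simp add: f_def\<close>)
  then obtain Y where Y: "\<forall>m N. Y m - f m N \<in> M N" by metis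
  have "Y m - (u m + a * Y (Suc m)) \<in> M N" for m N
  proof -
    have 1: "Y m - f m (Suc N) \<in> M N" using Y M_Suc by blast
    have 2: "a * (Y (Suc m) - f (Suc m) N) \<in> M N" using Y by (intro idl_mult[OF M]) blast
    have "f m (Suc N) = u m + (\<Sum>i<N. u (m + Suc i) * a ^ Suc i)" unfolding f_def by (subst sum.lessThan_Suc_shift) simp
    also have "(\<Sum>i<N. u (m + Suc i) * a ^ Suc i) = a * f (Suc m) N"
      by (simp add: f_def sum_distrib_left ac_simps)
    finally have "f m (Suc N) = u m + a * f (Suc m) N" .
    then have "Y m - (u m + a * Y (Suc m)) = (Y m - f m (Suc N)) - a * (Y (Suc m) - f (Suc m) N)"
      by (simp add: algebra_simps)
    then show ?thesis using idl_diff[OF M 1 2] by (simp only:)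
  qed
  then show ?thesis using sep by blast
qed

lemma series_span:
  assumes a: "a \<in> M 1" and S: "srng S"
  shows "\<forall>n. v n \<in> Span S gs \<Longrightarrow> \<exists>Y. \<forall>n. Y n \<in> Span (ser S a) gs \<and> Y n - (v n + a * Y (Suc n)) \<in> Z"
proof (induction gs arbitrary: v)
  case Nil
  then show ?case using Z0 by (intro exI[of _ "\<lambda>_. 0"]) auto
next
  case (Cons g gs)
  then have "\<forall>n. \<exists>s v'. v n = s * g + v' \<and> s \<in> S \<and> v' \<in> Span S gs" by auto
  then obtain s v' where v: "\<forall>n. v n = s n * g + v' n \<and> s n \<in> S \<and> v' n \<in> Span S gs" by metis
  then obtain Y where Y: "\<forall>n. Y n \<in> Span (ser S a) gs \<and> Y n - (v' n + a * Y (Suc n)) \<in> Z" using Cons.IH[of v'] by blast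
  obtain W where W: "\<forall>m. W m - (s m + a * W (Suc m)) \<in> Z" using series_limit[OF a, of s] by blast
  have "W n \<in> ser S a" for n
    unfolding ser_def
    by (rule CollectI, rule exI[of _ "\<lambda>i. s (n + i)"], rule exI[of _ "\<lambda>i. W (n + i)"]) (use v W in auto)
  then have "W n * g + Y n \<in> Span (ser S a) (g # gs)" for n using Y by auto
  moreover have "W n * g + Y n - (v n + a * (W (Suc n) * g + Y (Suc n))) \<in> Z" for n
  proof -
    have "(W n - (s n + a * W (Suc n))) * g + (Y n - (v' n + a * Y (Suc n))) \<in> Z"
      using W Y by (intro sub_add[OF Z] idl_mult'[OF Z]) auto
    moreover have "v n = s n * g + v' n" using v by blast
    ultimately show ?thesis by (simp add: algebra_simps)
  qed
  ultimately show ?case by (intro exI[of _ "\<lambda>n. W n * g + Y n"]) blast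
qed

text \<open>Write \<open>x\<close> as \<open>v + w + a x'\<close> and repeat with \<open>x'\<close>.
  The terms \<open>v\<close> sum to a combination of \<open>gs\<close> with power series
  coefficients, the terms \<open>w\<close> sum inside the ideal of \<open>bs\<close>, and the
  remainder lies in every \<open>M n\<close>. Thus \<open>a\<close> moves from the ideal into the
  coefficients.\<close>

lemma ser_span:
  assumes a: "a \<in> M 1" and S: "srng S"
    and all: "\<forall>x. x \<in> Span S gs + pid 1 (a # bs) Z"
  shows "\<forall>x. x \<in> Span (ser S a) gs + pid 1 bs Z"
proof
  fix x0
  have "\<exists>v w y. v \<in> Span S gs \<and> w \<in> Span UNIV bs \<and> x - (v + w + a * y) \<in> Z" for x
  proof -
    obtain v u where vu: "x = v + u" "v \<in> Span S gs" "u \<in> pid 1 (a # bs) Z" using spec[OF all, of x] by (rule set_plus_elim)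
    then obtain w' z where w': "u = w' + z" "w' \<in> Span UNIV (a # bs)" "z \<in> Z"
      unfolding pid_Span[OF Z] by (auto elim!: set_plus_elim)
    then obtain y w where "w' = y * a + w" "w \<in> Span UNIV bs" by auto
    then show ?thesis using vu w' by (intro exI[of _ v] exI[of _ w] exI[of _ y]) (simp add: algebra_simps)
  qed
  then obtain V W N where VW: "\<forall>x. V x \<in> Span S gs \<and> W x \<in> Span UNIV bs \<and> x - (V x + W x + a * N x) \<in> Z" by metis
  define y where "y n = (N ^^ n) x0" for n
  obtain P where P: "\<forall>n. P n \<in> Span (ser S a) gs \<and> P n - (V (y n) + a * P (Suc n)) \<in> Z"
    using series_span[OF a S, of "\<lambda>n. V (y n)" gs] VW by blast
  obtain R where R: "\<forall>n. R n \<in> Span (ser UNIV a) bs \<and> R n - (W (y n) + a * R (Suc n)) \<in> Z"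
    using series_span[OF a srng_UNIV, of "\<lambda>n. W (y n)" bs] VW by blast
  define E where "E n = y n - P n - R n" for n
  have E: "E n - a * E (Suc n) \<in> Z" for n
  proof -
    have 1: "y n - (V (y n) + W (y n) + a * y (Suc n)) \<in> Z" using VW by (simp add: y_def)
    have "(y n - (V (y n) + W (y n) + a * y (Suc n))) - (P n - (V (y n) + a * P (Suc n))) - (R n - (W (y n) + a * R (Suc n))) \<in> Z"
      by (rule idl_diff[OF Z idl_diff[OF Z 1]]) (use P R in blast)+
    then show ?thesis unfolding E_def by (simp add: algebra_simps)
  qed
  have "E 0 - a ^ n * E n \<in> Z" for n
  proof (induction n)
    case (Suc n)
    have "(E 0 - a ^ n * E n) + a ^ n * (E n - a * E (Suc n)) \<in> Z" by (rule sub_add[OF Z Suc idl_mult[OF Z E]])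
    then show ?case by (simp add: algebra_simps)
  qed (use Z0 in simp)
  moreover have "a ^ n * E n \<in> M n" for n using M_power[OF a, of n] idl_mult'[OF M] by simp
  ultimately have "\<forall>n. E 0 \<in> M n" using ZM idl_cong[OF M] by blast
  then have E0: "E 0 \<in> Z" by (rule sep)
  have "R 0 \<in> Span UNIV bs" using R Span_mono[of "ser UNIV a" UNIV bs] by blast
  then have "R 0 + E 0 \<in> pid 1 bs Z" unfolding pid_Span[OF Z] using E0 by (rule set_plus_intro)
  then have "P 0 + (R 0 + E 0) \<in> Span (ser S a) gs + pid 1 bs Z" using P by (intro set_plus_intro) blast+
  moreover have "P 0 + (R 0 + E 0) = x0" by (simp add: E_def y_def)
  ultimately show "x0 \<in> Span (ser S a) gs + pid 1 bs Z" by simp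
qed

lemma PS_span:
  assumes K: "srng K"
  shows "set as \<subseteq> M 1 \<Longrightarrow> \<forall>x. x \<in> Span K gs + pid 1 (as @ bs) Z \<Longrightarrow> \<forall>x. x \<in> Span (PS K as) gs + pid 1 bs Z"
proof (induction as arbitrary: bs)
  case (Cons a as)
  have eq: "pid 1 ((a # as) @ bs) Z = pid 1 (as @ (a # bs)) Z"
    by (simp add: pw_append pw_plus)
  have "\<forall>x. x \<in> Span K gs + pid 1 (as @ (a # bs)) Z" using Cons.prems(2) unfolding eq .
  then have *: "\<forall>x. x \<in> Span (PS K as) gs + pid 1 (a # bs) Z"
    by (rule Cons.IH[rotated]) (use Cons.prems(1) in simp)
  show ?case unfolding PS.simps by (rule ser_span[OF _ srng_PS[OF K] *]) (use Cons.prems(1) in simp)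
qed simp

text \<open>The quotient by the parameters has finite length, so finitely many elements span it over
  a coefficient field. By completeness the same elements span the ring over the power series in the
  parameters.\<close>

lemma exists_fin_alg:
  assumes as: "set as \<subseteq> M 1" and fin: "len (pid 1 as Z) UNIV \<noteq> \<infinity>"
    and red: "\<And>x. x * x \<in> Z \<Longrightarrow> x \<in> Z"
  shows "\<exists>A gs. fin_alg Z A (M 1) gs as p"
proof -
  obtain K where K: "srng K" "Z \<subseteq> K" "K \<inter> M 1 \<subseteq> Z" "\<forall>x. \<exists>k\<in>K. x - k \<in> M 1" using coefficient_field by blast
  interpret KP: local_pair Z K "M 1"
  proof
    show "\<exists>y. x * y - 1 \<in> Z" if "x \<notin> M 1" for x by (rule unit[OF that])
    show "\<exists>k\<in>K. x - k \<in> M 1" for x using K(4) by blast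
  qed (fact Z K M ZM one)+
  obtain n where "len (pid 1 as Z) UNIV = enat n" using fin by auto
  then obtain gs where gs: "\<forall>x. x \<in> Span K gs + pid 1 as Z"
    using KP.finite_generation[OF idl_pid[OF Z] pw_superset[OF sub_UNIV]] by blast
  let ?A = "PS K as"
  have A: "srng ?A" "K \<subseteq> ?A" by (rule srng_PS[OF K(1)], rule PS_superset[OF K(1)])
  have sA: "sub ?A ?A" using A(1) by (intro subI) (auto dest: srngD)
  have span: "\<forall>x. x \<in> Span ?A gs + pid 1 [] Z" by (rule PS_span[OF K(1) as]) (use gs in simp)
  have "fin_alg Z ?A (M 1) gs as p"
  proof
    show "\<exists>a\<in>?A. x - a \<in> M 1" for x using K(4) A(2) by blast
    show "x \<in> Span ?A gs + Z" for x using span by simp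
    show "set as \<subseteq> ?A" by (rule PS_vars[OF K(1)])
    show "x \<in> pw ?A 1 as Z" if x: "x \<in> ?A" "x \<in> M 1" for x
    proof -
      obtain k where k: "k \<in> K" "x - k \<in> pw ?A 1 as Z" using PS_constant_term[OF K(1,2) x(1)] by blast
      have "pw ?A 1 as Z \<subseteq> M 1"
        by (rule pw_least[OF M ZM]) (use as in \<open>auto intro!: idl_mult'[OF M]\<close>)
      then have "x - k \<in> M 1" using k(2) by blast
      then have "k \<in> M 1" using idl_cong[OF M] x(2) by blast
      then have "k \<in> pw ?A 1 as Z" using k(1) K(3) pw_superset[OF sA, of Z 1 as] by blast
      then have "(x - k) + k \<in> pw ?A 1 as Z" by (rule sub_add[OF pw_sub[OF sA idl_sub[OF Z]] k(2)])
      then show ?thesis by simp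
    qed
    show "\<exists>N. \<forall>q\<ge>1. of_nat q * len (pid q as (Z + (*) c ` UNIV)) UNIV \<le> of_nat (N * q ^ length as)"
      if "c \<in> ?A" "c \<notin> Z" for c
      by (rule PS_good[OF K(1-3) as that Z order.refl fin])
    show "Z \<subseteq> ?A" using K(2) A(2) by blast
    show "\<exists>y. x * y - 1 \<in> Z" if "x \<notin> M 1" for x by (rule unit[OF that])
    show "x \<in> Z" if "x * x \<in> Z" for x by (rule red[OF that])
  qed (fact Z A(1) M ZM one p pZ as fin)+
  then show ?thesis by blast
qed

end

section \<open>Noetherian local rings modulo a base ideal\<close>

definition prd :: "'t::comm_ring_1 set \<Rightarrow> 't set \<Rightarrow> 't set \<Rightarrow> 't set" where
  "prd Z I J = gen UNIV ({i * j | i j. i \<in> I \<and> j \<in> J} \<union> Z)"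

lemma idl_prd: "idl (prd Z I J)" by (simp add: prd_def sub_gen)

lemma prd_superset: "Z \<subseteq> prd Z I J" "i \<in> I \<Longrightarrow> j \<in> J \<Longrightarrow> i * j \<in> prd Z I J"
proof -
  show "Z \<subseteq> prd Z I J" unfolding prd_def using gen_superset by blast
  show "i \<in> I \<Longrightarrow> j \<in> J \<Longrightarrow> i * j \<in> prd Z I J" unfolding prd_def by (rule gen_inc) blast
qed

lemma prd_least: "idl U \<Longrightarrow> Z \<subseteq> U \<Longrightarrow> (\<And>i j. i \<in> I \<Longrightarrow> j \<in> J \<Longrightarrow> i * j \<in> U) \<Longrightarrow> prd Z I J \<subseteq> U"
  unfolding prd_def by (rule gen_minimal) auto

lemma prd_mono: "I \<subseteq> I' \<Longrightarrow> J \<subseteq> J' \<Longrightarrow> prd Z I J \<subseteq> prd Z I' J'"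
  unfolding prd_def by (rule gen_mono) blast

lemma gen_set_pid: assumes "idl Z" shows "gen UNIV (set xs \<union> Z) = pid 1 xs Z"
proof
  have "x \<in> pid 1 xs Z" if "x \<in> set xs" for x
    using pw_mem[OF sub_UNIV assms that UNIV_I[of 1], of 1] by simp
  then show "gen UNIV (set xs \<union> Z) \<subseteq> pid 1 xs Z"
    using pw_superset[OF sub_UNIV, of Z 1 xs] by (intro gen_minimal idl_pid assms) auto
  show "pid 1 xs Z \<subseteq> gen UNIV (set xs \<union> Z)"
  proof (rule pw_least[OF sub_gen])
    show "Z \<subseteq> gen UNIV (set xs \<union> Z)" using gen_superset by blast
    show "x ^ 1 * b \<in> gen UNIV (set xs \<union> Z)" if "x \<in> set xs" for x b
      using idl_mult'[OF sub_gen gen_inc, of x "set xs \<union> Z" b] that by simp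
  qed
qed

text \<open>The local ring is the whole type modulo \<open>K\<close>, and \<open>W n\<close> is the
  \<open>n\<close>-th power of its maximal ideal \<open>W 1\<close>.\<close>

locale noeth_local =
  fixes K :: "'t::comm_ring_1 set" and W :: "nat \<Rightarrow> 't set" and p :: nat
  assumes K: "idl K" and W: "idl (W n)" and W0: "W 0 = UNIV" and KW: "K \<subseteq> W n"
    and W_Suc: "W (Suc n) = prd K (W n) (W 1)"
    and noeth: "idl U \<Longrightarrow> K \<subseteq> U \<Longrightarrow> \<exists>Y. finite Y \<and> U = gen UNIV (Y \<union> K)"
    and unit: "x \<notin> W 1 \<Longrightarrow> \<exists>y. x * y - 1 \<in> K" and one: "1 \<notin> W 1"
    and p: "Factorial_Ring.prime p" and pK: "of_nat p \<in> K"
begin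

lemma W_step: "W (Suc n) \<subseteq> W n"
  unfolding W_Suc by (rule prd_least[OF W KW]) (rule idl_mult'[OF W])

lemma W_antimono: "i \<le> j \<Longrightarrow> W j \<subseteq> W i"
  by (rule lift_Suc_antimono_le[of W]) (use W_step in auto)

lemma W_mult: "x \<in> W i \<Longrightarrow> y \<in> W j \<Longrightarrow> x * y \<in> W (i + j)"
proof (induction j arbitrary: y)
  case 0
  then show ?case using idl_mult'[OF W] by simp
next
  case (Suc j)
  have "W (Suc j) \<subseteq> colon (W (i + Suc j)) x"
    unfolding W_Suc[of j]
  proof (rule prd_least[OF idl_colon[OF W]])
    show "K \<subseteq> colon (W (i + Suc j)) x"
      unfolding colon_def using idl_mult[OF W] KW[of "i + Suc j"] by (auto dest: subsetD)
    fix a b assume "a \<in> W j" "b \<in> W 1"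
    then have "x * a * b \<in> W (Suc (i + j))"
      unfolding W_Suc using Suc by (intro prd_superset(2)) auto
    then show "a * b \<in> colon (W (i + Suc j)) x" by (simp add: colon_def mult.assoc)
  qed
  then show ?case using Suc.prems by (auto simp: colon_def)
qed

lemma W_power: "x \<in> W 1 \<Longrightarrow> x ^ n \<in> W n"
  using W_mult[of x 1] by (induction n) (auto simp: W0)

lemma W_split: "W (n + s) \<subseteq> prd K (W n) (W s)"
proof (induction s)
  case 0
  show ?case using prd_superset(2)[of _ "W n" 1 "W 0" K] W0 by auto
next
  case (Suc s)
  have "W (n + Suc s) = prd K (W (n + s)) (W 1)" using W_Suc[of "n + s"] by simp
  also have "\<dots> \<subseteq> prd K (prd K (W n) (W s)) (W 1)" by (rule prd_mono[OF Suc order.refl])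
  also have "\<dots> \<subseteq> prd K (W n) (W (Suc s))"
  proof (rule prd_least[OF idl_prd prd_superset(1)])
    fix i c assume i: "i \<in> prd K (W n) (W s)" and c: "c \<in> W 1"
    have "prd K (W n) (W s) \<subseteq> colon (prd K (W n) (W (Suc s))) c"
    proof (rule prd_least[OF idl_colon[OF idl_prd]])
      show "K \<subseteq> colon (prd K (W n) (W (Suc s))) c"
        unfolding colon_def using idl_mult[OF K] prd_superset(1)[of K "W n" "W (Suc s)"] by (auto dest: subsetD)
      fix a b assume ab: "a \<in> W n" "b \<in> W s"
      have "a * (b * c) \<in> prd K (W n) (W (Suc s))"
        using W_mult[OF ab(2) c] ab by (intro prd_superset(2)) auto
      then show "a * b \<in> colon (prd K (W n) (W (Suc s))) c" by (simp add: colon_def mult_ac)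
    qed
    then show "i * c \<in> prd K (W n) (W (Suc s))" using i by (auto simp: colon_def mult.commute)
  qed
  finally show ?case .
qed

lemma fg: assumes "idl U" "K \<subseteq> U" obtains ys where "U = pid 1 ys K" "set ys \<subseteq> U"
proof -
  obtain Y where Y: "finite Y" "U = gen UNIV (Y \<union> K)" using noeth[OF assms] by blast
  obtain ys where ys: "set ys = Y" using finite_list[OF Y(1)] by blast
  have "U = pid 1 ys K" using Y(2) gen_set_pid[OF K, of ys] ys by simp
  moreover have "set ys \<subseteq> U" using Y(2) gen_superset ys by blast
  ultimately show thesis by (rule that)
qed

lemma W_products:
  assumes ys: "W 1 = pid 1 ys K"
    and U: "idl U" "K \<subseteq> U" "\<And>zs. set zs \<subseteq> set ys \<Longrightarrow> length zs = n \<Longrightarrow> prod_list zs \<in> U"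
  shows "W n \<subseteq> U"
  using U
proof (induction n arbitrary: U)
  case 0
  then have "1 \<in> U" using "0.prems"(3)[of "[]"] by simp
  then show ?case using idl_mult[OF "0.prems"(1), of 1] by auto
next
  case (Suc n)
  have y: "W n \<subseteq> colon U y" if "y \<in> set ys" for y
  proof (rule Suc.IH[OF idl_colon[OF Suc.prems(1)]])
    show "K \<subseteq> colon U y" unfolding colon_def using idl_mult[OF K] Suc.prems(2) by (auto dest: subsetD)
    show "prod_list zs \<in> colon U y" if "set zs \<subseteq> set ys" "length zs = n" for zs
      using Suc.prems(3)[of "y # zs"] that \<open>y \<in> set ys\<close> by (simp add: colon_def)
  qed
  show ?case
    unfolding W_Suc[of n]
  proof (rule prd_least[OF Suc.prems(1,2)])
    fix a c assume a: "a \<in> W n" and c: "c \<in> W 1"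
    have "pid 1 ys K \<subseteq> colon U a"
    proof (rule pw_least[OF idl_colon[OF Suc.prems(1)]])
      show "K \<subseteq> colon U a" unfolding colon_def using idl_mult[OF K] Suc.prems(2) by (auto dest: subsetD)
      fix x b assume "x \<in> set ys"
      then have "x * a \<in> U" using y[of x] a by (auto simp: colon_def)
      then have "b * (x * a) \<in> U" by (rule idl_mult[OF Suc.prems(1)])
      then show "x ^ 1 * b \<in> colon U a" by (simp add: colon_def mult_ac)
    qed
    then show "a * c \<in> U" using c ys by (auto simp: colon_def)
  qed
qed

lemma count_le_imp_power_dvd: "(x :: 't) ^ count_list zs x dvd prod_list zs"
proof (induction zs)
  case (Cons z zs)
  then show ?case by (cases "z = x") (auto intro: mult_dvd_mono dvd_mult)
qed simp

text \<open>A product of sufficiently many generators contains one generator to a high power.\<close>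

lemma W_le_if_radical:
  assumes U: "idl U" "K \<subseteq> U" and rad: "\<And>x. x \<in> W 1 \<Longrightarrow> \<exists>s. x ^ s \<in> U"
  shows "\<exists>n. W n \<subseteq> U"
proof -
  obtain ys where ys: "W 1 = pid 1 ys K" "set ys \<subseteq> W 1" using fg[OF W KW] by blast
  have "\<forall>y\<in>set ys. \<exists>s. y ^ s \<in> U" using rad ys(2) by blast
  then obtain s where s: "\<forall>y\<in>set ys. y ^ s y \<in> U" by (rule bchoice[THEN exE])
  define S where "S = sum s (set ys)"
  have "W (Suc S) \<subseteq> U"
  proof (rule W_products[OF ys(1) U])
    fix zs assume zs: "set zs \<subseteq> set ys" "length zs = Suc S"
    have "(\<Sum>y\<in>set ys. count_list zs y) = (\<Sum>y\<in>set zs. count_list zs y)"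
      by (rule sum.mono_neutral_right) (use zs(1) in \<open>auto simp: count_list_0_iff\<close>)
    also have "\<dots> = Suc S" using sum_count_set[of zs "set zs"] zs(2) by simp
    finally have "(\<Sum>y\<in>set ys. count_list zs y) > sum s (set ys)" by (simp add: S_def)
    then obtain y where y: "y \<in> set ys" "s y \<le> count_list zs y"
      by (metis linorder_not_le nat_less_le sum_mono)
    have "y ^ s y dvd prod_list zs" using le_imp_power_dvd[OF y(2)] count_le_imp_power_dvd dvd_trans by blast
    then show "prod_list zs \<in> U" using idl_mult'[OF U(1)] s y(1) by (auto elim!: dvdE)
  qed
  then show ?thesis by blast
qed

lemma len_W1: "len (W 1) UNIV \<le> 1"
proof (rule slen_simple[OF srng_UNIV W sub_UNIV])
  fix y assume "y \<notin> W 1"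
  then obtain z where z: "y * z - 1 \<in> K" using unit by blast
  let ?G = "gen UNIV (insert y (W 1))"
  have "y * z \<in> ?G" by (rule idl_mult'[OF sub_gen gen_inc]) simp
  moreover have "y * z - 1 \<in> ?G" by (rule gen_inc) (use z KW[of 1] in auto)
  ultimately have "y * z - (y * z - 1) \<in> ?G" by (rule idl_diff[OF sub_gen])
  then have "1 \<in> ?G" by simp
  then show "UNIV \<subseteq> ?G" using idl_mult[OF sub_gen, of 1 "insert y (W 1)"] by auto
qed

lemma len_W_finite: "len (W n) UNIV \<noteq> \<infinity>"
proof (induction n)
  case (Suc n)
  obtain ys where ys: "W n = pid 1 ys K" "set ys \<subseteq> W n" using fg[OF W KW] by blast
  have "pw (W 1) 1 ys K \<subseteq> W (Suc n)"
  proof (rule pw_least[OF W KW])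
    show "x ^ 1 * b \<in> W (Suc n)" if "x \<in> set ys" "b \<in> W 1" for x b
      using W_mult[of x n b 1] that ys(2) by auto
  qed
  then have "len (W (Suc n)) (W n) \<le> len (pw (W 1) 1 ys K) (pid 1 ys K)"
    by (intro slen_mono) (use ys in auto)
  also have "\<dots> \<le> of_nat (length ys) * len (W 1) UNIV" by (rule len_ideal_multiple_upper[OF K W])
  finally have "len (W (Suc n)) (W n) \<noteq> \<infinity>"
    by (rule enat_finite_mono[OF _ of_nat_mult_finite]) (use len_W1 in \<open>cases "len (W 1) UNIV"; simp\<close>)
  moreover have "len (W (Suc n)) UNIV = len (W (Suc n)) (W n) + len (W n) UNIV"
    by (rule len_add[OF W W sub_UNIV W_step subset_UNIV])
  ultimately show ?case using Suc by (metis plus_eq_infty_iff_enat)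
qed (simp add: W0 slen_self)

lemma len_finite: "W n \<subseteq> U \<Longrightarrow> len U UNIV \<noteq> \<infinity>"
  using enat_finite_mono[OF slen_mono[of "W n" U UNIV UNIV UNIV UNIV] len_W_finite] by simp

lemma br_mprimary:
  assumes I: "idl I" "K \<subseteq> I" "W c \<subseteq> I" and q: "q \<ge> 1" shows "\<exists>n. W n \<subseteq> br K I q"
proof (rule W_le_if_radical[OF idl_br br_superset(1)])
  show "\<exists>s. x ^ s \<in> br K I q" if "x \<in> W 1" for x
    using br_superset(2)[of "x ^ c" I q K] W_power[OF that, of c] I(3) by (auto simp flip: power_mult)
qed

end

section \<open>Completions\<close>

text \<open>\<open>ap v n t\<close> means that the element \<open>v\<close> of the completion is congruent to \<open>t\<close> modulo the
  \<open>n\<close>-th power of the maximal ideal.\<close>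

locale adic = noeth_local K W p
  for K :: "'t::comm_ring_1 set" and W p +
  fixes ap :: "'v::comm_ring_1 \<Rightarrow> nat \<Rightarrow> 't \<Rightarrow> bool"
  assumes ap_ex: "\<exists>t. ap v n t" and ap_cong: "ap v n s \<Longrightarrow> ap v n t \<longleftrightarrow> t - s \<in> W n"
    and ap_add: "ap v n s \<Longrightarrow> ap w n t \<Longrightarrow> ap (v + w) n (s + t)"
    and ap_mult: "ap v n s \<Longrightarrow> ap w n t \<Longrightarrow> ap (v * w) n (s * t)"
    and ap_zero: "ap 0 n 0" and ap_one: "ap 1 n 1"
    and ap_Suc: "ap v (Suc n) t \<Longrightarrow> ap v n t"
    and ap_lim: "\<forall>n. f (Suc n) - f n \<in> W n \<Longrightarrow> \<exists>v. \<forall>n. ap v n (f n)"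
    and red: "\<forall>n. ap (v * v) n 0 \<Longrightarrow> \<forall>n. ap v n 0"
begin

definition "M n = {v. ap v n 0}"
definition "Z = {v. \<forall>n. ap v n 0}"

lemma ap_uminus: assumes "ap v n s" shows "ap (- v) n (- s)"
proof -
  obtain t where t: "ap (- v) n t" using ap_ex by blast
  have "s + t - 0 \<in> W n" using ap_cong[OF ap_zero] ap_add[OF assms t] by simp
  then have "- s - t \<in> W n" using idl_uminus[OF W] by fastforce
  then show ?thesis using ap_cong[OF t] by simp
qed

lemma ap_diff: "ap v n s \<Longrightarrow> ap w n t \<Longrightarrow> ap (v - w) n (s - t)"
  using ap_add[OF _ ap_uminus, of v n s w t] by simp

lemma ap_sum: "(\<And>i. i \<in> I \<Longrightarrow> ap (f i) n (g i)) \<Longrightarrow> ap (sum f I) n (sum g I)"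
  by (induction I rule: infinite_finite_induct) (auto intro: ap_zero ap_add)

lemma ap_of_nat: "ap (of_nat k) n (of_nat k)"
  by (induction k) (auto intro: ap_zero ap_one ap_add)

lemma ap_power: "ap v n s \<Longrightarrow> ap (v ^ k) n (s ^ k)"
  by (induction k) (auto intro: ap_one ap_mult)

lemma ap_le: "n \<le> n' \<Longrightarrow> ap v n' t \<Longrightarrow> ap v n t"
  by (induction rule: inc_induct) (auto intro: ap_Suc)

lemma ap_0_iff: "ap v n s \<Longrightarrow> ap v n 0 \<longleftrightarrow> s \<in> W n"
  using ap_cong[of v n s 0] idl_uminus[OF W, of s n] idl_uminus[OF W, of "- s" n] by auto

lemma complete: "complete_ring Z M p"
proof
  show M: "idl (M n)" for n
  proof (rule subI)
    show "0 \<in> M n" by (simp add: M_def ap_zero)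
    show "x + y \<in> M n" if "x \<in> M n" "y \<in> M n" for x y using that ap_add[of x n 0 y 0] by (simp add: M_def)
    fix s x assume x: "x \<in> M n"
    obtain t where "ap s n t" using ap_ex by blast
    then show "s * x \<in> M n" using ap_mult[of s n t x 0] x by (simp add: M_def)
  qed
  have Z: "Z = (\<Inter>n. M n)" by (auto simp: Z_def M_def)
  show "idl Z" unfolding Z by (rule sub_Inter) (use M in auto)
  show "M 0 = UNIV" using ap_ex[of _ 0] ap_0_iff[of _ 0] W0 by (auto simp: M_def)
  show "M (Suc n) \<subseteq> M n" for n using ap_Suc by (auto simp: M_def)
  show "Z \<subseteq> M n" for n by (auto simp: Z)
  show "x \<in> Z" if "\<forall>n. x \<in> M n" for x using that by (simp add: Z)
  show "x * y \<in> M (i + j)" if x: "x \<in> M i" and y: "y \<in> M j" for x y i j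
  proof -
    obtain s t where st: "ap x (i + j) s" "ap y (i + j) t" using ap_ex by blast
    then have "ap x i s" "ap y j t" using ap_le by (metis le_add1 le_add2)+
    then have "s \<in> W i" "t \<in> W j" using x y ap_0_iff by (auto simp: M_def)
    then show ?thesis using W_mult ap_0_iff[OF ap_mult[OF st]] by (simp add: M_def)
  qed
  show "\<exists>g. \<forall>n. g - f n \<in> M n" if f: "\<forall>n. f (Suc n) - f n \<in> M n" for f
  proof -
    have "\<forall>n. \<exists>t. ap (f n) n t" using ap_ex by blast
    then obtain t where t: "\<forall>n. ap (f n) n (t n)" by (rule choice[THEN exE])
    have "t (Suc n) - t n \<in> W n" for n
    proof -
      have "ap (f n + (f (Suc n) - f n)) n (t n + 0)" using t f by (intro ap_add) (auto simp: M_def)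
      then show ?thesis using ap_cong[of "f (Suc n)" n "t n" "t (Suc n)"] ap_Suc t by simp
    qed
    then obtain g where g: "\<forall>n. ap g n (t n)" using ap_lim[of t] by blast
    have "g - f n \<in> M n" for n using ap_diff[of g n "t n" "f n" "t n"] g t by (simp add: M_def)
    then show ?thesis by blast
  qed
  show "\<exists>y. x * y - 1 \<in> Z" if x: "x \<notin> M 1" for x
  proof -
    \<comment> \<open>Level \<open>Suc n\<close> instead of \<open>n\<close> makes even
      \<open>t 0\<close> correct modulo \<open>W 1\<close>, so that every \<open>t n\<close> is a
      unit.\<close>
    have "\<forall>n. \<exists>t. ap x (Suc n) t" using ap_ex by blast
    then obtain t where t: "\<forall>n. ap x (Suc n) (t n)" by (rule choice[THEN exE])
    then have tn: "ap x n (t n)" "ap x n (t (Suc n))" for n using ap_Suc by blast+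
    have "t n \<notin> W 1" for n
    proof -
      have "ap x 1 (t n)" using t ap_le[of 1 "Suc n"] by simp
      then show ?thesis using x ap_0_iff[of x 1 "t n"] by (simp add: M_def)
    qed
    then have "\<forall>n. \<exists>y. t n * y - 1 \<in> K" using unit by blast
    then obtain y where y: "\<forall>n. t n * y n - 1 \<in> K" by (rule choice[THEN exE])
    have "y (Suc n) - y n \<in> W n" for n
    proof -
      have 1: "t n * y n - 1 \<in> W n" "t (Suc n) * y (Suc n) - 1 \<in> W n" using y KW by blast+
      have 2: "t (Suc n) - t n \<in> W n" using ap_cong[OF tn(1)] tn(2) by blast
      have "y (Suc n) - y n = y n * (t (Suc n) * y (Suc n) - 1) - y (Suc n) * (t n * y n - 1)
          - (y n * y (Suc n)) * (t (Suc n) - t n)" by (simp add: algebra_simps)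
      then show ?thesis using idl_mult[OF W] 1 2 by (simp only:) (intro idl_diff[OF W]; blast)
    qed
    then obtain v where v: "\<forall>n. ap v n (y n)" using ap_lim[of y] by blast
    have "ap (x * v - 1) n 0" for n
    proof -
      have "ap (x * v - 1) n (t n * y n - 1)" using v tn by (intro ap_diff ap_mult ap_one) auto
      then show ?thesis using ap_0_iff y KW[of n] by blast
    qed
    then show ?thesis by (auto simp: Z_def)
  qed
  show "1 \<notin> M 1" using ap_0_iff[OF ap_one, of 1] one by (simp add: M_def)
  show "of_nat p \<in> Z" using ap_0_iff[OF ap_of_nat] pK KW by (auto simp: Z_def)
qed (rule p)

sublocale C: complete_ring Z M p by (rule complete)

text \<open>The canonical map to the completion. Its values are chosen among elements that agree
  modulo \<open>Z\<close>, so it respects the ring operations modulo \<open>Z\<close> only.\<close>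

definition "j t = (SOME v. \<forall>n. ap v n t)"

lemma ap_j: "ap (j t) n t"
proof -
  have "\<exists>v. \<forall>n. ap v n t" using ap_lim[of "\<lambda>_. t"] sub_zero[OF W] by simp
  then have "\<forall>n. ap (j t) n t" unfolding j_def by (rule someI_ex)
  then show ?thesis by blast
qed

lemma j_preimage_idl: assumes U: "idl U" "Z \<subseteq> U" shows "idl {t. j t \<in> U}"
proof (rule subI)
  have cong: "x \<in> U" if "\<And>n. ap (x - y) n 0" "y \<in> U" for x y
    using idl_cong[OF U(1), of x y] that U(2) by (auto simp: Z_def)
  show "0 \<in> {t. j t \<in> U}" using cong[of "j 0" 0] ap_j sub_zero[OF U(1)] by simp
  show "s + t \<in> {t. j t \<in> U}" if "s \<in> {t. j t \<in> U}" "t \<in> {t. j t \<in> U}" for s t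
  proof -
    have "ap (j (s + t) - (j s + j t)) n (s + t - (s + t))" for n by (intro ap_diff ap_add ap_j)
    then have "ap (j (s + t) - (j s + j t)) n 0" for n by simp
    then show ?thesis using cong sub_add[OF U(1)] that by simp blast
  qed
  show "s * t \<in> {t. j t \<in> U}" if "t \<in> {t. j t \<in> U}" for s t
  proof -
    have "ap (j (s * t) - j s * j t) n (s * t - s * t)" for n by (intro ap_diff ap_mult ap_j)
    then have "ap (j (s * t) - j s * j t) n 0" for n by simp
    then show ?thesis using cong idl_mult[OF U(1)] that by simp blast
  qed
qed

lemma K_j: "t \<in> K \<Longrightarrow> j t \<in> Z"
  using ap_0_iff[OF ap_j] KW by (auto simp: Z_def)

text \<open>The completion of the \<open>n\<close>-th power of the maximal ideal is generated by its image: expand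
  an element as a series and collect the coefficients of each generator.\<close>

lemma M_expansion:
  assumes ys: "W n = pid 1 ys K" and U: "idl U" "Z \<subseteq> U" "\<And>y. y \<in> set ys \<Longrightarrow> j y \<in> U"
  shows "M n \<subseteq> U"
proof
  fix x assume x: "x \<in> M n"
  let ?k = "length ys"
  let ?D = "\<lambda>s. {t. \<exists>b z. t = (\<Sum>i<?k. ys ! i * b i) + z \<and> (\<forall>i. b i \<in> W s) \<and> z \<in> K}"
  have DI: "t \<in> ?D s" if "t = (\<Sum>i<?k. ys ! i * b i) + z" "\<And>i. b i \<in> W s" "z \<in> K" for t b z s
    using that by blast
  have D: "idl (?D s)" for s
  proof (rule subI)
    show "0 \<in> ?D s" using sub_zero[OF W] sub_zero[OF K] by (auto intro!: exI[of _ "\<lambda>_. 0"])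
    fix c t assume t: "t \<in> ?D s"
    then obtain b z where b: "t = (\<Sum>i<?k. ys ! i * b i) + z" "\<forall>i. b i \<in> W s" "z \<in> K" by blast
    have 1: "c * t = (\<Sum>i<?k. ys ! i * (c * b i)) + c * z"
      unfolding b(1) by (simp add: sum_distrib_left algebra_simps)
    show "c * t \<in> ?D s" by (rule DI[OF 1]) (use idl_mult[OF W] b(2) idl_mult[OF K b(3)] in auto)
    fix t' assume "t' \<in> ?D s"
    then obtain b' z' where b': "t' = (\<Sum>i<?k. ys ! i * b' i) + z'" "\<forall>i. b' i \<in> W s" "z' \<in> K" by blast
    have 2: "t' + t = (\<Sum>i<?k. ys ! i * (b' i + b i)) + (z' + z)"
      unfolding b(1) b'(1) by (simp add: sum.distrib algebra_simps)
    show "t' + t \<in> ?D s" by (rule DI[OF 2]) (use sub_add[OF W] b(2) b'(2) sub_add[OF K b'(3) b(3)] in auto)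
  qed
  have KD: "K \<subseteq> ?D s" for s
  proof
    fix z assume "z \<in> K"
    then show "z \<in> ?D s" using sub_zero[OF W] by (auto intro!: exI[of _ "\<lambda>_. 0"])
  qed
  have dec: "W (n + s) \<subseteq> ?D s" for s
  proof (rule order.trans[OF W_split prd_least[OF D KD]])
    fix a c assume a: "a \<in> W n" and c: "c \<in> W s"
    have "pid 1 ys K \<subseteq> colon (?D s) c"
    proof (rule pw_least[OF idl_colon[OF D]])
      show "K \<subseteq> colon (?D s) c" unfolding colon_def using KD idl_mult[OF K] by blast
      fix y r assume "y \<in> set ys"
      then obtain i0 where i0: "i0 < ?k" "ys ! i0 = y" by (auto simp: in_set_conv_nth)
      let ?b = "\<lambda>i. if i = i0 then r * c else 0"
      have "(\<Sum>i<?k. ys ! i * ?b i) = (\<Sum>i<?k. if i = i0 then ys ! i0 * (r * c) else 0)"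
        by (rule sum.cong) auto
      also have "\<dots> = y * (r * c)" using i0 by simp
      finally have 3: "c * (y * r) = (\<Sum>i<?k. ys ! i * ?b i) + 0" by (simp add: mult_ac)
      have "c * (y * r) \<in> ?D s" by (rule DI[OF 3]) (use idl_mult[OF W c] sub_zero[OF W] sub_zero[OF K] in auto)
      then show "y ^ 1 * r \<in> colon (?D s) c" by (simp add: colon_def)
    qed
    then have "c * a \<in> ?D s" using a ys unfolding colon_def by blast
    then show "a * c \<in> ?D s" by (subst mult.commute)
  qed
  have "\<forall>s. \<exists>t. ap x (n + s) t" using ap_ex by blast
  then obtain t where t: "\<forall>s. ap x (n + s) (t s)" by (rule choice[THEN exE])
  \<comment> \<open>As \<open>x\<close> lies in \<open>M n\<close>, zero is a valid approximation at
    level \<open>n\<close>; starting from it makes the telescoping sum of differences equal to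
    \<open>t' s\<close>.\<close>
  define t' where "t' s = (case s of 0 \<Rightarrow> 0 | Suc _ \<Rightarrow> t s)" for s
  have t': "ap x (n + s) (t' s)" for s using t[rule_format, of s] x by (cases s) (auto simp: t'_def M_def)
  have "t' (Suc s) - t' s \<in> W (n + s)" for s
    using ap_cong[OF t'[of s]] ap_Suc[of x "n + s"] t'[of "Suc s"] by simp
  then have "\<forall>s. t' (Suc s) - t' s \<in> ?D s" using dec by blast
  then have "\<forall>s. \<exists>bz. t' (Suc s) - t' s = (\<Sum>i<?k. ys ! i * fst bz i) + snd bz \<and> (\<forall>i. fst bz i \<in> W s) \<and> snd bz \<in> K"
    by simp
  then obtain bz where bz: "\<forall>s. t' (Suc s) - t' s = (\<Sum>i<?k. ys ! i * fst (bz s) i) + snd (bz s) \<and>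
      (\<forall>i. fst (bz s) i \<in> W s) \<and> snd (bz s) \<in> K" by (rule choice[THEN exE])
  define b z where "b s i = fst (bz s) i" and "z s = snd (bz s)" for s i
  have b: "t' (Suc s) - t' s = (\<Sum>i<?k. ys ! i * b s i) + z s" "b s i \<in> W s" "z s \<in> K" for s i
    using bz by (auto simp: b_def z_def)
  let ?B = "\<lambda>i s. \<Sum>r<s. b r i"
  have "\<exists>v. \<forall>s. ap v s (?B i s)" for i by (rule ap_lim) (simp add: b)
  then obtain g where g: "\<forall>i s. ap (g i) s (?B i s)" by (metis (full_types))
  have sum: "t' s = (\<Sum>i<?k. ys ! i * ?B i s) + (\<Sum>r<s. z r)" for s
  proof (induction s)
    case (Suc s)
    have "t' (Suc s) = t' s + ((\<Sum>i<?k. ys ! i * b s i) + z s)" using b(1)[of s] by (simp add: algebra_simps)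
    then show ?case using Suc by (simp add: algebra_simps sum.distrib)
  qed (simp add: t'_def)
  let ?y = "\<Sum>i<?k. j (ys ! i) * g i"
  have "ap (x - ?y) s 0" for s
  proof -
    have "ap x s (t' s)" using ap_le[OF _ t'[of s]] by simp
    then have "ap (x - ?y) s (t' s - (\<Sum>i<?k. ys ! i * ?B i s))"
      by (intro ap_diff ap_sum ap_mult ap_j) (use g in auto)
    moreover have "t' s - (\<Sum>i<?k. ys ! i * ?B i s) = (\<Sum>r<s. z r)" using sum[of s] by simp
    moreover have "(\<Sum>r<s. z r) \<in> W s" by (rule idl_sum[OF W]) (use b KW[of s] in auto)
    ultimately show ?thesis using ap_0_iff by metis
  qed
  then have "x - ?y \<in> U" using U(2) by (auto simp: Z_def)
  moreover have "?y \<in> U" by (rule idl_sum[OF U(1)]) (rule idl_mult'[OF U(1,3)], simp)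
  ultimately show "x \<in> U" using idl_cong[OF U(1)] by blast
qed

text \<open>For an ideal \<open>U\<close> containing \<open>W c\<close> this is its extension to the
  completion; membership then depends on the approximation at level \<open>c\<close> alone.\<close>

definition "ext c U = {v. \<exists>t\<in>U. ap v c t}"

lemma ext_cong:
  assumes "idl U" "W c \<subseteq> U" "ap v c t" shows "v \<in> ext c U \<longleftrightarrow> t \<in> U"
  unfolding ext_def using assms ap_cong[OF assms(3)] idl_cong[OF assms(1), of _ t] by blast

lemma idl_ext: assumes U: "idl U" "W c \<subseteq> U" shows "idl (ext c U)"
proof (rule subI)
  show "0 \<in> ext c U" using ext_cong[OF U ap_zero] sub_zero[OF U(1)] by simp
  show "v + w \<in> ext c U" if "v \<in> ext c U" "w \<in> ext c U" for v w
    using that ap_add sub_add[OF U(1)] unfolding ext_def by blast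
  show "v * w \<in> ext c U" if "w \<in> ext c U" for v w
    using that ap_mult[of v c _ w] ap_ex[of v c] idl_mult[OF U(1)] unfolding ext_def by blast
qed

lemma M_ext: "idl U \<Longrightarrow> W c \<subseteq> U \<Longrightarrow> M c \<subseteq> ext c U"
  using sub_zero unfolding ext_def M_def by blast

text \<open>Chains of ideals go up by \<open>ext c\<close> and down by preimages under
  \<open>j\<close>. On the way down they stay strict because every \<open>v\<close> differs from
  some \<open>j t\<close> by an element of \<open>M c\<close>, which lies in all the ideals
  concerned.\<close>

lemma len_ext: assumes U: "idl U" "W c \<subseteq> U" shows "len (ext c U) UNIV = len U UNIV"
proof (rule antisym)
  have strict: "ext c V \<subset> ext c V'" if "idl V" "W c \<subseteq> V" "idl V'" "V \<subset> V'" for V V'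
  proof -
    from that(4) obtain t where t: "t \<in> V'" "t \<notin> V" by blast
    have "j t \<in> ext c V'" "j t \<notin> ext c V"
      using ext_cong[OF _ _ ap_j] t that by auto
    then show ?thesis using that(4) unfolding ext_def by blast
  qed
  show "len U UNIV \<le> len (ext c U) UNIV"
    unfolding slen_def
  proof (rule chain_sup_least)
    fix n C assume C: "\<forall>i\<le>n. idl (C i) \<and> U \<subseteq> C i \<and> C i \<subseteq> UNIV" "\<forall>i<n. C i \<subset> C (Suc i)"
    show "enat n \<le> chain_sup (\<lambda>N. idl N \<and> ext c U \<subseteq> N \<and> N \<subseteq> UNIV)"
    proof (rule chain_sup_upper[of _ _ "\<lambda>i. ext c (C i)"]; intro allI impI)
      fix i assume "i \<le> n"
      then have "idl (C i)" "U \<subseteq> C i" using C by auto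
      then show "idl (ext c (C i)) \<and> ext c U \<subseteq> ext c (C i) \<and> ext c (C i) \<subseteq> UNIV"
        using idl_ext[of "C i" c] U(2) unfolding ext_def by blast
    next
      fix i assume "i < n"
      then have "idl (C i)" "U \<subseteq> C i" "idl (C (Suc i))" "C i \<subset> C (Suc i)" using C by (auto dest: Suc_leI)
      then show "ext c (C i) \<subset> ext c (C (Suc i))" using U(2) by (intro strict) blast+
    qed
  qed
  show "len (ext c U) UNIV \<le> len U UNIV"
    unfolding slen_def
  proof (rule chain_sup_least)
    fix n C assume C: "\<forall>i\<le>n. idl (C i) \<and> ext c U \<subseteq> C i \<and> C i \<subseteq> UNIV" "\<forall>i<n. C i \<subset> C (Suc i)"
    let ?D = "\<lambda>i. {t. j t \<in> C i}"
    show "enat n \<le> chain_sup (\<lambda>N. idl N \<and> U \<subseteq> N \<and> N \<subseteq> UNIV)"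
    proof (rule chain_sup_upper[of _ _ ?D]; intro allI impI)
      fix i assume "i \<le> n"
      then have i: "idl (C i)" "ext c U \<subseteq> C i" using C by auto
      have "Z \<subseteq> C i" using i(2) C.ZM[of c] M_ext[OF U] by blast
      then have "idl (?D i)" by (rule j_preimage_idl[OF i(1)])
      moreover have "U \<subseteq> ?D i" using ext_cong[OF U ap_j] i(2) by blast
      ultimately show "idl (?D i) \<and> U \<subseteq> ?D i \<and> ?D i \<subseteq> UNIV" by blast
    next
      fix i assume i: "i < n"
      then have s: "idl (C i)" "ext c U \<subseteq> C i" "idl (C (Suc i))" "ext c U \<subseteq> C (Suc i)" "C i \<subset> C (Suc i)"
        using C by (auto dest: Suc_leI)
      then obtain v where v: "v \<in> C (Suc i)" "v \<notin> C i" by blast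
      obtain t where t: "ap v c t" using ap_ex by blast
      have "j t - v \<in> M c" using ap_diff[OF ap_j[of t c] t] by (simp add: M_def)
      then have "j t - v \<in> C i" "j t - v \<in> C (Suc i)" using M_ext[OF U] s by blast+
      then have "j t \<notin> C i" "j t \<in> C (Suc i)" using v idl_cong[OF s(1)] idl_cong[OF s(3)] by blast+
      then show "?D i \<subset> ?D (Suc i)" using s(5) by blast
    qed
  qed
qed

text \<open>The level changes from \<open>c\<close> to \<open>n\<close> because the bracket power
  may contain only a higher power of the maximal ideal. The inclusion from right to left rests on
  \<open>M_expansion\<close>: \<open>M n\<close> is generated by images of elements of
  \<open>W n\<close>.\<close>

lemma br_ext:
  assumes I: "idl I" "K \<subseteq> I" "W c \<subseteq> I" and cn: "c \<le> n" "W n \<subseteq> br K I q"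
  shows "br Z (ext c I) q = ext n (br K I q)"
proof
  have B: "idl (br K I q)" by (rule idl_br)
  show "br Z (ext c I) q \<subseteq> ext n (br K I q)"
  proof (rule br_least[OF idl_ext[OF B cn(2)]])
    show "Z \<subseteq> ext n (br K I q)" using C.ZM[of n] M_ext[OF B cn(2)] by blast
    fix v assume v: "v \<in> ext c I"
    obtain t where t: "ap v n t" using ap_ex by blast
    then have "t \<in> I" using v ext_cong[OF I(1,3)] ap_le[OF cn(1)] by blast
    then show "v ^ q \<in> ext n (br K I q)"
      using ext_cong[OF B cn(2) ap_power[OF t]] br_superset(2) by blast
  qed
  let ?B = "br Z (ext c I) q"
  have Zle: "Z \<subseteq> ?B" by (rule br_superset(1))
  have jB: "j t \<in> ?B" if "t \<in> br K I q" for t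
  proof -
    have "br K I q \<subseteq> {t. j t \<in> ?B}"
    proof (rule br_least[OF j_preimage_idl[OF idl_br Zle]])
      show "K \<subseteq> {t. j t \<in> ?B}" using K_j Zle by blast
      fix s assume "s \<in> I"
      then have "j s ^ q \<in> ?B" using ext_cong[OF I(1,3) ap_j] by (intro br_superset(2)) blast
      moreover have "ap (j (s ^ q) - j s ^ q) n (s ^ q - s ^ q)" for n by (intro ap_diff ap_power ap_j)
      then have "j (s ^ q) - j s ^ q \<in> Z" by (simp add: Z_def)
      ultimately show "s ^ q \<in> {t. j t \<in> ?B}" using idl_cong[OF idl_br] Zle by blast
    qed
    then show ?thesis using that by blast
  qed
  obtain ys where ys: "W n = pid 1 ys K" "set ys \<subseteq> W n" using fg[OF W KW] by blast
  have M: "M n \<subseteq> ?B" by (rule M_expansion[OF ys(1) idl_br Zle]) (use jB ys(2) cn(2) in blast)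
  show "ext n (br K I q) \<subseteq> ?B"
  proof
    fix v assume "v \<in> ext n (br K I q)"
    then obtain t where t: "t \<in> br K I q" "ap v n t" unfolding ext_def by blast
    have "v - j t \<in> M n" using ap_diff[OF t(2) ap_j[of t n]] by (simp add: M_def)
    then show "v \<in> ?B" using jB[OF t(1)] M idl_cong[OF idl_br, of v "j t"] by blast
  qed
qed

theorem convergent_hk:
  assumes as: "set as \<subseteq> W 1" "W c0 \<subseteq> pid 1 as K"
    and I: "idl I" "K \<subseteq> I" "W c \<subseteq> I"
  shows "convergent (\<lambda>e. rlen (len (br K I (p ^ e)) UNIV) / real (p ^ e) ^ length as)"
proof -
  let ?as = "map j as"
  let ?P = "pid 1 ?as Z"
  have P: "idl ?P" "Z \<subseteq> ?P" using idl_pid[OF C.Z] pw_superset[OF sub_UNIV] by blast+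
  have asM: "set ?as \<subseteq> M 1" using as(1) ap_0_iff[OF ap_j] by (auto simp: M_def)
  obtain ys where ys: "W c0 = pid 1 ys K" "set ys \<subseteq> W c0" using fg[OF W KW] by blast
  have "pid 1 as K \<subseteq> {t. j t \<in> ?P}"
  proof (rule pw_least[OF j_preimage_idl[OF P]])
    show "K \<subseteq> {t. j t \<in> ?P}" using K_j P(2) by blast
    fix x b assume "x \<in> set as"
    then have "j x ^ 1 * 1 \<in> ?P" by (intro pw_mem[OF sub_UNIV C.Z]) auto
    then show "x ^ 1 * b \<in> {t. j t \<in> ?P}" using idl_mult'[OF j_preimage_idl[OF P], of x b] by simp
  qed
  then have "M c0 \<subseteq> ?P" by (intro M_expansion[OF ys(1) P]) (use ys(2) as(2) in blast)
  moreover have "M c0 = ext c0 (W c0)"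
    unfolding ext_def M_def using sub_zero[OF W] ap_0_iff by blast
  ultimately have "len ?P UNIV \<le> len (W c0) UNIV"
    using slen_mono[of "M c0" ?P UNIV UNIV UNIV UNIV] len_ext[OF W, of c0] by simp
  then have fin: "len ?P UNIV \<noteq> \<infinity>" using len_W_finite enat_finite_mono by blast
  have red': "x \<in> Z" if "x * x \<in> Z" for x using red[of x] that by (simp add: Z_def)
  obtain A gs where "fin_alg Z A (M 1) gs ?as p"
    using C.exists_fin_alg[OF asM fin red'] by blast
  then interpret fa: fin_alg Z A "M 1" gs ?as p .
  \<comment> \<open>The exponent \<open>Suc c\<close> is positive and takes every parameter into the
    extension of \<open>I\<close>, which contains \<open>M c\<close>.\<close>
  interpret hk: hk_alg Z A "M 1" gs ?as p "ext c I" "Suc c"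
  proof
    show "idl (ext c I)" by (rule idl_ext[OF I(1,3)])
    show "Z \<subseteq> ext c I" using C.ZM[of c] M_ext[OF I(1,3)] by blast
    show "Suc c \<ge> 1" by simp
    fix a assume "a \<in> set ?as"
    then have "a ^ Suc c \<in> M (1 * Suc c)" using asM by (intro C.M_power) auto
    then show "a ^ Suc c \<in> ext c I" using M_ext[OF I(1,3)] C.M_antimono[of c "Suc c"] by auto
  qed
  have "hk.fr Z e = rlen (len (br K I (p ^ e)) UNIV) / real (p ^ e) ^ length as" for e
  proof -
    have "p ^ e \<ge> 1" using prime_gt_0_nat[OF p] by simp
    then obtain n0 where n0: "W n0 \<subseteq> br K I (p ^ e)" using br_mprimary[OF I] by blast
    define n where "n = max c n0"
    have n: "c \<le> n" "W n \<subseteq> br K I (p ^ e)" using n0 W_antimono[of n0 n] by (auto simp: n_def)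
    have "br Z (ext c I) (p ^ e) + Z = br Z (ext c I) (p ^ e)"
      using plus_least[OF idl_br order.refl br_superset(1)] plus_left_subset[OF C.Z] by blast
    then show ?thesis
      unfolding hk.fr_def hk.F_def using len_ext[OF idl_br n(2)] br_ext[OF I n] by simp
  qed
  then have "hk.fr Z = (\<lambda>e. rlen (len (br K I (p ^ e)) UNIV) / real (p ^ e) ^ length as)" by blast
  then show ?thesis using hk.convergent_hk by (simp only:)
qed

end

section \<open>Passage to quotients of the free commutative ring\<close>

context cring
begin

definition "pre I = {t. feval R t \<in> I}"
abbreviation "ker0 \<equiv> pre {\<zero>}"

lemma mem_pre: "t \<in> pre I \<longleftrightarrow> feval R t \<in> I" by (simp add: pre_def)

lemma idl_pre: "ideal I R \<Longrightarrow> idl (pre I)"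
proof (rule subI)
  assume I: "ideal I R"
  then interpret I: ideal I R .
  show "0 \<in> pre I" using I.zero_closed by (simp add: mem_pre)
  show "\<And>x y. x \<in> pre I \<Longrightarrow> y \<in> pre I \<Longrightarrow> x + y \<in> pre I" by (simp add: mem_pre)
  show "\<And>s x. x \<in> pre I \<Longrightarrow> s * x \<in> pre I" using I.I_l_closed by (simp add: mem_pre)
qed

lemma idl_ker0: "idl ker0" by (rule idl_pre[OF zeroideal])

lemma ker0_pre: "ideal I R \<Longrightarrow> ker0 \<subseteq> pre I"
  using additive_subgroup.zero_closed[OF ideal.axioms(1)] by (auto simp: mem_pre)

lemma feval_eqD: "feval R s = feval R t \<Longrightarrow> s - t \<in> ker0"
  by (simp add: mem_pre)

lemma idl_saturated: "idl U \<Longrightarrow> ker0 \<subseteq> U \<Longrightarrow> s \<in> U \<Longrightarrow> feval R s = feval R t \<Longrightarrow> t \<in> U"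
  using feval_eqD[of s t] idl_cong[of U s t] by auto

lemma ideal_image: assumes "idl U" shows "ideal (feval R ` U) R"
proof (rule idealI[OF ring_axioms])
  show "subgroup (feval R ` U) (add_monoid R)"
  proof (rule add.subgroupI)
    show "feval R ` U \<subseteq> carrier R" by auto
    show "feval R ` U \<noteq> {}" using sub_zero[OF assms] by auto
    fix a assume "a \<in> feval R ` U"
    then obtain t where "t \<in> U" "a = feval R t" by blast
    then show "\<ominus> a \<in> feval R ` U" using idl_uminus[OF assms, of t] by (auto intro: image_eqI[of _ _ "- t"])
  next
    fix a b assume "a \<in> feval R ` U" "b \<in> feval R ` U"
    then obtain s t where "s \<in> U" "a = feval R s" "t \<in> U" "b = feval R t" by blast
    then show "a \<oplus> b \<in> feval R ` U" using sub_add[OF assms, of s t] by (auto intro: image_eqI[of _ _ "s + t"])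
  qed
  fix a x assume "a \<in> feval R ` U" and x: "x \<in> carrier R"
  then obtain t where "t \<in> U" "a = feval R t" by blast
  then have "x \<otimes> a = feval R (fvar x * t)" "fvar x * t \<in> U" using x idl_mult[OF assms] by (auto simp: feval_fvar)
  then show "x \<otimes> a \<in> feval R ` U" by blast
  then show "a \<otimes> x \<in> feval R ` U" using m_comm[of a x] x \<open>a = feval R t\<close> by simp
qed

lemma pre_image: assumes "idl U" "ker0 \<subseteq> U" shows "pre (feval R ` U) = U"
proof
  show "U \<subseteq> pre (feval R ` U)" by (auto simp: mem_pre)
  show "pre (feval R ` U) \<subseteq> U"
  proof
    fix t assume "t \<in> pre (feval R ` U)"
    then obtain s where "s \<in> U" "feval R s = feval R t" by (auto simp: mem_pre)
    then show "t \<in> U" by (rule idl_saturated[OF assms])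
  qed
qed

lemma fvar_pre: "I \<subseteq> carrier R \<Longrightarrow> x \<in> I \<Longrightarrow> fvar x \<in> pre I \<and> feval R (fvar x) = x"
  by (auto simp: mem_pre feval_fvar)

lemma image_pre: "I \<subseteq> carrier R \<Longrightarrow> feval R ` pre I = I"
proof (intro equalityI subsetI)
  fix x assume I: "I \<subseteq> carrier R" and x: "x \<in> I"
  show "x \<in> feval R ` pre I" by (rule image_eqI[of _ _ "fvar x"]) (use fvar_pre[OF I x] in auto)
qed (auto simp: mem_pre)

lemma pre_mono_iff: "I \<subseteq> carrier R \<Longrightarrow> pre I \<subseteq> pre J \<longleftrightarrow> I \<subseteq> J"
proof
  assume I: "I \<subseteq> carrier R" and sub: "pre I \<subseteq> pre J"
  show "I \<subseteq> J"
  proof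
    fix x assume "x \<in> I"
    then have "fvar x \<in> pre J" "feval R (fvar x) = x" using fvar_pre[OF I] sub by blast+
    then show "x \<in> J" by (simp add: mem_pre)
  qed
qed (auto simp: mem_pre)

lemma pre_inj: "I \<subseteq> carrier R \<Longrightarrow> J \<subseteq> carrier R \<Longrightarrow> pre I = pre J \<longleftrightarrow> I = J"
  using pre_mono_iff[of I J] pre_mono_iff[of J I] by auto

lemma pre_carrier: "pre (carrier R) = UNIV" by (auto simp: mem_pre)

lemma pre_genideal: "pre (Idl (feval R ` Y)) = gen UNIV (Y \<union> ker0)"
proof
  have Y: "feval R ` Y \<subseteq> carrier R" by auto
  let ?G = "gen UNIV (Y \<union> ker0)"
  have G: "idl ?G" "ker0 \<subseteq> ?G" "Y \<subseteq> ?G" using gen_superset[of "Y \<union> ker0" UNIV] by (auto simp: sub_gen)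
  have "Idl (feval R ` Y) \<subseteq> feval R ` ?G"
    by (rule genideal_minimal[OF ideal_image[OF G(1)]]) (use G(3) in blast)
  then have "pre (Idl (feval R ` Y)) \<subseteq> pre (feval R ` ?G)" by (auto simp: mem_pre)
  then show "pre (Idl (feval R ` Y)) \<subseteq> ?G" unfolding pre_image[OF G(1,2)] .
  show "?G \<subseteq> pre (Idl (feval R ` Y))"
    by (rule gen_minimal[OF _ idl_pre[OF genideal_ideal[OF Y]]])
      (use genideal_self[OF Y] ker0_pre[OF genideal_ideal[OF Y]] in \<open>auto simp: mem_pre\<close>)
qed

lemma pre_bracket_power:
  assumes "I \<subseteq> carrier R" shows "pre (bracket_power R I q) = br ker0 (pre I) q"
proof -
  have "(\<lambda>x. x [^] q) ` I = feval R ` (\<lambda>x. x ^ q) ` pre I"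
    unfolding image_image feval_power using arg_cong[OF image_pre[OF assms], of "(`) (\<lambda>x. x [^] q)"]
    by (simp add: image_image)
  then show ?thesis unfolding bracket_power_def br_def by (simp add: pre_genideal)
qed

lemma pre_ideal_prod:
  assumes I: "ideal I R" and J: "ideal J R" shows "pre (I \<cdot> J) = prd ker0 (pre I) (pre J)"
proof
  let ?G = "prd ker0 (pre I) (pre J)"
  have G: "idl ?G" "ker0 \<subseteq> ?G" "\<And>i j. i \<in> pre I \<Longrightarrow> j \<in> pre J \<Longrightarrow> i * j \<in> ?G"
    unfolding prd_def by (auto simp: sub_gen intro: gen_inc)
  have sub: "I \<subseteq> carrier R" "J \<subseteq> carrier R" using I J by (simp_all add: ideal.Icarr subsetI)
  have "x \<in> feval R ` ?G" if "x \<in> I \<cdot> J" for x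
    using that
  proof (induction rule: ideal_prod.induct)
    case (prod i j)
    then have "fvar i * fvar j \<in> ?G" using sub by (intro G(3)) (auto simp: mem_pre feval_fvar)
    then have "feval R (fvar i * fvar j) \<in> feval R ` ?G" by (rule imageI)
    then show ?case using prod sub by (auto simp: feval_fvar subsetD)
  next
    case (sum x y)
    then show ?case using additive_subgroup.a_closed[OF ideal.axioms(1)[OF ideal_image[OF G(1)]]] by blast
  qed
  then have "pre (I \<cdot> J) \<subseteq> pre (feval R ` ?G)" by (auto simp: mem_pre)
  then show "pre (I \<cdot> J) \<subseteq> ?G" unfolding pre_image[OF G(1,2)] .
  have "ideal (I \<cdot> J) R" by (rule ideal_prod_is_ideal[OF I J])
  then show "?G \<subseteq> pre (I \<cdot> J)"
    unfolding prd_def using idl_pre ker0_pre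
    by (intro gen_minimal) (auto simp: mem_pre intro: ideal_prod.prod)
qed

end

lemma chain_sup_mono_map:
  assumes "\<And>N. P N \<Longrightarrow> Q (f N)" "\<And>N N'. P N \<Longrightarrow> P N' \<Longrightarrow> N \<subset> N' \<Longrightarrow> f N \<subset> f N'"
  shows "chain_sup P \<le> chain_sup Q"
proof (rule chain_sup_least)
  fix n C assume "\<forall>i\<le>n. P (C i)" "\<forall>i<n. C i \<subset> C (Suc i)"
  then show "enat n \<le> chain_sup Q"
    by (intro chain_sup_upper[of _ _ "\<lambda>i. f (C i)"]) (use assms in auto)
qed

context cring
begin

lemma module_length_quot:
  assumes I: "ideal I R"
  shows "module_length R (quot_module R I) = len (pre I) UNIV"
proof -
  interpret I: ideal I R by (rule I)
  let ?Q = "R Quot I" and ?h = "(+>) I"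
  interpret h: ring_hom_ring R ?Q ?h by (rule I.rcos_ring_hom_ring)
  have add: "subgroup N (add_monoid (quot_module R I)) \<longleftrightarrow> subgroup N (add_monoid ?Q)" for N
    by (simp add: subgroup_def m_inv_def quot_module_def)
  have sm: "submodule N R (quot_module R I) \<longleftrightarrow>
      subgroup N (add_monoid ?Q) \<and> (\<forall>a\<in>carrier R. \<forall>x\<in>N. ?h a \<otimes>\<^bsub>?Q\<^esub> x \<in> N)" for N
    unfolding submodule_def submodule_axioms_def add by (auto simp: quot_module_def)
  have car: "\<exists>a\<in>carrier R. x = ?h a" if "x \<in> carrier ?Q" for x
    using that unfolding FactRing_def A_RCOSETS_def' by auto
  have eq: "?h a = ?h b \<longleftrightarrow> a \<ominus> b \<in> I" if "a \<in> carrier R" "b \<in> carrier R" for a b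
    by (rule quotient_eq_iff_same_a_r_cos[OF I that, symmetric])
  show ?thesis
  proof (rule antisym)
    let ?f = "\<lambda>N. {t. ?h (feval R t) \<in> N}"
    show "module_length R (quot_module R I) \<le> len (pre I) UNIV"
      unfolding module_length_def slen_def
    proof (rule chain_sup_mono_map[of _ _ ?f])
      fix N assume N: "submodule N R (quot_module R I)"
      then have sg: "subgroup N (add_monoid ?Q)" and act: "\<forall>a\<in>carrier R. \<forall>x\<in>N. ?h a \<otimes>\<^bsub>?Q\<^esub> x \<in> N"
        unfolding sm by (rule conjunct1, rule conjunct2)
      have z: "\<zero>\<^bsub>?Q\<^esub> \<in> N" using subgroup.one_closed[OF sg] by simp
      have ad: "x \<oplus>\<^bsub>?Q\<^esub> y \<in> N" if "x \<in> N" "y \<in> N" for x y using subgroup.m_closed[OF sg that] by simp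
      have "idl (?f N)"
      proof (rule subI)
        show "0 \<in> ?f N" unfolding mem_Collect_eq feval_zero h.hom_zero by (rule z)
        fix s t assume t: "t \<in> ?f N"
        show "s + t \<in> ?f N" if "s \<in> ?f N" 
          using that t unfolding mem_Collect_eq feval_add h.hom_add[OF feval_closed feval_closed] by (rule ad)
        show "s * t \<in> ?f N" 
          using t unfolding mem_Collect_eq feval_mult h.hom_mult[OF feval_closed feval_closed]
          by (rule act[rule_format, OF feval_closed])
      qed
      moreover have "?h (feval R t) = \<zero>\<^bsub>?Q\<^esub>" if "t \<in> pre I" for t

        using I.a_rcos_const[of "feval R t"] that unfolding mem_pre FactRing_def by simp
      then have "pre I \<subseteq> ?f N" using z by (intro subsetI) (simp only: mem_Collect_eq)
      ultimately show "idl (?f N) \<and> pre I \<subseteq> ?f N \<and> ?f N \<subseteq> UNIV" by simp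
    next
      fix N N' assume N: "submodule N R (quot_module R I)" "submodule N' R (quot_module R I)" "N \<subset> N'"
      then obtain x where x: "x \<in> N'" "x \<notin> N" by blast
      then have "x \<in> carrier ?Q" using N(2) subgroup.subset[of N' "add_monoid ?Q"] by (auto simp: sm)
      then obtain a where "a \<in> carrier R" "x = ?h a" using car by blast
      then have "fvar a \<in> ?f N'" "fvar a \<notin> ?f N" using x by (simp_all add: feval_fvar)
      then show "?f N \<subset> ?f N'" using N(3) by blast
    qed
    let ?g = "\<lambda>U. (\<lambda>t. ?h (feval R t)) ` U"
    show "len (pre I) UNIV \<le> module_length R (quot_module R I)"
      unfolding module_length_def slen_def
    proof (rule chain_sup_mono_map[of _ _ ?g])
      fix U assume U: "idl U \<and> pre I \<subseteq> U \<and> U \<subseteq> UNIV"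
      have "subgroup (?g U) (add_monoid ?Q)"
      proof (rule h.S.add.subgroupI)
        show "?g U \<subseteq> carrier ?Q" by (auto intro: h.hom_closed)
        show "?g U \<noteq> {}" using U sub_zero by blast
        fix a assume "a \<in> ?g U"
        then obtain t where t: "t \<in> U" "a = ?h (feval R t)" by blast
        then have "\<ominus>\<^bsub>?Q\<^esub> a = ?h (feval R (- t))" "- t \<in> U" using U idl_uminus by auto
        then show "\<ominus>\<^bsub>?Q\<^esub> a \<in> ?g U" by blast
      next
        fix a b assume "a \<in> ?g U" "b \<in> ?g U"
        then obtain s t where t: "s \<in> U" "a = ?h (feval R s)" "t \<in> U" "b = ?h (feval R t)" by blast
        then have "a \<oplus>\<^bsub>?Q\<^esub> b = ?h (feval R (s + t))" "s + t \<in> U" using U sub_add by auto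
        then show "a \<oplus>\<^bsub>?Q\<^esub> b \<in> ?g U" by blast
      qed
      moreover have "?h a \<otimes>\<^bsub>?Q\<^esub> x \<in> ?g U" if a: "a \<in> carrier R" "x \<in> ?g U" for a x
      proof -
        obtain t where t: "t \<in> U" "x = ?h (feval R t)" using a by blast
        then have "?h a \<otimes>\<^bsub>?Q\<^esub> x = ?h (feval R (fvar a * t))" "fvar a * t \<in> U"
          using U idl_mult a by (auto simp: feval_fvar)
        then show ?thesis by blast
      qed
      ultimately show "submodule (?g U) R (quot_module R I)" by (simp add: sm)
    next
      fix U U' assume U: "idl U \<and> pre I \<subseteq> U \<and> U \<subseteq> UNIV" "idl U' \<and> pre I \<subseteq> U' \<and> U' \<subseteq> UNIV" "U \<subset> U'"
      then obtain t where t: "t \<in> U'" "t \<notin> U" by blast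
      have "?h (feval R t) \<notin> ?g U"
      proof
        assume "?h (feval R t) \<in> ?g U"
        then obtain s where s: "s \<in> U" "?h (feval R t) = ?h (feval R s)" by blast
        then have "t - s \<in> pre I" by (simp add: eq mem_pre)
        then show False using s t U idl_cong[of U t s] by blast
      qed
      then show "?g U \<subset> ?g U'" using t U(3) by blast
    qed
  qed
qed

lemma hilbert_kunz_pre:
  assumes "I \<subseteq> carrier R"
  shows "hilbert_kunz R p I =
    lim (\<lambda>e. rlen (len (br ker0 (pre I) (p ^ e)) UNIV) / real (p ^ e) ^ the_enat (krull_dim R))"
proof -
  have "ideal (bracket_power R I q) R" for q
    unfolding bracket_power_def using assms by (intro genideal_ideal) auto
  then show ?thesis
    unfolding hilbert_kunz_def rlen_def by (simp add: module_length_quot pre_bracket_power[OF assms])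
qed

end

section \<open>Prime ideals and dimension\<close>

text \<open>The union of a chain is finitely generated over \<open>K\<close>, so one member already
  contains the generators and equals the union.\<close>

lemma noeth_maximal:
  assumes noeth: "\<And>U. idl U \<Longrightarrow> K \<subseteq> U \<Longrightarrow> \<exists>Y. finite Y \<and> U = gen UNIV (Y \<union> K)"
    and F: "\<And>U. U \<in> F \<Longrightarrow> idl U \<and> K \<subseteq> U" and ne: "F \<noteq> {}"
  shows "\<exists>V\<in>F. \<forall>U\<in>F. V \<subseteq> U \<longrightarrow> U = V"
proof (rule subset_Zorn_nonempty[OF ne])
  fix C assume C: "C \<noteq> {}" "subset.chain F C"
  then have CF: "C \<subseteq> F" and lin: "\<And>U V. U \<in> C \<Longrightarrow> V \<in> C \<Longrightarrow> U \<subseteq> V \<or> V \<subseteq> U"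
    by (auto simp: subset_chain_def)
  have I: "idl U" "K \<subseteq> U" if "U \<in> C" for U using that CF F by auto
  have "idl (\<Union>C)"
  proof (rule subI)
    show "0 \<in> \<Union>C" using C(1) I(1) sub_zero by blast
    fix x y assume "x \<in> \<Union>C" "y \<in> \<Union>C"
    then obtain U V where U: "U \<in> C" "x \<in> U" "V \<in> C" "y \<in> V" by blast
    then consider "x \<in> V" | "y \<in> U" using lin by blast
    then show "x + y \<in> \<Union>C"
      using sub_add[OF I(1)[OF U(1)], of x y] sub_add[OF I(1)[OF U(3)], of x y] U by cases auto
  next
    fix s x assume "x \<in> \<Union>C"
    then obtain U where U: "U \<in> C" "x \<in> U" by blast
    then show "s * x \<in> \<Union>C" using idl_mult[OF I(1)[OF U(1)] U(2)] by blast
  qed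
  moreover have "K \<subseteq> \<Union>C" using C(1) I(2) by blast
  ultimately obtain Y where Y: "finite Y" "\<Union>C = gen UNIV (Y \<union> K)" using noeth by blast
  then have "Y \<subseteq> \<Union>C" using gen_superset by blast
  then obtain B where B: "B \<in> C" "Y \<subseteq> B" using finite_subset_Union_chain[OF Y(1) _ C] by blast
  have "\<Union>C \<subseteq> B" unfolding Y(2) by (rule gen_minimal) (use B I in auto)
  then have "\<Union>C = B" using B(1) by blast
  then show "\<Union>C \<in> F" using B(1) CF by blast
qed

lemma idl_principal_plus: "idl U \<Longrightarrow> idl (U + (*) x ` UNIV)"
  by (rule idl_plus[OF _ idl_image[OF sub_UNIV]])

lemma principal_plus_superset: assumes "idl U" shows "U \<subseteq> U + (*) x ` UNIV" "x \<in> U + (*) x ` UNIV"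
proof -
  show "U \<subseteq> U + (*) x ` UNIV" by (rule plus_left_subset[OF idl_image[OF sub_UNIV]])
  have "x * 1 \<in> (*) x ` UNIV" by (rule imageI) simp
  then show "x \<in> U + (*) x ` UNIV" using plus_right_subset[OF assms, of "(*) x ` UNIV"] by auto
qed

definition prm :: "'t::comm_ring_1 set \<Rightarrow> 't set \<Rightarrow> bool" where
  "prm K P \<longleftrightarrow> idl P \<and> K \<subseteq> P \<and> 1 \<notin> P \<and> (\<forall>x y. x * y \<in> P \<longrightarrow> x \<in> P \<or> y \<in> P)"

lemma prmD:
  assumes "prm K P" shows "idl P" "K \<subseteq> P" "1 \<notin> P" "x * y \<in> P \<Longrightarrow> x \<in> P \<or> y \<in> P"
  using assms by (auto simp: prm_def)

lemma prm_prod: "finite I \<Longrightarrow> prm K P \<Longrightarrow> prod f I \<in> P \<Longrightarrow> \<exists>i\<in>I. f i \<in> P"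
  by (induction I rule: finite_induct) (use prmD in \<open>fastforce+\<close>)

lemma prm_prod_list: "prm K P \<Longrightarrow> prod_list xs \<in> P \<Longrightarrow> \<exists>x\<in>set xs. x \<in> P"
  by (induction xs) (use prmD in \<open>fastforce+\<close>)

text \<open>The hypothesis says, on elements, that the product of the ideals in \<open>Ps\<close>
  lies in \<open>Q\<close>: the list \<open>xs\<close> picks one factor from each.\<close>

lemma prm_above_product:
  assumes Q: "prm K Q" and Ps: "\<And>xs. list_all2 (\<in>) xs Ps \<Longrightarrow> prod_list xs \<in> Q"
  shows "\<exists>P\<in>set Ps. P \<subseteq> Q"
proof (rule ccontr)
  assume "\<not> ?thesis"
  then have "\<forall>P\<in>set Ps. \<exists>x. x \<in> P \<and> x \<notin> Q" by blast
  then obtain f where f: "\<forall>P\<in>set Ps. f P \<in> P \<and> f P \<notin> Q" by (rule bchoice[THEN exE])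
  have "list_all2 (\<in>) (map f Ps) Ps" using f by (simp add: list_all2_conv_all_nth)
  then have "prod_list (map f Ps) \<in> Q" by (rule Ps)
  then obtain x where "x \<in> set (map f Ps)" "x \<in> Q" using prm_prod_list[OF Q] by blast
  then show False using f by auto
qed

lemma prime_avoidance:
  assumes V: "idl V" and F: "finite F" "\<And>P. P \<in> F \<Longrightarrow> prm K P \<and> \<not> V \<subseteq> P"
  shows "\<exists>b\<in>V. \<forall>P\<in>F. b \<notin> P"
  using F
proof (induction F rule: finite_psubset_induct)
  case (psubset F)
  consider "F = {}" | P0 where "F = {P0}" | P0 P1 where "P0 \<in> F" "P1 \<in> F" "P0 \<noteq> P1" by blast
  then show ?case
  proof cases
    case 1
    then show ?thesis using sub_zero[OF V] by blast
  next
    case 2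
    then show ?thesis using psubset.prems[of P0] by blast
  next
    case 3
    have "\<forall>P\<in>F. \<exists>b. b \<in> V \<and> (\<forall>P'\<in>F - {P}. b \<notin> P')"
    proof
      fix P assume "P \<in> F"
      then have "F - {P} \<subset> F" by blast
      then show "\<exists>b. b \<in> V \<and> (\<forall>P'\<in>F - {P}. b \<notin> P')" using psubset.IH[of "F - {P}"] psubset.prems by blast
    qed
    then obtain b where b: "\<forall>P\<in>F. b P \<in> V \<and> (\<forall>P'\<in>F - {P}. b P \<notin> P')" by (rule bchoice[THEN exE])
    show ?thesis
    proof (cases "\<exists>P\<in>F. b P \<notin> P")
      case True
      then obtain P where "P \<in> F" "b P \<notin> P" by blast
      then show ?thesis using b by (intro bexI[of _ "b P"]) auto
    next
      case False
      \<comment> \<open>Now every \<open>b P\<close> lies in \<open>P\<close> and in no other member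
        of \<open>F\<close>. The product lies in all members except \<open>P0\<close>, while
        \<open>b P0\<close> lies in \<open>P0\<close> alone, so their sum avoids every
        member.\<close>
      let ?c = "prod b (F - {P0})"
      have fin: "finite (F - {P0})" using psubset.hyps by simp
      have mem: "?c \<in> U" if "idl U" "P \<in> F - {P0}" "b P \<in> U" for U P
      proof -
        have "?c = b P * prod b (F - {P0} - {P})" by (rule prod.remove[OF fin that(2)])
        then show ?thesis using idl_mult'[OF that(1,3)] by simp
      qed
      have P: "idl P" if "P \<in> F" for P using psubset.prems[OF that] prmD by blast
      have "?c \<in> V" by (rule mem[OF V, of P1]) (use 3 b in auto)
      then have "b P0 + ?c \<in> V" using b 3(1) sub_add[OF V] by blast
      moreover have "b P0 + ?c \<notin> P" if PF: "P \<in> F" for P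
      proof (cases "P = P0")
        case True
        have "?c \<notin> P0"
        proof
          assume "?c \<in> P0"
          then obtain P' where "P' \<in> F - {P0}" "b P' \<in> P0"
            using prm_prod[OF fin] psubset.prems[OF 3(1)] by blast
          then show False using b 3(1) by blast
        qed
        moreover have "b P0 \<in> P0" using False 3(1) by blast
        ultimately show ?thesis using True idl_diff[OF P[OF 3(1)], of "b P0 + ?c" "b P0"] by auto
      next
        case neq: False
        then have "?c \<in> P" using PF False by (intro mem[OF P[OF PF], of P]) auto
        moreover have "b P0 \<notin> P" using b 3(1) PF neq by blast
        ultimately show ?thesis using idl_diff[OF P[OF PF], of "b P0 + ?c" ?c] by auto
      qed
      ultimately show ?thesis by blast
    qed
  qed
qed

section \<open>Products of primes, parameters and negligible lengths\<close>

context noeth_local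
begin

text \<open>A maximal counterexample \<open>V\<close> is proper and not prime, say with
  \<open>x y\<close> in \<open>V\<close>. The lists for \<open>V + (x)\<close> and
  \<open>V + (y)\<close>, concatenated, then serve for \<open>V\<close>.\<close>

lemma prime_product:
  assumes "idl U" "K \<subseteq> U"
  shows "\<exists>Ps. (\<forall>P\<in>set Ps. prm K P \<and> U \<subseteq> P) \<and> (\<forall>xs. list_all2 (\<in>) xs Ps \<longrightarrow> prod_list xs \<in> U)"
    (is "?good U")
proof (rule ccontr)
  assume "\<not> ?good U"
  let ?F = "{U. idl U \<and> K \<subseteq> U \<and> \<not> ?good U}"
  have "?F \<noteq> {}" using assms \<open>\<not> ?good U\<close> by blast
  then obtain V where "V \<in> ?F" and max: "\<forall>U\<in>?F. V \<subseteq> U \<longrightarrow> U = V"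
    using noeth_maximal[of K ?F, OF noeth] by blast
  then have V: "idl V" "K \<subseteq> V" "\<not> ?good V" by auto
  have "1 \<notin> V"
  proof
    assume "1 \<in> V"
    then have "V = UNIV" using idl_mult[OF V(1), of 1] by auto
    then have "?good V" by (intro exI[of _ "[]"]) simp
    then show False using V(3) by contradiction
  qed
  moreover have "\<not> prm K V"
  proof
    assume "prm K V"
    then have "?good V" by (intro exI[of _ "[V]"]) (auto simp: list_all2_Cons2)
    then show False using V(3) by contradiction
  qed
  ultimately obtain x y where xy: "x * y \<in> V" "x \<notin> V" "y \<notin> V" using V by (auto simp: prm_def)
  have "?good (V + (*) z ` UNIV)" if "z \<notin> V" for z
  proof (rule ccontr)
    assume "\<not> ?thesis"
    then have "V + (*) z ` UNIV \<in> ?F"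
      using idl_principal_plus[OF V(1)] principal_plus_superset(1)[OF V(1), of z] V(2) by blast
    then have "V + (*) z ` UNIV = V" using max principal_plus_superset(1)[OF V(1), of z] by blast
    then show False using principal_plus_superset(2)[OF V(1), of z] that by simp
  qed
  from this[OF xy(2)] this[OF xy(3)]
  obtain Ps Ps' where Ps: "\<forall>P\<in>set Ps. prm K P \<and> V + (*) x ` UNIV \<subseteq> P"
      "\<forall>xs. list_all2 (\<in>) xs Ps \<longrightarrow> prod_list xs \<in> V + (*) x ` UNIV"
      "\<forall>P\<in>set Ps'. prm K P \<and> V + (*) y ` UNIV \<subseteq> P"
      "\<forall>xs. list_all2 (\<in>) xs Ps' \<longrightarrow> prod_list xs \<in> V + (*) y ` UNIV" by blast
  have "?good V"
  proof (intro exI[of _ "Ps @ Ps'"] conjI ballI allI impI)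
    fix P assume P: "P \<in> set (Ps @ Ps')"
    then show "prm K P" using Ps by auto
    show "V \<subseteq> P" using P Ps(1,3) principal_plus_superset(1)[OF V(1)] by auto blast+
  next
    fix xs assume "list_all2 (\<in>) xs (Ps @ Ps')"
    then obtain us vs where uv: "xs = us @ vs" "list_all2 (\<in>) us Ps" "list_all2 (\<in>) vs Ps'"
      by (auto simp: list_all2_append2)
    then have "prod_list us \<in> V + (*) x ` UNIV" "prod_list vs \<in> V + (*) y ` UNIV" using Ps by blast+
    then obtain v r v' r' where "prod_list us = v + x * r" "v \<in> V" "prod_list vs = v' + y * r'" "v' \<in> V"
      by (auto elim!: set_plus_elim)
    moreover have "(v + x * r) * (v' + y * r') = (v' + y * r') * v + (x * r) * v' + (r * r') * (x * y)"
      by (simp add: algebra_simps)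
    ultimately show "prod_list xs \<in> V"
      using xy(1) sub_add[OF V(1)] idl_mult[OF V(1)] by (simp add: uv(1))
  qed
  then show False using V(3) by contradiction
qed

lemma prm_W1: "prm K (W 1)"
proof -
  have "y \<in> W 1" if xy: "x * y \<in> W 1" "x \<notin> W 1" for x y
  proof -
    obtain z where "x * z - 1 \<in> K" using unit[OF xy(2)] by blast
    then have "z * (x * y) \<in> W 1" "y * (x * z - 1) \<in> W 1"
      using idl_mult[OF W xy(1)] idl_mult[OF W, of "x * z - 1" 1 y] KW[of 1] by blast+
    then have "z * (x * y) - y * (x * z - 1) \<in> W 1" by (rule idl_diff[OF W])
    then show ?thesis by (simp add: algebra_simps)
  qed
  then show ?thesis using W KW one unfolding prm_def by blast
qed

lemma proper_le_W1: assumes U: "idl U" "K \<subseteq> U" "1 \<notin> U" shows "U \<subseteq> W 1"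
proof
  fix x assume x: "x \<in> U"
  show "x \<in> W 1"
  proof (rule ccontr)
    assume "x \<notin> W 1"
    then obtain y where "x * y - 1 \<in> K" using unit by blast
    then have "x * y - 1 \<in> U" "x * y \<in> U" using U(2) idl_mult'[OF U(1) x] by auto
    then show False using idl_cong[OF U(1), of "x * y" 1] U(3) by blast
  qed
qed

definition pchain :: "'t set \<Rightarrow> nat \<Rightarrow> (nat \<Rightarrow> 't set) \<Rightarrow> bool" where
  "pchain U n C \<longleftrightarrow> U \<subseteq> C 0 \<and> (\<forall>i\<le>n. prm K (C i)) \<and> (\<forall>i<n. C i \<subset> C (Suc i))"

lemma pchain_extend:
  assumes "pchain U n C" "prm K P" "P \<subset> C 0"
  shows "pchain P (Suc n) (case_nat P C)"
  unfolding pchain_def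
proof (intro conjI allI impI)
  show "prm K (case_nat P C i)" if "i \<le> Suc n" for i using that assms by (cases i) (auto simp: pchain_def)
  show "case_nat P C i \<subset> case_nat P C (Suc i)" if "i < Suc n" for i
    using that assms by (cases i) (auto simp: pchain_def)
qed simp

lemma pchain_mono: "pchain U n C \<Longrightarrow> U' \<subseteq> U \<Longrightarrow> pchain U' n C"
  unfolding pchain_def by blast

text \<open>An element of the maximal ideal outside the non-maximal primes of a prime factorization
  of \<open>U\<close> shortens all chains of primes above \<open>U\<close>.\<close>

lemma parameters_if_chains_bounded:
  assumes "idl U" "K \<subseteq> U" "\<And>n' C. pchain U n' C \<Longrightarrow> n' \<le> n"
  shows "\<exists>bs N. length bs = n \<and> set bs \<subseteq> W 1 \<and> W N \<subseteq> pid 1 bs U"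
  using assms
proof (induction n arbitrary: U)
  case 0
  obtain Ps where Ps: "\<forall>P\<in>set Ps. prm K P \<and> U \<subseteq> P" "\<forall>xs. list_all2 (\<in>) xs Ps \<longrightarrow> prod_list xs \<in> U"
    using prime_product[OF "0.prems"(1,2)] by blast
  have all: "P = W 1" if "P \<in> set Ps" for P
  proof (rule ccontr)
    assume neq: "P \<noteq> W 1"
    have P: "prm K P" "U \<subseteq> P" using Ps that by auto
    then have "P \<subset> W 1" using proper_le_W1[OF prmD(1-3)[OF P(1)]] neq by blast
    moreover have "pchain (W 1) 0 (\<lambda>_. W 1)" using prm_W1 by (simp add: pchain_def)
    ultimately have "pchain U 1 (case_nat P (\<lambda>_. W 1))" using pchain_extend[OF _ P(1)] pchain_mono[OF _ P(2)] by simp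
    then show False using "0.prems"(3) by fastforce
  qed
  obtain ys where ys: "W 1 = pid 1 ys K" "set ys \<subseteq> W 1" using fg[OF W KW] by blast
  have "W (length Ps) \<subseteq> U"
  proof (rule W_products[OF ys(1) "0.prems"(1,2)])
    fix zs assume zs: "set zs \<subseteq> set ys" "length zs = length Ps"
    have "zs ! i \<in> Ps ! i" if "i < length Ps" for i
    proof -
      have "zs ! i \<in> set zs" using that zs(2) by simp
      then show ?thesis using all[OF nth_mem[OF that]] zs(1) ys(2) by blast
    qed
    then have "list_all2 (\<in>) zs Ps" using zs(2) by (simp add: list_all2_conv_all_nth)
    then show "prod_list zs \<in> U" using Ps(2) by blast
  qed
  then show ?case by (intro exI[of _ "[]"] exI[of _ "length Ps"]) simp
next
  case (Suc n)
  obtain Ps where Ps: "\<forall>P\<in>set Ps. prm K P \<and> U \<subseteq> P" "\<forall>xs. list_all2 (\<in>) xs Ps \<longrightarrow> prod_list xs \<in> U"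
    using prime_product[OF Suc.prems(1,2)] by blast
  have "\<exists>b\<in>W 1. \<forall>P\<in>set Ps - {W 1}. b \<notin> P"
  proof (rule prime_avoidance[OF W])
    fix P assume P: "P \<in> set Ps - {W 1}"
    then have "prm K P" using Ps by auto
    then show "prm K P \<and> \<not> W 1 \<subseteq> P" using proper_le_W1[OF prmD(1-3)] P by blast
  qed simp
  then obtain b where b: "b \<in> W 1" "\<forall>P\<in>set Ps - {W 1}. b \<notin> P" by blast
  let ?U = "U + (*) b ` UNIV"
  note U = principal_plus_superset[OF Suc.prems(1), of b]
  have "n' \<le> n" if C: "pchain ?U n' C" for n' C
  proof -
    have C0: "prm K (C 0)" "U \<subseteq> C 0" "b \<in> C 0" using C U unfolding pchain_def by auto
    obtain P where P: "P \<in> set Ps" "P \<subseteq> C 0" using prm_above_product[OF C0(1), of Ps] Ps(2) C0(2) by blast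
    show ?thesis
    proof (cases "P = W 1")
      case True
      have "n' = 0"
      proof (rule ccontr)
        assume "n' \<noteq> 0"
        then have c: "prm K (C 1)" "C 0 \<subset> C 1" using C by (auto simp: pchain_def)
        then show False using P(2) True proper_le_W1[OF prmD(1-3)[OF c(1)]] by blast
      qed
      then show ?thesis by simp
    next
      case False
      then have "P \<subset> C 0" "prm K P" "U \<subseteq> P" using b(2) C0(3) P Ps(1) by auto
      then have "pchain U (Suc n') (case_nat P C)" using pchain_extend[OF C] pchain_mono by blast
      then show ?thesis using Suc.prems(3) by fastforce
    qed
  qed
  then obtain bs N where "length bs = n" "set bs \<subseteq> W 1" "W N \<subseteq> pid 1 bs ?U"
    using Suc.IH[OF idl_principal_plus[OF Suc.prems(1)]] U(1) Suc.prems(2) by blast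
  then show ?case using b(1) by (intro exI[of _ "b # bs"] exI[of _ N]) simp
qed

text \<open>A chain of primes above \<open>c\<close> extends downwards by one step, so
  \<open>d - 1\<close> parameters suffice modulo \<open>c\<close> and the length is
  \<open>O(q^(d-1))\<close>. For \<open>d = 0\<close> no prime contains \<open>c\<close>, which is
  then a unit modulo \<open>K\<close>.\<close>

lemma small_length:
  assumes dim: "\<And>n C. pchain K n C \<Longrightarrow> n \<le> d"
    and c: "\<And>P. prm K P \<Longrightarrow> c \<in> P \<Longrightarrow> \<exists>Q. prm K Q \<and> Q \<subset> P"
    and I: "idl I" "K \<subseteq> I" "W c0 \<subseteq> I"
  shows "\<exists>k. \<forall>q\<ge>1. of_nat q * len (br K I q + (*) c ` UNIV) UNIV \<le> of_nat (k * q ^ d)"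
proof -
  let ?U = "K + (*) c ` UNIV"
  note U = idl_principal_plus[OF K, of c] principal_plus_superset[OF K, of c]
  have chains: "Suc n \<le> d" if C: "pchain ?U n C" for n C
  proof -
    have "prm K (C 0)" "c \<in> C 0" using C U(3) unfolding pchain_def by auto
    then obtain Q where Q: "prm K Q" "Q \<subset> C 0" using c by blast
    then show ?thesis using dim pchain_mono[OF pchain_extend[OF C Q] prmD(2)[OF Q(1)]] by blast
  qed
  have B: "idl (br K I q + (*) c ` UNIV)" for q by (rule idl_principal_plus[OF idl_br])
  have UB: "?U \<subseteq> br K I q + (*) c ` UNIV" for q by (intro plus_mono br_superset(1) order.refl)
  show ?thesis
  proof (cases d)
    case 0
    have "1 \<in> ?U"
    proof (rule ccontr)
      assume "1 \<notin> ?U"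
      then have "?U \<subseteq> W 1" by (rule proper_le_W1[OF U(1,2)])
      then have "pchain ?U 0 (\<lambda>_. W 1)" using prm_W1 by (simp add: pchain_def)
      then show False using chains 0 by fastforce
    qed
    then have "1 \<in> br K I q + (*) c ` UNIV" for q using UB by blast
    then have "br K I q + (*) c ` UNIV = UNIV" for q using idl_mult[OF B, of 1] by fastforce
    then show ?thesis by (simp add: slen_self)
  next
    case (Suc d')
    have "n \<le> d'" if "pchain ?U n C" for n C using chains[OF that] Suc by simp
    then obtain bs N where bs: "length bs = d'" "set bs \<subseteq> W 1" "W N \<subseteq> pid 1 bs ?U"
      using parameters_if_chains_bounded[OF U(1,2)] by blast
    have "len (pid 1 bs ?U) UNIV \<noteq> \<infinity>" by (rule len_finite[OF bs(3)])
    then obtain L where L: "len (pid 1 bs ?U) UNIV = of_nat L" by (auto simp: of_nat_eq_enat)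
    define s where "s = Suc c0"
    have "of_nat q * len (br K I q + (*) c ` UNIV) UNIV \<le> of_nat (s ^ d' * L * q ^ d)" for q
    proof -
      have "pid (s * q) bs ?U \<subseteq> br K I q + (*) c ` UNIV"
      proof (rule pw_least[OF B UB])
        fix x b assume "x \<in> set bs"
        then have "x ^ s \<in> I" using W_power[of x s] W_antimono[of c0 s] bs(2) I(3) by (auto simp: s_def)
        then have "(x ^ s) ^ q \<in> br K I q" by (rule br_superset(2))
        then have "x ^ (s * q) \<in> br K I q + (*) c ` UNIV"
          using principal_plus_superset(1)[OF idl_br[of K I q], of c] by (auto simp: power_mult)
        then show "x ^ (s * q) * b \<in> br K I q + (*) c ` UNIV" by (rule idl_mult'[OF B])
      qed
      then have "len (br K I q + (*) c ` UNIV) UNIV \<le> len (pid (s * q) bs ?U) UNIV" by (intro slen_mono) auto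
      also have "\<dots> \<le> of_nat ((s * q) ^ d') * len (pid 1 bs ?U) UNIV"
        using len_pid[OF U(1), of "s * q" bs] bs(1) by simp
      also have "\<dots> = of_nat ((s * q) ^ d' * L)" unfolding L by simp
      finally have "of_nat q * len (br K I q + (*) c ` UNIV) UNIV \<le> of_nat q * of_nat ((s * q) ^ d' * L)"
        by (intro mult_left_mono) auto
      also have "\<dots> = of_nat (s ^ d' * L * q ^ d)" unfolding Suc by (simp flip: of_nat_mult add: power_mult_distrib mult_ac)
      finally show ?thesis .
    qed
    then show ?thesis by blast
  qed
qed

lemma small_length_tendsto:
  assumes dim: "\<And>n C. pchain K n C \<Longrightarrow> n \<le> d"
    and c: "\<And>P. prm K P \<Longrightarrow> c \<in> P \<Longrightarrow> \<exists>Q. prm K Q \<and> Q \<subset> P"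
    and I: "idl I" "K \<subseteq> I" "W c0 \<subseteq> I"
  shows "(\<lambda>e. rlen (len (br K I (p ^ e) + (*) c ` UNIV) UNIV) / real (p ^ e) ^ d) \<longlonglongrightarrow> 0"
proof -
  obtain k where k: "\<forall>q\<ge>1. of_nat q * len (br K I q + (*) c ` UNIV) UNIV \<le> of_nat (k * q ^ d)"
  proof -
    have "\<exists>k. \<forall>q\<ge>1. of_nat q * len (br K I q + (*) c ` UNIV) UNIV \<le> of_nat (k * q ^ d)"
      by (rule small_length[OF _ _ I]) (use dim c in blast)+
    then show thesis using that by blast
  qed
  have p1: "real p > 1" using prime_gt_1_nat[OF p] by simp
  let ?r = "\<lambda>e. rlen (len (br K I (p ^ e) + (*) c ` UNIV) UNIV)"
  have bound: "?r e / real (p ^ e) ^ d \<le> real k * inverse (real p) ^ e" for e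
  proof -
    have q: "p ^ e \<ge> 1" using prime_gt_0_nat[OF p] by simp
    let ?l = "len (br K I (p ^ e) + (*) c ` UNIV) UNIV"
    have "W n \<subseteq> br K I (p ^ e) \<Longrightarrow> ?l \<noteq> \<infinity>" for n
      using len_finite[of n "br K I (p ^ e) + (*) c ` UNIV"] principal_plus_superset(1)[OF idl_br] by blast
    then have fin: "?l \<noteq> \<infinity>" using br_mprimary[OF I q] by blast
    have "of_nat (p ^ e) * ?l \<le> of_nat (k * (p ^ e) ^ d)" using k q by blast
    then have "rlen (of_nat (p ^ e) * ?l) \<le> rlen (of_nat (k * (p ^ e) ^ d))"
      by (rule rlen_mono) (simp add: of_nat_eq_enat del: of_nat_mult of_nat_power)
    then have "real (p ^ e) * ?r e \<le> real k * real (p ^ e) ^ d"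
      unfolding rlen_mult[OF fin] rlen_of_nat by simp
    then show ?thesis using p1 by (simp add: field_simps)
  qed
  have "(\<lambda>e. real k * inverse (real p) ^ e) \<longlonglongrightarrow> real k * 0"
    by (intro tendsto_mult tendsto_const LIMSEQ_realpow_zero) (use p1 in \<open>auto simp: field_simps\<close>)
  then have lim: "(\<lambda>e. real k * inverse (real p) ^ e) \<longlonglongrightarrow> 0" by simp
  show ?thesis
    by (rule tendsto_sandwich[OF _ _ tendsto_const lim]; intro always_eventually allI bound)
      (simp add: rlen_nonneg)
qed

end

section \<open>The local ring and its completion\<close>

lemma (in cring) ideal_ideal_power: "ideal I R \<Longrightarrow> ideal (ideal_power R I n) R"
  by (induction n) (auto intro: oneideal ideal_prod_is_ideal)

lemma (in cring) noeth_pre: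
  assumes "noetherian_ring R" and U: "idl U" "ker0 \<subseteq> U"
  shows "\<exists>Y. finite Y \<and> U = gen UNIV (Y \<union> ker0)"
proof -
  obtain A where A: "A \<subseteq> carrier R" "finite A" "feval R ` U = Idl A"
    using noetherian_ring.finetely_gen[OF assms(1) ideal_image[OF U(1)]] by blast
  have "feval R ` fvar ` A = A" using A(1) by (force simp: feval_fvar image_image)
  then have "pre (Idl A) = gen UNIV (fvar ` A \<union> ker0)" using pre_genideal[of "fvar ` A"] by simp
  then have "U = gen UNIV (fvar ` A \<union> ker0)" using pre_image[OF U] A(3) by simp
  then show ?thesis using A(2) by blast
qed

text \<open>If \<open>x\<close> had no inverse, an ideal maximal among the proper ones above
  \<open>x\<close> would map to a maximal ideal of \<open>R\<close>. That can only be
  \<open>m\<close>, which \<open>x\<close> avoids.\<close>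

lemma (in cring) local_unit:
  assumes noeth: "noetherian_ring R" and loc: "\<And>N. maximalideal N R \<Longrightarrow> N = m" and x: "x \<notin> pre m"
  shows "\<exists>y. x * y - 1 \<in> ker0"
proof (rule ccontr)
  assume no: "\<not> ?thesis"
  let ?G = "ker0 + (*) x ` UNIV"
  let ?F = "{U. idl U \<and> ?G \<subseteq> U \<and> 1 \<notin> U}"
  note G = idl_principal_plus[OF idl_ker0, of x] principal_plus_superset[OF idl_ker0, of x]
  have "1 \<notin> ?G"
  proof
    assume "1 \<in> ?G"
    then obtain k y where "1 = k + x * y" "k \<in> ker0" by (auto elim!: set_plus_elim)
    then have "x * y - 1 = - k" "- k \<in> ker0" using idl_uminus[OF idl_ker0] by (auto simp: algebra_simps)
    then have "x * y - 1 \<in> ker0" by (simp only:)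
    then show False using no by blast
  qed
  then have "?F \<noteq> {}" using G(1) by blast
  moreover have "\<And>U. U \<in> ?F \<Longrightarrow> idl U \<and> ker0 \<subseteq> U" using G(2) by blast
  ultimately obtain V where V: "V \<in> ?F" "\<forall>U\<in>?F. V \<subseteq> U \<longrightarrow> U = V"
    using noeth_maximal[of ker0 ?F, OF noeth_pre[OF noeth]] by blast
  then have V': "idl V" "ker0 \<subseteq> V" "1 \<notin> V" "x \<in> V" using G(2,3) by auto
  have "maximalideal (feval R ` V) R"
  proof (rule maximalidealI[OF ideal_image[OF V'(1)]])
    show "carrier R \<noteq> feval R ` V"
    proof
      assume "carrier R = feval R ` V"
      then have "pre (feval R ` V) = UNIV" using pre_carrier by simp
      then show False using V'(3) pre_image[OF V'(1,2)] by simp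
    qed
    fix J assume J: "ideal J R" "feval R ` V \<subseteq> J" "J \<subseteq> carrier R"
    have VJ: "V \<subseteq> pre J" using J(2) by (auto simp: mem_pre)
    show "J = feval R ` V \<or> J = carrier R"
    proof (cases "1 \<in> pre J")
      case True
      then show ?thesis using ideal.one_imp_carrier[OF J(1)] by (simp add: mem_pre)
    next
      case False
      then have "pre J \<in> ?F" using idl_pre[OF J(1)] VJ V(1) by blast
      then have "pre J = V" using V(2) VJ by blast
      then show ?thesis using image_pre[OF J(3)] by simp
    qed
  qed
  then have "pre m = V" using loc pre_image[OF V'(1,2)] by blast
  then show False using V'(4) x by blast
qed

lemma (in cring) noeth_local_pre:
  assumes noeth: "noetherian_ring R" and loc: "\<exists>!N. maximalideal N R" and m: "maximalideal m R"
    and p: "Factorial_Ring.prime p" and char: "has_characteristic R p"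
  shows "noeth_local ker0 (\<lambda>n. pre (ideal_power R m n)) p"
proof -
  interpret m: maximalideal m R by (rule m)
  have one: "ideal_power R m 1 = m"
    using ideal_prod_one[OF m.is_ideal] ideal_prod_commute[OF m.is_ideal oneideal] by simp
  show ?thesis
  proof
    show "idl ker0" by (rule idl_ker0)
    show "idl (pre (ideal_power R m n))" for n by (intro idl_pre ideal_ideal_power m.is_ideal)
    show "pre (ideal_power R m 0) = UNIV" by (simp add: pre_carrier)
    show "ker0 \<subseteq> pre (ideal_power R m n)" for n by (intro ker0_pre ideal_ideal_power m.is_ideal)
    show "pre (ideal_power R m (Suc n)) = prd ker0 (pre (ideal_power R m n)) (pre (ideal_power R m 1))" for n
      unfolding one by (simp add: pre_ideal_prod ideal_ideal_power m.is_ideal)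
    show "\<exists>Y. finite Y \<and> U = gen UNIV (Y \<union> ker0)" if "idl U" "ker0 \<subseteq> U" for U by (rule noeth_pre[OF noeth that])
    show "\<exists>y. x * y - 1 \<in> ker0" if "x \<notin> pre (ideal_power R m 1)" for x
      using local_unit[OF noeth _ that[unfolded one]] loc m by blast
    show "1 \<notin> pre (ideal_power R m 1)"
      unfolding one using m.one_imp_carrier m.I_notcarr by (auto simp: mem_pre)
    show "Factorial_Ring.prime p" by (rule p)
    have "feval R (of_nat n) = [n] \<cdot> \<one>" for n
      by (induction n) (simp_all add: add.nat_pow_Suc a_comm)
    then show "of_nat p \<in> ker0" using char by (simp add: mem_pre has_characteristic_def)
  qed
qed

lemma (in ideal) mem_coset_iff:
  assumes "a \<in> carrier R" "b \<in> carrier R" shows "b \<in> I +> a \<longleftrightarrow> b \<ominus> a \<in> I"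
  using quotient_eq_iff_same_a_r_cos[OF ideal_axioms assms(2,1)] a_repr_independence'[of b a]
    a_rcos_self[OF assms(2)] assms by auto

text \<open>A member of the completion is a sequence of cosets, and \<open>t\<close> approximates it
  at level \<open>n\<close> when its value lies in the \<open>n\<close>-th coset. The completion is
  lifted to a free ring as well; the elements \<open>v\<close> live there.\<close>

lemma (in cring) adic_pre:
  fixes m :: "'a set"
  defines "Q \<equiv> adic_completion R m"
  assumes "noeth_local ker0 (\<lambda>n. pre (ideal_power R m n)) p" and m: "ideal m R" and red: "reduced_ring Q"
  shows "adic ker0 (\<lambda>n. pre (ideal_power R m n)) p (\<lambda>v n t. feval R t \<in> feval Q v n)"
proof -
  interpret nl: noeth_local ker0 "\<lambda>n. pre (ideal_power R m n)" p by (rule assms(2))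
  interpret Q: cring Q using red by (simp add: reduced_ring_def)
  let ?m = "\<lambda>n. ideal_power R m n"
  have id: "ideal (?m n) R" for n by (rule ideal_ideal_power[OF m])
  have coset: "\<exists>a\<in>carrier R. feval Q v n = ?m n +> a" for v n
    using Q.feval_closed[of v] unfolding Q_def adic_completion_def FactRing_def A_RCOSETS_def' by auto
  have mem: "feval R t \<in> ?m n +> a \<longleftrightarrow> feval R t \<ominus> a \<in> ?m n" if "a \<in> carrier R" for t n a
    by (rule ideal.mem_coset_iff[OF id that feval_closed])
  have ap: "feval R t \<in> feval Q v n \<longleftrightarrow> feval Q v n = ?m n +> feval R t" for t v n
    using coset[of v n] ideal.axioms(1)[OF id[of n]] abelian_subgroup.a_repr_independence'[OF abelian_subgroupI3]
      ideal.mem_coset_iff[OF id feval_closed feval_closed, of t n t] is_abelian_group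
    by (metis abelian_subgroup.a_rcos_self abelian_subgroupI3 feval_closed)
  have opQ: "(f \<oplus>\<^bsub>Q\<^esub> g) n = f n <+> g n" "(f \<otimes>\<^bsub>Q\<^esub> g) n = rcoset_mult R (?m n) (f n) (g n)"
    "\<one>\<^bsub>Q\<^esub> n = ?m n +> \<one>" for f g n
    by (simp_all add: Q_def adic_completion_def FactRing_def)
  have zeroQ: "\<zero>\<^bsub>Q\<^esub> n = ?m n" for n by (simp add: Q_def adic_completion_def FactRing_def)
  show ?thesis
  proof
    fix v w :: "(nat \<Rightarrow> 'a set) frng" and n s t
    show "\<exists>t. feval R t \<in> feval Q v n"
    proof -
      obtain a where a: "a \<in> carrier R" "feval Q v n = ?m n +> a" using coset by blast
      then have "feval R (fvar a) \<in> feval Q v n"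
        using mem[OF a(1), of "fvar a" n] additive_subgroup.zero_closed[OF ideal.axioms(1)[OF id]]
        by (simp add: feval_fvar minus_eq r_neg)
      then show ?thesis by blast
    qed
    show "(feval R t \<in> feval Q v n) = (t - s \<in> pre (?m n))" if "feval R s \<in> feval Q v n"
      using that unfolding ap[of s] by (simp add: mem mem_pre)
    show "feval R (s + t) \<in> feval Q (v + w) n" if "feval R s \<in> feval Q v n" "feval R t \<in> feval Q w n"
    proof -
      have "feval Q (v + w) n = (?m n +> feval R s) <+> (?m n +> feval R t)"
        using that unfolding ap by (simp add: opQ)
      then show ?thesis unfolding ap by (simp add: ideal.a_rcos_sum[OF id])
    qed
    show "feval R (s * t) \<in> feval Q (v * w) n" if "feval R s \<in> feval Q v n" "feval R t \<in> feval Q w n"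
    proof -
      have "feval Q (v * w) n = rcoset_mult R (?m n) (?m n +> feval R s) (?m n +> feval R t)"
        using that unfolding ap by (simp add: opQ)
      then show ?thesis unfolding ap by (simp add: ideal.rcoset_mult_add[OF id])
    qed
    show "feval R 0 \<in> feval Q 0 n"
      using additive_subgroup.zero_closed[OF ideal.axioms(1)[OF id]] by (simp add: zeroQ)
    show "feval R 1 \<in> feval Q 1 n" unfolding ap by (simp add: opQ)
    show "feval R t \<in> feval Q v n" if "feval R t \<in> feval Q v (Suc n)"
      using that Q.feval_closed[of v] unfolding Q_def adic_completion_def by auto
  next
    fix f assume f: "\<forall>n. f (Suc n) - f n \<in> pre (?m n)"
    define g where "g n = ?m n +> feval R (f n)" for n
    have "g \<in> carrier Q"
      unfolding Q_def adic_completion_def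
    proof (simp, intro conjI allI)
      show "g n \<in> carrier (R Quot ?m n)" for n
        unfolding g_def FactRing_def A_RCOSETS_def' by auto
      show "g (Suc n) \<subseteq> g n" for n
      proof
        fix b assume b: "b \<in> g (Suc n)"
        then have bc: "b \<in> carrier R"
          unfolding g_def using ideal.Icarr[OF id[of "Suc n"]] by (auto simp: a_r_coset_def' simp del: ideal_power.simps)
        let ?b = "fvar b"
        have "?b - f (Suc n) \<in> pre (?m (Suc n))"
          using b mem[of "feval R (f (Suc n))" ?b "Suc n"] bc by (simp add: g_def mem_pre feval_fvar)
        then have "?b - f (Suc n) \<in> pre (?m n)" using nl.W_step by blast
        then have "?b - f n \<in> pre (?m n)" using f idl_trans[OF nl.W] by blast
        then show "b \<in> g n" using mem[of "feval R (f n)" ?b n] bc by (simp add: g_def mem_pre feval_fvar)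
      qed
    qed
    then have "feval R (f n) \<in> feval Q (fvar g) n" for n
      unfolding ap by (simp add: Q.feval_fvar g_def)
    then show "\<exists>v. \<forall>n. feval R (f n) \<in> feval Q v n" by blast
  next
    fix v assume v: "\<forall>n. feval R 0 \<in> feval Q (v * v) n"
    have z: "feval Q w = \<zero>\<^bsub>Q\<^esub>" if "\<forall>n. feval R 0 \<in> feval Q w n" for w
    proof
      fix n show "feval Q w n = \<zero>\<^bsub>Q\<^esub> n"
        using that additive_subgroup.zero_closed[OF ideal.axioms(1)[OF id]] unfolding ap zeroQ
        by (simp add: abelian_subgroup.a_rcos_const[OF abelian_subgroupI3[OF ideal.axioms(1)[OF id] is_abelian_group]])
    qed
    have "feval Q (v ^ 2) = \<zero>\<^bsub>Q\<^esub>" using z[OF v] by (simp add: power2_eq_square)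
    then have "feval Q v [^]\<^bsub>Q\<^esub> (2::nat) = \<zero>\<^bsub>Q\<^esub>" by (simp only: Q.feval_power)
    then have "feval Q v = \<zero>\<^bsub>Q\<^esub>" using red Q.feval_closed[of v] unfolding reduced_ring_def by blast
    then show "\<forall>n. feval R 0 \<in> feval Q v n"
      using additive_subgroup.zero_closed[OF ideal.axioms(1)[OF id]] by (simp add: zeroQ)
  qed
qed

section \<open>Products with Frobenius powers of parameter ideals\<close>

lemma prd_pid:
  assumes Z: "idl Z" and I: "idl I" "Z \<subseteq> I" shows "prd Z I (pid 1 bs Z) = pw I 1 bs Z"
proof
  have P: "idl (pw I 1 bs Z)" by (rule pw_sub[OF I(1) Z])
  show "prd Z I (pid 1 bs Z) \<subseteq> pw I 1 bs Z"
  proof (rule prd_least[OF P pw_superset[OF I(1)]])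
    fix i b assume i: "i \<in> I" and b: "b \<in> pid 1 bs Z"
    have "pid 1 bs Z \<subseteq> colon (pw I 1 bs Z) i"
    proof (rule pw_least[OF idl_colon[OF P]])
      show "Z \<subseteq> colon (pw I 1 bs Z) i"
        unfolding colon_def using idl_mult[OF Z] pw_superset[OF I(1), of Z 1 bs] by auto
      fix x r assume "x \<in> set bs"
      then have "x ^ 1 * (r * i) \<in> pw I 1 bs Z" by (rule pw_mem[OF I(1) Z _ idl_mult[OF I(1) i]])
      then show "x ^ 1 * r \<in> colon (pw I 1 bs Z) i" by (simp add: colon_def mult_ac)
    qed
    then show "i * b \<in> pw I 1 bs Z" using b by (auto simp: colon_def)
  qed
  show "pw I 1 bs Z \<subseteq> prd Z I (pid 1 bs Z)"
  proof (rule pw_least[OF idl_prd prd_superset(1)])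
    fix x b assume x: "x \<in> set bs" and b: "b \<in> I"
    have "x ^ 1 * 1 \<in> pid 1 bs Z" by (rule pw_mem[OF sub_UNIV Z x UNIV_I])
    then have "b * x \<in> prd Z I (pid 1 bs Z)" using b by (intro prd_superset(2)) auto
    then show "x ^ 1 * b \<in> prd Z I (pid 1 bs Z)" by (simp add: mult.commute)
  qed
qed

context noeth_local
begin

lemma p_power_pos: "p ^ e \<ge> 1" using prime_gt_0_nat[OF p] by simp

lemma frobenius_preimage: assumes V: "idl V" "K \<subseteq> V" shows "idl {x. c * x ^ (p ^ e) \<in> V}"
proof (rule subI)
  show "0 \<in> {x. c * x ^ (p ^ e) \<in> V}" using sub_zero[OF V(1)] prime_gt_0_nat[OF p] by (simp add: power_0_left)
  show "x + y \<in> {x. c * x ^ (p ^ e) \<in> V}"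
    if "x \<in> {x. c * x ^ (p ^ e) \<in> V}" "y \<in> {x. c * x ^ (p ^ e) \<in> V}" for x y
  proof -
    have "c * ((x + y) ^ (p ^ e) - (x ^ (p ^ e) + y ^ (p ^ e))) \<in> V"
      using idl_mult[OF V(1)] frobenius_add[OF K p pK] V(2) by blast
    then have "c * (x + y) ^ (p ^ e) - (c * x ^ (p ^ e) + c * y ^ (p ^ e)) \<in> V" by (simp add: algebra_simps)
    moreover have "c * x ^ (p ^ e) + c * y ^ (p ^ e) \<in> V" using that sub_add[OF V(1)] by blast
    ultimately show ?thesis using idl_cong[OF V(1)] by blast
  qed
  show "s * x \<in> {x. c * x ^ (p ^ e) \<in> V}" if "x \<in> {x. c * x ^ (p ^ e) \<in> V}" for s x
  proof -
    have "s ^ (p ^ e) * (c * x ^ (p ^ e)) \<in> V" using that idl_mult[OF V(1)] by blast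
    then show ?thesis by (simp add: power_mult_distrib mult_ac)
  qed
qed

lemma frobenius_preimage_K: assumes V: "idl V" "K \<subseteq> V" shows "K \<subseteq> {x. c * x ^ (p ^ e) \<in> V}"
proof
  fix x assume "x \<in> K"
  then have "x ^ (p ^ e) \<in> V" using idl_power[OF K, of x "p ^ e"] prime_gt_0_nat[OF p] V(2) by auto
  then have "c * x ^ (p ^ e) \<in> V" by (rule idl_mult[OF V(1)])
  then show "x \<in> {x. c * x ^ (p ^ e) \<in> V}" by simp
qed

lemma br_br: "br K (br K J (p ^ f)) (p ^ e) = br K J (p ^ (f + e))"
proof
  let ?V = "br K J (p ^ (f + e))"
  have V: "idl ?V" "K \<subseteq> ?V" by (rule idl_br, rule br_superset(1))
  have "br K J (p ^ f) \<subseteq> {x. 1 * x ^ (p ^ e) \<in> ?V}"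
    using br_superset(2)[of _ J "p ^ (f + e)" K]
    by (intro br_least frobenius_preimage frobenius_preimage_K V) (simp add: power_add flip: power_mult)
  then show "br K (br K J (p ^ f)) (p ^ e) \<subseteq> ?V" by (intro br_least V) auto
  show "?V \<subseteq> br K (br K J (p ^ f)) (p ^ e)"
    using br_superset(2)[of _ J "p ^ f" K]
    by (intro br_least idl_br br_superset(1)) (simp add: power_add power_mult br_superset(2))
qed

lemma br_prd: "br K (prd K I J) (p ^ e) = prd K (br K I (p ^ e)) (br K J (p ^ e))"
proof
  let ?V = "prd K (br K I (p ^ e)) (br K J (p ^ e))" and ?W = "br K (prd K I J) (p ^ e)"
  have V: "idl ?V" "K \<subseteq> ?V" by (rule idl_prd, rule prd_superset(1))
  have W: "idl ?W" "K \<subseteq> ?W" by (rule idl_br, rule br_superset(1))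
  have "prd K I J \<subseteq> {x. 1 * x ^ (p ^ e) \<in> ?V}"
    by (intro prd_least frobenius_preimage frobenius_preimage_K V)
      (auto simp: power_mult_distrib intro!: prd_superset(2) br_superset(2))
  then show "?W \<subseteq> ?V" by (intro br_least V) auto
  have KC: "K \<subseteq> colon ?W x" for x unfolding colon_def using idl_mult[OF K] W(2) by (auto dest: subsetD)
  have 1: "br K I (p ^ e) \<subseteq> colon ?W (j ^ (p ^ e))" if "j \<in> J" for j
  proof (rule br_least[OF idl_colon[OF W(1)] KC])
    fix x assume "x \<in> I"
    then have "(x * j) ^ (p ^ e) \<in> ?W" using that by (intro br_superset(2) prd_superset(2))
    then show "x ^ (p ^ e) \<in> colon ?W (j ^ (p ^ e))" by (simp add: colon_def power_mult_distrib mult.commute)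
  qed
  show "?V \<subseteq> ?W"
  proof (rule prd_least[OF W])
    fix x y assume x: "x \<in> br K I (p ^ e)" and y: "y \<in> br K J (p ^ e)"
    have "br K J (p ^ e) \<subseteq> colon ?W x"
      by (rule br_least[OF idl_colon[OF W(1)] KC]) (use 1 x in \<open>auto simp: colon_def mult.commute\<close>)
    then show "x * y \<in> ?W" using y by (auto simp: colon_def)
  qed
qed

lemma br_pid: "br K (pid 1 as K) (p ^ e) = pid (p ^ e) as K"
proof
  let ?V = "pid (p ^ e) as K"
  have V: "idl ?V" "K \<subseteq> ?V" using idl_pid[OF K] pw_superset[OF sub_UNIV] by blast+
  have "pid 1 as K \<subseteq> {x. 1 * x ^ (p ^ e) \<in> ?V}"
    by (rule pw_least[OF frobenius_preimage[OF V] frobenius_preimage_K[OF V]])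
      (use pw_mem[OF sub_UNIV K _ UNIV_I, of _ as "p ^ e"] in \<open>auto simp: power_mult_distrib\<close>)
  then show "br K (pid 1 as K) (p ^ e) \<subseteq> ?V" by (intro br_least V) auto
  show "?V \<subseteq> br K (pid 1 as K) (p ^ e)"
  proof (rule pw_least[OF idl_br br_superset(1)])
    fix x b assume "x \<in> set as"
    then have "x ^ 1 * 1 \<in> pid 1 as K" by (intro pw_mem[OF sub_UNIV K]) auto
    then show "x ^ (p ^ e) * b \<in> br K (pid 1 as K) (p ^ e)" by (intro idl_mult'[OF idl_br] br_superset(2)) simp
  qed
qed

lemma br_mono: "I \<subseteq> J \<Longrightarrow> br K I q \<subseteq> br K J q"
  by (rule br_least[OF idl_br br_superset(1)]) (auto intro: br_superset(2))

text \<open>These are the ideals primary to the maximal ideal, together with the unit ideal.\<close>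

definition "mp I \<longleftrightarrow> idl I \<and> K \<subseteq> I \<and> (\<exists>c. W c \<subseteq> I)"

lemma mpD: "mp I \<Longrightarrow> idl I" "mp I \<Longrightarrow> K \<subseteq> I" by (auto simp: mp_def)

lemma mp_finite: "mp I \<Longrightarrow> len I UNIV \<noteq> \<infinity>" unfolding mp_def using len_finite by blast

lemma mp_br: "mp I \<Longrightarrow> mp (br K I (p ^ e))"
  unfolding mp_def using idl_br br_superset(1) br_mprimary[OF _ _ _ p_power_pos] by blast

lemma mp_prd: assumes "mp I" "mp J" shows "mp (prd K I J)"
proof -
  obtain c c' where "W c \<subseteq> I" "W c' \<subseteq> J" using assms by (auto simp: mp_def)
  then have "W (c + c') \<subseteq> prd K I J" using W_split[of c c'] prd_mono by blast
  then show ?thesis unfolding mp_def using idl_prd prd_superset(1) by blast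
qed

lemma mp_superset: "mp I \<Longrightarrow> I \<subseteq> J \<Longrightarrow> idl J \<Longrightarrow> mp J" unfolding mp_def by blast

text \<open>A way of saying that \<open>c\<close> lies in no minimal prime.\<close>

definition "nonmin c \<longleftrightarrow> (\<forall>P. prm K P \<longrightarrow> c \<in> P \<longrightarrow> (\<exists>Q. prm K Q \<and> Q \<subset> P))"

lemma nonmin_one: "nonmin 1" by (auto simp: nonmin_def prm_def)

lemma nonmin_mult: "nonmin a \<Longrightarrow> nonmin b \<Longrightarrow> nonmin (a * b)"
  unfolding nonmin_def using prmD(4) by blast

text \<open>Tight closure gives every element its own multiplier and its own bound for the
  exponents. For finitely many generators take the product and the maximum; additivity of the
  Frobenius extends this to the ideal that they generate.\<close>

lemma uniform_multiplier:
  assumes Y: "finite Y"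
    and mult: "\<forall>y\<in>Y. \<exists>c e0. nonmin c \<and> (\<forall>e\<ge>e0. c * y ^ (p ^ e) \<in> br K V (p ^ e))"
  shows "\<exists>c e0. nonmin c \<and> (\<forall>e\<ge>e0. \<forall>x\<in>br K (gen UNIV (Y \<union> K)) (p ^ e). c * x \<in> br K V (p ^ e))"
proof -
  have "\<exists>c e0. nonmin c \<and> (\<forall>e\<ge>e0. \<forall>y\<in>Y. c * y ^ (p ^ e) \<in> br K V (p ^ e))"
    using Y mult
  proof (induction Y rule: finite_induct)
    case empty
    then show ?case using nonmin_one by blast
  next
    case (insert y Y)
    obtain c e0 where c: "nonmin c" "\<forall>e\<ge>e0. \<forall>y\<in>Y. c * y ^ (p ^ e) \<in> br K V (p ^ e)" using insert by auto
    obtain c' e0' where c': "nonmin c'" "\<forall>e\<ge>e0'. c' * y ^ (p ^ e) \<in> br K V (p ^ e)" using insert by auto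
    have "c * c' * z ^ (p ^ e) \<in> br K V (p ^ e)" if e: "e \<ge> max e0 e0'" and z: "z \<in> insert y Y" for e z
    proof (cases "z = y")
      case True
      then have "c' * z ^ (p ^ e) \<in> br K V (p ^ e)" using c'(2) e by simp
      then have "c * (c' * z ^ (p ^ e)) \<in> br K V (p ^ e)" by (rule idl_mult[OF idl_br])
      then show ?thesis by (simp add: mult_ac)
    next
      case False
      then have "c * z ^ (p ^ e) \<in> br K V (p ^ e)" using c(2) e z by simp
      then have "c' * (c * z ^ (p ^ e)) \<in> br K V (p ^ e)" by (rule idl_mult[OF idl_br])
      then show ?thesis by (simp add: mult_ac)
    qed
    then show ?case using nonmin_mult[OF c(1) c'(1)] by blast
  qed
  then obtain c e0 where c: "nonmin c" "\<forall>e\<ge>e0. \<forall>y\<in>Y. c * y ^ (p ^ e) \<in> br K V (p ^ e)" by blast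
  have "c * x \<in> br K V (p ^ e)" if e: "e \<ge> e0" and x: "x \<in> br K (gen UNIV (Y \<union> K)) (p ^ e)" for e x
  proof -
    let ?V = "br K V (p ^ e)"
    have V: "idl ?V" "K \<subseteq> ?V" by (rule idl_br, rule br_superset(1))
    have "gen UNIV (Y \<union> K) \<subseteq> {x. c * x ^ (p ^ e) \<in> ?V}"
      using frobenius_preimage_K[OF V] c(2) e by (intro gen_minimal frobenius_preimage V Un_least) auto
    then have "br K (gen UNIV (Y \<union> K)) (p ^ e) \<subseteq> colon ?V c"
      by (intro br_least idl_colon V) (use idl_mult[OF K] V(2) in \<open>auto simp: colon_def\<close>)
    then show ?thesis using x by (auto simp: colon_def)
  qed
  then show ?thesis using c(1) by blast
qed

lemma len_torsion:
  assumes "mp U" "idl V" "U \<subseteq> V" "\<And>v. v \<in> V \<Longrightarrow> c * v \<in> U"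
  shows "len U V \<le> len (U + (*) c ` UNIV) UNIV"
  by (rule slen_torsion) (use assms mpD(1) mp_finite in \<open>auto simp: sub_UNIV\<close>)

end

locale hk_setting = noeth_local K W p
  for K :: "'t::comm_ring_1 set" and W p +
  fixes as :: "'t list" and d :: nat
  assumes d: "length as = d" and mp_as: "mp (pid 1 as K)"
    and dim: "pchain K n C \<Longrightarrow> n \<le> d"
    and conv: "mp I \<Longrightarrow> convergent (\<lambda>e. rlen (len (br K I (p ^ e)) UNIV) / real (p ^ e) ^ d)"
begin

definition "hk I e = rlen (len (br K I (p ^ e)) UNIV) / real (p ^ e) ^ d"
definition "small c I e = rlen (len (br K I (p ^ e) + (*) c ` UNIV) UNIV) / real (p ^ e) ^ d"

lemma N_pos: "real (p ^ e) ^ d > 0" using prime_gt_0_nat[OF p] by simp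

lemma hk_tendsto: "mp I \<Longrightarrow> hk I \<longlonglongrightarrow> lim (hk I)"
  using conv[of I] unfolding hk_def[abs_def] by (simp add: convergent_LIMSEQ_iff)

lemma small_tendsto: "nonmin c \<Longrightarrow> mp I \<Longrightarrow> small c I \<longlonglongrightarrow> 0"
  unfolding mp_def small_def[abs_def] by (elim conjE exE, rule small_length_tendsto) (auto intro: dim simp: nonmin_def)

lemma small_finite: assumes "mp I" shows "len (br K I (p ^ e) + (*) c ` UNIV) UNIV \<noteq> \<infinity>"
  by (rule mp_finite, rule mp_superset[OF mp_br[OF assms] principal_plus_superset(1)[OF idl_br]])
    (rule idl_principal_plus[OF idl_br])

text \<open>Compare both bracket powers with their sum, which \<open>c\<close> multiplies into each
  of them. Each differs from the sum by at most its length modulo \<open>c\<close>, which is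
  negligible.\<close>

lemma hk_torsion:
  assumes c: "nonmin c" and I: "mp I1" "mp I2"
    and 1: "\<And>e x. e \<ge> e0 \<Longrightarrow> x \<in> br K I1 (p ^ e) \<Longrightarrow> c * x \<in> br K I2 (p ^ e)"
    and 2: "\<And>e x. e \<ge> e0 \<Longrightarrow> x \<in> br K I2 (p ^ e) \<Longrightarrow> c * x \<in> br K I1 (p ^ e)"
  shows "lim (hk I1) = lim (hk I2)"
proof -
  have bound: "\<bar>hk I1 e - hk I2 e\<bar> \<le> small c I1 e + small c I2 e" if e: "e \<ge> e0" for e
  proof -
    let ?U = "br K I1 (p ^ e)" and ?V = "br K I2 (p ^ e)"
    let ?T = "?U + ?V"
    have UV: "mp ?U" "mp ?V" using I mp_br by auto
    have T: "idl ?T" "?U \<subseteq> ?T" "?V \<subseteq> ?T"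
      using idl_plus[OF idl_br idl_br] plus_left_subset[OF idl_br] plus_right_subset[OF idl_br] by blast+
    have cT: "c * t \<in> ?U" "c * t \<in> ?V" if t: "t \<in> ?T" for t
    proof -
      obtain u v where uv: "t = u + v" "u \<in> ?U" "v \<in> ?V" using t by (auto elim!: set_plus_elim)
      show "c * t \<in> ?U" unfolding uv(1) distrib_left
        using idl_mult[OF idl_br uv(2)] 2[OF e uv(3)] by (rule sub_add[OF idl_br])
      show "c * t \<in> ?V" unfolding uv(1) distrib_left
        using 1[OF e uv(2)] idl_mult[OF idl_br uv(3)] by (rule sub_add[OF idl_br])
    qed
    have fin: "len ?T UNIV \<noteq> \<infinity>" by (rule mp_finite[OF mp_superset[OF UV(1) T(2,1)]])
    have l: "rlen (len D ?T) \<le> rlen (len (D + (*) c ` UNIV) UNIV)" "rlen (len D UNIV) = rlen (len D ?T) + rlen (len ?T UNIV)"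
      if D: "mp D" "D \<subseteq> ?T" "\<And>t. t \<in> ?T \<Longrightarrow> c * t \<in> D" for D
    proof -
      have "mp (D + (*) c ` UNIV)"
        using mp_superset[OF D(1)] principal_plus_superset(1) idl_principal_plus mpD(1)[OF D(1)] by blast
      then show "rlen (len D ?T) \<le> rlen (len (D + (*) c ` UNIV) UNIV)"
        by (intro rlen_mono len_torsion D T mp_finite)
      have "len D UNIV = len D ?T + len ?T UNIV"
        by (rule len_add[OF mpD(1)[OF D(1)] T(1) sub_UNIV D(2) subset_UNIV])
      moreover then have "len D ?T \<noteq> \<infinity>" using mp_finite[OF D(1)] enat_add_finiteD by metis
      ultimately show "rlen (len D UNIV) = rlen (len D ?T) + rlen (len ?T UNIV)" using fin rlen_add by simp
    qed
    have "\<bar>rlen (len ?U UNIV) - rlen (len ?V UNIV)\<bar>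
        \<le> rlen (len (?U + (*) c ` UNIV) UNIV) + rlen (len (?V + (*) c ` UNIV) UNIV)"
      using l[OF UV(1) T(2) cT(1)] l[OF UV(2) T(3) cT(2)] rlen_nonneg[of "len ?U ?T"] rlen_nonneg[of "len ?V ?T"]
      by linarith
    then show ?thesis unfolding hk_def small_def using N_pos[of e]
      by (simp add: divide_right_mono flip: diff_divide_distrib add_divide_distrib)
  qed
  have "(\<lambda>e. small c I1 e + small c I2 e) \<longlonglongrightarrow> 0 + 0"
    by (intro tendsto_add small_tendsto c I)
  then have s: "(\<lambda>e. small c I1 e + small c I2 e) \<longlonglongrightarrow> 0" by simp
  have "(\<lambda>e. hk I1 e - hk I2 e) \<longlonglongrightarrow> 0"
    by (rule tendsto_0_le[OF s, of _ 1], rule eventually_sequentiallyI[of e0]) (use bound in fastforce)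
  moreover have "(\<lambda>e. hk I1 e - hk I2 e) \<longlonglongrightarrow> lim (hk I1) - lim (hk I2)"
    by (intro tendsto_diff hk_tendsto I)
  ultimately show ?thesis using LIMSEQ_unique by fastforce
qed

text \<open>The colon ideals of the parameters are controlled by the convergence of the normalized lengths
  of the Frobenius powers of the parameter ideal.\<close>

lemma hk_parameter_product:
  assumes c: "nonmin c" and I: "mp I"
    and cI: "\<And>e x. e \<ge> e0 \<Longrightarrow> x \<in> br K (pid 1 as K) (p ^ (f + e)) \<Longrightarrow> c * x \<in> br K I (p ^ e)"
  shows "lim (hk (prd K I (br K (pid 1 as K) (p ^ f)))) =
    real d * lim (hk I) + lim (hk (br K (pid 1 as K) (p ^ f)))"
proof -
  let ?a = "br K (pid 1 as K) (p ^ f)"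
  have a: "mp ?a" using mp_br[OF mp_as] .
  have IA: "mp (prd K I ?a)" by (rule mp_prd[OF I a])
  have p2: "p \<ge> 2" using prime_ge_2_nat[OF p] .
  \<comment> \<open>The difference in parentheses is the drop in length from \<open>p ^ d\<close>
    copies of the quotient by \<open>b\<close> to the quotient by its \<open>p\<close>-th bracket
    power; the latter is normalized by a power larger by \<open>p ^ d\<close>, whence the
    factor.\<close>
  let ?D = "\<lambda>e. real d * (small c I e + real p ^ d * (hk ?a e - hk ?a (Suc e)))"
  have bound: "\<bar>hk (prd K I ?a) e - (real d * hk I e + hk ?a e)\<bar> \<le> ?D e" if e: "e \<ge> e0" for e
  proof -
    define bs where "bs = map (\<lambda>x. x ^ p ^ (f + e)) as"
    define i where "i = br K I (p ^ e)"
    let ?b = "pid 1 bs K"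
    have lbs: "length bs = d" by (simp add: bs_def d)
    have b: "?b = br K (pid 1 as K) (p ^ (f + e))" "pid p bs K = br K (pid 1 as K) (p ^ (f + Suc e))"
      unfolding bs_def pw_map_power br_pid by (simp_all add: mult.commute)
    have bA: "br K ?a (p ^ e) = ?b" "br K ?a (p ^ Suc e) = pid p bs K" unfolding b br_br by simp_all
    have mpb: "mp ?b" "mp (pid p bs K)" unfolding b by (rule mp_br[OF mp_as])+
    have i: "mp i" unfolding i_def by (rule mp_br[OF I])
    have prod: "br K (prd K I ?a) (p ^ e) = pw i 1 bs K"
      unfolding br_prd bA i_def[symmetric] by (rule prd_pid[OF K mpD[OF i]])
    have mpp: "mp (pw i 1 bs K)" unfolding prod[symmetric] by (rule mp_br[OF IA])
    have pb: "pw i 1 bs K \<subseteq> ?b" by (rule pw_mono) auto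
    let ?l = "len (pw i 1 bs K) ?b" and ?s = "len (i + (*) c ` UNIV) UNIV"
    have sfin: "?s \<noteq> \<infinity>" unfolding i_def by (rule small_finite[OF I])
    have add: "len (pw i 1 bs K) UNIV = ?l + len ?b UNIV"
      by (rule len_add[OF mpD(1)[OF mpp] mpD(1)[OF mpb(1)] sub_UNIV pb subset_UNIV])
    have lfin: "?l \<noteq> \<infinity>" using add mp_finite[OF mpp] enat_add_finiteD by metis
    have upper: "?l \<le> of_nat d * len i UNIV"
      using len_ideal_multiple_upper[OF K mpD(1)[OF i], of bs] lbs by simp
    define N N' where "N = the_enat (len ?b UNIV)" and "N' = the_enat (len (pid p bs K) UNIV)"
    have N: "len ?b UNIV = enat N" "len (pid p bs K) UNIV = enat N'"
      using mp_finite[OF mpb(1)] mp_finite[OF mpb(2)] by (auto simp: N_def N'_def)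
    \<comment> \<open>The first summand measures how far \<open>b\<close> is from lying in
      \<open>i\<close>, the second bounds the colon ideals modulo \<open>b\<close>. By
      \<open>NN\<close> the subtraction of natural numbers is exact.\<close>
    define \<delta> where "\<delta> = ?s + enat (p ^ d * N - N')"
    have NN: "N' \<le> p ^ d * N" using len_pid[OF K, of p bs] lbs N by (simp add: of_nat_eq_enat)
    have lower: "of_nat (length bs) * len i UNIV \<le> ?l + of_nat (length bs) * \<delta>"
    proof (rule len_ideal_multiple_lower[OF K mpD[OF i]])
      fix pre' x post assume bs: "bs = pre' @ x # post"
      let ?u = "colon (pid 1 (pre' @ post) K) x"
      have u: "idl ?u" by (rule idl_colon[OF idl_pid[OF K]])
      have "len i (i + ?u) \<le> len i (i + ?b) + len ?b (?b + ?u)"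
        by (rule len_colon_compare[OF K mpD(1)[OF i] mpD(1)[OF mpb(1)] u])
      also have "\<dots> \<le> ?s + enat (p ^ d * N - N')"
      proof (rule add_mono)
        show "len i (i + ?b) \<le> ?s"
        proof (rule len_torsion[OF i])
          show "idl (i + ?b)" by (rule idl_plus[OF mpD(1)[OF i] mpD(1)[OF mpb(1)]])
          show "i \<subseteq> i + ?b" by (rule plus_left_subset[OF mpD(1)[OF mpb(1)]])
          fix v assume "v \<in> i + ?b"
          then obtain x y where xy: "v = x + y" "x \<in> i" "y \<in> ?b" by (auto elim!: set_plus_elim)
          have "c * y \<in> i" unfolding i_def by (rule cI[OF e]) (use xy(3) in \<open>simp only: b(1)\<close>)
          with idl_mult[OF mpD(1)[OF i] xy(2)] show "c * v \<in> i" unfolding xy(1) distrib_left by (rule sub_add[OF mpD(1)[OF i]])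
        qed
        let ?k = "len ?b (?b + ?u)"
        have bu: "?b \<subseteq> ?b + ?u" "idl (?b + ?u)"
          using plus_left_subset[OF u] idl_plus[OF mpD(1)[OF mpb(1)] u] by blast+
        have "len ?b UNIV = ?k + len (?b + ?u) UNIV"
          by (rule len_add[OF mpD(1)[OF mpb(1)] bu(2) sub_UNIV bu(1) subset_UNIV])
        then have "?k \<noteq> \<infinity>" using mp_finite[OF mpb(1)] enat_add_finiteD by metis
        then obtain k where k: "?k = enat k" by auto
        have "enat N' + of_nat (p ^ length (pre' @ post)) * ?k \<le> of_nat (p ^ d) * enat N"
          using pid_defect[OF K p2, of pre' x post] unfolding bs[symmetric] lbs N .
        then have "N' + p ^ length (pre' @ post) * k \<le> p ^ d * N" unfolding k by (simp add: of_nat_eq_enat)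
        \<comment> \<open>The factor \<open>p ^ (d - 1)\<close> that multiplies \<open>k\<close> is
          at least 1 and is simply dropped.\<close>
        moreover have "k \<le> p ^ length (pre' @ post) * k" using p_power_pos[of "length (pre' @ post)"] by simp
        ultimately show "?k \<le> enat (p ^ d * N - N')" unfolding k enat_ord_simps by linarith
      qed
      finally show "len i (i + ?u) \<le> \<delta>" by (simp add: \<delta>_def)
    qed
    have \<delta>fin: "\<delta> \<noteq> \<infinity>" using sfin by (simp add: \<delta>_def plus_eq_infty_iff_enat del: not_infinity_eq)
    have ifin: "len i UNIV \<noteq> \<infinity>" by (rule mp_finite[OF i])
    have up: "rlen ?l \<le> real d * rlen (len i UNIV)"
      using rlen_mono[OF upper of_nat_mult_finite[OF ifin]] by (simp add: rlen_mult[OF ifin])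
    have "?l + of_nat d * \<delta> \<noteq> \<infinity>" using lfin of_nat_mult_finite[OF \<delta>fin, of d] by (simp add: plus_eq_infty_iff_enat del: not_infinity_eq)
    then have "rlen (of_nat d * len i UNIV) \<le> rlen (?l + of_nat d * \<delta>)" using lower lbs by (intro rlen_mono) simp_all
    then have low: "real d * rlen (len i UNIV) \<le> rlen ?l + real d * rlen \<delta>"
      unfolding rlen_mult[OF ifin] rlen_add[OF lfin of_nat_mult_finite[OF \<delta>fin]] rlen_mult[OF \<delta>fin] .
    have r\<delta>: "rlen \<delta> = rlen ?s + (real p ^ d * rlen (len ?b UNIV) - rlen (len (pid p bs K) UNIV))"
    proof -
      have "rlen \<delta> = rlen ?s + rlen (enat (p ^ d * N - N'))" unfolding \<delta>_def by (rule rlen_add[OF sfin]) simp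
      also have "rlen (enat (p ^ d * N - N')) = real p ^ d * real N - real N'"
        using NN by (simp add: rlen_def of_nat_diff)
      finally show ?thesis unfolding N rlen_def by simp
    qed
    have radd: "rlen (len (pw i 1 bs K) UNIV) = rlen ?l + rlen (len ?b UNIV)"
      unfolding add by (rule rlen_add[OF lfin mp_finite[OF mpb(1)]])
    have "\<bar>rlen (len (pw i 1 bs K) UNIV) - (real d * rlen (len i UNIV) + rlen (len ?b UNIV))\<bar> \<le> real d * rlen \<delta>"
      using up low radd mult_nonneg_nonneg[OF of_nat_0_le_iff[of d] rlen_nonneg[of \<delta>]]
      unfolding abs_le_iff by linarith
    then have le: "\<bar>rlen (len (pw i 1 bs K) UNIV) - (real d * rlen (len i UNIV) + rlen (len ?b UNIV))\<bar> / real (p ^ e) ^ d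
        \<le> real d * rlen \<delta> / real (p ^ e) ^ d" by (rule divide_right_mono) simp
    have "hk (prd K I ?a) e - (real d * hk I e + hk ?a e) =
        (rlen (len (pw i 1 bs K) UNIV) - (real d * rlen (len i UNIV) + rlen (len ?b UNIV))) / real (p ^ e) ^ d"
      unfolding hk_def prod bA i_def by (simp add: diff_divide_distrib add_divide_distrib)
    moreover have "?D e = real d * rlen \<delta> / real (p ^ e) ^ d"
    proof -
      have "real p ^ d * hk ?a (Suc e) = rlen (len (pid p bs K) UNIV) / real (p ^ e) ^ d"
        unfolding hk_def bA using p2 by (simp add: power_mult_distrib)
      then have "?D e = real d * (rlen ?s / real (p ^ e) ^ d +
          (real p ^ d * (rlen (len ?b UNIV) / real (p ^ e) ^ d) - rlen (len (pid p bs K) UNIV) / real (p ^ e) ^ d))"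
        unfolding right_diff_distrib small_def i_def[symmetric] hk_def[of ?a e] bA(1) by (simp only:)
      moreover have "real d * (A / N + (P * (B / N) - C / N)) = real d * (A + (P * B - C)) / N" for A B C P N :: real
        by (simp add: diff_divide_distrib add_divide_distrib algebra_simps)
      ultimately show ?thesis unfolding r\<delta> by (simp only:)
    qed
    ultimately show ?thesis using le N_pos[of e] by (simp add: abs_divide)
  qed
  have "?D \<longlonglongrightarrow> real d * (0 + real p ^ d * (lim (hk ?a) - lim (hk ?a)))"
    by (intro tendsto_mult tendsto_add tendsto_diff tendsto_const small_tendsto c I hk_tendsto a LIMSEQ_Suc)
  then have D: "?D \<longlonglongrightarrow> 0" by simp
  have "(\<lambda>e. hk (prd K I ?a) e - (real d * hk I e + hk ?a e)) \<longlonglongrightarrow> 0"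
    by (rule tendsto_0_le[OF D, of _ 1], rule eventually_sequentiallyI[of e0]) (use bound in fastforce)
  moreover have "(\<lambda>e. hk (prd K I ?a) e - (real d * hk I e + hk ?a e)) \<longlonglongrightarrow>
      lim (hk (prd K I ?a)) - (real d * lim (hk I) + lim (hk ?a))"
    by (intro tendsto_diff tendsto_add tendsto_mult tendsto_const hk_tendsto I IA a)
  ultimately show ?thesis using LIMSEQ_unique by fastforce
qed

theorem hk_product:
  assumes I: "mp I" and J: "mp J" and JI: "br K J (p ^ f) \<subseteq> I"
    and c: "nonmin c"
    and 1: "\<And>e x. e \<ge> e0 \<Longrightarrow> x \<in> br K (pid 1 as K) (p ^ e) \<Longrightarrow> c * x \<in> br K J (p ^ e)"
    and 2: "\<And>e x. e \<ge> e0 \<Longrightarrow> x \<in> br K J (p ^ e) \<Longrightarrow> c * x \<in> br K (pid 1 as K) (p ^ e)"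
  shows "lim (hk (prd K I (br K J (p ^ f)))) = real d * lim (hk I) + lim (hk (br K J (p ^ f)))"
proof -
  let ?a = "br K (pid 1 as K) (p ^ f)" and ?J = "br K J (p ^ f)"
  have mp: "mp ?a" "mp ?J" using mp_br mp_as J by auto
  have prod: "c * x \<in> prd K U V'" if V: "\<And>v. v \<in> V \<Longrightarrow> c * v \<in> V'" and x: "x \<in> prd K U V" for U V V' x
  proof -
    have "prd K U V \<subseteq> colon (prd K U V') c"
    proof (rule prd_least[OF idl_colon[OF idl_prd]])
      show "K \<subseteq> colon (prd K U V') c" unfolding colon_def using idl_mult[OF K] prd_superset(1) by blast
      fix u v assume "u \<in> U" "v \<in> V"
      then have "u * (c * v) \<in> prd K U V'" by (intro prd_superset(2) V)
      then show "u * v \<in> colon (prd K U V') c" by (simp add: colon_def mult_ac)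
    qed
    then show ?thesis using x by (auto simp: colon_def)
  qed
  have "lim (hk (prd K I ?J)) = lim (hk (prd K I ?a))"
  proof (rule hk_torsion[OF c mp_prd[OF I mp(2)] mp_prd[OF I mp(1)], of e0])
    fix e x assume e: "e \<ge> e0"
    show "x \<in> br K (prd K I ?J) (p ^ e) \<Longrightarrow> c * x \<in> br K (prd K I ?a) (p ^ e)"
      unfolding br_prd br_br by (rule prod[rotated]) (use 2 e in auto)
    show "x \<in> br K (prd K I ?a) (p ^ e) \<Longrightarrow> c * x \<in> br K (prd K I ?J) (p ^ e)"
      unfolding br_prd br_br by (rule prod[rotated]) (use 1 e in auto)
  qed
  moreover have "lim (hk ?J) = lim (hk ?a)"
    by (rule hk_torsion[OF c mp(2,1), of e0]) (use 1 2 in \<open>auto simp: br_br\<close>)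
  moreover have "lim (hk (prd K I ?a)) = real d * lim (hk I) + lim (hk ?a)"
  proof (rule hk_parameter_product[OF c I, of e0])
    fix e x assume "e \<ge> e0" "x \<in> br K (pid 1 as K) (p ^ (f + e))"
    then have "c * x \<in> br K ?J (p ^ e)" using 1[of "f + e" x] by (simp add: br_br)
    then show "c * x \<in> br K I (p ^ e)" using br_mono[OF JI] by blast
  qed
  ultimately show ?thesis by simp
qed

end

section \<open>The theorem\<close>

context cring
begin

lemma prm_image: assumes P: "prm ker0 P" shows "primeideal (feval R ` P) R"
proof (rule primeidealI[OF ideal_image[OF prmD(1)[OF P]] is_cring])
  note pi = pre_image[OF prmD(1,2)[OF P]]
  show "carrier R \<noteq> feval R ` P" using pi prmD(3)[OF P] pre_carrier by force
  fix a b assume ab: "a \<in> carrier R" "b \<in> carrier R" "a \<otimes> b \<in> feval R ` P"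
  then have "fvar a * fvar b \<in> pre (feval R ` P)" by (simp add: mem_pre feval_fvar)
  then have "fvar a \<in> P \<or> fvar b \<in> P" unfolding pi by (rule prmD(4)[OF P])
  then show "a \<in> feval R ` P \<or> b \<in> feval R ` P"
    using imageI[of "fvar a" P "feval R"] imageI[of "fvar b" P "feval R"] ab by (auto simp: feval_fvar)
qed

lemma prm_pre: assumes "primeideal P R" shows "prm ker0 (pre P)"
proof -
  interpret primeideal P R by (rule assms)
  show ?thesis
    unfolding prm_def
  proof (intro conjI allI impI)
    show "1 \<notin> pre P" using I_notcarr one_imp_carrier by (simp add: mem_pre) metis
    show "x \<in> pre P \<or> y \<in> pre P" if "x * y \<in> pre P" for x y
      using I_prime[of "feval R x" "feval R y"] that by (simp add: mem_pre)
  qed (rule idl_pre[OF is_ideal], rule ker0_pre[OF is_ideal])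
qed

lemma prm_image_strict:
  assumes P: "prm ker0 P" and Q: "prm ker0 Q" and PQ: "P \<subset> Q" shows "feval R ` P \<subset> feval R ` Q"
proof (rule psubsetI)
  show "feval R ` P \<subseteq> feval R ` Q" using PQ by (intro image_mono) (rule psubset_imp_subset)
  show "feval R ` P \<noteq> feval R ` Q"
  proof
    assume "feval R ` P = feval R ` Q"
    then have "pre (feval R ` P) = pre (feval R ` Q)" by (rule arg_cong)
    then show False using PQ unfolding pre_image[OF prmD(1,2)[OF P]] pre_image[OF prmD(1,2)[OF Q]] by simp
  qed
qed

lemma radical_W:
  assumes nl: "noeth_local ker0 (\<lambda>n. pre (ideal_power R m n)) p" and m: "ideal m R"
    and I: "ideal I R" "radical R I = m"
  shows "noeth_local.mp ker0 (\<lambda>n. pre (ideal_power R m n)) (pre I)"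
proof -
  interpret nl: noeth_local ker0 "\<lambda>n. pre (ideal_power R m n)" p by (rule nl)
  have one: "ideal_power R m 1 = m"
    using ideal_prod_one[OF m] ideal_prod_commute[OF m oneideal] by simp
  have "\<exists>n. x ^ n \<in> pre I" if "x \<in> pre (ideal_power R m 1)" for x
    using that[unfolded one] I(2) by (auto simp: mem_pre radical_def)
  then show ?thesis
    unfolding nl.mp_def using nl.W_le_if_radical[OF idl_pre[OF I(1)] ker0_pre[OF I(1)]]
      idl_pre[OF I(1)] ker0_pre[OF I(1)] by blast
qed

lemma tight_closure_pre:
  assumes x: "x \<in> tight_closure R p I" and I: "I \<subseteq> carrier R"
  shows "\<exists>c e0. (\<forall>P. prm ker0 P \<longrightarrow> c \<in> P \<longrightarrow> (\<exists>Q. prm ker0 Q \<and> Q \<subset> P)) \<and>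
    (\<forall>e\<ge>e0. \<forall>t. feval R t = x \<longrightarrow> c * t ^ (p ^ e) \<in> br ker0 (pre I) (p ^ e))"
proof -
  obtain c e0 where c: "c \<in> carrier R" "\<forall>P. minimal_prime R P \<longrightarrow> c \<notin> P"
    and e0: "\<forall>e\<ge>e0. c \<otimes> (x [^] (p ^ e)) \<in> bracket_power R I (p ^ e)"
    using x unfolding tight_closure_def by blast
  have "\<exists>Q. prm ker0 Q \<and> Q \<subset> P" if P: "prm ker0 P" "fvar c \<in> P" for P
  proof -
    note pi = pre_image[OF prmD(1,2)[OF P(1)]]
    have "c \<in> feval R ` P" using imageI[OF P(2), of "feval R"] c(1) by (simp add: feval_fvar)
    then have "\<not> minimal_prime R (feval R ` P)" using c(2) by blast
    then obtain Q where Q: "primeideal Q R" "Q \<subseteq> feval R ` P" "Q \<noteq> feval R ` P"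
      using prm_image[OF P(1)] unfolding minimal_prime_def by blast
    have cP: "feval R ` P \<subseteq> carrier R" by auto
    then have cQ: "Q \<subseteq> carrier R" using Q(2) by (rule order.trans[rotated])
    have "pre Q \<subset> pre (feval R ` P)"
      using Q(2,3) pre_mono_iff[OF cQ, of "feval R ` P"] pre_inj[OF cQ cP] by (simp add: psubset_eq)
    then show ?thesis using prm_pre[OF Q(1)] unfolding pi by blast
  qed
  moreover have "fvar c * t ^ (p ^ e) \<in> br ker0 (pre I) (p ^ e)" if "e \<ge> e0" "feval R t = x" for e t
    unfolding pre_bracket_power[OF I, symmetric] using e0 c(1) that by (simp add: mem_pre feval_fvar)
  ultimately show ?thesis by blast
qed

lemma ideal_subset_tight_closure:
  assumes I: "I \<subseteq> carrier R" and "\<one> \<noteq> \<zero>" shows "I \<subseteq> tight_closure R p I"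
proof
  fix x assume x: "x \<in> I"
  have "\<one> \<notin> P" if "minimal_prime R P" for P
    using that primeideal.I_notcarr ideal.one_imp_carrier primeideal.axioms(1) unfolding minimal_prime_def by metis
  moreover have "\<one> \<otimes> (x [^] (p ^ e)) \<in> bracket_power R I (p ^ e)" for e
  proof -
    have "(\<lambda>x. x [^] (p ^ e)) ` I \<subseteq> carrier R" using I by auto
    then have "x [^] (p ^ e) \<in> bracket_power R I (p ^ e)"
      unfolding bracket_power_def using genideal_self x by blast
    then show ?thesis using subsetD[OF I x] by simp
  qed
  ultimately show "x \<in> tight_closure R p I"
    unfolding tight_closure_def using x I by blast
qed

end

theorem proposition4p2:
  fixes R :: "('a, 'b) ring_scheme" and \<mm> I J :: "'a set" and p d q0 :: nat
  assumes "noetherian_ring R" and "local_ring R" and "\<mm> = max_ideal R"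
    and "reduced_ring R" and "excellent R"
    and "Factorial_Ring.prime p" and "has_characteristic R p"
    and "krull_dim R = enat d"
    and "reduced_ring (adic_completion R \<mm>)" and "equidimensional (adic_completion R \<mm>)"
    and "primary_to R \<mm> I" and "primary_to R \<mm> J"
    and "\<exists>xs. system_of_parameters R xs \<and>
           tight_closure R p (Idl\<^bsub>R\<^esub> (set xs)) = tight_closure R p J"
    and "q0 \<in> range (\<lambda>e::nat. p ^ e)" and "bracket_power R J q0 \<subseteq> I"
  shows "\<forall>q \<in> range (\<lambda>e::nat. p ^ e). q0 \<le> q \<longrightarrow>
           hilbert_kunz R p (ideal_prod R I (bracket_power R J q)) =
             real d * hilbert_kunz R p I + hilbert_kunz R p (bracket_power R J q)"
proof -
  note m = assms(3) and prime = assms(6)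
  interpret cring R using assms(2) by (simp add: local_ring_def)
  have unique: "\<exists>!N. maximalideal N R" using assms(2) by (simp add: local_ring_def)
  have max: "maximalideal \<mm> R" unfolding m max_ideal_def by (rule theI'[OF unique])
  have mi: "ideal \<mm> R" using max by (rule maximalideal.axioms)
  have loc: "noeth_local ker0 (\<lambda>n. pre (ideal_power R \<mm> n)) p"
    by (rule noeth_local_pre[OF assms(1) unique max prime assms(7)])
  interpret adic ker0 "\<lambda>n. pre (ideal_power R \<mm> n)" p
    "\<lambda>v n t. feval R t \<in> feval (adic_completion R \<mm>) v n"
    by (rule adic_pre[OF loc mi assms(9)])
  have id: "ideal I R" "radical R I = \<mm>" "ideal J R" "radical R J = \<mm>"
    using assms(11,12) by (auto simp: primary_to_def primary_ideal_def)
  have sub: "I \<subseteq> carrier R" "J \<subseteq> carrier R" using id by (simp_all add: ideal.Icarr subsetI)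
  have mpI: "mp (pre I)" and mpJ: "mp (pre J)"
    by (rule radical_W[OF loc mi id(1,2)], rule radical_W[OF loc mi id(3,4)])
  obtain xs where xs: "set xs \<subseteq> \<mm>" "length xs = d" "primary_to R \<mm> (Idl\<^bsub>R\<^esub> (set xs))"
    and tc: "tight_closure R p (Idl\<^bsub>R\<^esub> (set xs)) = tight_closure R p J"
    using assms(13) assms(8) unfolding system_of_parameters_def m by auto
  define as where "as = map fvar xs"
  have carr: "set xs \<subseteq> carrier R" using xs(1) ideal.Icarr[OF mi] by blast
  then have "feval R ` set as = set xs" by (force simp: as_def feval_fvar image_image)
  then have pa: "pre (Idl\<^bsub>R\<^esub> (set xs)) = pid 1 as ker0"
    using pre_genideal[of "set as"] gen_set_pid[OF idl_ker0, of as] by simp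
  have ida: "ideal (Idl\<^bsub>R\<^esub> (set xs)) R" by (rule genideal_ideal[OF carr])
  have suba: "Idl\<^bsub>R\<^esub> (set xs) \<subseteq> carrier R" using ida by (simp add: ideal.Icarr subsetI)
  have mpa: "mp (pid 1 as ker0)"
    using radical_W[OF loc mi ida] xs(3) unfolding pa by (simp add: primary_to_def)
  have one: "ideal_power R \<mm> 1 = \<mm>"
    using ideal_prod_one[OF mi] ideal_prod_commute[OF mi oneideal] by simp
  have asm: "set as \<subseteq> pre (ideal_power R \<mm> 1)"
    unfolding one using xs(1) carr by (auto simp: as_def mem_pre feval_fvar subset_eq)
  interpret hk_setting ker0 "\<lambda>n. pre (ideal_power R \<mm> n)" p as d
  proof
    show "length as = d" using xs(2) by (simp add: as_def)
    show "mp (pid 1 as ker0)" by (rule mpa)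
    show "n \<le> d" if C: "pchain ker0 n C" for n C
    proof -
      have "enat n \<le> krull_dim R"
        unfolding krull_dim_def
      proof (rule chain_sup_upper[of _ _ "\<lambda>i. feval R ` C i"]; intro allI impI)
        show "primeideal (feval R ` C i) R" if "i \<le> n" for i
          using C that by (intro prm_image) (simp add: pchain_def)
        show "feval R ` C i \<subset> feval R ` C (Suc i)" if "i < n" for i
          using C that by (intro prm_image_strict) (simp_all add: pchain_def)
      qed
      then show ?thesis using assms(8) by simp
    qed
    show "convergent (\<lambda>e. rlen (len (br ker0 I (p ^ e)) UNIV) / real (p ^ e) ^ d)" if I: "mp I" for I
    proof -
      obtain c c0 where "idl I" "ker0 \<subseteq> I" "pre (ideal_power R \<mm> c) \<subseteq> I" "pre (ideal_power R \<mm> c0) \<subseteq> pid 1 as ker0"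
        using I mpa unfolding mp_def by blast
      then show ?thesis using convergent_hk[OF asm, of c0 I c] xs(2) by (simp add: as_def)
    qed
  qed
  have nz: "\<one>\<^bsub>R\<^esub> \<noteq> \<zero>\<^bsub>R\<^esub>"
  proof
    assume "\<one>\<^bsub>R\<^esub> = \<zero>\<^bsub>R\<^esub>"
    then have "\<one>\<^bsub>R\<^esub> \<in> \<mm>" using additive_subgroup.zero_closed[OF ideal.axioms(1)[OF mi]] by simp
    then show False using ideal.one_imp_carrier[OF mi] maximalideal.I_notcarr[OF max] by simp
  qed
  \<comment> \<open>Equality of the tight closures puts the parameter ideal and \<open>J\<close>
    each into the tight closure of the other; this turns such a containment into one multiplier
    valid for all large exponents.\<close>
  have fin: "\<exists>c e0. nonmin c \<and> (\<forall>e\<ge>e0. \<forall>x\<in>br ker0 (pre A) (p ^ e). c * x \<in> br ker0 (pre B) (p ^ e))"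
    if A: "ideal A R" "A \<subseteq> tight_closure R p B" "B \<subseteq> carrier R" for A B
  proof -
    obtain Y where Y: "finite Y" "pre A = gen UNIV (Y \<union> ker0)"
      using noeth_pre[OF assms(1) idl_pre[OF A(1)] ker0_pre[OF A(1)]] by blast
    have "\<forall>y\<in>Y. \<exists>c e0. nonmin c \<and> (\<forall>e\<ge>e0. c * y ^ (p ^ e) \<in> br ker0 (pre B) (p ^ e))"
    proof
      fix y assume "y \<in> Y"
      then have "y \<in> pre A" using gen_superset[of "Y \<union> ker0" UNIV] Y(2) by blast
      then have "feval R y \<in> tight_closure R p B" using A(2) by (auto simp: mem_pre)
      from tight_closure_pre[OF this A(3)] obtain c e0
        where c: "\<forall>P. prm ker0 P \<longrightarrow> c \<in> P \<longrightarrow> (\<exists>Q. prm ker0 Q \<and> Q \<subset> P)"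
          and e0: "\<forall>e\<ge>e0. \<forall>t. feval R t = feval R y \<longrightarrow> c * t ^ (p ^ e) \<in> br ker0 (pre B) (p ^ e)"
        by (elim exE conjE)
      have "nonmin c" unfolding nonmin_def by (rule c)
      moreover have "\<forall>e\<ge>e0. c * y ^ (p ^ e) \<in> br ker0 (pre B) (p ^ e)"
        by (intro allI impI e0[rule_format, OF _ HOL.refl])
      ultimately show "\<exists>c e0. nonmin c \<and> (\<forall>e\<ge>e0. c * y ^ (p ^ e) \<in> br ker0 (pre B) (p ^ e))"
        by (intro exI conjI)
    qed
    from uniform_multiplier[OF Y(1) this] show ?thesis unfolding Y(2) .
  qed
  have "Idl\<^bsub>R\<^esub> (set xs) \<subseteq> tight_closure R p J"
    unfolding tc[symmetric] by (rule ideal_subset_tight_closure[OF suba nz])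
  from fin[OF ida this sub(2)] obtain c1 e1 where
      c1: "nonmin c1" "\<forall>e\<ge>e1. \<forall>x\<in>br ker0 (pid 1 as ker0) (p ^ e). c1 * x \<in> br ker0 (pre J) (p ^ e)"
    unfolding pa by (elim exE conjE)
  have "J \<subseteq> tight_closure R p (Idl\<^bsub>R\<^esub> (set xs))"
    unfolding tc by (rule ideal_subset_tight_closure[OF sub(2) nz])
  from fin[OF id(3) this suba] obtain c2 e2 where
      c2: "nonmin c2" "\<forall>e\<ge>e2. \<forall>x\<in>br ker0 (pre J) (p ^ e). c2 * x \<in> br ker0 (pid 1 as ker0) (p ^ e)"
    unfolding pa by (elim exE conjE)
  have c: "nonmin (c1 * c2)" by (rule nonmin_mult[OF c1(1) c2(1)])
  have HK: "hilbert_kunz R p A = lim (hk (pre A))" if "A \<subseteq> carrier R" for A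
    unfolding hilbert_kunz_pre[OF that] hk_def[abs_def] assms(8) by simp
  show ?thesis
  proof (intro ballI impI)
    fix q assume "q \<in> range (\<lambda>e::nat. p ^ e)" and q0: "q0 \<le> q"
    then obtain f where f: "q = p ^ f" by blast
    obtain f0 where f0: "q0 = p ^ f0" using assms(14) by blast
    have "f0 \<le> f" using q0 prime_gt_1_nat[OF prime] unfolding f f0 by simp
    have "pre (bracket_power R J q0) \<subseteq> pre I" using assms(15) by (auto simp: mem_pre)
    then have le0: "br ker0 (pre J) (p ^ f0) \<subseteq> pre I" unfolding f0 pre_bracket_power[OF sub(2)] .
    \<comment> \<open>Both are powers of \<open>p\<close>, so \<open>q\<close> is a multiple of
      \<open>q0\<close> and \<open>x^q\<close> is a power of \<open>x^q0\<close>.\<close>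
    have le: "br ker0 (pre J) (p ^ f) \<subseteq> pre I"
    proof (rule br_least[OF idl_pre[OF id(1)] ker0_pre[OF id(1)]])
      fix x assume "x \<in> pre J"
      then have "x ^ p ^ f0 \<in> pre I" using le0 br_superset(2) by blast
      then have "(x ^ p ^ f0) ^ p ^ (f - f0) \<in> pre I"
        by (rule idl_power[OF idl_pre[OF id(1)]]) (use prime_gt_0_nat[OF prime] in simp)
      then show "x ^ p ^ f \<in> pre I" using \<open>f0 \<le> f\<close> by (simp flip: power_mult power_add)
    qed
    have Jq: "ideal (bracket_power R J q) R"
      unfolding bracket_power_def using sub(2) by (intro genideal_ideal) auto
    have subs: "bracket_power R J q \<subseteq> carrier R" "ideal_prod R I (bracket_power R J q) \<subseteq> carrier R"
      using Jq ideal_prod_in_carrier[OF id(1) Jq] by (simp_all add: ideal.Icarr subsetI)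
    have "lim (hk (prd ker0 (pre I) (br ker0 (pre J) (p ^ f)))) =
        real d * lim (hk (pre I)) + lim (hk (br ker0 (pre J) (p ^ f)))"
    proof (rule hk_product[OF mpI mpJ le c, of "max e1 e2"])
      fix e x assume e: "max e1 e2 \<le> e"
      show "c1 * c2 * x \<in> br ker0 (pre J) (p ^ e)" if "x \<in> br ker0 (pid 1 as ker0) (p ^ e)"
        using idl_mult[OF idl_br c1(2)[rule_format, OF _ that], of c2] e by (simp add: mult_ac)
      show "c1 * c2 * x \<in> br ker0 (pid 1 as ker0) (p ^ e)" if "x \<in> br ker0 (pre J) (p ^ e)"
        using idl_mult[OF idl_br c2(2)[rule_format, OF _ that], of c1] e by (simp add: mult_ac)
    qed
    then show "hilbert_kunz R p (ideal_prod R I (bracket_power R J q)) =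
        real d * hilbert_kunz R p I + hilbert_kunz R p (bracket_power R J q)"
      unfolding HK[OF sub(1)] HK[OF subs(1)] HK[OF subs(2)] pre_ideal_prod[OF id(1) Jq]
        pre_bracket_power[OF sub(2)] unfolding f .
  qed
qed

end
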